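(* Suppose that $K$ satisfies $\int_0^1 \frac{\varphi_K(s)}{s}\,ds<\infty$ and $\int_1^\infty \frac{\varphi_K(s)}{s^2}\,ds<\infty$. Let $f\in H^2$. Set $$ d\mu_z(\zeta)=\frac{1-|z|^2}{2\pi|\zeta-z|^2}|d\zeta|,\quad z\in\mathbb{D},\quad \zeta\in\partial\mathbb{D}. $$ Then the following conditions are equivalent. (i) $f\in\mathcal{Q}_K$. (ii) $\widetilde{f}\in\mathcal{Q}_K(\partial\mathbb{D})$. (iii) $|\widetilde{f}|\in \mathcal{Q}_K(\partial\mathbb{D})$ and $$ \sup_{a\in \mathbb{D}}\int_\mathbb{D}\left(\int_{\partial \mathbb{D}}|\widetilde{f}(\zeta)|d\mu_z(\zeta)-|f(z)|\right)^2\frac{K(1-|\sigma_a(z)|^2)}{(1-|z|^2)^2} dA(z)<\infty. $$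
   Context: $\mathbb{D}$ is the unit disk, $\partial\mathbb{D}$ its boundary, $dA$ the area measure on $\mathbb{D}$, $H^2$ the Hardy space, and $\sigma_a(z)=\frac{a-z}{1-\overline{a}z}$. $K:[0,\infty)\to[0,\infty)$ is a right-continuous increasing function and $\varphi_K(s)=\sup_{0<t\le 1}K(st)/K(t)$ for $0<s<\infty$. The space $\mathcal{Q}_K$ consists of analytic $f$ on $\mathbb{D}$ with $\sup_{a\in\mathbb{D}}\int_\mathbb{D}|f'(z)|^2K(g(a,z))\,dA(z)<\infty$, where $g(a,z)$ is the Green function of $\mathbb{D}$ with singularity at $a$ (equivalently, with $K(1-|\sigma_a(z)|^2)$ in place of $K(g(a,z))$). $\mathcal{Q}_K(\partial\mathbb{D})$ is the space of $f\in L^2(\partial\mathbb{D})$ with $\sup_{I\subset\partial\mathbb{D}}\int_I\int_I\frac{|f(\zeta)-f(\eta)|^2}{|\zeta-\eta|^2}K\left(\frac{|\zeta-\eta|}{|I|}\right)|d\zeta||d\eta|<\infty$, the supremum over arcs $I$. For $f\in H^2$, $\widetilde{f}$ denotes its non-tangential boundary limit function on $\partial\mathbb{D}$. *)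

theory Defs
  imports "HOL-Analysis.Analysis"
begin

definition disk_aut :: "complex \<Rightarrow> complex \<Rightarrow> complex" where
  "disk_aut a z = (a - z) / (1 - cnj a * z)"

definition green_disk :: "complex \<Rightarrow> complex \<Rightarrow> real" where
  "green_disk a z = ln (1 / cmod (disk_aut a z))"

text \<open>phi_K(s) = sup_{0<t<=1} K(st)/K(t), valued in [0,\<infinity>] (ratio computed in ennreal,
  so c/0 = \<infinity> for c > 0 and 0/0 = 0).\<close>
definition phiK :: "(real \<Rightarrow> real) \<Rightarrow> real \<Rightarrow> ennreal" where
  "phiK K s = (SUP t\<in>{0<..1}. ennreal (K (s * t)) / ennreal (K t))"

definition hardy2 :: "(complex \<Rightarrow> complex) \<Rightarrow> bool" where
  "hardy2 f \<longleftrightarrow> f holomorphic_on ball 0 1 \<and>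
     (\<exists>C. \<forall>r\<in>{0..<1}. (LBINT t=0..2*pi. (cmod (f (of_real r * cis t)))\<^sup>2) \<le> C)"

definition nt_limit :: "(complex \<Rightarrow> complex) \<Rightarrow> complex \<Rightarrow> complex \<Rightarrow> bool" where
  "nt_limit f \<zeta> L \<longleftrightarrow> (\<forall>\<alpha>>1. (f \<longlongrightarrow> L)
     (at \<zeta> within {z. cmod z < 1 \<and> cmod (z - \<zeta>) < \<alpha> * (1 - cmod z)}))"

definition bdry_fun :: "(complex \<Rightarrow> complex) \<Rightarrow> complex \<Rightarrow> complex" where
  "bdry_fun f \<zeta> = (if \<exists>L. nt_limit f \<zeta> L then THE L. nt_limit f \<zeta> L else 0)"

definition QK :: "(real \<Rightarrow> real) \<Rightarrow> (complex \<Rightarrow> complex) \<Rightarrow> bool" where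
  "QK K f \<longleftrightarrow> f holomorphic_on ball 0 1 \<and>
     (SUP a\<in>ball 0 1. \<integral>\<^sup>+ z\<in>ball 0 1.
        ennreal ((cmod (deriv f z))\<^sup>2 * K (green_disk a z)) \<partial>lborel) < top"

text \<open>Q_K(boundary): F in L^2 of the circle (parametrised by zeta = cis theta, |d zeta| = d theta),
  with the sup over arcs I = {cis u | u in [t, t + l]}, 0 < l <= 2 pi, |I| = l, finite.\<close>
definition QK_bd :: "(real \<Rightarrow> real) \<Rightarrow> (complex \<Rightarrow> complex) \<Rightarrow> bool" where
  "QK_bd K F \<longleftrightarrow> (\<lambda>\<theta>. F (cis \<theta>)) \<in> borel_measurable lborel \<and>
     (\<integral>\<^sup>+ \<theta>\<in>{0..2*pi}. ennreal ((cmod (F (cis \<theta>)))\<^sup>2) \<partial>lborel) < top \<and>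
     (SUP (t, l)\<in>UNIV \<times> {0<..2*pi}.
        \<integral>\<^sup>+ u\<in>{t..t+l}. \<integral>\<^sup>+ v\<in>{t..t+l}.
          ennreal ((cmod (F (cis u) - F (cis v)))\<^sup>2 / (cmod (cis u - cis v))\<^sup>2
                   * K (cmod (cis u - cis v) / l)) \<partial>lborel \<partial>lborel) < top"

definition poisson_int :: "(complex \<Rightarrow> real) \<Rightarrow> complex \<Rightarrow> real" where
  "poisson_int F z = set_lebesgue_integral lborel {0..2*pi}
     (\<lambda>\<theta>. F (cis \<theta>) * (1 - (cmod z)\<^sup>2) / (2 * pi * (cmod (cis \<theta> - z))\<^sup>2))"

end

theory Submission
  imports Defs "HOL-Complex_Analysis.Complex_Analysis"
begin

text \<open>
  Write \<open>F\<close> for the boundary function and \<open>V G z\<close> for the double integral of \<open>\<bar>G u - G v\<bar>\<^sup>2\<close> against the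
  Poisson measure of \<open>z\<close> in both variables.

  (i) implies (ii): in the coordinate \<open>\<sigma>\<^sub>a\<close> both the Green energy of \<open>f\<close> and the double integral of
  \<open>\<bar>F u - F v\<bar>\<^sup>2 / \<bar>u - v\<bar>\<^sup>2\<close> with weight \<open>K \<bar>\<sigma>\<^sub>a u - \<sigma>\<^sub>a v\<bar>\<close> are diagonal in the Taylor coefficients of
  \<open>f \<circ> \<sigma>\<^sub>a\<close>, and the \<open>n\<close>-th weights are comparable Laplace transforms of \<open>K\<close>. For \<open>a\<close> over the centre of
  an arc \<open>I\<close> at height \<open>\<bar>I\<bar>\<close>, \<open>\<bar>\<sigma>\<^sub>a u - \<sigma>\<^sub>a v\<bar>\<close> is comparable to \<open>\<bar>u - v\<bar> / \<bar>I\<bar>\<close> on \<open>I\<close>.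

  (ii) implies (iii): conversely, a decomposition into dyadic arcs bounds the weighted double integral by the
  arc condition. Integrating \<open>K (1 - \<bar>\<sigma>\<^sub>a z\<bar>\<^sup>2)\<close> against two Poisson kernels over the disk shows that it
  controls the integral of \<open>V F z K (1 - \<bar>\<sigma>\<^sub>a z\<bar>\<^sup>2) / (1 - \<bar>z\<bar>\<^sup>2)\<^sup>2\<close>, and the square of the gap between
  the Poisson integral of \<open>\<bar>F\<bar>\<close> and \<open>\<bar>f z\<bar>\<close> is at most \<open>V F z\<close>.

  (iii) implies (i): \<open>(1 - \<bar>z\<bar>\<^sup>2) \<bar>f' z\<bar>\<close> is at most four times the Poisson mean of
  \<open>\<bar>\<bar>F\<bar> - \<bar>f z\<bar>\<bar>\<close>, so its square is at most \<open>32 (V \<bar>F\<bar> z + gap\<^sup>2)\<close>.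
\<close>

section \<open>Area integrals of holomorphic functions\<close>

text \<open>The two integrals of \<open>phiK\<close> control different scales. Integrability of
  phi/s near 0 makes the sums of \<open>\<Phi>\<close> over small dyadic scales converge;
  integrability of phi/s^2 at infinity gives linear growth of \<open>\<Phi>\<close> and absorbs the
  tails of the Laplace and Fourier integrals. Two obstacles shape the route. The Green function has
  a logarithmic pole at \<open>a\<close>, so for unbounded K its weight is not pointwise bounded by
  a multiple of K (1 - |sigma_a|^2); once \<open>a\<close> is moved to the origin the weights are
  radial and are compared coefficient by coefficient. And sigma_a turns a radius into a circular
  arc, so radial limits do not survive the change of variables: nontangential limits almost
  everywhere are required, and they come from a maximal inequality applied to Taylor remainders.
  Identities are proved first for dilates, which are continuous up to the circle, and reach the
  boundary function through L^2 convergence or Fatou's lemma.\<close>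

lemma lborel_complex_eq:
  "(lborel :: complex measure) = distr (lborel \<Otimes>\<^sub>M lborel) borel (\<lambda>p. Complex (fst p) (snd p))"
proof (rule lborel_eqI)
  fix l u :: complex
  assume le: "\<And>b. b \<in> Basis \<Longrightarrow> l \<bullet> b \<le> u \<bullet> b"
  have m: "(\<lambda>p. Complex (fst p) (snd p)) \<in> borel_measurable (borel :: (real \<times> real) measure)"
    by (intro borel_measurable_continuous_onI continuous_on_Complex continuous_intros)
  have "(\<lambda>p. Complex (fst p) (snd p)) -` box l u = box (Re l) (Re u) \<times> box (Im l) (Im u)"
    by (auto simp: box_def Basis_complex_def inner_complex_def)
  moreover have "Re l \<le> Re u" "Im l \<le> Im u"
    using le[of 1] le[of \<i>] by (auto simp: Basis_complex_def)
  ultimately show "emeasure (distr (lborel \<Otimes>\<^sub>M lborel) borel (\<lambda>p. Complex (fst p) (snd p))) (box l u)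
      = ennreal (\<Prod>b\<in>Basis. (u - l) \<bullet> b)"
    using m lborel.emeasure_pair_measure_Times[of "box (Re l) (Re u)" lborel "box (Im l) (Im u)"]
    by (simp add: emeasure_distr lborel_prod Basis_complex_def ennreal_mult'')
qed simp

lemma nn_integral_complex_iterated:
  fixes G :: "complex \<Rightarrow> ennreal"
  assumes [measurable]: "G \<in> borel_measurable borel"
  shows "(\<integral>\<^sup>+z. G z \<partial>lborel) = (\<integral>\<^sup>+x. \<integral>\<^sup>+y. G (Complex x y) \<partial>lborel \<partial>lborel)"
proof -
  have m: "(\<lambda>p. Complex (fst p) (snd p)) \<in> borel_measurable (borel :: (real \<times> real) measure)"
    by (intro borel_measurable_continuous_onI continuous_on_Complex continuous_intros)
  then have m' [measurable]: "(\<lambda>p. Complex (fst p) (snd p)) \<in> borel_measurable (lborel \<Otimes>\<^sub>M lborel)"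
    by (simp add: lborel_prod)
  have "(\<integral>\<^sup>+z. G z \<partial>lborel) = (\<integral>\<^sup>+p. G (Complex (fst p) (snd p)) \<partial>(lborel \<Otimes>\<^sub>M lborel))"
    by (subst lborel_complex_eq) (simp add: nn_integral_distr)
  also have "\<dots> = (\<integral>\<^sup>+x. \<integral>\<^sup>+y. G (Complex x y) \<partial>lborel \<partial>lborel)"
    by (subst lborel_pair.nn_integral_snd[symmetric] lborel.nn_integral_fst[symmetric]) simp_all
  finally show ?thesis .
qed

text \<open>\<open>real^2\<close> enters because Jacobian determinants are formed from matrices. The
  two coordinate maps are mutually inverse linear isometries, so measures and derivatives carry over
  unchanged.\<close>

definition complex_of_vec :: "real^2 \<Rightarrow> complex" where
  "complex_of_vec x = Complex (x $ 1) (x $ 2)"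

definition vec_of_complex :: "complex \<Rightarrow> real^2" where
  "vec_of_complex z = vector [Re z, Im z]"

lemma vec_complex_inverse [simp]:
  "complex_of_vec (vec_of_complex z) = z" "vec_of_complex (complex_of_vec x) = x"
  by (simp_all add: complex_of_vec_def vec_of_complex_def complex_eq_iff vec_eq_iff forall_2)

lemma bounded_linear_complex_of_vec: "bounded_linear complex_of_vec"
  by (rule linear_conv_bounded_linear[THEN iffD1])
     (auto simp: linear_iff complex_of_vec_def complex_eq_iff)

lemma bounded_linear_vec_of_complex: "bounded_linear vec_of_complex"
  by (rule linear_conv_bounded_linear[THEN iffD1])
     (auto simp: linear_iff vec_of_complex_def vec_eq_iff forall_2)

lemma continuous_complex_of_vec: "continuous_on A complex_of_vec"
  and continuous_vec_of_complex: "continuous_on B vec_of_complex"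
  using bounded_linear.linear linear_continuous_on bounded_linear_complex_of_vec bounded_linear_vec_of_complex
  by blast+

lemma borel_complex_of_vec [measurable]: "complex_of_vec \<in> borel_measurable borel"
  and borel_vec_of_complex [measurable]: "vec_of_complex \<in> borel_measurable borel"
  by (intro borel_measurable_continuous_onI continuous_complex_of_vec continuous_vec_of_complex)+

lemma lborel_complex_vec: "(lborel :: complex measure) = distr lborel borel complex_of_vec"
proof (rule lborel_eqI)
  fix l u :: complex
  assume le: "\<And>b. b \<in> Basis \<Longrightarrow> l \<bullet> b \<le> u \<bullet> b"
  have "complex_of_vec -` box l u = box (vec_of_complex l) (vec_of_complex u)"
    by (simp add: set_eq_iff in_box_complex_iff mem_box_cart complex_of_vec_def vec_of_complex_def forall_2)
  moreover have r: "Re l \<le> Re u" "Im l \<le> Im u"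
    using le[of 1] le[of \<i>] by (auto simp: Basis_complex_def)
  moreover have "emeasure lborel (box (vec_of_complex l) (vec_of_complex u))
      = ennreal ((Re u - Re l) * (Im u - Im l))"
  proof -
    have "(\<Prod>b\<in>(Basis :: (real^2) set). (vec_of_complex u - vec_of_complex l) \<bullet> b)
        = (\<Prod>i\<in>UNIV. (vec_of_complex u - vec_of_complex l) $ i)"
    proof -
      have "(Basis :: (real^2) set) = (\<lambda>i. axis i 1) ` UNIV"
        by (auto simp: Basis_vec_def)
      moreover have "inj (\<lambda>i::2. axis i (1::real))" by (auto simp: inj_on_def axis_eq_axis)
      ultimately have "(\<Prod>b\<in>Basis. v \<bullet> b) = (\<Prod>i\<in>UNIV. v $ i)" for v :: "real^2"
        by (subst \<open>Basis = _\<close>, subst prod.reindex) (auto simp: inner_axis)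
      then show ?thesis .
    qed
    also have "\<dots> = (Re u - Re l) * (Im u - Im l)"
      by (simp add: UNIV_2 vec_of_complex_def)
    finally have P: "(\<Prod>b\<in>(Basis :: (real^2) set). (vec_of_complex u - vec_of_complex l) \<bullet> b)
        = (Re u - Re l) * (Im u - Im l)" .
    have "\<forall>b\<in>(Basis :: (real^2) set). vec_of_complex l \<bullet> b \<le> vec_of_complex u \<bullet> b"
      using r by (auto simp: Basis_vec_def inner_axis vec_of_complex_def exhaust_2 forall_2)
    then show ?thesis
      using P by (subst emeasure_lborel_box) auto
  qed
  ultimately show "emeasure (distr lborel borel complex_of_vec) (box l u) = ennreal (\<Prod>b\<in>Basis. (u - l) \<bullet> b)"
    by (simp add: emeasure_distr Basis_complex_def)
qed simp

text \<open>Multiplication by c is a rotation combined with scaling by |c|; hence the real Jacobian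
  of a holomorphic map is the squared modulus of its derivative.\<close>

lemma det_matrix_complex_mult:
  "det (matrix (\<lambda>h. vec_of_complex (c * complex_of_vec h))) = (cmod c)\<^sup>2"
  unfolding cmod_power2
  by (simp add: det_2 matrix_def vec_of_complex_def complex_of_vec_def axis_def power2_eq_square)

text \<open>The inverse of an injective holomorphic map is holomorphic, so images of Borel sets are
  Borel. The area formula is then the real change of variables with Jacobian |g'|^2.\<close>

lemma emeasure_holomorphic_image:
  assumes S: "open S" and g: "g holomorphic_on S" and inj: "inj_on g S"
    and B [measurable]: "B \<in> sets borel" and BS: "B \<subseteq> S"
  shows "g ` B \<in> sets borel"
    and "emeasure lborel (g ` B) = (\<integral>\<^sup>+z\<in>B. ennreal ((cmod (deriv g z))\<^sup>2) \<partial>lborel)"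
proof -
  obtain h where h: "h holomorphic_on (g ` S)" "\<And>z. z \<in> S \<Longrightarrow> h (g z) = z"
    using holomorphic_has_inverse[OF g S inj] by metis
  have opn: "open (g ` S)"
    using open_mapping_thm3[OF g S inj] by simp
  have "g ` B = {w \<in> g ` S. h w \<in> B}"
    using BS h(2) by (auto simp: image_iff)
  also have "\<dots> = (\<lambda>w. if w \<in> g ` S then h w else undefined) -` B \<inter> g ` S" by auto
  also have "\<dots> \<in> sets borel"
  proof -
    have "h \<in> borel_measurable (restrict_space borel (g ` S))"
      by (rule borel_measurable_continuous_on_restrict[OF holomorphic_on_imp_continuous_on[OF h(1)]])
    then have "h -` B \<inter> space (restrict_space borel (g ` S)) \<in> sets (restrict_space borel (g ` S))"
      by (rule measurable_sets[OF _ B])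
    then have "h -` B \<inter> g ` S \<in> sets borel"
      using opn by (simp add: sets_restrict_space_iff space_restrict_space)
    moreover have "(\<lambda>w. if w \<in> g ` S then h w else undefined) -` B \<inter> g ` S = h -` B \<inter> g ` S" by auto
    ultimately show ?thesis by simp
  qed
  finally show gB [measurable]: "g ` B \<in> sets borel" .
  have dm: "(\<lambda>z. indicator B z * (cmod (deriv g z))\<^sup>2) \<in> borel_measurable borel"
  proof -
    have "continuous_on S (deriv g)"
      using g S by (simp add: holomorphic_deriv holomorphic_on_imp_continuous_on)
    then have "(\<lambda>z. indicator S z *\<^sub>R deriv g z) \<in> borel_measurable borel"
      using S by (intro borel_measurable_continuous_on_indicator) auto
    then have "(\<lambda>z. indicator B z * (cmod (indicator S z *\<^sub>R deriv g z))\<^sup>2) \<in> borel_measurable borel"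
      by measurable
    also have "(\<lambda>z. indicator B z * (cmod (indicator S z *\<^sub>R deriv g z))\<^sup>2) = (\<lambda>z. indicator B z * (cmod (deriv g z))\<^sup>2)"
      using BS by (intro ext) (auto simp: indicator_def)
    finally show ?thesis .
  qed
  define F where "F = vec_of_complex \<circ> g \<circ> complex_of_vec"
  define B' where "B' = complex_of_vec -` B"
  define F' where "F' x h = vec_of_complex (deriv g (complex_of_vec x) * complex_of_vec h)" for x h
  have B'm [measurable]: "B' \<in> sets borel"
    unfolding B'_def using measurable_sets[OF borel_complex_of_vec B] by simp
  have der: "(F has_derivative F' x) (at x within B')" if "x \<in> B'" for x
  proof -
    have "complex_of_vec x \<in> S" using that BS by (auto simp: B'_def)
    then have "(g has_field_derivative deriv g (complex_of_vec x)) (at (complex_of_vec x))"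
      using g S holomorphic_derivI by blast
    then have "(g has_derivative (*) (deriv g (complex_of_vec x))) (at (complex_of_vec x))"
      by (simp add: has_field_derivative_def)
    from diff_chain_at[OF bounded_linear_imp_has_derivative[OF bounded_linear_complex_of_vec] this]
    have "((g \<circ> complex_of_vec) has_derivative ((*) (deriv g (complex_of_vec x)) \<circ> complex_of_vec)) (at x)" .
    from diff_chain_at[OF this bounded_linear_imp_has_derivative[OF bounded_linear_vec_of_complex]]
    have "((vec_of_complex \<circ> (g \<circ> complex_of_vec)) has_derivative
        (vec_of_complex \<circ> ((*) (deriv g (complex_of_vec x)) \<circ> complex_of_vec))) (at x)" .
    then show ?thesis
      by (auto simp: F_def F'_def[abs_def] o_def intro: has_derivative_at_withinI)
  qed
  have injF: "inj_on F B'"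
  proof (rule inj_onI)
    fix x y assume "x \<in> B'" "y \<in> B'" "F x = F y"
    then have "g (complex_of_vec x) = g (complex_of_vec y)"
      by (metis F_def comp_apply vec_complex_inverse(1))
    then have "complex_of_vec x = complex_of_vec y"
      using inj \<open>x \<in> B'\<close> \<open>y \<in> B'\<close> BS by (auto simp: B'_def inj_on_def)
    then show "x = y" by (metis vec_complex_inverse(2))
  qed
  have det: "\<bar>det (matrix (F' x))\<bar> = (cmod (deriv g (complex_of_vec x)))\<^sup>2" for x
    unfolding F'_def det_matrix_complex_mult by simp
  have FB: "F ` B' = complex_of_vec -` (g ` B)"
  proof (intro equalityI subsetI)
    fix y assume "y \<in> complex_of_vec -` (g ` B)"
    then obtain b where b: "b \<in> B" "complex_of_vec y = g b" by auto
    then have "y = F (vec_of_complex b)" by (metis F_def comp_apply vec_complex_inverse)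
    then show "y \<in> F ` B'" using b(1) by (simp add: B'_def)
  qed (auto simp: F_def B'_def)
  have FBm [measurable]: "F ` B' \<in> sets borel"
    unfolding FB using measurable_sets[OF borel_complex_of_vec gB] by simp
  have e1: "emeasure lborel (g ` B) = emeasure lborel (F ` B')"
    unfolding FB by (subst lborel_complex_vec) (simp add: emeasure_distr)
  define J where "J x = indicator B' x * (cmod (deriv g (complex_of_vec x)))\<^sup>2" for x
  have Jm [measurable]: "J \<in> borel_measurable borel"
    using measurable_compose[OF borel_complex_of_vec dm] by (simp add: J_def[abs_def] B'_def indicator_def vimage_def)
  have Jnn: "0 \<le> J x" for x by (simp add: J_def)
  have e2: "(\<integral>\<^sup>+z\<in>B. ennreal ((cmod (deriv g z))\<^sup>2) \<partial>lborel) = (\<integral>\<^sup>+x. ennreal (J x) \<partial>lborel)"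
  proof -
    have "(\<integral>\<^sup>+z\<in>B. ennreal ((cmod (deriv g z))\<^sup>2) \<partial>lborel) = (\<integral>\<^sup>+z. ennreal (indicator B z * (cmod (deriv g z))\<^sup>2) \<partial>lborel)"
      by (intro nn_integral_cong) (auto simp: indicator_def)
    also have "\<dots> = (\<integral>\<^sup>+x. ennreal (indicator B (complex_of_vec x) * (cmod (deriv g (complex_of_vec x)))\<^sup>2) \<partial>lborel)"
      using dm by (subst lborel_complex_vec) (simp add: nn_integral_distr)
    finally show ?thesis by (simp add: J_def B'_def indicator_def)
  qed
  have Jint: "((\<lambda>x. \<bar>det (matrix (F' x))\<bar>) has_integral m) B' \<longleftrightarrow> (J has_integral m) UNIV" for m
  proof -
    have "J = (\<lambda>x. if x \<in> B' then \<bar>det (matrix (F' x))\<bar> else 0)"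
      unfolding J_def det by auto
    then show ?thesis by (simp only: has_integral_restrict_UNIV)
  qed
  \<comment> \<open>One equivalence serves both cases below: a finite integral yields a finite
    measure of the same value, and a finite measure yields a finite integral, so neither side can be
    infinite alone.\<close>
  have key: "F ` B' \<in> lmeasurable \<and> measure lebesgue (F ` B') = m \<longleftrightarrow> (J has_integral m) UNIV" for m
    using has_measure_differentiable_image[OF _ der injF, of m] Jint[of m] B'm
    by (simp add: sets_completionI_sets)
  show "emeasure lborel (g ` B) = (\<integral>\<^sup>+z\<in>B. ennreal ((cmod (deriv g z))\<^sup>2) \<partial>lborel)"
  proof (cases "(\<integral>\<^sup>+x. ennreal (J x) \<partial>lborel) < \<infinity>")
    case True
    then obtain r where r: "0 \<le> r" "(\<integral>\<^sup>+x. ennreal (J x) \<partial>lborel) = ennreal r"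
      by (cases "\<integral>\<^sup>+x. ennreal (J x) \<partial>lborel") auto
    then have "(J has_integral r) UNIV"
      by (intro nn_integral_has_integral) (auto simp: Jnn)
    then have "F ` B' \<in> lmeasurable" "measure lebesgue (F ` B') = r" using key by auto
    then have "emeasure lebesgue (F ` B') = ennreal r"
      by (metis emeasure_eq_measure2)
    then show ?thesis using e1 e2 r FBm by simp
  next
    case False
    then have inf: "(\<integral>\<^sup>+x. ennreal (J x) \<partial>lborel) = \<infinity>" by (simp add: less_top[symmetric])
    have "emeasure lborel (F ` B') = \<infinity>"
    proof (rule ccontr)
      assume "emeasure lborel (F ` B') \<noteq> \<infinity>"
      then have "F ` B' \<in> lmeasurable"
        using FBm by (auto simp: fmeasurable_def less_top)
      then have "(J has_integral (measure lebesgue (F ` B'))) UNIV" using key by blast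
      then have "(\<integral>\<^sup>+x. ennreal (J x) \<partial>lborel) = ennreal (measure lebesgue (F ` B'))"
        by (intro nn_integral_has_integral_lborel) (auto simp: Jnn)
      then show False using inf by simp
    qed
    then show ?thesis using e1 e2 inf by simp
  qed
qed

text \<open>Two measures are identified: Lebesgue measure restricted to the image of S, and the
  push-forward under g of the density |g'|^2. They agree on Borel sets by the area formula, so
  integrands need no approximation argument.\<close>

theorem nn_integral_holomorphic_substitution:
  fixes G :: "complex \<Rightarrow> ennreal"
  assumes S: "open S" and g: "g holomorphic_on S" and inj: "inj_on g S"
    and G [measurable]: "G \<in> borel_measurable borel"
  shows "(\<integral>\<^sup>+z\<in>g ` S. G z \<partial>lborel) = (\<integral>\<^sup>+z\<in>S. ennreal ((cmod (deriv g z))\<^sup>2) * G (g z) \<partial>lborel)"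
proof -
  have S' [measurable]: "S \<in> sets borel" using S by simp
  have gS [measurable]: "g ` S \<in> sets borel"
    using emeasure_holomorphic_image(1)[OF S g inj S'] by simp
  \<comment> \<open>Nothing is known about g off S, so g and its derivative are cut to 0 there to
    become Borel on the whole plane.\<close>
  define g1 where "g1 z = indicator S z *\<^sub>R g z" for z
  define d1 where "d1 z = indicator S z *\<^sub>R deriv g z" for z
  have [measurable]: "g1 \<in> borel_measurable borel" "d1 \<in> borel_measurable borel"
    using g S unfolding g1_def[abs_def] d1_def[abs_def]
    by (auto intro!: borel_measurable_continuous_on_indicator
        simp: holomorphic_deriv holomorphic_on_imp_continuous_on)
  have eq: "density lborel (indicator (g ` S)) = distr (density lborel (\<lambda>z. ennreal ((cmod (d1 z))\<^sup>2))) borel g1"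
  proof (rule measure_eqI)
    fix A :: "complex set" assume "A \<in> sets (density lborel (indicator (g ` S)))"
    then have A [measurable]: "A \<in> sets borel" by simp
    define B where "B = g1 -` A \<inter> S"
    have Bm [measurable]: "B \<in> sets borel"
      unfolding B_def using measurable_sets[of g1 borel borel A] by simp
    have gB: "g ` B = A \<inter> g ` S" unfolding B_def g1_def by auto
    have "emeasure (distr (density lborel (\<lambda>z. ennreal ((cmod (d1 z))\<^sup>2))) borel g1) A
       = (\<integral>\<^sup>+z\<in>(g1 -` A). ennreal ((cmod (d1 z))\<^sup>2) \<partial>lborel)"
      using measurable_sets[of g1 borel borel A]
      by (simp add: emeasure_distr emeasure_density)
    also have "\<dots> = (\<integral>\<^sup>+z\<in>B. ennreal ((cmod (deriv g z))\<^sup>2) \<partial>lborel)"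
      by (intro nn_integral_cong) (auto simp: indicator_def B_def d1_def)
    also have "\<dots> = emeasure lborel (A \<inter> g ` S)"
      using emeasure_holomorphic_image(2)[OF S g inj Bm] gB by (auto simp: B_def)
    also have "\<dots> = emeasure (density lborel (indicator (g ` S))) A"
      by (subst emeasure_density) (auto simp: nn_integral_indicator[symmetric] indicator_inter_arith mult.commute
            simp del: nn_integral_indicator)
    finally show "emeasure (density lborel (indicator (g ` S))) A
        = emeasure (distr (density lborel (\<lambda>z. ennreal ((cmod (d1 z))\<^sup>2))) borel g1) A" by simp
  qed simp
  have "(\<integral>\<^sup>+z\<in>g ` S. G z \<partial>lborel) = (\<integral>\<^sup>+z. G z \<partial>density lborel (indicator (g ` S)))"
    by (subst nn_integral_density) (auto simp: mult.commute)
  also have "\<dots> = (\<integral>\<^sup>+z. ennreal ((cmod (d1 z))\<^sup>2) * G (g1 z) \<partial>lborel)"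
    unfolding eq by (simp add: nn_integral_distr nn_integral_density)
  also have "\<dots> = (\<integral>\<^sup>+z\<in>S. ennreal ((cmod (deriv g z))\<^sup>2) * G (g z) \<partial>lborel)"
    by (intro nn_integral_cong) (auto simp: d1_def g1_def indicator_def)
  finally show ?thesis .
qed

section \<open>Polar coordinates and Parseval's identity\<close>

lemma null_sets_complex_axis: "{z::complex. Im z = 0} \<in> null_sets lborel"
proof -
  have m: "{z::complex. Im z = 0} \<in> sets borel" by measurable
  have "emeasure lborel {z::complex. Im z = 0} = (\<integral>\<^sup>+z. indicator {z::complex. Im z = 0} z \<partial>lborel)"
    using m by simp
  also have "\<dots> = (\<integral>\<^sup>+x. \<integral>\<^sup>+y. indicator {0::real} y \<partial>lborel \<partial>(lborel :: real measure))"
  proof -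
    have "indicator {z::complex. Im z = 0} (Complex x y) = (indicator {0} y :: ennreal)" for x y
      by (simp add: indicator_def)
    then show ?thesis using m by (subst nn_integral_complex_iterated) simp_all
  qed
  also have "\<dots> = 0" by simp
  finally show ?thesis using m by auto
qed

lemma borel_measurable_cis [measurable]: "cis \<in> borel_measurable borel"
  by (intro borel_measurable_continuous_onI continuous_intros)

text \<open>Polar coordinates come from the conformal map exp on a half strip. Writing the radius as
  exp(-s) turns powers of the radius into exponentials, so radial weights later appear as Laplace
  transforms.\<close>

theorem nn_integral_disk_polar:
  fixes G :: "complex \<Rightarrow> ennreal"
  assumes [measurable]: "G \<in> borel_measurable borel"
  shows "(\<integral>\<^sup>+z\<in>ball 0 1. G z \<partial>lborel) =
    (\<integral>\<^sup>+s\<in>{0<..}. (ennreal (exp (- 2 * s)) * (\<integral>\<^sup>+t\<in>{0..2*pi}. G (of_real (exp (-s)) * cis t) \<partial>lborel)) \<partial>lborel)"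
proof -
  define S where "S = {w. Re w < 0 \<and> 0 < Im w \<and> Im w < 2*pi}"
  have S: "open S" unfolding S_def
    by (intro open_Collect_conj open_Collect_less continuous_intros)
  have inj: "inj_on exp S"
  proof (rule inj_onI)
    fix x y assume xy: "x \<in> S" "y \<in> S" "exp x = exp y"
    then obtain n :: int where n: "x = y + of_int (2*n) * of_real pi * \<i>"
      by (auto simp: exp_eq)
    then have "Im x - Im y = 2 * pi * n" by simp
    moreover have "\<bar>Im x - Im y\<bar> < 2*pi" using xy unfolding S_def by auto
    ultimately have "\<bar>2 * pi * n\<bar> < 2*pi" by simp
    then have "\<bar>real_of_int n\<bar> < 1" by (simp add: abs_mult)
    then have "n = 0" by linarith
    then show "x = y" using n by simp
  qed
  have img: "ball 0 1 - {z. Im z = 0} \<subseteq> exp ` S" "exp ` S \<subseteq> ball 0 1"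
  proof -
    show "exp ` S \<subseteq> ball 0 1" by (auto simp: S_def)
    show "ball 0 1 - {z. Im z = 0} \<subseteq> exp ` S"
    proof
      fix z assume z: "z \<in> ball 0 1 - {z::complex. Im z = 0}"
      then have z0: "z \<noteq> 0" by auto
      \<comment> \<open>The principal logarithm has imaginary part in (-pi, pi]; nonpositive values
        are lifted by 2 pi to land in the strip over (0, 2 pi).\<close>
      define w where "w = (if Im (Ln z) > 0 then Ln z else Ln z + 2*pi*\<i>)"
      have "exp w = z" using z0 exp_two_pi_i by (auto simp: w_def exp_add algebra_simps)
      have "Im (Ln z) \<noteq> 0"
      proof
        assume "Im (Ln z) = 0"
        then have "Im (exp (Ln z)) = 0" by (simp add: Im_exp)
        then show False using z z0 by simp
      qed
      moreover have "- pi < Im (Ln z)" "Im (Ln z) \<le> pi" using z0 mpi_less_Im_Ln Im_Ln_le_pi by auto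
      moreover have "Re (Ln z) < 0" using z z0 by simp
      ultimately have "w \<in> S" using pi_gt_zero by (auto simp: w_def S_def)
      then show "z \<in> exp ` S" using \<open>exp w = z\<close> by blast
    qed
  qed
  have "(\<integral>\<^sup>+z\<in>ball 0 1. G z \<partial>lborel) = (\<integral>\<^sup>+z\<in>exp ` S. G z \<partial>lborel)"
  proof (rule nn_integral_cong_AE)
    \<comment> \<open>The image of the strip misses only points of the real axis, a null
      set.\<close>
    have "AE z::complex in lborel. Im z \<noteq> 0"
      using AE_not_in[OF null_sets_complex_axis] by simp
    then show "AE z in lborel. G z * indicator (ball 0 1) z = G z * indicator (exp ` S) z"
    proof eventually_elim
      case (elim z)
      then have "z \<in> ball 0 1 \<longleftrightarrow> z \<in> exp ` S" using img by blast
      then show ?case by (simp only: indicator_def)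
    qed
  qed
  also have "\<dots> = (\<integral>\<^sup>+z\<in>S. ennreal ((cmod (deriv exp z))\<^sup>2) * G (exp z) \<partial>lborel)"
    by (rule nn_integral_holomorphic_substitution[OF S _ inj]) (auto intro: holomorphic_intros)
  also have "\<dots> = (\<integral>\<^sup>+z\<in>S. ennreal (exp (2 * Re z)) * G (exp z) \<partial>lborel)"
    by (simp add: exp_double DERIV_imp_deriv[OF DERIV_exp])
  also have "\<dots> = (\<integral>\<^sup>+x. \<integral>\<^sup>+y. ennreal (exp (2*x)) * G (exp (Complex x y)) * indicator S (Complex x y) \<partial>lborel \<partial>lborel)"
    using S by (subst nn_integral_complex_iterated) (auto intro!: borel_measurable_times_ennreal simp: borel_measurable_indicator)
  also have "\<dots> = (\<integral>\<^sup>+x. indicator {..<0} x * (ennreal (exp (2*x)) * (\<integral>\<^sup>+t\<in>{0..2*pi}. G (of_real (exp x) * cis t) \<partial>lborel)) \<partial>lborel)"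
  proof (rule nn_integral_cong)
    fix x :: real
    have "(\<integral>\<^sup>+y. ennreal (exp (2*x)) * G (exp (Complex x y)) * indicator S (Complex x y) \<partial>lborel)
       = (\<integral>\<^sup>+y. (indicator {..<0} x * ennreal (exp (2*x))) * (G (of_real (exp x) * cis y) * indicator {0..2*pi} y) \<partial>lborel)"
    proof (rule nn_integral_cong_AE)
      have "AE y::real in lborel. y \<notin> {0, 2*pi}"
        by (rule AE_not_in) (intro finite_imp_null_set_lborel, simp)
      then show "AE y in lborel. ennreal (exp (2*x)) * G (exp (Complex x y)) * indicator S (Complex x y) =
         (indicator {..<0} x * ennreal (exp (2*x))) * (G (of_real (exp x) * cis y) * indicator {0..2*pi} y)"
        by eventually_elim (auto simp: S_def indicator_def exp_eq_polar exp_of_real)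
    qed
    also have "\<dots> = (indicator {..<0} x * ennreal (exp (2*x))) * (\<integral>\<^sup>+t\<in>{0..2*pi}. G (of_real (exp x) * cis t) \<partial>lborel)"
      by (rule nn_integral_cmult) measurable
    finally show "(\<integral>\<^sup>+y. ennreal (exp (2*x)) * G (exp (Complex x y)) * indicator S (Complex x y) \<partial>lborel) =
       indicator {..<0} x * (ennreal (exp (2*x)) * (\<integral>\<^sup>+t\<in>{0..2*pi}. G (of_real (exp x) * cis t) \<partial>lborel))"
      by (simp add: mult.assoc)
  qed
  also have "\<dots> = (\<integral>\<^sup>+s. indicator {0<..} s * (ennreal (exp (- 2 * s)) * (\<integral>\<^sup>+t\<in>{0..2*pi}. G (of_real (exp (-s)) * cis t) \<partial>lborel)) \<partial>lborel)"
  proof -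
    show ?thesis
      by (subst nn_integral_real_affine[where c = "-1" and t = 0]) (auto simp: indicator_def intro!: nn_integral_cong)
  qed
  finally show ?thesis by (simp add: mult.commute)
qed

lemma nn_integral_has_integral_atLeastAtMost:
  fixes f :: "real \<Rightarrow> real"
  assumes f: "continuous_on {a..b} f" "\<And>x. x \<in> {a..b} \<Longrightarrow> 0 \<le> f x" and I: "(f has_integral I) {a..b}"
  shows "(\<integral>\<^sup>+t\<in>{a..b}. ennreal (f t) \<partial>lborel) = ennreal I"
proof -
  have "(\<lambda>x. indicator {a..b} x *\<^sub>R f x) \<in> borel_measurable borel"
    using f(1) by (intro borel_measurable_continuous_on_indicator) auto
  moreover have "((\<lambda>x. indicator {a..b} x *\<^sub>R f x) has_integral I) UNIV"
  proof -
    have "(\<lambda>x. indicator {a..b} x *\<^sub>R f x) = (\<lambda>x. if x \<in> {a..b} then f x else 0)"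
      by (auto simp: indicator_def)
    then show ?thesis using I by (simp only: has_integral_restrict_UNIV)
  qed
  ultimately have "(\<integral>\<^sup>+t. ennreal (indicator {a..b} t *\<^sub>R f t) \<partial>lborel) = ennreal I"
    using f(2) by (intro nn_integral_has_integral_lborel) (auto simp: indicator_def)
  moreover have "(\<integral>\<^sup>+t\<in>{a..b}. ennreal (f t) \<partial>lborel) = (\<integral>\<^sup>+t. ennreal (indicator {a..b} t *\<^sub>R f t) \<partial>lborel)"
    by (intro nn_integral_cong) (auto simp: indicator_def)
  ultimately show ?thesis by simp
qed

lemma has_integral_cis_int:
  "((\<lambda>t. cis (of_int k * t)) has_integral (if k = 0 then of_real (2*pi) else 0)) {0..2*pi}"
proof (cases "k = 0")
  case True
  then show ?thesis using has_integral_const_real[of "1::complex" 0 "2*pi"] by (simp add: scaleR_conv_of_real)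
next
  case False
  define F where "F t = cis (of_int k * t) / (\<i> * of_int k)" for t
  have "(F has_vector_derivative cis (of_int k * t)) (at t within {0..2*pi})" for t
  proof -
    have "((\<lambda>z. exp (\<i> * of_int k * z) / (\<i> * of_int k)) has_field_derivative exp (\<i> * of_int k * of_real t)) (at (of_real t))"
      using False by (auto intro!: derivative_eq_intros)
    from has_vector_derivative_real_field[OF this, of "{0..2*pi}"] show ?thesis
      by (simp add: F_def[abs_def] cis_conv_exp mult.assoc)
  qed
  then have "((\<lambda>t. cis (of_int k * t)) has_integral (F (2*pi) - F 0)) {0..2*pi}"
    by (intro fundamental_theorem_of_calculus) auto
  moreover have "F (2*pi) = F 0"
  proof -
    have "cis (of_int k * (2*pi)) = 1"
      by (metis cis_multiple_2pi Ints_of_int mult.commute)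
    then show ?thesis by (simp add: F_def)
  qed
  ultimately show ?thesis using False by simp
qed

lemma has_integral_norm_trig_sum:
  fixes a :: "nat \<Rightarrow> complex"
  shows "((\<lambda>t. (cmod (\<Sum>n<N. a n * cis (real n * t)))\<^sup>2) has_integral (\<Sum>n<N. 2*pi*(cmod (a n))\<^sup>2)) {0..2*pi}"
proof -
  have ex: "of_real ((cmod (\<Sum>n<N. a n * cis (real n * t)))\<^sup>2) =
     (\<Sum>n<N. \<Sum>m<N. (a n * cnj (a m)) * cis (of_int (int n - int m) * t))" for t
    by (simp add: complex_norm_square sum_product cis_cnj cis_mult cnj_sum algebra_simps
        del: of_real_power)
  have "((\<lambda>t. \<Sum>n<N. \<Sum>m<N. (a n * cnj (a m)) * cis (of_int (int n - int m) * t)) has_integral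
     (\<Sum>n<N. \<Sum>m<N. (a n * cnj (a m)) * (if int n - int m = 0 then of_real (2*pi) else 0))) {0..2*pi}"
    by (intro has_integral_sum has_integral_mult_right has_integral_cis_int finite_lessThan)
  also have "(\<Sum>n<N. \<Sum>m<N. (a n * cnj (a m)) * (if int n - int m = 0 then of_real (2*pi) else 0))
    = of_real (\<Sum>n<N. 2*pi*(cmod (a n))\<^sup>2)"
  proof -
    have "(\<Sum>m<N. (a n * cnj (a m)) * (if int n - int m = 0 then of_real (2*pi) else 0)) = of_real (2*pi*(cmod (a n))\<^sup>2)"
      if "n < N" for n
    proof -
      have "(\<Sum>m<N. (a n * cnj (a m)) * (if int n - int m = 0 then of_real (2*pi) else 0))
         = (\<Sum>m<N. if m = n then (a n * cnj (a m)) * of_real (2*pi) else 0)"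
        by (intro sum.cong) auto
      also have "\<dots> = (a n * cnj (a n)) * of_real (2*pi)" using that by simp
      finally show ?thesis by (simp add: complex_norm_square del: of_real_power)
    qed
    then show ?thesis by simp
  qed
  finally have "((\<lambda>t. of_real ((cmod (\<Sum>n<N. a n * cis (real n * t)))\<^sup>2) :: complex) has_integral of_real (\<Sum>n<N. 2*pi*(cmod (a n))\<^sup>2)) {0..2*pi}"
    by (simp only: ex)
  from has_integral_linear[OF this bounded_linear_Re] show ?thesis by (simp add: o_def)
qed

text \<open>The coefficients are absolutely summable at every radius below 1, so the partial sums
  are uniformly bounded and dominated convergence carries the finite orthogonality relation to the
  limit.\<close>

theorem nn_integral_circle_power_series:
  fixes c :: "nat \<Rightarrow> complex"
  assumes g: "\<And>z. cmod z < 1 \<Longrightarrow> (\<lambda>n. c n * z ^ n) sums g z" and r: "0 \<le> r" "r < 1"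
  shows "(\<integral>\<^sup>+t\<in>{0..2*pi}. ennreal ((cmod (g (of_real r * cis t)))\<^sup>2) \<partial>lborel)
     = (\<Sum>n. ennreal (2*pi*(cmod (c n))\<^sup>2 * r ^ (2*n)))"
proof -
  define a where "a n = c n * of_real r ^ n" for n
  have sm: "summable (\<lambda>n. cmod (a n))"
  proof -
    \<comment> \<open>A radius strictly between r and 1: convergence there gives absolute
      convergence at r.\<close>
    have "summable (\<lambda>n. c n * of_real ((1 + r)/2) ^ n)"
      using g[of "of_real ((1 + r)/2)"] r by (auto simp: sums_iff simp del: of_real_add of_real_divide)
    then have "summable (\<lambda>n. norm (c n * of_real r ^ n))"
      by (rule powser_insidea) (use r in \<open>auto simp del: of_real_add of_real_divide\<close>)
    then show ?thesis by (simp add: a_def)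
  qed
  define S where "S N t = (\<Sum>n<N. a n * cis (real n * t))" for N t
  have cisn: "cis (real n * t) = cis t ^ n" for n t by (simp add: Complex.DeMoivre)
  have Sb: "cmod (S N t) \<le> (\<Sum>n. cmod (a n))" for N t
  proof -
    have "cmod (S N t) \<le> (\<Sum>n<N. cmod (a n))"
      unfolding S_def by (rule order.trans[OF norm_sum]) (simp add: norm_mult)
    also have "\<dots> \<le> (\<Sum>n. cmod (a n))" by (intro sum_le_suminf sm) auto
    finally show ?thesis .
  qed
  have Slim: "(\<lambda>N. S N t) \<longlonglongrightarrow> g (of_real r * cis t)" for t
    using g[of "of_real r * cis t"] r
    by (simp add: sums_def S_def a_def cisn power_mult_distrib norm_mult mult.assoc)
  have Sm [measurable]: "S N \<in> borel_measurable borel" for N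
    unfolding S_def[abs_def] by measurable
  have e: "(\<integral>\<^sup>+t\<in>{0..2*pi}. ennreal ((cmod (S N t))\<^sup>2) \<partial>lborel) = (\<Sum>n<N. ennreal (2*pi*(cmod (c n))\<^sup>2 * r ^ (2*n)))" for N
  proof -
    have "(\<integral>\<^sup>+t\<in>{0..2*pi}. ennreal ((cmod (S N t))\<^sup>2) \<partial>lborel) = ennreal (\<Sum>n<N. 2*pi*(cmod (a n))\<^sup>2)"
      using has_integral_norm_trig_sum[of a N] unfolding S_def
      by (intro nn_integral_has_integral_atLeastAtMost) (auto intro!: continuous_intros)
    also have "\<dots> = (\<Sum>n<N. ennreal (2*pi*(cmod (c n))\<^sup>2 * r ^ (2*n)))"
      using r by (subst sum_ennreal[symmetric])
        (auto simp: a_def norm_mult norm_power power_mult_distrib power_mult[symmetric] mult.commute mult.left_commute)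
    finally show ?thesis .
  qed
  have "(\<lambda>N. \<integral>\<^sup>+t. ennreal ((cmod (S N t))\<^sup>2) * indicator {0..2*pi} t \<partial>lborel) \<longlonglongrightarrow>
     (\<integral>\<^sup>+t. ennreal ((cmod (g (of_real r * cis t)))\<^sup>2) * indicator {0..2*pi} t \<partial>lborel)"
  proof (rule nn_integral_dominated_convergence)
    show "(\<lambda>t. ennreal ((cmod (g (of_real r * cis t)))\<^sup>2) * indicator {0..2*pi} t) \<in> borel_measurable lborel"
    proof -
      have "(\<lambda>t. g (of_real r * cis t)) \<in> borel_measurable borel"
        by (rule borel_measurable_LIMSEQ_metric[OF Sm Slim])
      then show ?thesis by measurable
    qed
    show "(\<integral>\<^sup>+t. ennreal ((\<Sum>n. cmod (a n))\<^sup>2) * indicator {0..2*pi} t \<partial>lborel) < \<infinity>"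
      by (simp add: nn_integral_cmult_indicator ennreal_mult_less_top)
    show "AE t in lborel. ennreal ((cmod (S N t))\<^sup>2) * indicator {0..2*pi} t \<le> ennreal ((\<Sum>n. cmod (a n))\<^sup>2) * indicator {0..2*pi} t" for N
      by (auto intro!: mult_right_mono ennreal_leI power_mono Sb)
    show "AE t in lborel. (\<lambda>N. ennreal ((cmod (S N t))\<^sup>2) * indicator {0..2*pi} t) \<longlonglongrightarrow>
        ennreal ((cmod (g (of_real r * cis t)))\<^sup>2) * indicator {0..2*pi} t"
      by (auto simp: indicator_def intro!: tendsto_ennrealI tendsto_intros Slim)
  qed measurable
  then have "(\<lambda>N. \<Sum>n<N. ennreal (2*pi*(cmod (c n))\<^sup>2 * r ^ (2*n))) \<longlonglongrightarrow>
     (\<integral>\<^sup>+t\<in>{0..2*pi}. ennreal ((cmod (g (of_real r * cis t)))\<^sup>2) \<partial>lborel)"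
    by (simp only: e)
  moreover have "(\<lambda>N. \<Sum>n<N. ennreal (2*pi*(cmod (c n))\<^sup>2 * r ^ (2*n))) \<longlonglongrightarrow>
     (\<Sum>n. ennreal (2*pi*(cmod (c n))\<^sup>2 * r ^ (2*n)))"
    by (rule summable_LIMSEQ) simp
  ultimately show ?thesis by (rule LIMSEQ_unique)
qed

text \<open>A radial weight keeps the monomials orthogonal, so Parseval on each circle suffices. The
  Jacobian factor exp(-2 s) raises the exponent by one, hence \<open>Suc n\<close> in the Laplace
  transform.\<close>

theorem nn_integral_disk_power_series:
  fixes c :: "nat \<Rightarrow> complex" and k :: "real \<Rightarrow> ennreal"
  assumes g: "\<And>z. cmod z < 1 \<Longrightarrow> (\<lambda>n. c n * z ^ n) sums g z" and hol: "g holomorphic_on ball 0 1"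
    and k [measurable]: "k \<in> borel_measurable borel"
  shows "(\<integral>\<^sup>+z\<in>ball 0 1. ennreal ((cmod (g z))\<^sup>2) * k (cmod z) \<partial>lborel)
     = (\<Sum>n. ennreal (2*pi*(cmod (c n))\<^sup>2) * (\<integral>\<^sup>+s\<in>{0<..}. ennreal (exp (- 2 * real (Suc n) * s)) * k (exp (-s)) \<partial>lborel))"
proof -
  define g1 where "g1 z = indicator (ball 0 1) z *\<^sub>R g z" for z
  have [measurable]: "g1 \<in> borel_measurable borel"
    unfolding g1_def[abs_def] using hol
    by (intro borel_measurable_continuous_on_indicator holomorphic_on_imp_continuous_on) auto
  have "(\<integral>\<^sup>+z\<in>ball 0 1. ennreal ((cmod (g z))\<^sup>2) * k (cmod z) \<partial>lborel)
     = (\<integral>\<^sup>+z\<in>ball 0 1. ennreal ((cmod (g1 z))\<^sup>2) * k (cmod z) \<partial>lborel)"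
    by (intro nn_integral_cong) (auto simp: g1_def indicator_def)
  also have "\<dots> = (\<integral>\<^sup>+s\<in>{0<..}. (ennreal (exp (- 2 * s)) * (\<integral>\<^sup>+t\<in>{0..2*pi}.
       ennreal ((cmod (g1 (of_real (exp (-s)) * cis t)))\<^sup>2) * k (cmod (of_real (exp (-s)) * cis t)) \<partial>lborel)) \<partial>lborel)"
    by (rule nn_integral_disk_polar) measurable
  also have "\<dots> = (\<integral>\<^sup>+s. (\<Sum>n. ennreal (2*pi*(cmod (c n))\<^sup>2) * (ennreal (exp (- 2 * real (Suc n) * s)) * k (exp (-s)) * indicator {0<..} s)) \<partial>lborel)"
  proof (rule nn_integral_cong)
    fix s :: real
    show "ennreal (exp (- 2 * s)) * (\<integral>\<^sup>+t\<in>{0..2*pi}.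
       ennreal ((cmod (g1 (of_real (exp (-s)) * cis t)))\<^sup>2) * k (cmod (of_real (exp (-s)) * cis t)) \<partial>lborel) * indicator {0<..} s
       = (\<Sum>n. ennreal (2*pi*(cmod (c n))\<^sup>2) * (ennreal (exp (- 2 * real (Suc n) * s)) * k (exp (-s)) * indicator {0<..} s))"
    proof (cases "s > 0")
      case True
      have "(\<integral>\<^sup>+t\<in>{0..2*pi}. ennreal ((cmod (g1 (of_real (exp (-s)) * cis t)))\<^sup>2) * k (cmod (of_real (exp (-s)) * cis t)) \<partial>lborel)
        = (\<integral>\<^sup>+t. k (exp (-s)) * (ennreal ((cmod (g (of_real (exp (-s)) * cis t)))\<^sup>2) * indicator {0..2*pi} t) \<partial>lborel)"
        using True by (intro nn_integral_cong) (auto simp: g1_def indicator_def norm_mult mult.commute simp flip: exp_of_real)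
      also have "\<dots> = k (exp (-s)) * (\<integral>\<^sup>+t. (ennreal ((cmod (g (of_real (exp (-s)) * cis t)))\<^sup>2) * indicator {0..2*pi} t) \<partial>lborel)"
      proof (rule nn_integral_cmult)
        have "(\<lambda>t. g1 (of_real (exp (-s)) * cis t)) \<in> borel_measurable borel" by measurable
        also have "(\<lambda>t. g1 (of_real (exp (-s)) * cis t)) = (\<lambda>t. g (of_real (exp (-s)) * cis t))"
          using True by (auto simp: g1_def indicator_def norm_mult simp flip: exp_of_real)
        finally show "(\<lambda>t. ennreal ((cmod (g (of_real (exp (-s)) * cis t)))\<^sup>2) * indicator {0..2*pi} t) \<in> borel_measurable lborel"
          by measurable
      qed
      also have "\<dots> = k (exp (-s)) * (\<Sum>n. ennreal (2*pi*(cmod (c n))\<^sup>2 * exp (-s) ^ (2*n)))"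
        using True by (subst nn_integral_circle_power_series[OF g]) auto
      finally have "ennreal (exp (- 2 * s)) * (\<integral>\<^sup>+t\<in>{0..2*pi}. ennreal ((cmod (g1 (of_real (exp (-s)) * cis t)))\<^sup>2) * k (cmod (of_real (exp (-s)) * cis t)) \<partial>lborel)
        = (\<Sum>n. ennreal (exp (- 2 * s)) * (k (exp (-s)) * ennreal (2*pi*(cmod (c n))\<^sup>2 * exp (-s) ^ (2*n))))"
        by (simp only: ennreal_suminf_cmult)
      also have "\<dots> = (\<Sum>n. ennreal (2*pi*(cmod (c n))\<^sup>2) * (ennreal (exp (- 2 * real (Suc n) * s)) * k (exp (-s))))"
      proof (rule suminf_cong)
        fix n
        have "exp (- 2 * real (Suc n) * s) = exp (- 2 * s) * exp (-s) ^ (2*n)"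
          by (simp add: exp_of_nat_mult[symmetric] exp_add[symmetric] algebra_simps)
        then show "ennreal (exp (- 2 * s)) * (k (exp (-s)) * ennreal (2*pi*(cmod (c n))\<^sup>2 * exp (-s) ^ (2*n)))
          = ennreal (2*pi*(cmod (c n))\<^sup>2) * (ennreal (exp (- 2 * real (Suc n) * s)) * k (exp (-s)))"
          by (simp add: ennreal_mult mult_ac)
      qed
      finally show ?thesis using True by simp
    qed simp
  qed
  also have "\<dots> = (\<Sum>n. \<integral>\<^sup>+s. ennreal (2*pi*(cmod (c n))\<^sup>2) * (ennreal (exp (- 2 * real (Suc n) * s)) * k (exp (-s)) * indicator {0<..} s) \<partial>lborel)"
    by (rule nn_integral_suminf) measurable
  also have "\<dots> = (\<Sum>n. ennreal (2*pi*(cmod (c n))\<^sup>2) * (\<integral>\<^sup>+s\<in>{0<..}. ennreal (exp (- 2 * real (Suc n) * s)) * k (exp (-s)) \<partial>lborel))"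
    by (intro suminf_cong nn_integral_cmult) measurable
  finally show ?thesis .
qed

text \<open>Differentiation shifts the coefficients by one, so the exponent \<open>Suc n\<close> now
  matches the index of the coefficient; the constant term is invisible to the energy.\<close>

lemma nn_integral_disk_deriv:
  fixes k :: "real \<Rightarrow> ennreal"
  assumes h: "h holomorphic_on ball 0 1" and k: "k \<in> borel_measurable borel"
  defines "c \<equiv> \<lambda>n. (deriv ^^ n) h 0 / fact n"
  shows "(\<integral>\<^sup>+z\<in>ball 0 1. ennreal ((cmod (deriv h z))\<^sup>2) * k (cmod z) \<partial>lborel)
     = (\<Sum>n. ennreal (2*pi*(real (Suc n) * cmod (c (Suc n)))\<^sup>2) * (\<integral>\<^sup>+s\<in>{0<..}. ennreal (exp (- 2 * real (Suc n) * s)) * k (exp (-s)) \<partial>lborel))"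
proof -
  have s: "(\<lambda>n. c n * z ^ n) sums h z" if "cmod z < 1" for z
    using holomorphic_power_series[OF h, of z] that by (simp add: c_def)
  have d: "(\<lambda>n. diffs c n * z ^ n) sums deriv h z" if "cmod z < 1" for z
  proof (rule termdiffs_sums_strong[OF s])
    show "(h has_field_derivative deriv h z) (at z)"
      using h that by (intro holomorphic_derivI[of h "ball 0 1"]) auto
  qed (use that in auto)
  show ?thesis
    by (subst nn_integral_disk_power_series[OF d holomorphic_deriv[OF h open_ball] k])
       (auto simp: diffs_def norm_mult norm_of_nat simp del: of_nat_Suc)
qed

section \<open>Disk automorphisms\<close>

lemma nn_integral_lborel_shift:
  fixes H :: "real \<Rightarrow> ennreal"
  assumes [measurable]: "H \<in> borel_measurable borel"
  shows "(\<integral>\<^sup>+x. H (x + c) \<partial>lborel) = (\<integral>\<^sup>+x. H x \<partial>lborel)"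
  using nn_integral_real_affine[of H 1 c] by (simp add: add.commute)

text \<open>The starting point c is moved to the multiple of 2 pi in [c, c + 2 pi), and from there
  to 0 by whole periods. Half-open intervals make the pieces tile without overlap.\<close>

lemma nn_integral_periodic:
  fixes H :: "real \<Rightarrow> ennreal"
  assumes [measurable]: "H \<in> borel_measurable borel" and per: "\<And>x. H (x + 2*pi) = H x"
  shows "(\<integral>\<^sup>+x\<in>{c..c+2*pi}. H x \<partial>lborel) = (\<integral>\<^sup>+x\<in>{0..2*pi}. H x \<partial>lborel)"
proof -
  define I where "I c = (\<integral>\<^sup>+x\<in>{c..<c+2*pi}. H x \<partial>lborel)" for c
  have closed: "(\<integral>\<^sup>+x\<in>{c..c+2*pi}. H x \<partial>lborel) = I c" for c
    unfolding I_def
  proof (rule nn_integral_cong_AE)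
    have "AE x::real in lborel. x \<notin> {c+2*pi}"
      by (rule AE_not_in) (intro finite_imp_null_set_lborel, simp)
    then show "AE x in lborel. H x * indicator {c..c+2*pi} x = H x * indicator {c..<c+2*pi} x"
      by eventually_elim (auto simp: indicator_def)
  qed
  have shift: "I (c + 2*pi) = I c" for c
  proof -
    have "I c = (\<integral>\<^sup>+x. H (x + 2*pi) * indicator {c+2*pi..<c+2*pi+2*pi} (x + 2*pi) \<partial>lborel)"
      unfolding I_def by (intro nn_integral_cong) (auto simp: per indicator_def)
    also have "\<dots> = I (c + 2*pi)"
      unfolding I_def by (rule nn_integral_lborel_shift) measurable
    finally show ?thesis by simp
  qed
  have shiftn: "I (c + 2 * pi * real n) = I c" for c n
    by (induction n) (use shift[of "c + 2 * pi * real n" for n] in \<open>simp_all add: algebra_simps\<close>)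
  have shiftz: "I (2 * pi * of_int k) = I 0" for k
  proof (cases "k \<ge> 0")
    case True
    then show ?thesis using shiftn[of 0 "nat k"] by simp
  next
    case False
    then show ?thesis using shiftn[of "2 * pi * of_int k" "nat (-k)"] by (simp add: algebra_simps)
  qed
  \<comment> \<open>Cut at m and transport the left piece by one period to the right end.\<close>
  have mid: "I c = I m" if m: "c \<le> m" "m < c + 2*pi" for c m
  proof -
    have "I c = (\<integral>\<^sup>+x. (H x * indicator {c..<m} x + H x * indicator {m..<c+2*pi} x) \<partial>lborel)"
      unfolding I_def using m by (intro nn_integral_cong) (auto simp: indicator_def)
    also have "\<dots> = (\<integral>\<^sup>+x. H x * indicator {c..<m} x \<partial>lborel) + (\<integral>\<^sup>+x. H x * indicator {m..<c+2*pi} x \<partial>lborel)"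
      by (rule nn_integral_add) measurable
    also have "(\<integral>\<^sup>+x. H x * indicator {c..<m} x \<partial>lborel) = (\<integral>\<^sup>+x. H (x + 2*pi) * indicator {c+2*pi..<m+2*pi} (x + 2*pi) \<partial>lborel)"
      by (intro nn_integral_cong) (auto simp: per indicator_def)
    also have "\<dots> = (\<integral>\<^sup>+x. H x * indicator {c+2*pi..<m+2*pi} x \<partial>lborel)"
      by (rule nn_integral_lborel_shift) measurable
    also have "\<dots> + (\<integral>\<^sup>+x. H x * indicator {m..<c+2*pi} x \<partial>lborel)
       = (\<integral>\<^sup>+x. (H x * indicator {c+2*pi..<m+2*pi} x + H x * indicator {m..<c+2*pi} x) \<partial>lborel)"
      by (rule nn_integral_add[symmetric]) measurable
    also have "\<dots> = I m"
      unfolding I_def using m by (intro nn_integral_cong) (auto simp: indicator_def)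
    finally show ?thesis .
  qed
  define k where "k = \<lceil>c / (2*pi)\<rceil>"
  have "c / (2*pi) \<le> of_int k" "of_int k < c / (2*pi) + 1"
    unfolding k_def by linarith+
  then have "c \<le> 2 * pi * of_int k" "2 * pi * of_int k < c + 2*pi"
    using pi_gt_zero by (auto simp: field_simps)
  then have "I c = I 0" using mid shiftz by metis
  then show ?thesis using closed[of c] closed[of 0] by simp
qed

section \<open>Metric identities for disk automorphisms\<close>

lemma one_minus_cnj_mult_nonzero:
  assumes "cmod a < 1" "cmod z \<le> 1"
  shows "1 - cnj a * z \<noteq> 0"
proof
  assume "1 - cnj a * z = 0"
  then have "cmod a * cmod z = 1" by (metis complex_mod_cnj eq_iff_diff_eq_0 norm_mult norm_one)
  moreover have "cmod a * cmod z \<le> cmod a * 1" using assms by (intro mult_left_mono) auto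
  ultimately show False using assms by simp
qed

lemma norm_one_minus_cnj_mult_ge:
  assumes "cmod z \<le> 1"
  shows "1 - cmod a \<le> cmod (1 - cnj a * z)"
proof -
  have "cmod a * cmod z \<le> cmod a * 1" using assms by (intro mult_left_mono) auto
  moreover have "1 - cmod (cnj a * z) \<le> cmod (1 - cnj a * z)"
    using norm_triangle_ineq2[of 1 "cnj a * z"] by simp
  ultimately show ?thesis by (simp add: norm_mult)
qed

lemma one_minus_norm_disk_aut:
  assumes "1 - cnj a * z \<noteq> 0"
  shows "1 - (cmod (disk_aut a z))\<^sup>2 = (1 - (cmod a)\<^sup>2) * (1 - (cmod z)\<^sup>2) / (cmod (1 - cnj a * z))\<^sup>2"
proof -
  have "(cmod (1 - cnj a * z))\<^sup>2 - (cmod (a - z))\<^sup>2 = (1 - (cmod a)\<^sup>2) * (1 - (cmod z)\<^sup>2)"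
    unfolding cmod_power2 by (simp add: power2_eq_square algebra_simps)
  then show ?thesis using assms by (simp add: disk_aut_def norm_divide power_divide field_simps)
qed

lemma norm_disk_aut_less:
  assumes "cmod a < 1" "cmod z < 1"
  shows "cmod (disk_aut a z) < 1"
proof -
  have nz: "1 - cnj a * z \<noteq> 0" using one_minus_cnj_mult_nonzero assms by simp
  have "0 < (1 - (cmod a)\<^sup>2) * (1 - (cmod z)\<^sup>2) / (cmod (1 - cnj a * z))\<^sup>2"
    using assms nz by (intro divide_pos_pos mult_pos_pos) (auto simp: power_less_one_iff)
  then have "(cmod (disk_aut a z))\<^sup>2 < 1" using one_minus_norm_disk_aut[OF nz] by simp
  then show ?thesis by (simp add: power_less_one_iff)
qed

lemma norm_disk_aut_circle:
  assumes "cmod a < 1" "cmod z = 1"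
  shows "cmod (disk_aut a z) = 1"
proof -
  have nz: "1 - cnj a * z \<noteq> 0" using one_minus_cnj_mult_nonzero assms by simp
  have "1 - (cmod (disk_aut a z))\<^sup>2 = 0" using one_minus_norm_disk_aut[OF nz] assms by simp
  then show ?thesis by (simp add: power2_eq_1_iff) (smt (verit) norm_ge_zero)
qed

lemma disk_aut_involution:
  assumes "cmod a < 1" "cmod z \<le> 1"
  shows "disk_aut a (disk_aut a z) = z"
proof -
  have nz: "1 - cnj a * z \<noteq> 0" using one_minus_cnj_mult_nonzero assms by simp
  have "cmod (disk_aut a z) \<le> 1"
    using norm_disk_aut_less[of a z] norm_disk_aut_circle[of a z] assms by linarith
  then have nz2: "1 - cnj a * disk_aut a z \<noteq> 0" using one_minus_cnj_mult_nonzero assms by simp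
  define D where "D = 1 - cnj a * z"
  have e: "disk_aut a z * D = a - z" using nz by (simp add: disk_aut_def D_def)
  have "(a - disk_aut a z) * D = z * ((1 - cnj a * disk_aut a z) * D)"
  proof -
    have "(a - disk_aut a z) * D = a * D - disk_aut a z * D" by (simp add: algebra_simps)
    also have "\<dots> = z * (D - cnj a * (disk_aut a z * D))"
      unfolding e by (simp add: D_def algebra_simps)
    finally show ?thesis by (simp add: algebra_simps)
  qed
  then have "a - disk_aut a z = z * (1 - cnj a * disk_aut a z)"
    using nz by (simp add: D_def)
  then show ?thesis using nz2 unfolding disk_aut_def[of a "disk_aut a z"] by simp
qed

text \<open>Chords scale by the geometric mean of the derivatives at their two end points. This is
  the identity behind the conformal invariance of du dv / |u - v|^2.\<close>

lemma disk_aut_diff: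
  assumes "1 - cnj a * z \<noteq> 0" "1 - cnj a * w \<noteq> 0"
  shows "disk_aut a z - disk_aut a w = of_real (1 - (cmod a)\<^sup>2) * (w - z) / ((1 - cnj a * z) * (1 - cnj a * w))"
proof -
  have "(a - z) * (1 - cnj a * w) - (a - w) * (1 - cnj a * z) = (1 - a * cnj a) * (w - z)"
    by (simp add: algebra_simps)
  then show ?thesis using assms
    by (simp add: disk_aut_def diff_frac_eq complex_norm_square del: of_real_power)
qed

lemma norm_disk_aut_diff:
  assumes "cmod a < 1" "cmod z \<le> 1" "cmod w \<le> 1"
  shows "cmod (disk_aut a z - disk_aut a w)
     = (1 - (cmod a)\<^sup>2) * cmod (z - w) / (cmod (1 - cnj a * z) * cmod (1 - cnj a * w))"
proof -
  have "0 \<le> 1 - (cmod a)\<^sup>2" using assms by (simp add: power_le_one_iff)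
  then show ?thesis
    using disk_aut_diff[of a z w] one_minus_cnj_mult_nonzero[of a] assms
    by (simp add: norm_divide norm_mult norm_minus_commute del: of_real_diff)
qed

lemma disk_aut_has_derivative:
  assumes "1 - cnj a * z \<noteq> 0"
  shows "(disk_aut a has_field_derivative - of_real (1 - (cmod a)\<^sup>2) / (1 - cnj a * z)\<^sup>2) (at z)"
proof -
  have "((\<lambda>z. (a - z) / (1 - cnj a * z)) has_field_derivative
     ((-1) * (1 - cnj a * z) - (a - z) * (- cnj a)) / ((1 - cnj a * z) * (1 - cnj a * z))) (at z)"
    using assms by (auto intro!: derivative_eq_intros)
  also have "((-1) * (1 - cnj a * z) - (a - z) * (- cnj a)) = - of_real (1 - (cmod a)\<^sup>2)"
    by (simp add: complex_norm_square algebra_simps del: of_real_power)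
  finally show ?thesis by (simp add: disk_aut_def[abs_def] power2_eq_square)
qed

lemma norm_deriv_disk_aut:
  assumes "cmod a < 1" "cmod z \<le> 1"
  shows "cmod (deriv (disk_aut a) z) = (1 - (cmod a)\<^sup>2) / (cmod (1 - cnj a * z))\<^sup>2"
proof -
  have "0 \<le> 1 - (cmod a)\<^sup>2" using assms by (simp add: power_le_one_iff)
  then show ?thesis
    using DERIV_imp_deriv[OF disk_aut_has_derivative[OF one_minus_cnj_mult_nonzero[OF assms]]]
    by (simp add: norm_divide norm_power del: of_real_diff)
qed

lemma holomorphic_disk_aut: "cmod a < 1 \<Longrightarrow> disk_aut a holomorphic_on ball 0 1"
  by (rule holomorphic_onI)
    (meson disk_aut_has_derivative field_differentiable_at_within field_differentiable_def
      less_imp_le mem_ball_0 one_minus_cnj_mult_nonzero)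

lemma disk_aut_image_ball:
  assumes "cmod a < 1"
  shows "disk_aut a ` ball 0 1 = ball 0 1" "inj_on (disk_aut a) (ball 0 1)"
proof -
  show "disk_aut a ` ball 0 1 = ball 0 1"
  proof (intro equalityI subsetI)
    fix z assume z: "z \<in> ball (0::complex) 1"
    then have "z = disk_aut a (disk_aut a z)" "disk_aut a z \<in> ball 0 1"
      using assms disk_aut_involution norm_disk_aut_less by auto
    then show "z \<in> disk_aut a ` ball 0 1" by blast
  qed (use assms norm_disk_aut_less in auto)
  show "inj_on (disk_aut a) (ball 0 1)"
    by (rule inj_on_inverseI[of _ "disk_aut a"]) (use assms disk_aut_involution in auto)
qed

lemma borel_measurable_disk_aut [measurable]: "disk_aut a \<in> borel_measurable borel"
  unfolding disk_aut_def[abs_def] by measurable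

lemma nn_integral_disk_aut:
  fixes G :: "complex \<Rightarrow> ennreal"
  assumes a: "cmod a < 1" and G: "G \<in> borel_measurable borel"
  shows "(\<integral>\<^sup>+z\<in>ball 0 1. G z \<partial>lborel)
    = (\<integral>\<^sup>+z\<in>ball 0 1. ennreal ((cmod (deriv (disk_aut a) z))\<^sup>2) * G (disk_aut a z) \<partial>lborel)"
  using nn_integral_holomorphic_substitution[OF open_ball holomorphic_disk_aut[OF a] disk_aut_image_ball(2)[OF a] G]
  by (simp add: disk_aut_image_ball(1)[OF a])

lemma holomorphic_comp_disk_aut:
  assumes a: "cmod a < 1" and f: "f holomorphic_on ball 0 1"
  shows "(\<lambda>z. f (disk_aut a z)) holomorphic_on ball 0 1"
  using holomorphic_on_compose_gen[OF holomorphic_disk_aut[OF a] f] disk_aut_image_ball(1)[OF a]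
  by (simp add: o_def)

lemma deriv_comp_disk_aut:
  assumes a: "cmod a < 1" and f: "f holomorphic_on ball 0 1" and z: "cmod z < 1"
  shows "deriv (\<lambda>z. f (disk_aut a z)) z = deriv f (disk_aut a z) * deriv (disk_aut a) z"
proof -
  have "disk_aut a field_differentiable at z"
    using holomorphic_disk_aut[OF a] z by (auto simp: holomorphic_on_open field_differentiable_def)
  moreover have "f field_differentiable at (disk_aut a z)"
    using f norm_disk_aut_less[OF a z] by (auto simp: holomorphic_on_open field_differentiable_def)
  ultimately show ?thesis using deriv_chain[of "disk_aut a" z f] by (simp add: o_def)
qed

text \<open>The squared chain-rule factor is exactly the Jacobian of \<open>disk_aut\<close>, so the
  Dirichlet energy is conformally invariant and a weight centred at \<open>a\<close> becomes
  radial.\<close>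

lemma nn_integral_deriv_disk_aut:
  fixes k :: "real \<Rightarrow> ennreal"
  assumes a: "cmod a < 1" and f: "f holomorphic_on ball 0 1" and [measurable]: "k \<in> borel_measurable borel"
  shows "(\<integral>\<^sup>+z\<in>ball 0 1. ennreal ((cmod (deriv f z))\<^sup>2) * k (cmod (disk_aut a z)) \<partial>lborel)
    = (\<integral>\<^sup>+z\<in>ball 0 1. ennreal ((cmod (deriv (\<lambda>z. f (disk_aut a z)) z))\<^sup>2) * k (cmod z) \<partial>lborel)"
proof -
  define d1 where "d1 z = indicator (ball 0 1) z *\<^sub>R deriv f z" for z
  have [measurable]: "d1 \<in> borel_measurable borel"
    unfolding d1_def[abs_def] using f
    by (intro borel_measurable_continuous_on_indicator holomorphic_on_imp_continuous_on holomorphic_deriv) auto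
  have "(\<integral>\<^sup>+z\<in>ball 0 1. ennreal ((cmod (deriv f z))\<^sup>2) * k (cmod (disk_aut a z)) \<partial>lborel)
    = (\<integral>\<^sup>+z\<in>ball 0 1. ennreal ((cmod (d1 z))\<^sup>2) * k (cmod (disk_aut a z)) \<partial>lborel)"
    by (intro nn_integral_cong) (auto simp: d1_def indicator_def)
  also have "\<dots> = (\<integral>\<^sup>+z\<in>ball 0 1. ennreal ((cmod (deriv (disk_aut a) z))\<^sup>2) *
      (ennreal ((cmod (d1 (disk_aut a z)))\<^sup>2) * k (cmod (disk_aut a (disk_aut a z)))) \<partial>lborel)"
    by (rule nn_integral_disk_aut[OF a]) measurable
  also have "\<dots> = (\<integral>\<^sup>+z\<in>ball 0 1. ennreal ((cmod (deriv (\<lambda>z. f (disk_aut a z)) z))\<^sup>2) * k (cmod z) \<partial>lborel)"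
  proof (rule nn_integral_cong)
    fix z :: complex
    show "ennreal ((cmod (deriv (disk_aut a) z))\<^sup>2) * (ennreal ((cmod (d1 (disk_aut a z)))\<^sup>2) * k (cmod (disk_aut a (disk_aut a z)))) * indicator (ball 0 1) z
      = ennreal ((cmod (deriv (\<lambda>z. f (disk_aut a z)) z))\<^sup>2) * k (cmod z) * indicator (ball 0 1) z"
    proof (cases "cmod z < 1")
      case True
      then show ?thesis using norm_disk_aut_less[OF a True] disk_aut_involution[OF a, of z]
        by (simp add: d1_def indicator_def deriv_comp_disk_aut[OF a f] norm_mult power_mult_distrib ennreal_mult mult_ac)
    qed (simp add: indicator_def)
  qed
  finally show ?thesis .
qed

text \<open>A smooth lift of the boundary map to angles. With w = 1 - cnj a * zeta, sigma_a zeta = -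
  zeta * cnj w / w on the circle, and w stays in the right half plane, where the principal logarithm
  has no jump. The summand \<open>pi\<close> accounts for the sign.\<close>

definition moebius_angle :: "complex \<Rightarrow> real \<Rightarrow> real" where
  "moebius_angle a t = pi + t - 2 * Im (Ln (1 - cnj a * cis t))"

lemma Re_one_minus_cnj_cis_pos:
  assumes "cmod a < 1"
  shows "0 < Re (1 - cnj a * cis t)"
proof -
  have "Re (cnj a * cis t) \<le> cmod (cnj a * cis t)" by (rule complex_Re_le_cmod)
  then show ?thesis using assms by (simp add: norm_mult)
qed

lemma cis_moebius_angle:
  assumes a: "cmod a < 1"
  shows "cis (moebius_angle a t) = disk_aut a (cis t)"
proof -
  define w where "w t = 1 - cnj a * cis t" for t
  define \<psi> where "\<psi> t = pi + t - 2 * Im (Ln (w t))" for t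
  have wnz: "w t \<noteq> 0" for t using one_minus_cnj_mult_nonzero[OF a, of "cis t"] by (simp add: w_def)
  have "cis (\<psi> t) = disk_aut a (cis t)"
  proof -
    have u: "cis (Im (Ln (w t))) = w t / of_real (cmod (w t))"
    proof -
      have "w t = exp (Ln (w t))" using wnz by simp
      also have "\<dots> = of_real (cmod (w t)) * cis (Im (Ln (w t)))"
        using wnz by (subst exp_eq_polar) (simp add: exp_of_real[symmetric])
      finally show ?thesis using wnz by (simp add: field_simps)
    qed
    have "cis (\<psi> t) = cis pi * cis t * cnj (cis (Im (Ln (w t)))) * cnj (cis (Im (Ln (w t))))"
    proof -
      have "\<psi> t = pi + t + - Im (Ln (w t)) + - Im (Ln (w t))" by (simp add: \<psi>_def)
      then show ?thesis by (simp only: cis_mult[symmetric] cis_cnj)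
    qed
    also have "\<dots> = - cis t * (cnj (w t) * cnj (w t)) / (of_real (cmod (w t)) * of_real (cmod (w t)))"
      by (simp add: u)
    also have "of_real (cmod (w t)) * of_real (cmod (w t)) = w t * cnj (w t)"
      by (simp add: complex_norm_square[symmetric] power2_eq_square)
    also have "- cis t * (cnj (w t) * cnj (w t)) / (w t * cnj (w t)) = - cis t * cnj (w t) / w t"
      using wnz by (simp add: field_simps)
    also have "- cis t * cnj (w t) = a - cis t"
    proof -
      have "cis t * cnj (cis t) = 1" by (simp add: cis_cnj cis_mult)
      then show ?thesis by (simp add: w_def algebra_simps)
    qed
    finally show ?thesis by (simp add: disk_aut_def w_def)
  qed
  then show ?thesis by (simp add: moebius_angle_def \<psi>_def w_def)
qed

text \<open>The derivative arises as 1 + 2 Re (b / (1 - b)) with b = cnj a * cis t. It is the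
  Poisson kernel of \<open>a\<close>, because |1 - cnj a * zeta| = |zeta - a| on the circle.\<close>

lemma moebius_angle_has_derivative:
  assumes a: "cmod a < 1"
  shows "(moebius_angle a has_real_derivative (1 - (cmod a)\<^sup>2) / (cmod (1 - cnj a * cis t))\<^sup>2) (at t)"
proof -
  define w where "w t = 1 - cnj a * cis t" for t
  define \<psi> where "\<psi> t = pi + t - 2 * Im (Ln (w t))" for t
  define p where "p t = (1 - (cmod a)\<^sup>2) / (cmod (w t))\<^sup>2" for t
  have wnz: "w t \<noteq> 0" for t using one_minus_cnj_mult_nonzero[OF a, of "cis t"] by (simp add: w_def)
  have Rew: "Re (w t) > 0" for t unfolding w_def by (rule Re_one_minus_cnj_cis_pos[OF a])
  have "(\<psi> has_real_derivative p t) (at t)"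
  proof -
    have "(w has_vector_derivative - (cnj a * (\<i> * cis t))) (at t)"
    proof -
      have "((\<lambda>z. 1 - cnj a * exp (\<i> * z)) has_field_derivative - (cnj a * (\<i> * exp (\<i> * of_real t)))) (at (of_real t))"
        by (auto intro!: derivative_eq_intros)
      from has_vector_derivative_real_field[OF this, of UNIV] show ?thesis
        by (simp add: w_def[abs_def] cis_conv_exp)
    qed
    moreover have "(Ln has_field_derivative inverse (w t)) (at (w t))"
      using Rew[of t] by (intro has_field_derivative_Ln) (auto simp: complex_nonpos_Reals_iff)
    ultimately have "((Ln \<circ> w) has_vector_derivative (- (cnj a * (\<i> * cis t))) * inverse (w t)) (at t)"
      by (rule field_vector_diff_chain_at)
    then have "((\<lambda>t. Im (Ln (w t))) has_real_derivative Im ((- (cnj a * (\<i> * cis t))) * inverse (w t))) (at t)"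
      using bounded_linear.has_vector_derivative[OF bounded_linear_Im]
      by (fastforce simp: o_def has_real_derivative_iff_has_vector_derivative)
    then have "(\<psi> has_real_derivative 0 + 1 - 2 * Im ((- (cnj a * (\<i> * cis t))) * inverse (w t))) (at t)"
      unfolding \<psi>_def[abs_def]
      by (intro DERIV_diff DERIV_add DERIV_const DERIV_ident DERIV_cmult)
    also have "0 + 1 - 2 * Im ((- (cnj a * (\<i> * cis t))) * inverse (w t)) = p t"
    proof -
      define b where "b = cnj a * cis t"
      have wb: "w t = 1 - b" by (simp add: w_def b_def)
      have nb: "cmod b = cmod a" by (simp add: b_def norm_mult)
      have "(- (cnj a * (\<i> * cis t))) * inverse (w t) = - \<i> * (b / (1 - b))"
        by (simp add: wb b_def field_simps)
      then have "0 + 1 - 2 * Im ((- (cnj a * (\<i> * cis t))) * inverse (w t)) = 1 - 2 * Im (- \<i> * (b / (1 - b)))"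
        by (simp only: add_0)
      also have "\<dots> = 1 + 2 * Re (b / (1 - b))"
      proof -
        have "Im (- \<i> * x) = - Re x" for x by simp
        then show ?thesis by (simp only:)
      qed
      also have "Re (b / (1 - b)) = Re (b * cnj (1 - b)) / (cmod (1 - b))\<^sup>2"
        by (simp add: complex_div_cnj[of b "1 - b"])
      also have "1 + 2 * (Re (b * cnj (1 - b)) / (cmod (1 - b))\<^sup>2) = ((cmod (1 - b))\<^sup>2 + 2 * Re (b * cnj (1 - b))) / (cmod (1 - b))\<^sup>2"
        using wnz[of t] by (simp add: wb add_divide_distrib)
      also have "(cmod (1 - b))\<^sup>2 + 2 * Re (b * cnj (1 - b)) = 1 - (cmod b)\<^sup>2"
        unfolding cmod_power2 by (simp add: power2_eq_square algebra_simps)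
      finally show ?thesis by (simp add: p_def wb nb)
    qed
    finally show ?thesis .
  qed
  moreover have "\<psi> = moebius_angle a" by (rule ext) (simp add: moebius_angle_def \<psi>_def w_def)
  ultimately show ?thesis by (simp add: p_def w_def)
qed

lemma borel_measurable_moebius_angle [measurable]:
  assumes "cmod a < 1"
  shows "moebius_angle a \<in> borel_measurable borel"
  by (intro borel_measurable_continuous_onI continuous_at_imp_continuous_on ballI
      DERIV_isCont[OF moebius_angle_has_derivative[OF assms]])

text \<open>Over one period the lift gains exactly 2 pi, so its range is again a full period and
  periodicity of H closes the substitution.\<close>

theorem nn_integral_moebius_angle:
  fixes H :: "real \<Rightarrow> ennreal"
  assumes a: "cmod a < 1" and H [measurable]: "H \<in> borel_measurable borel" and per: "\<And>t. H (t + 2*pi) = H t"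
  shows "(\<integral>\<^sup>+t\<in>{0..2*pi}. H t \<partial>lborel)
    = (\<integral>\<^sup>+t\<in>{0..2*pi}. H (moebius_angle a t) * ennreal ((1 - (cmod a)\<^sup>2) / (cmod (1 - cnj a * cis t))\<^sup>2) \<partial>lborel)"
proof -
  let ?\<psi> = "moebius_angle a"
  have cp: "continuous_on {0..2*pi} (\<lambda>t. (1 - (cmod a)\<^sup>2) / (cmod (1 - cnj a * cis t))\<^sup>2)"
    using one_minus_cnj_mult_nonzero[OF a] by (intro continuous_intros) auto
  have pnn: "0 \<le> (1 - (cmod a)\<^sup>2) / (cmod (1 - cnj a * cis t))\<^sup>2" for t
    using a by (auto simp: power_le_one_iff)
  have psi2: "?\<psi> (2*pi) = ?\<psi> 0 + 2*pi" by (simp add: moebius_angle_def)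
  have "(\<integral>\<^sup>+t\<in>{0..2*pi}. H t \<partial>lborel) = (\<integral>\<^sup>+t\<in>{?\<psi> 0..?\<psi> 0 + 2*pi}. H t \<partial>lborel)"
    by (rule nn_integral_periodic[OF H per, symmetric])
  also have "\<dots> = (\<integral>\<^sup>+t. H t * indicator {?\<psi> 0..?\<psi> (2*pi)} t \<partial>lborel)"
    by (simp add: psi2)
  also have "\<dots> = (\<integral>\<^sup>+t. H (?\<psi> t) * ennreal ((1 - (cmod a)\<^sup>2) / (cmod (1 - cnj a * cis t))\<^sup>2) * indicator {0..2*pi} t \<partial>lborel)"
    by (rule nn_integral_substitution_aux[OF H _ moebius_angle_has_derivative[OF a] cp pnn]) auto
  finally show ?thesis .
qed

section \<open>The Poisson kernel\<close>

text \<open>The constant 1/2 replaces the sharp 2/pi to keep later bounds rational. Up to pi/3 the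
  cosine is at least 1/2; beyond it sin x is at least sqrt 3 / 2 >= 0.85, while x / 2 is below
  0.8.\<close>

lemma half_le_sin:
  assumes "0 \<le> x" "x \<le> pi / 2"
  shows "x / 2 \<le> sin x"
proof (cases "x \<le> pi / 3")
  case True
  have "sin 0 - 0 / 2 \<le> sin x - x / 2"
  proof (rule DERIV_nonneg_imp_nondecreasing[OF assms(1)])
    fix y assume y: "0 \<le> y" "y \<le> x"
    have "cos (pi / 3) \<le> cos y" using y True pi_gt_zero by (intro cos_monotone_0_pi_le) linarith+
    then have "0 \<le> cos y - 1 / 2" by (simp add: cos_60)
    moreover have "((\<lambda>x. sin x - x / 2) has_real_derivative cos y - 1 / 2) (at y)"
      by (auto intro!: derivative_eq_intros)
    ultimately show "\<exists>z. ((\<lambda>x. sin x - x / 2) has_real_derivative z) (at y) \<and> 0 \<le> z" by blast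
  qed
  then show ?thesis by simp
next
  case False
  have "sin (pi / 3) \<le> sin x" using False assms by (intro sin_monotone_2pi_le) auto
  moreover have "1.7 \<le> sqrt 3" by (rule real_le_rsqrt) (simp add: power2_eq_square)
  moreover have "pi < 3.2" using pi_approx by simp
  ultimately show ?thesis using assms(2) by (simp add: sin_60)
qed

section \<open>Chord length against angle\<close>

lemma norm_cis_diff: "cmod (cis u - cis v) = 2 * \<bar>sin ((u - v) / 2)\<bar>"
proof -
  have "(cmod (cis u - cis v))\<^sup>2 = 2 - 2 * cos (u - v)"
  proof -
    have "(sin u)\<^sup>2 + (cos u)\<^sup>2 = 1" "(sin v)\<^sup>2 + (cos v)\<^sup>2 = 1" by simp_all
    then show ?thesis
      unfolding cmod_power2 by (simp add: cos_diff power2_diff algebra_simps)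
  qed
  also have "\<dots> = (2 * \<bar>sin ((u - v) / 2)\<bar>)\<^sup>2"
  proof -
    have "2 * ((u - v) / 2) = u - v" by simp
    then show ?thesis using cos_double_sin[of "(u - v) / 2"] by (simp only: power_mult_distrib) simp
  qed
  finally show ?thesis by (simp only: power2_eq_iff_nonneg norm_ge_zero abs_ge_zero mult_nonneg_nonneg zero_le_numeral)
qed

lemma norm_cis_diff_le: "cmod (cis u - cis v) \<le> \<bar>u - v\<bar>"
  using abs_sin_x_le_abs_x[of "(u - v) / 2"] by (simp add: norm_cis_diff)

lemma norm_cis_diff_ge:
  assumes "\<bar>u - v\<bar> \<le> pi"
  shows "\<bar>u - v\<bar> / 2 \<le> cmod (cis u - cis v)"
proof -
  have "\<bar>u - v\<bar> / 2 / 2 \<le> sin (\<bar>u - v\<bar> / 2)" using assms by (intro half_le_sin) auto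
  also have "\<dots> \<le> \<bar>sin ((u - v) / 2)\<bar>"
  proof (cases "u \<ge> v")
    case False
    then have "\<bar>u - v\<bar> / 2 = - ((u - v) / 2)" by (simp only: abs_of_neg minus_divide_left diff_less_0_iff_less not_le)
    then show ?thesis using abs_ge_minus_self[of "sin ((u - v) / 2)"] by (simp only: sin_minus)
  qed simp
  finally show ?thesis by (simp add: norm_cis_diff)
qed

lemma norm_cis_diff_le_2: "cmod (cis u - cis v) \<le> 2"
  using norm_triangle_ineq4[of "cis u" "cis v"] by simp

lemma norm_cis_minus_ge: "1 - cmod z \<le> cmod (cis t - z)"
  using norm_triangle_ineq2[of "cis t" z] by simp

lemma cis_minus_nonzero: "cmod z < 1 \<Longrightarrow> cis t - z \<noteq> 0"
  using norm_cis_minus_ge[of z t] by auto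

definition poisson_kernel :: "complex \<Rightarrow> real \<Rightarrow> real" where
  "poisson_kernel z t = (1 - (cmod z)\<^sup>2) / (cmod (cis t - z))\<^sup>2"

lemma poisson_kernel_nonneg: "cmod z < 1 \<Longrightarrow> 0 \<le> poisson_kernel z t"
  by (simp add: poisson_kernel_def power_le_one_iff)

lemma continuous_poisson_kernel: "cmod z < 1 \<Longrightarrow> continuous_on A (poisson_kernel z)"
  unfolding poisson_kernel_def[abs_def]
  by (intro continuous_intros) (auto simp: cis_minus_nonzero)

lemma borel_measurable_poisson_kernel [measurable]: "poisson_kernel z \<in> borel_measurable borel"
  unfolding poisson_kernel_def[abs_def] by measurable

section \<open>Cauchy and Poisson formulas on the circle\<close>

lemma circle_cauchy_integral:
  fixes \<phi> :: "complex \<Rightarrow> complex"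
  assumes "continuous_on (cball 0 1) \<phi>" "\<phi> holomorphic_on ball 0 1" "cmod w < 1"
  shows "((\<lambda>t. \<phi> (cis t) * cis t / (cis t - w)) has_integral (2 * pi * \<phi> w)) {0..2*pi}"
proof -
  have "((\<lambda>u. \<phi> u / (u - w)) has_contour_integral (2 * of_real pi * \<i> * \<phi> w)) (part_circlepath 0 1 0 (2*pi))"
    using Cauchy_integral_circlepath[of 0 1 \<phi> w] assms by (simp add: circlepath_def)
  then have "((\<lambda>t. \<phi> (0 + of_real 1 * cis t) / ((0 + of_real 1 * cis t) - w) * of_real 1 * \<i> * cis t)
      has_integral (2 * of_real pi * \<i> * \<phi> w)) {0..2*pi}"
    by (subst (asm) has_contour_integral_part_circlepath_iff) auto
  from has_integral_mult_right[OF this, of "- \<i>"] show ?thesis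
    by (simp add: mult_ac)
qed

text \<open>Cauchy's formula is applied to phi u * (1 - |z|^2) / (1 - cnj z * u). This function
  still equals phi at z, and on the circle the extra factor turns the Cauchy kernel into the Poisson
  kernel.\<close>

lemma circle_poisson_integral:
  fixes \<phi> :: "complex \<Rightarrow> complex"
  assumes c: "continuous_on (cball 0 1) \<phi>" and h: "\<phi> holomorphic_on ball 0 1" and z: "cmod z < 1"
  shows "((\<lambda>t. \<phi> (cis t) * of_real (poisson_kernel z t)) has_integral (2 * pi * \<phi> z)) {0..2*pi}"
proof -
  define \<psi> where "\<psi> u = \<phi> u * (of_real (1 - (cmod z)\<^sup>2) / (1 - cnj z * u))" for u
  have nz: "1 - cnj z * u \<noteq> 0" if "cmod u \<le> 1" for u
    using one_minus_cnj_mult_nonzero[OF z that] .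
  have "((\<lambda>t. \<psi> (cis t) * cis t / (cis t - z)) has_integral (2 * pi * \<psi> z)) {0..2*pi}"
  proof (rule circle_cauchy_integral)
    show "continuous_on (cball 0 1) \<psi>" "\<psi> holomorphic_on ball 0 1"
      unfolding \<psi>_def[abs_def] using nz by (auto intro!: continuous_intros c holomorphic_intros h)
  qed (rule z)
  moreover have "\<psi> z = \<phi> z"
  proof -
    have "1 - cnj z * z = of_real (1 - (cmod z)\<^sup>2)" by (simp add: complex_norm_square mult.commute del: of_real_power)
    then show ?thesis using nz[of z] z by (simp add: \<psi>_def)
  qed
  moreover have "\<psi> (cis t) * cis t / (cis t - z) = \<phi> (cis t) * of_real (poisson_kernel z t)" for t
  proof -
    have e: "1 - cnj z * cis t = cis t * cnj (cis t - z)"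
      by (simp add: algebra_simps cis_cnj cis_mult)
    have "of_real ((cmod (cis t - z))\<^sup>2) = (cis t - z) * cnj (cis t - z)"
      by (simp add: complex_norm_square del: of_real_power)
    then have "complex_of_real (poisson_kernel z t) = of_real (1 - (cmod z)\<^sup>2) / ((cis t - z) * cnj (cis t - z))"
      unfolding poisson_kernel_def by (simp only: of_real_divide)
    then show ?thesis unfolding \<psi>_def e by simp
  qed
  ultimately show ?thesis by simp
qed

lemma circle_deriv_integral:
  fixes \<phi> :: "complex \<Rightarrow> complex"
  assumes c: "continuous_on (cball 0 1) \<phi>" and h: "\<phi> holomorphic_on ball 0 1" and z: "cmod z < 1"
  shows "((\<lambda>t. \<phi> (cis t) * (cis t / (cis t - z)\<^sup>2)) has_integral (2 * pi * deriv \<phi> z)) {0..2*pi}"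
proof -
  have z': "z \<in> ball 0 1" using z by simp
  note * = Cauchy_derivative_integral_circlepath[OF c h z']
  have "((\<lambda>u. \<phi> u / (u - z)\<^sup>2) has_contour_integral (2 * of_real pi * \<i> * deriv \<phi> z)) (part_circlepath 0 1 0 (2*pi))"
    using has_contour_integral_integral[OF *(1)] DERIV_imp_deriv[OF *(2)]
    by (simp add: circlepath_def field_simps)
  then have "((\<lambda>t. \<phi> (0 + of_real 1 * cis t) / ((0 + of_real 1 * cis t) - z)\<^sup>2 * of_real 1 * \<i> * cis t)
      has_integral (2 * of_real pi * \<i> * deriv \<phi> z)) {0..2*pi}"
    by (subst (asm) has_contour_integral_part_circlepath_iff) auto
  from has_integral_mult_right[OF this, of "- \<i>"] show ?thesis
    by (simp add: mult_ac)
qed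

text \<open>Up to conjugation the integrand is the boundary value of phi u * u / (1 - cnj z * u)^2,
  which is holomorphic and vanishes at 0; its mean is therefore 0.\<close>

lemma circle_conj_integral:
  fixes \<phi> :: "complex \<Rightarrow> complex"
  assumes c: "continuous_on (cball 0 1) \<phi>" and h: "\<phi> holomorphic_on ball 0 1" and z: "cmod z < 1"
  shows "((\<lambda>t. cnj (\<phi> (cis t)) * (cis t / (cis t - z)\<^sup>2)) has_integral 0) {0..2*pi}"
proof -
  define \<psi> where "\<psi> u = \<phi> u * (u / (1 - cnj z * u)\<^sup>2)" for u
  have nz: "1 - cnj z * u \<noteq> 0" if "cmod u \<le> 1" for u
    using one_minus_cnj_mult_nonzero[OF z that] .
  have "((\<lambda>t. \<psi> (cis t) * cis t / (cis t - 0)) has_integral (2 * pi * \<psi> 0)) {0..2*pi}"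
  proof (rule circle_cauchy_integral)
    show "continuous_on (cball 0 1) \<psi>" "\<psi> holomorphic_on ball 0 1"
      unfolding \<psi>_def[abs_def] using nz by (auto intro!: continuous_intros c holomorphic_intros h)
  qed simp
  then have "((\<lambda>t. \<psi> (cis t)) has_integral 0) {0..2*pi}"
    by (simp add: \<psi>_def)
  from has_integral_linear[OF this bounded_linear_cnj]
  have "((\<lambda>t. cnj (\<psi> (cis t))) has_integral 0) {0..2*pi}" by (simp add: o_def)
  moreover have "cnj (\<psi> (cis t)) = cnj (\<phi> (cis t)) * (cis t / (cis t - z)\<^sup>2)" for t
  proof -
    have e: "1 - z * cnj (cis t) = cnj (cis t) * (cis t - z)"
      by (simp add: algebra_simps cis_cnj cis_mult)
    have "cnj (\<psi> (cis t)) = cnj (\<phi> (cis t)) * (cnj (cis t) / (cnj (cis t) * (cis t - z))\<^sup>2)"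
      by (simp add: \<psi>_def flip: e)
    also have "cnj (cis t) / (cnj (cis t) * (cis t - z))\<^sup>2 = cis t / (cis t - z)\<^sup>2"
    proof -
      have "cis t * cnj (cis t) = 1" by (simp add: cis_cnj cis_mult)
      then have "cis t * (cnj (cis t))\<^sup>2 = cnj (cis t)" by (simp add: power2_eq_square mult.assoc[symmetric])
      then have "cnj (cis t) / (cnj (cis t) * (cis t - z))\<^sup>2 = cis t * (cnj (cis t))\<^sup>2 / ((cnj (cis t))\<^sup>2 * (cis t - z)\<^sup>2)"
        by (simp only: power_mult_distrib)
      then show ?thesis by simp
    qed
    finally show ?thesis .
  qed
  ultimately show ?thesis by simp
qed

section \<open>Dilates and Taylor coefficients\<close>

lemma dilate_properties:
  assumes f: "f holomorphic_on ball 0 1" and \<rho>: "0 \<le> \<rho>" "\<rho> < 1"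
  shows "continuous_on (cball 0 1) (\<lambda>u. f (of_real \<rho> * u))" "(\<lambda>u. f (of_real \<rho> * u)) holomorphic_on ball 0 1"
    "\<And>z. cmod z < 1 \<Longrightarrow> deriv (\<lambda>u. f (of_real \<rho> * u)) z = of_real \<rho> * deriv f (of_real \<rho> * z)"
proof -
  have sub: "(\<lambda>u. of_real \<rho> * u) ` cball 0 1 \<subseteq> ball (0::complex) 1"
  proof -
    have "\<rho> * cmod u < 1" if "cmod u \<le> 1" for u :: complex
      using mult_left_mono[OF that \<rho>(1)] \<rho>(2) by simp
    then show ?thesis using \<rho> by (auto simp: norm_mult)
  qed
  show "continuous_on (cball 0 1) (\<lambda>u. f (of_real \<rho> * u))"
    by (rule continuous_on_compose2[OF holomorphic_on_imp_continuous_on[OF f] _ sub]) (intro continuous_intros)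
  have "(f \<circ> (\<lambda>u. of_real \<rho> * u)) holomorphic_on ball 0 1"
    by (intro holomorphic_on_compose_gen[OF _ f] holomorphic_intros
        subset_trans[OF image_mono[OF ball_subset_cball] sub])
  then show "(\<lambda>u. f (of_real \<rho> * u)) holomorphic_on ball 0 1" by (simp add: o_def)
  fix z :: complex assume "cmod z < 1"
  then have "of_real \<rho> * z \<in> ball 0 1" using sub by force
  then have "f field_differentiable at (of_real \<rho> * z)"
    using f by (auto simp: holomorphic_on_open field_differentiable_def)
  then have "deriv (f \<circ> (\<lambda>u. of_real \<rho> * u)) z = deriv f (of_real \<rho> * z) * deriv (\<lambda>u. of_real \<rho> * u) z"
    by (intro deriv_chain) (auto intro!: derivative_intros)
  then show "deriv (\<lambda>u. f (of_real \<rho> * u)) z = of_real \<rho> * deriv f (of_real \<rho> * z)"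
    by (simp add: o_def)
qed

lemma borel_measurable_circle_dilate:
  assumes f: "continuous_on (ball 0 1) f" and \<rho>: "0 \<le> \<rho>" "\<rho> < 1"
  shows "(\<lambda>t. f (of_real \<rho> * cis t) :: complex) \<in> borel_measurable borel"
proof (rule borel_measurable_continuous_onI, rule continuous_on_compose2[OF f])
  show "continuous_on UNIV (\<lambda>t. of_real \<rho> * cis t)" by (intro continuous_intros)
  show "range (\<lambda>t. of_real \<rho> * cis t) \<subseteq> ball 0 1" using \<rho> by (auto simp: norm_mult)
qed

text \<open>Parseval bounds every finite partial sum at radius r by the Hardy bound. The radius
  tends to 1 inside finite sums only, so no interchange of limits arises.\<close>

lemma hardy2_summable:
  assumes "hardy2 f"
  shows "summable (\<lambda>n. (cmod ((deriv ^^ n) f 0 / fact n))\<^sup>2)"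
proof -
  define c where "c n = (deriv ^^ n) f 0 / fact n" for n
  have f: "f holomorphic_on ball 0 1" using assms by (simp add: hardy2_def)
  obtain C where C: "\<And>r. r \<in> {0..<1} \<Longrightarrow> (LBINT t=0..2*pi. (cmod (f (of_real r * cis t)))\<^sup>2) \<le> C"
    using assms unfolding hardy2_def by blast
  have s: "(\<lambda>n. c n * z ^ n) sums f z" if "cmod z < 1" for z
    using holomorphic_power_series[OF f, of z] that by (simp add: c_def)
  have b: "(\<Sum>n<N. 2*pi*(cmod (c n))\<^sup>2 * r ^ (2*n)) \<le> C" if r: "0 \<le> r" "r < 1" for r N
  proof -
    let ?g = "\<lambda>t. (cmod (f (of_real r * cis t)))\<^sup>2"
    have cont: "continuous_on {0..2*pi} ?g"
      by (intro continuous_intros continuous_on_compose2[OF holomorphic_on_imp_continuous_on[OF f]])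
         (use r in \<open>auto simp: norm_mult\<close>)
    have int: "set_integrable lborel {0..2*pi} ?g"
      using borel_integrable_atLeastAtMost'[OF cont] .
    have nn: "(\<integral>\<^sup>+t\<in>{0..2*pi}. ennreal (?g t) \<partial>lborel) = ennreal (integral {0..2*pi} ?g)"
      by (rule nn_integral_has_integral_atLeastAtMost[OF cont])
         (use cont in \<open>auto intro: integrable_integral integrable_continuous_real\<close>)
    have "integral {0..2*pi} ?g = (LBINT t=0..2*pi. ?g t)"
      using set_borel_integral_eq_integral(2)[OF int] interval_integral_Icc[of 0 "2*pi" ?g]
      by (simp add: zero_ereal_def)
    also have "\<dots> \<le> C" using C[of r] r by simp
    finally have iC: "integral {0..2*pi} ?g \<le> C" .
    then have le: "(\<integral>\<^sup>+t\<in>{0..2*pi}. ennreal (?g t) \<partial>lborel) \<le> ennreal C"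
      unfolding nn by (rule ennreal_leI)
    have "0 \<le> integral {0..2*pi} ?g" by (rule integral_nonneg[OF integrable_continuous_real[OF cont]]) simp
    then have C0: "0 \<le> C" using iC by linarith
    have "ennreal (\<Sum>n<N. 2*pi*(cmod (c n))\<^sup>2 * r ^ (2*n)) = (\<Sum>n<N. ennreal (2*pi*(cmod (c n))\<^sup>2 * r ^ (2*n)))"
      using r by (intro sum_ennreal[symmetric]) auto
    also have "\<dots> \<le> (\<Sum>n. ennreal (2*pi*(cmod (c n))\<^sup>2 * r ^ (2*n)))"
      by (rule sum_le_suminf) auto
    also have "\<dots> \<le> ennreal C"
      using le nn_integral_circle_power_series[of c f, OF s r] by metis
    finally show ?thesis using C0 by (simp add: ennreal_le_iff)
  qed
  have b1: "(\<Sum>n<N. 2*pi*(cmod (c n))\<^sup>2) \<le> C" for N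
  proof -
    have "((\<lambda>r. \<Sum>n<N. 2*pi*(cmod (c n))\<^sup>2 * r ^ (2*n)) \<longlongrightarrow> (\<Sum>n<N. 2*pi*(cmod (c n))\<^sup>2 * 1 ^ (2*n))) (at_left 1)"
      by (intro tendsto_intros)
    moreover have "\<forall>\<^sub>F r in at_left (1::real). (\<Sum>n<N. 2*pi*(cmod (c n))\<^sup>2 * r ^ (2*n)) \<le> C"
      using b by (auto simp: eventually_at_left[of 0 "1::real"] intro!: exI[of _ 0])
    ultimately have "(\<Sum>n<N. 2*pi*(cmod (c n))\<^sup>2 * 1 ^ (2*n)) \<le> C"
      by (rule tendsto_upperbound) simp
    then show ?thesis by simp
  qed
  have "summable (\<lambda>n. 2*pi*(cmod (c n))\<^sup>2)"
    by (rule summableI_nonneg_bounded[where x = C]) (use b1 in auto)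
  then have "summable (\<lambda>n. (1 / (2*pi)) * (2*pi*(cmod (c n))\<^sup>2))" by (rule summable_mult)
  then show ?thesis by (simp add: c_def)
qed

section \<open>Nontangential limits\<close>

text \<open>The weak-type bound for the Hardy-Littlewood maximal function. Vitali's lemma selects
  disjoint intervals whose fivefold enlargements cover E; the 5 is that enlargement.\<close>

lemma maximal_weak_type:
  fixes g :: "real \<Rightarrow> ennreal"
  assumes [measurable]: "g \<in> borel_measurable borel" "E \<in> sets borel" and lam: "lam > 0"
    and E: "\<And>\<theta>. \<theta> \<in> E \<Longrightarrow> \<exists>s>0. ennreal (lam * (2 * s)) < (\<integral>\<^sup>+t\<in>{\<theta>-s..\<theta>+s}. g t \<partial>lborel)"
  shows "emeasure lborel E \<le> ennreal (5 / lam) * (\<integral>\<^sup>+t. g t \<partial>lborel)"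
proof (cases "(\<integral>\<^sup>+t. g t \<partial>lborel) = \<infinity>")
  case True
  then show ?thesis using lam by (simp add: ennreal_mult_top)
next
  case False
  then obtain G where G: "(\<integral>\<^sup>+t. g t \<partial>lborel) = ennreal G" "0 \<le> G"
    by (cases "\<integral>\<^sup>+t. g t \<partial>lborel") auto
  obtain s where s: "\<And>\<theta>. \<theta> \<in> E \<Longrightarrow> 0 < s \<theta> \<and> ennreal (lam * (2 * s \<theta>)) < (\<integral>\<^sup>+t\<in>{\<theta>-s \<theta>..\<theta>+s \<theta>}. g t \<partial>lborel)"
    using E by metis
  \<comment> \<open>Vitali's lemma needs bounded radii; they are bounded because g has a finite
    integral.\<close>
  have sB: "0 < s \<theta> \<and> s \<theta> \<le> G / (2 * lam)" if "\<theta> \<in> E" for \<theta>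
  proof -
    have "ennreal (lam * (2 * s \<theta>)) < (\<integral>\<^sup>+t\<in>{\<theta>-s \<theta>..\<theta>+s \<theta>}. g t \<partial>lborel)" using s[OF that] by simp
    also have "\<dots> \<le> (\<integral>\<^sup>+t. g t \<partial>lborel)" by (intro nn_integral_mono) (auto simp: indicator_def)
    finally have "lam * (2 * s \<theta>) < G" using s[OF that] lam by (simp add: G ennreal_less_iff)
    then show ?thesis using s[OF that] lam by (simp add: field_simps)
  qed
  have "E \<subseteq> (\<Union>i\<in>E. cball i (s i))" using s by force
  then obtain C where C: "countable C" "C \<subseteq> E"
     "pairwise (\<lambda>i j. disjnt (cball i (s i)) (cball j (s j))) C"
     "E \<subseteq> (\<Union>i\<in>C. cball i (5 * s i))"
    by (rule Vitali_covering_lemma_cballs[where a = "\<lambda>x. x" and r = s and B = "G / (2 * lam)" and S = E and K = E])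
       (use sB in auto)
  \<comment> \<open>Disjointness means that at most one selected interval contains t. Sums over the
    countable family are written as \<open>count_space\<close> integrals so that they commute with
    the Lebesgue integral.\<close>
  have ind: "(\<integral>\<^sup>+i. indicator (cball i (s i)) t \<partial>count_space C) \<le> 1" for t
  proof (cases "\<exists>i\<in>C. t \<in> cball i (s i)")
    case True
    then obtain i where i: "i \<in> C" "t \<in> cball i (s i)" by auto
    have "(\<integral>\<^sup>+j. indicator (cball j (s j)) t \<partial>count_space C) = (\<integral>\<^sup>+j. indicator {i} j \<partial>count_space C)"
    proof (rule nn_integral_cong)
      fix j assume "j \<in> space (count_space C)"
      then have "j = i \<or> disjnt (cball j (s j)) (cball i (s i))"
        using C(3) i by (auto simp: pairwise_def)
      then show "indicator (cball j (s j)) t = (indicator {i} j :: ennreal)"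
        using i by (auto simp: indicator_def disjnt_iff)
    qed
    also have "\<dots> \<le> 1" using i by (simp add: one_ennreal_def)
    finally show ?thesis .
  next
    case False
    then have "(\<integral>\<^sup>+j. indicator (cball j (s j)) t \<partial>count_space C) = (\<integral>\<^sup>+j. 0 \<partial>count_space C)"
      by (intro nn_integral_cong) (auto simp: indicator_def)
    then show ?thesis by simp
  qed
  have "emeasure lborel E = (\<integral>\<^sup>+t. indicator E t \<partial>lborel)" by simp
  also have "\<dots> \<le> (\<integral>\<^sup>+t. \<integral>\<^sup>+i. indicator (cball i (5 * s i)) t \<partial>count_space C \<partial>lborel)"
  proof (rule nn_integral_mono)
    fix t
    show "indicator E t \<le> (\<integral>\<^sup>+i. indicator (cball i (5 * s i)) t \<partial>count_space C)"
    proof (cases "t \<in> E")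
      case True
      then obtain i where i: "i \<in> C" "t \<in> cball i (5 * s i)" using C(4) by auto
      have "1 = (\<integral>\<^sup>+j. indicator {i} j \<partial>count_space C)" using i by (simp add: one_ennreal_def)
      also have "\<dots> \<le> (\<integral>\<^sup>+j. indicator (cball j (5 * s j)) t \<partial>count_space C)"
        using i by (intro nn_integral_mono) (auto simp: indicator_def)
      finally show ?thesis using True by simp
    qed simp
  qed
  also have "\<dots> = (\<integral>\<^sup>+i. \<integral>\<^sup>+t. indicator (cball i (5 * s i)) t \<partial>lborel \<partial>count_space C)"
    using C(1) by (intro nn_integral_count_space_nn_integral borel_measurable_indicator) auto
  also have "\<dots> \<le> (\<integral>\<^sup>+i. \<integral>\<^sup>+t. ennreal (5 / lam) * (g t * indicator (cball i (s i)) t) \<partial>lborel \<partial>count_space C)"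
  proof (rule nn_integral_mono)
    fix i assume "i \<in> space (count_space C)"
    then have i: "i \<in> E" using C(2) by auto
    have "(\<integral>\<^sup>+t. indicator (cball i (5 * s i)) t \<partial>lborel) = ennreal (10 * s i)"
      using s[OF i] by (simp add: cball_eq_atLeastAtMost)
    also have "\<dots> = ennreal (5 / lam) * ennreal (lam * (2 * s i))"
      using s[OF i] lam by (simp add: ennreal_mult[symmetric])
    also have "\<dots> \<le> ennreal (5 / lam) * (\<integral>\<^sup>+t\<in>{i-s i..i+s i}. g t \<partial>lborel)"
      using s[OF i] by (intro mult_left_mono) auto
    also have "\<dots> = (\<integral>\<^sup>+t. ennreal (5 / lam) * (g t * indicator (cball i (s i)) t) \<partial>lborel)"
      by (simp add: nn_integral_cmult cball_eq_atLeastAtMost)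
    finally show "(\<integral>\<^sup>+t. indicator (cball i (5 * s i)) t \<partial>lborel) \<le> \<dots>" .
  qed
  also have "\<dots> = (\<integral>\<^sup>+t. \<integral>\<^sup>+i. ennreal (5 / lam) * (g t * indicator (cball i (s i)) t) \<partial>count_space C \<partial>lborel)"
    using C(1)
    by (intro nn_integral_count_space_nn_integral[symmetric] borel_measurable_times_ennreal borel_measurable_indicator) auto
  also have "\<dots> = (\<integral>\<^sup>+t. ennreal (5 / lam) * (g t * (\<integral>\<^sup>+i. indicator (cball i (s i)) t \<partial>count_space C)) \<partial>lborel)"
    by (simp add: nn_integral_cmult)
  also have "\<dots> \<le> (\<integral>\<^sup>+t. ennreal (5 / lam) * (g t * 1) \<partial>lborel)"
    by (intro nn_integral_mono mult_left_mono ind) auto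
  also have "\<dots> = ennreal (5 / lam) * (\<integral>\<^sup>+t. g t \<partial>lborel)"
    by (simp add: nn_integral_cmult)
  finally show ?thesis .
qed

text \<open>A bell-shaped kernel is dominated by a geometric superposition of interval indicators,
  so interval averages control it. The k-th interval contributes at most 8 lam 2^-k, and these sum
  to 16 lam.\<close>

lemma poisson_average_le:
  fixes g :: "real \<Rightarrow> ennreal"
  assumes [measurable]: "g \<in> borel_measurable borel" and \<delta>: "\<delta> > 0" and lam: "lam \<ge> 0"
    and av: "\<And>s. s > 0 \<Longrightarrow> (\<integral>\<^sup>+t\<in>{\<theta>-s..\<theta>+s}. g t \<partial>lborel) \<le> ennreal (lam * (2 * s))"
  shows "(\<integral>\<^sup>+t. g t * ennreal (\<delta> / (max \<delta> \<bar>t - \<theta>\<bar>)\<^sup>2) \<partial>lborel) \<le> ennreal (16 * lam)"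
proof -
  define a where "a k = 4 / (4 ^ k * \<delta>)" for k :: nat
  define J where "J k = {\<theta> - 2 ^ k * \<delta>..\<theta> + 2 ^ k * \<delta>}" for k :: nat
  have pt: "ennreal (\<delta> / (max \<delta> \<bar>t - \<theta>\<bar>)\<^sup>2) \<le> (\<Sum>k. ennreal (a k) * indicator (J k) t)" for t
  proof -
    have "\<exists>k. \<bar>t - \<theta>\<bar> \<le> 2 ^ k * \<delta>"
    proof -
      obtain k where "\<bar>t - \<theta>\<bar> / \<delta> < 2 ^ k" using real_arch_pow[of 2] by auto
      then show ?thesis using \<delta> by (intro exI[of _ k]) (simp add: field_simps)
    qed
    \<comment> \<open>Minimality of k gives |t - theta| > 2^(k-1) delta when k > 0, which bounds the
      kernel by \<open>a k\<close>; for k = 0 the floor delta in the maximum does the same.\<close>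
    then obtain k where k: "\<bar>t - \<theta>\<bar> \<le> 2 ^ k * \<delta>" "\<And>j. j < k \<Longrightarrow> \<not> \<bar>t - \<theta>\<bar> \<le> 2 ^ j * \<delta>"
      using exists_least_iff[of "\<lambda>k. \<bar>t - \<theta>\<bar> \<le> 2 ^ k * \<delta>"] by auto
    have big: "2 ^ k * \<delta> / 2 \<le> max \<delta> \<bar>t - \<theta>\<bar>"
    proof (cases k)
      case 0
      then show ?thesis using \<delta> max.cobounded1[of \<delta> "\<bar>t - \<theta>\<bar>"] by (simp del: max.cobounded1)
    next
      case (Suc j)
      then show ?thesis using k(2)[of j] by simp
    qed
    have "(2 ^ k * \<delta> / 2)\<^sup>2 \<le> (max \<delta> \<bar>t - \<theta>\<bar>)\<^sup>2"
      using big \<delta> by (intro power_mono) auto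
    then have "\<delta> / (max \<delta> \<bar>t - \<theta>\<bar>)\<^sup>2 \<le> \<delta> / (2 ^ k * \<delta> / 2)\<^sup>2"
      using \<delta> by (intro divide_left_mono mult_pos_pos) auto
    also have "\<dots> = a k"
    proof -
      have "((2::real) ^ k)\<^sup>2 = 4 ^ k" by (simp add: power2_eq_square flip: power_mult_distrib)
      then show ?thesis using \<delta> by (simp add: a_def power2_eq_square field_simps)
    qed
    finally have "ennreal (\<delta> / (max \<delta> \<bar>t - \<theta>\<bar>)\<^sup>2) \<le> ennreal (a k)" by (rule ennreal_leI)
    also have "\<dots> = ennreal (a k) * indicator (J k) t"
      using k(1) by (simp add: J_def indicator_def abs_le_iff)
    also have "\<dots> = (\<Sum>i\<in>{k}. ennreal (a i) * indicator (J i) t)"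
      by (subst sum.insert) auto
    also have "\<dots> \<le> (\<Sum>k. ennreal (a k) * indicator (J k) t)" by (rule sum_le_suminf) auto
    finally show ?thesis .
  qed
  have "(\<integral>\<^sup>+t. g t * ennreal (\<delta> / (max \<delta> \<bar>t - \<theta>\<bar>)\<^sup>2) \<partial>lborel) \<le> (\<integral>\<^sup>+t. (\<Sum>k. ennreal (a k) * (g t * indicator (J k) t)) \<partial>lborel)"
  proof (rule nn_integral_mono)
    fix t
    have "g t * ennreal (\<delta> / (max \<delta> \<bar>t - \<theta>\<bar>)\<^sup>2) \<le> g t * (\<Sum>k. ennreal (a k) * indicator (J k) t)"
      by (rule mult_left_mono[OF pt]) simp
    also have "\<dots> = (\<Sum>k. ennreal (a k) * (g t * indicator (J k) t))"
      by (subst ennreal_suminf_cmult[symmetric]) (simp add: mult.left_commute)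
    finally show "g t * ennreal (\<delta> / (max \<delta> \<bar>t - \<theta>\<bar>)\<^sup>2) \<le> \<dots>" .
  qed
  also have "\<dots> = (\<Sum>k. ennreal (a k) * (\<integral>\<^sup>+t\<in>J k. g t \<partial>lborel))"
    by (subst nn_integral_suminf) (auto simp: nn_integral_cmult J_def)
  also have "\<dots> \<le> (\<Sum>k. ennreal (8 * lam * (1/2) ^ k))"
  proof (intro suminf_le summableI)
    fix k
    have "ennreal (a k) * (\<integral>\<^sup>+t\<in>J k. g t \<partial>lborel) \<le> ennreal (a k) * ennreal (lam * (2 * (2 ^ k * \<delta>)))"
      unfolding J_def using \<delta> by (intro mult_left_mono av) auto
    also have "\<dots> = ennreal (a k * (lam * (2 * (2 ^ k * \<delta>))))"
      using \<delta> lam by (intro ennreal_mult[symmetric]) (auto simp: a_def)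
    also have "a k * (lam * (2 * (2 ^ k * \<delta>))) = 8 * lam * (1/2) ^ k"
    proof -
      have "(4::real) ^ k = 2 ^ k * 2 ^ k" by (simp flip: power_mult_distrib)
      then show ?thesis using \<delta> by (simp add: a_def field_simps)
    qed
    finally show "ennreal (a k) * (\<integral>\<^sup>+t\<in>J k. g t \<partial>lborel) \<le> ennreal (8 * lam * (1/2) ^ k)" .
  qed
  also have "\<dots> = ennreal (\<Sum>k. 8 * lam * (1/2) ^ k)"
    using lam by (intro suminf_ennreal2 summable_mult summable_geometric) auto
  also have "(\<Sum>k. 8 * lam * (1/2) ^ k) = 16 * lam"
    by (subst suminf_mult) (auto simp: suminf_geometric summable_geometric)
  finally show ?thesis .
qed

definition stolz :: "real \<Rightarrow> complex \<Rightarrow> complex set" where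
  "stolz \<alpha> \<zeta> = {z. cmod z < 1 \<and> cmod (z - \<zeta>) < \<alpha> * (1 - cmod z)}"

lemma nt_limit_stolz: "nt_limit f \<zeta> L \<longleftrightarrow> (\<forall>\<alpha>>1. (f \<longlongrightarrow> L) (at \<zeta> within stolz \<alpha> \<zeta>))"
  by (simp add: nt_limit_def stolz_def)

text \<open>For each fixed z the angles whose cone contains z form an open set, and a union of open
  sets is open whatever P is. Level sets of maximal functions over cones are thus measurable at
  once.\<close>

lemma open_stolz_shadow: "open {\<theta>. \<exists>z\<in>stolz \<alpha> (cis \<theta>). P z}"
proof -
  have "{\<theta>. \<exists>z\<in>stolz \<alpha> (cis \<theta>). P z} = (\<Union>z\<in>{z. cmod z < 1 \<and> P z}. {\<theta>. cmod (z - cis \<theta>) < \<alpha> * (1 - cmod z)})"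
    by (auto simp: stolz_def)
  also have "open \<dots>"
    by (intro open_UN ballI open_Collect_less continuous_intros)
  finally show ?thesis .
qed

text \<open>The Poisson formula is applied to the holomorphic function phi^2, and absolute values
  are taken inside the integral.\<close>

lemma norm_square_le_poisson:
  fixes \<phi> :: "complex \<Rightarrow> complex"
  assumes c: "continuous_on (cball 0 1) \<phi>" and h: "\<phi> holomorphic_on ball 0 1" and z: "cmod z < 1"
  shows "ennreal (2 * pi * (cmod (\<phi> z))\<^sup>2)
    \<le> (\<integral>\<^sup>+t\<in>{0..2*pi}. ennreal ((cmod (\<phi> (cis t)))\<^sup>2 * poisson_kernel z t) \<partial>lborel)"
proof -
  let ?g = "\<lambda>t. (cmod (\<phi> (cis t)))\<^sup>2 * poisson_kernel z t"
  have cc: "continuous_on {0..2*pi} (\<lambda>t. \<phi> (cis t))"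
    by (rule continuous_on_compose2[OF c]) (auto intro!: continuous_intros)
  have gc: "continuous_on {0..2*pi} ?g"
    by (intro continuous_intros cc continuous_poisson_kernel z)
  have I: "((\<lambda>t. (\<phi> (cis t))\<^sup>2 * of_real (poisson_kernel z t)) has_integral (2 * pi * (\<phi> z)\<^sup>2)) {0..2*pi}"
    using circle_poisson_integral[of "\<lambda>u. (\<phi> u)\<^sup>2" z] c h z
    by (auto intro!: continuous_intros holomorphic_intros)
  have "cmod (integral {0..2*pi} (\<lambda>t. (\<phi> (cis t))\<^sup>2 * of_real (poisson_kernel z t))) \<le> integral {0..2*pi} ?g"
  proof (rule integral_norm_bound_integral)
    show "(\<lambda>t. (\<phi> (cis t))\<^sup>2 * of_real (poisson_kernel z t)) integrable_on {0..2*pi}" using I by blast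
    show "?g integrable_on {0..2*pi}" by (rule integrable_continuous_real[OF gc])
  qed (use poisson_kernel_nonneg[OF z] in \<open>auto simp: norm_mult norm_power\<close>)
  moreover have "integral {0..2*pi} (\<lambda>t. (\<phi> (cis t))\<^sup>2 * of_real (poisson_kernel z t)) = 2 * pi * (\<phi> z)\<^sup>2"
    using I by (rule integral_unique)
  ultimately have "2 * pi * (cmod (\<phi> z))\<^sup>2 \<le> integral {0..2*pi} ?g"
    by (simp add: norm_mult norm_power)
  moreover have "(\<integral>\<^sup>+t\<in>{0..2*pi}. ennreal (?g t) \<partial>lborel) = ennreal (integral {0..2*pi} ?g)"
    by (rule nn_integral_has_integral_atLeastAtMost[OF gc])
       (use poisson_kernel_nonneg[OF z] integrable_integral[OF integrable_continuous_real[OF gc]] in auto)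
  ultimately show ?thesis by (simp add: ennreal_leI)
qed

text \<open>For z in a cone at cis theta, the distance from z to cis t dominates 1 - |z| and also,
  by the triangle inequality through cis theta, a multiple of |t - theta|. This yields the bell
  shape that \<open>poisson_average_le\<close> expects.\<close>

lemma poisson_kernel_stolz_le:
  assumes \<alpha>: "\<alpha> > 0" and z: "z \<in> stolz \<alpha> (cis \<theta>)" and t: "\<bar>t - \<theta>\<bar> \<le> pi"
  shows "poisson_kernel z t \<le> 8 * (1 + \<alpha>)\<^sup>2 * ((1 - cmod z) / (max (1 - cmod z) \<bar>t - \<theta>\<bar>)\<^sup>2)"
proof -
  define \<delta> where "\<delta> = 1 - cmod z"
  have \<delta>: "0 < \<delta>" and zz: "cmod (z - cis \<theta>) < \<alpha> * \<delta>" using z by (auto simp: stolz_def \<delta>_def)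
  define D where "D = cmod (cis t - z)"
  have d1: "\<delta> \<le> D" using norm_cis_minus_ge[of z t] by (simp add: \<delta>_def D_def)
  have "\<bar>t - \<theta>\<bar> / 2 \<le> cmod (cis t - cis \<theta>)" using norm_cis_diff_ge[OF t] .
  also have "\<dots> \<le> D + cmod (z - cis \<theta>)"
    unfolding D_def using norm_triangle_ineq[of "cis t - z" "z - cis \<theta>"] by simp
  also have "\<dots> \<le> D + \<alpha> * D" using zz d1 \<alpha> mult_left_mono[of \<delta> D \<alpha>] by linarith
  finally have d2: "\<bar>t - \<theta>\<bar> \<le> 2 * (1 + \<alpha>) * D" by (simp add: algebra_simps)
  have "1 * D \<le> 2 * (1 + \<alpha>) * D" using d1 \<delta> \<alpha> by (intro mult_right_mono) auto
  then have d3: "\<delta> \<le> 2 * (1 + \<alpha>) * D" using d1 by simp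
  define m where "m = max \<delta> \<bar>t - \<theta>\<bar>"
  have m0: "0 < m" using \<delta> by (simp add: m_def)
  have "m \<le> 2 * (1 + \<alpha>) * D" using d2 d3 by (simp add: m_def)
  then have "m\<^sup>2 \<le> (2 * (1 + \<alpha>) * D)\<^sup>2" using m0 by (intro power_mono) auto
  then have m2: "m\<^sup>2 \<le> 4 * (1 + \<alpha>)\<^sup>2 * D\<^sup>2" unfolding power_mult_distrib by simp
  have D0: "0 < D" using d1 \<delta> by simp
  have "1 - (cmod z)\<^sup>2 = \<delta> * (1 + cmod z)" by (simp add: \<delta>_def power2_eq_square algebra_simps)
  also have "\<dots> \<le> \<delta> * 2" using \<delta> by (intro mult_left_mono) (auto simp: \<delta>_def)
  finally have n: "1 - (cmod z)\<^sup>2 \<le> 2 * \<delta>" by simp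
  have "poisson_kernel z t \<le> 2 * \<delta> / D\<^sup>2"
    unfolding poisson_kernel_def D_def[symmetric] by (intro divide_right_mono n) auto
  also have "\<dots> \<le> 8 * (1 + \<alpha>)\<^sup>2 * (\<delta> / m\<^sup>2)"
  proof -
    have "2 * \<delta> * m\<^sup>2 \<le> 2 * \<delta> * (4 * (1 + \<alpha>)\<^sup>2 * D\<^sup>2)" using m2 \<delta> by (intro mult_left_mono) auto
    then show ?thesis using m0 D0 by (simp add: field_simps)
  qed
  finally show ?thesis by (simp add: m_def \<delta>_def)
qed

text \<open>If the dilate exceeds mu somewhere in the cone, some interval average of its squared
  boundary values exceeds \<open>lam\<close>, and the weak-type bound applies. Dilates are used
  because the Poisson formula requires continuity on the closed disk.\<close>

lemma stolz_maximal_dilate: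
  fixes c :: "nat \<Rightarrow> complex"
  assumes f: "f holomorphic_on ball 0 1" and s: "\<And>z. cmod z < 1 \<Longrightarrow> (\<lambda>n. c n * z ^ n) sums f z"
    and sm: "summable (\<lambda>n. (cmod (c n))\<^sup>2)" and \<alpha>: "\<alpha> > 0" and \<mu>: "\<mu> > 0" and \<rho>: "0 \<le> \<rho>" "\<rho> < 1"
  shows "emeasure lborel {\<theta>\<in>{0<..<2*pi}. \<exists>z\<in>stolz \<alpha> (cis \<theta>). \<mu> < cmod (f (of_real \<rho> * z))}
    \<le> ennreal (1280 * (1 + \<alpha>)\<^sup>2 * (\<Sum>n. (cmod (c n))\<^sup>2) / \<mu>\<^sup>2)"
proof -
  define S where "S = (\<Sum>n. (cmod (c n))\<^sup>2)"
  define C where "C = 8 * (1 + \<alpha>)\<^sup>2"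
  have C: "C > 0" using \<alpha> by (simp add: C_def)
  \<comment> \<open>Chosen so that the bound C * 16 * lam obtained from
    \<open>poisson_average_le\<close> equals 2 * pi * mu^2.\<close>
  define lam where "lam = pi * \<mu>\<^sup>2 / (8 * C)"
  have lam: "lam > 0" using \<mu> C by (simp add: lam_def)
  define E where "E = {\<theta>\<in>{0<..<2*pi}. \<exists>z\<in>stolz \<alpha> (cis \<theta>). \<mu> < cmod (f (of_real \<rho> * z))}"
  have "E = {\<theta>. \<exists>z\<in>stolz \<alpha> (cis \<theta>). \<mu> < cmod (f (of_real \<rho> * z))} \<inter> {0<..<2*pi}"
    by (auto simp: E_def)
  then have Eb: "E \<in> sets borel" using open_stolz_shadow by auto
  define h where "h t = ennreal ((cmod (f (of_real \<rho> * cis t)))\<^sup>2)" for t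
  have [measurable]: "(\<lambda>t. f (of_real \<rho> * cis t)) \<in> borel_measurable borel"
    by (rule borel_measurable_circle_dilate[OF holomorphic_on_imp_continuous_on[OF f] \<rho>])
  have hm [measurable]: "h \<in> borel_measurable borel" unfolding h_def[abs_def] by measurable
  have hper: "h (t + 2*pi) = h t" for t by (simp add: h_def flip: cis_mult)
  \<comment> \<open>For theta in (0, 2 pi) the window [theta - pi, theta + pi] lies in [-pi, 3 pi],
    which consists of two periods; hence 4 pi S below.\<close>
  define g where "g t = h t * indicator {-pi..3*pi} t" for t
  have gm [measurable]: "g \<in> borel_measurable borel" unfolding g_def[abs_def] by measurable
  have hS: "(\<integral>\<^sup>+t\<in>{0..2*pi}. h t \<partial>lborel) \<le> ennreal (2*pi*S)"
  proof -
    have "(\<integral>\<^sup>+t\<in>{0..2*pi}. h t \<partial>lborel) = (\<Sum>n. ennreal (2*pi*(cmod (c n))\<^sup>2 * \<rho> ^ (2*n)))"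
      unfolding h_def by (rule nn_integral_circle_power_series[OF s \<rho>])
    also have "\<dots> \<le> (\<Sum>n. ennreal (2*pi*(cmod (c n))\<^sup>2))"
    proof (intro suminf_le summableI ennreal_leI)
      fix n
      have "\<rho> ^ (2*n) \<le> 1" using \<rho> by (intro power_le_one) auto
      then show "2*pi*(cmod (c n))\<^sup>2 * \<rho> ^ (2*n) \<le> 2*pi*(cmod (c n))\<^sup>2"
        using mult_left_mono[of "\<rho> ^ (2*n)" 1 "2*pi*(cmod (c n))\<^sup>2"] by simp
    qed
    also have "\<dots> = ennreal (\<Sum>n. 2*pi*(cmod (c n))\<^sup>2)"
      by (intro suminf_ennreal2 summable_mult sm) auto
    also have "(\<Sum>n. 2*pi*(cmod (c n))\<^sup>2) = 2*pi*S" unfolding S_def by (rule suminf_mult[OF sm])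
    finally show ?thesis .
  qed
  have gS: "(\<integral>\<^sup>+t. g t \<partial>lborel) \<le> ennreal (4*pi*S)"
  proof -
    have "(\<integral>\<^sup>+t. g t \<partial>lborel) \<le> (\<integral>\<^sup>+t. (h t * indicator {-pi..-pi+2*pi} t + h t * indicator {pi..pi+2*pi} t) \<partial>lborel)"
      by (intro nn_integral_mono) (auto simp: g_def indicator_def)
    also have "\<dots> = (\<integral>\<^sup>+t\<in>{-pi..-pi+2*pi}. h t \<partial>lborel) + (\<integral>\<^sup>+t\<in>{pi..pi+2*pi}. h t \<partial>lborel)"
      by (rule nn_integral_add) measurable
    also have "\<dots> = (\<integral>\<^sup>+t\<in>{0..2*pi}. h t \<partial>lborel) + (\<integral>\<^sup>+t\<in>{0..2*pi}. h t \<partial>lborel)"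
      using nn_integral_periodic[OF hm hper, of "-pi"] nn_integral_periodic[OF hm hper, of pi] by simp
    also have "\<dots> \<le> ennreal (2*pi*S) + ennreal (2*pi*S)" by (intro add_mono hS)
    also have "\<dots> = ennreal (4*pi*S)"
      using suminf_nonneg[OF sm] by (subst ennreal_plus[symmetric]) (auto simp: S_def)
    finally show ?thesis .
  qed
  have "\<exists>s>0. ennreal (lam * (2 * s)) < (\<integral>\<^sup>+t\<in>{\<theta>-s..\<theta>+s}. g t \<partial>lborel)" if \<theta>: "\<theta> \<in> E" for \<theta>
  proof (rule ccontr)
    assume neg: "\<not> (\<exists>s>0. ennreal (lam * (2 * s)) < (\<integral>\<^sup>+t\<in>{\<theta>-s..\<theta>+s}. g t \<partial>lborel))"
    obtain z where z: "z \<in> stolz \<alpha> (cis \<theta>)" "\<mu> < cmod (f (of_real \<rho> * z))" and \<theta>2: "0 < \<theta>" "\<theta> < 2*pi"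
      using \<theta> by (auto simp: E_def)
    have z1: "cmod z < 1" using z by (simp add: stolz_def)
    define \<delta> where "\<delta> = 1 - cmod z"
    have \<delta>: "\<delta> > 0" using z1 by (simp add: \<delta>_def)
    have av: "(\<integral>\<^sup>+t. g t * ennreal (\<delta> / (max \<delta> \<bar>t - \<theta>\<bar>)\<^sup>2) \<partial>lborel) \<le> ennreal (16 * lam)"
    proof (intro poisson_average_le \<delta> gm)
      show "(\<integral>\<^sup>+t\<in>{\<theta>-s..\<theta>+s}. g t \<partial>lborel) \<le> ennreal (lam * (2 * s))" if "s > 0" for s
        using neg that by (meson not_less)
    qed (use lam in simp)
    have "ennreal (2 * pi * (cmod (f (of_real \<rho> * z)))\<^sup>2)
      \<le> (\<integral>\<^sup>+t\<in>{0..2*pi}. ennreal ((cmod (f (of_real \<rho> * cis t)))\<^sup>2 * poisson_kernel z t) \<partial>lborel)"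
      by (rule norm_square_le_poisson[OF dilate_properties(1,2)[OF f \<rho>] z1])
    also have "\<dots> = (\<integral>\<^sup>+t\<in>{\<theta>-pi..\<theta>-pi+2*pi}. ennreal ((cmod (f (of_real \<rho> * cis t)))\<^sup>2 * poisson_kernel z t) \<partial>lborel)"
      by (rule nn_integral_periodic[symmetric]) (auto simp: poisson_kernel_def simp flip: cis_mult)
    also have "\<dots> \<le> (\<integral>\<^sup>+t. ennreal C * (g t * ennreal (\<delta> / (max \<delta> \<bar>t - \<theta>\<bar>)\<^sup>2)) \<partial>lborel)"
    proof (rule nn_integral_mono)
      fix t
      show "ennreal ((cmod (f (of_real \<rho> * cis t)))\<^sup>2 * poisson_kernel z t) * indicator {\<theta>-pi..\<theta>-pi+2*pi} t
        \<le> ennreal C * (g t * ennreal (\<delta> / (max \<delta> \<bar>t - \<theta>\<bar>)\<^sup>2))"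
      proof (cases "\<bar>t - \<theta>\<bar> \<le> pi")
        case True
        have "(cmod (f (of_real \<rho> * cis t)))\<^sup>2 * poisson_kernel z t
            \<le> (cmod (f (of_real \<rho> * cis t)))\<^sup>2 * (C * (\<delta> / (max \<delta> \<bar>t - \<theta>\<bar>)\<^sup>2))"
          using poisson_kernel_stolz_le[OF \<alpha> z(1) True] by (intro mult_left_mono) (auto simp: C_def \<delta>_def)
        then have "ennreal ((cmod (f (of_real \<rho> * cis t)))\<^sup>2 * poisson_kernel z t)
            \<le> ennreal (C * ((cmod (f (of_real \<rho> * cis t)))\<^sup>2 * (\<delta> / (max \<delta> \<bar>t - \<theta>\<bar>)\<^sup>2)))"
          by (intro ennreal_leI) (simp add: mult_ac)
        also have "\<dots> = ennreal C * (h t * ennreal (\<delta> / (max \<delta> \<bar>t - \<theta>\<bar>)\<^sup>2))"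
          using C \<delta> by (simp add: h_def ennreal_mult del: times_divide_eq_right)
        also have "h t = g t" using True \<theta>2 by (auto simp: g_def indicator_def)
        finally show ?thesis by (auto simp: indicator_def)
      qed (auto simp: indicator_def)
    qed
    also have "\<dots> = ennreal C * (\<integral>\<^sup>+t. g t * ennreal (\<delta> / (max \<delta> \<bar>t - \<theta>\<bar>)\<^sup>2) \<partial>lborel)"
      by (rule nn_integral_cmult) measurable
    also have "\<dots> \<le> ennreal C * ennreal (16 * lam)" by (intro mult_left_mono av) auto
    also have "\<dots> = ennreal (2 * pi * \<mu>\<^sup>2)"
      using C lam by (subst ennreal_mult[symmetric]) (auto simp: lam_def)
    finally have "2 * pi * (cmod (f (of_real \<rho> * z)))\<^sup>2 \<le> 2 * pi * \<mu>\<^sup>2"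
      by (simp add: ennreal_le_iff)
    then have "(cmod (f (of_real \<rho> * z)))\<^sup>2 \<le> \<mu>\<^sup>2" by simp
    then have "cmod (f (of_real \<rho> * z)) \<le> \<mu>" using \<mu> by (simp add: power2_le_iff_abs_le)
    then show False using z(2) by simp
  qed
  then have "emeasure lborel E \<le> ennreal (5 / lam) * (\<integral>\<^sup>+t. g t \<partial>lborel)"
    by (intro maximal_weak_type Eb gm lam) auto
  also have "\<dots> \<le> ennreal (5 / lam) * ennreal (4*pi*S)" by (intro mult_left_mono gS) auto
  also have "\<dots> = ennreal (5 / lam * (4*pi*S))"
    using lam suminf_nonneg[OF sm] by (intro ennreal_mult[symmetric]) (auto simp: S_def)
  also have "5 / lam * (4*pi*S) = 1280 * (1 + \<alpha>)\<^sup>2 * S / \<mu>\<^sup>2"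
    using \<mu> by (simp add: lam_def C_def)
  finally show ?thesis by (simp add: E_def S_def)
qed

text \<open>A fixed countable family of radii keeps boundary limits within sequences of Borel
  functions; the offset 2 makes every radius positive.\<close>

definition radius_seq :: "nat \<Rightarrow> real" where
  "radius_seq k = 1 - 1 / real (k + 2)"

lemma radius_seq: "0 < radius_seq k" "radius_seq k < 1"
  by (auto simp: radius_seq_def field_simps)

lemma radius_seq_LIMSEQ: "radius_seq \<longlonglongrightarrow> 1"
proof -
  have "(\<lambda>k. 1 - 1 / real (k + 2)) \<longlonglongrightarrow> 1 - 0"
    by (intro tendsto_diff tendsto_const LIMSEQ_ignore_initial_segment[OF lim_1_over_n])
  then show ?thesis by (simp add: radius_seq_def[abs_def])
qed

lemma radius_seq_stolz: "cmod \<zeta> = 1 \<Longrightarrow> \<alpha> > 1 \<Longrightarrow> of_real (radius_seq k) * \<zeta> \<in> stolz \<alpha> \<zeta>"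
proof -
  assume \<zeta>: "cmod \<zeta> = 1" and \<alpha>: "\<alpha> > 1"
  have "of_real (radius_seq k) * \<zeta> - \<zeta> = of_real (radius_seq k - 1) * \<zeta>" by (simp add: algebra_simps)
  then have "cmod (of_real (radius_seq k) * \<zeta> - \<zeta>) = 1 - radius_seq k"
    using radius_seq[of k] \<zeta> by (simp add: norm_mult del: of_real_diff)
  moreover have "1 - radius_seq k < \<alpha> * (1 - radius_seq k)" using radius_seq[of k] \<alpha> by simp
  ultimately show ?thesis using radius_seq[of k] \<zeta> by (simp add: stolz_def norm_mult)
qed

text \<open>Cones are open, so a point z of the cone is \<open>radius_seq k\<close> times another
  point of the cone for all large k. The level set of f therefore lies in the lower limit of the
  level sets of the dilates, and continuity from below transfers the uniform bound.\<close>

lemma stolz_maximal: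
  fixes c :: "nat \<Rightarrow> complex"
  assumes f: "f holomorphic_on ball 0 1" and s: "\<And>z. cmod z < 1 \<Longrightarrow> (\<lambda>n. c n * z ^ n) sums f z"
    and sm: "summable (\<lambda>n. (cmod (c n))\<^sup>2)" and \<alpha>: "\<alpha> > 0" and \<mu>: "\<mu> > 0"
  shows "emeasure lborel {\<theta>\<in>{0<..<2*pi}. \<exists>z\<in>stolz \<alpha> (cis \<theta>). \<mu> < cmod (f z)}
    \<le> ennreal (1280 * (1 + \<alpha>)\<^sup>2 * (\<Sum>n. (cmod (c n))\<^sup>2) / \<mu>\<^sup>2)" (is "_ \<le> ?B")
proof -
  define E where "E k = {\<theta>\<in>{0<..<2*pi}. \<exists>z\<in>stolz \<alpha> (cis \<theta>). \<mu> < cmod (f (of_real (radius_seq k) * z))}" for k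
  have Eeq: "E k = {\<theta>. \<exists>z\<in>stolz \<alpha> (cis \<theta>). \<mu> < cmod (f (of_real (radius_seq k) * z))} \<inter> {0<..<2*pi}" for k
    by (auto simp: E_def)
  have Em: "E k \<in> sets lborel" for k
    unfolding Eeq using open_stolz_shadow by auto
  define H where "H k = (\<Inter>j\<in>{k..}. E j)" for k
  have Hm: "H k \<in> sets lborel" for k unfolding H_def using Em by (intro sets.countable_INT') auto
  have sub: "{\<theta>\<in>{0<..<2*pi}. \<exists>z\<in>stolz \<alpha> (cis \<theta>). \<mu> < cmod (f z)} \<subseteq> (\<Union>k. H k)"
  proof
    fix \<theta> assume "\<theta> \<in> {\<theta>\<in>{0<..<2*pi}. \<exists>z\<in>stolz \<alpha> (cis \<theta>). \<mu> < cmod (f z)}"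
    then obtain z where z: "cmod z < 1" "cmod (z - cis \<theta>) < \<alpha> * (1 - cmod z)" "\<mu> < cmod (f z)"
      and \<theta>: "\<theta> \<in> {0<..<2*pi}" by (auto simp: stolz_def)
    define w where "w k = z / of_real (radius_seq k)" for k
    have wz: "w \<longlonglongrightarrow> z"
    proof -
      have "(\<lambda>k. z / of_real (radius_seq k)) \<longlonglongrightarrow> z / of_real 1"
        by (intro tendsto_intros radius_seq_LIMSEQ) auto
      then show ?thesis by (simp add: w_def[abs_def])
    qed
    have "\<forall>\<^sub>F k in sequentially. cmod (w k) < 1"
      by (rule order_tendstoD(2)[OF _ z(1)]) (intro tendsto_intros wz)
    moreover have "\<forall>\<^sub>F k in sequentially. cmod (w k - cis \<theta>) - \<alpha> * (1 - cmod (w k)) < 0"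
    proof (rule order_tendstoD(2))
      show "(\<lambda>k. cmod (w k - cis \<theta>) - \<alpha> * (1 - cmod (w k))) \<longlonglongrightarrow> cmod (z - cis \<theta>) - \<alpha> * (1 - cmod z)"
        by (intro tendsto_intros wz)
    qed (use z in simp)
    ultimately have "\<forall>\<^sub>F k in sequentially. \<theta> \<in> E k"
    proof eventually_elim
      case (elim k)
      have "of_real (radius_seq k) * w k = z" using radius_seq[of k] by (simp add: w_def)
      then show ?case using elim z(3) \<theta> by (auto simp: E_def stolz_def intro!: bexI[of _ "w k"])
    qed
    then show "\<theta> \<in> (\<Union>k. H k)" by (auto simp: eventually_sequentially H_def)
  qed
  have "emeasure lborel {\<theta>\<in>{0<..<2*pi}. \<exists>z\<in>stolz \<alpha> (cis \<theta>). \<mu> < cmod (f z)} \<le> emeasure lborel (\<Union>k. H k)"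
    by (rule emeasure_mono[OF sub]) (intro sets.countable_UN Hm subsetI, use Hm in auto)
  also have "\<dots> = (SUP k. emeasure lborel (H k))"
    by (rule SUP_emeasure_incseq[symmetric]) (use Hm in \<open>auto simp: incseq_def H_def\<close>)
  also have "\<dots> \<le> ?B"
  proof (rule SUP_least)
    fix k
    have "emeasure lborel (H k) \<le> emeasure lborel (E k)"
      by (rule emeasure_mono) (use Em in \<open>auto simp: H_def\<close>)
    also have "\<dots> \<le> ?B"
      unfolding E_def using radius_seq[of k] by (intro stolz_maximal_dilate assms) auto
    finally show "emeasure lborel (H k) \<le> ?B" .
  qed
  finally show ?thesis .
qed

text \<open>Failure of the Cauchy condition, at tolerance epsilon, in the part of the cone beyond
  radius r. No limit value is mentioned, so for fixed parameters the angles with this property form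
  an open set.\<close>

definition stolz_osc :: "(complex \<Rightarrow> complex) \<Rightarrow> real \<Rightarrow> real \<Rightarrow> real \<Rightarrow> complex \<Rightarrow> bool" where
  "stolz_osc f \<alpha> \<epsilon> r \<zeta> \<longleftrightarrow> (\<exists>z\<in>stolz \<alpha> \<zeta>. \<exists>w\<in>stolz \<alpha> \<zeta>. r < cmod z \<and> r < cmod w \<and> \<epsilon> < cmod (f z - f w))"

section \<open>Existence and measurability of nontangential limits\<close>

lemma nt_limit_seq:
  assumes L: "nt_limit f \<zeta> L" and \<zeta>: "cmod \<zeta> = 1" and \<alpha>: "\<alpha> > 1"
    and x: "x \<longlonglongrightarrow> \<zeta>" "\<And>k. x k \<in> stolz \<alpha> \<zeta>"
  shows "(\<lambda>k. f (x k)) \<longlonglongrightarrow> L"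
proof -
  have lim: "(f \<longlongrightarrow> L) (at \<zeta> within stolz \<alpha> \<zeta>)" using L \<alpha> by (simp add: nt_limit_stolz)
  have "filterlim x (at \<zeta> within stolz \<alpha> \<zeta>) sequentially"
  proof -
    have "x k \<noteq> \<zeta>" for k
    proof
      assume "x k = \<zeta>"
      moreover have "cmod (x k) < 1" using x(2)[of k] unfolding stolz_def by blast
      ultimately show False using \<zeta> by simp
    qed
    then show ?thesis unfolding filterlim_at using x by simp
  qed
  then show ?thesis by (rule filterlim_compose[OF lim])
qed

lemma radial_seq_LIMSEQ: "(\<lambda>k. of_real (radius_seq k) * \<zeta>) \<longlonglongrightarrow> (\<zeta> :: complex)"
proof -
  have "(\<lambda>k. of_real (radius_seq k) * \<zeta>) \<longlonglongrightarrow> of_real 1 * \<zeta>"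
    by (intro tendsto_intros radius_seq_LIMSEQ)
  then show ?thesis by simp
qed

lemma nt_limit_radial:
  assumes "nt_limit f \<zeta> L" "cmod \<zeta> = 1"
  shows "(\<lambda>k. f (of_real (radius_seq k) * \<zeta>)) \<longlonglongrightarrow> L"
  by (rule nt_limit_seq[OF assms, of 2]) (auto intro: radial_seq_LIMSEQ radius_seq_stolz assms)

lemma bdry_fun_eq:
  assumes "nt_limit f \<zeta> L" "cmod \<zeta> = 1"
  shows "bdry_fun f \<zeta> = L"
proof -
  have "(THE L. nt_limit f \<zeta> L) = L"
    using assms nt_limit_radial LIMSEQ_unique by (intro the_equality) blast+
  then show ?thesis using assms by (auto simp: bdry_fun_def)
qed

text \<open>Cauchy's criterion with countable parameters, which makes the set of convergence Borel.
  In the converse direction the limit is found along the radius, which lies in every cone, so one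
  value serves all apertures.\<close>

lemma ex_nt_limit_iff:
  assumes \<zeta>: "cmod \<zeta> = 1"
  shows "(\<exists>L. nt_limit f \<zeta> L) \<longleftrightarrow>
    (\<forall>a j. \<exists>m. \<not> stolz_osc f (real a + 2) (1 / (real j + 1)) (1 - 1 / (real m + 1)) \<zeta>)" (is "_ = ?R")
proof
  assume "\<exists>L. nt_limit f \<zeta> L"
  then obtain L where L: "nt_limit f \<zeta> L" ..
  show ?R
  proof (intro allI)
    fix a j :: nat
    define \<epsilon> where "\<epsilon> = 1 / (real j + 1)"
    have "\<epsilon> > 0" by (simp add: \<epsilon>_def)
    have "(f \<longlongrightarrow> L) (at \<zeta> within stolz (real a + 2) \<zeta>)" using L by (simp add: nt_limit_stolz)
    then have "\<forall>\<^sub>F z in at \<zeta> within stolz (real a + 2) \<zeta>. dist (f z) L < \<epsilon> / 2"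
      using \<open>\<epsilon> > 0\<close> by (intro tendstoD) auto
    then obtain d where d: "d > 0" "\<And>z. z \<in> stolz (real a + 2) \<zeta> \<Longrightarrow> z \<noteq> \<zeta> \<Longrightarrow> dist z \<zeta> < d \<Longrightarrow> dist (f z) L < \<epsilon> / 2"
      by (auto simp: eventually_at)
    obtain m where m: "(real a + 2) / d < real m" using reals_Archimedean2 by blast
    have near: "dist (f z) L < \<epsilon> / 2" if z: "z \<in> stolz (real a + 2) \<zeta>" "1 - 1 / (real m + 1) < cmod z" for z
    proof (rule d(2)[OF z(1)])
      show "z \<noteq> \<zeta>" using z \<zeta> by (auto simp: stolz_def)
      have "cmod (z - \<zeta>) < (real a + 2) * (1 - cmod z)" using z by (simp add: stolz_def)
      also have "\<dots> \<le> (real a + 2) * (1 / (real m + 1))" using z by (intro mult_left_mono) auto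
      also have "\<dots> < d" using m d(1) by (simp add: field_simps)
      finally show "dist z \<zeta> < d" by (simp add: dist_norm)
    qed
    have "\<not> stolz_osc f (real a + 2) \<epsilon> (1 - 1 / (real m + 1)) \<zeta>"
    proof
      assume "stolz_osc f (real a + 2) \<epsilon> (1 - 1 / (real m + 1)) \<zeta>"
      then obtain z w where "z \<in> stolz (real a + 2) \<zeta>" "w \<in> stolz (real a + 2) \<zeta>"
        "1 - 1 / (real m + 1) < cmod z" "1 - 1 / (real m + 1) < cmod w" "\<epsilon> < cmod (f z - f w)"
        by (auto simp: stolz_osc_def)
      then have "dist (f z) L < \<epsilon> / 2" "dist (f w) L < \<epsilon> / 2" "\<epsilon> < dist (f z) (f w)"
        using near by (auto simp: dist_norm)
      then show False using dist_triangle2[of "f z" "f w" L] by linarith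
    qed
    then show "\<exists>m. \<not> stolz_osc f (real a + 2) (1 / (real j + 1)) (1 - 1 / (real m + 1)) \<zeta>"
      unfolding \<epsilon>_def by blast
  qed
next
  assume R: ?R
  define x where "x k = of_real (radius_seq k) * \<zeta>" for k
  have xs: "x k \<in> stolz \<alpha> \<zeta>" if "\<alpha> > 1" for k \<alpha> unfolding x_def by (rule radius_seq_stolz[OF \<zeta> that])
  have xn: "1 - 1 / (real m + 1) < cmod (x k)" if "m \<le> k" for m k
  proof -
    have "cmod (x k) = 1 - 1 / real (k + 2)" using \<zeta> radius_seq[of k] by (simp add: x_def norm_mult) (simp add: radius_seq_def)
    moreover have "1 / real (k + 2) < 1 / (real m + 1)" using that by (intro divide_strict_left_mono) auto
    ultimately show ?thesis by simp
  qed
  have "Cauchy (\<lambda>k. f (x k))"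
  proof (rule metric_CauchyI)
    fix e :: real assume "e > 0"
    then obtain j where j: "1 / (real j + 1) < e"
      using reals_Archimedean[of e] by (auto simp: inverse_eq_divide add.commute)
    obtain m where m: "\<not> stolz_osc f (real 0 + 2) (1 / (real j + 1)) (1 - 1 / (real m + 1)) \<zeta>" using R by blast
    have "dist (f (x k)) (f (x l)) < e" if "m \<le> k" "m \<le> l" for k l
    proof -
      have "\<not> 1 / (real j + 1) < cmod (f (x k) - f (x l))"
        using m xs[of "real 0 + 2"] xn[OF that(1)] xn[OF that(2)] unfolding stolz_osc_def by (auto simp: Bex_def)
      then show ?thesis using j by (simp add: dist_norm)
    qed
    then show "\<exists>M. \<forall>m\<ge>M. \<forall>n\<ge>M. dist (f (x m)) (f (x n)) < e" by blast
  qed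
  then obtain L where L: "(\<lambda>k. f (x k)) \<longlonglongrightarrow> L" using Cauchy_convergent_iff convergent_def by blast
  have "nt_limit f \<zeta> L"
    unfolding nt_limit_stolz
  proof (intro allI impI tendstoI)
    fix \<alpha> e :: real assume "\<alpha> > 1" "e > 0"
    obtain a where a: "\<alpha> \<le> real a" using real_arch_simple by blast
    have mono: "z \<in> stolz (real a + 2) \<zeta>" if "z \<in> stolz \<alpha> \<zeta>" for z
    proof -
      have "\<alpha> * (1 - cmod z) \<le> (real a + 2) * (1 - cmod z)"
        using that a by (intro mult_right_mono) (auto simp: stolz_def)
      moreover have "cmod z < 1" "cmod (z - \<zeta>) < \<alpha> * (1 - cmod z)" using that by (auto simp: stolz_def)
      ultimately show ?thesis unfolding stolz_def by (blast intro: less_le_trans)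
    qed
    obtain j where j: "1 / (real j + 1) < e"
      using reals_Archimedean[of e] \<open>e > 0\<close> by (auto simp: inverse_eq_divide add.commute)
    obtain m where m: "\<not> stolz_osc f (real a + 2) (1 / (real j + 1)) (1 - 1 / (real m + 1)) \<zeta>" using R by blast
    have "dist (f z) L < e" if z: "z \<in> stolz \<alpha> \<zeta>" "dist z \<zeta> < 1 / (real m + 1)" for z
    proof -
      have "cmod \<zeta> - cmod z \<le> cmod (\<zeta> - z)" by (rule norm_triangle_ineq2)
      then have zn: "1 - 1 / (real m + 1) < cmod z" using z(2) \<zeta> by (simp add: dist_norm norm_minus_commute)
      have "cmod (f z - f (x k)) \<le> 1 / (real j + 1)" if "m \<le> k" for k
      proof -
        have "x k \<in> stolz (real a + 2) \<zeta>" by (rule xs) simp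
        then show ?thesis
          using m mono[OF z(1)] zn xn[OF that] unfolding stolz_osc_def by (meson not_less)
      qed
      then have "cmod (f z - L) \<le> 1 / (real j + 1)"
        by (intro LIMSEQ_le_const2[OF tendsto_norm[OF tendsto_diff[OF tendsto_const L]]]) blast
      then show ?thesis using j by (simp add: dist_norm)
    qed
    then show "\<forall>\<^sub>F z in at \<zeta> within stolz \<alpha> \<zeta>. dist (f z) L < e"
      unfolding eventually_at by (intro exI[of _ "1 / (real m + 1)"]) auto
  qed
  then show "\<exists>L. nt_limit f \<zeta> L" by blast
qed

lemma open_stolz_osc: "open {\<theta>. stolz_osc f \<alpha> \<epsilon> r (cis \<theta>)}"
proof -
  have "{\<theta>. stolz_osc f \<alpha> \<epsilon> r (cis \<theta>)} =
    (\<Union>(z, w)\<in>{(z, w). cmod z < 1 \<and> cmod w < 1 \<and> r < cmod z \<and> r < cmod w \<and> \<epsilon> < cmod (f z - f w)}.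
       {\<theta>. cmod (z - cis \<theta>) < \<alpha> * (1 - cmod z)} \<inter> {\<theta>. cmod (w - cis \<theta>) < \<alpha> * (1 - cmod w)})"
    by (auto simp: stolz_osc_def stolz_def)
  also have "open \<dots>"
    by (intro open_UN ballI) (auto intro!: open_Int open_Collect_less continuous_intros)
  finally show ?thesis .
qed

lemma nt_limit_set_borel: "{\<theta>. \<exists>L. nt_limit f (cis \<theta>) L} \<in> sets borel"
proof -
  have [measurable]: "Measurable.pred borel (\<lambda>\<theta>. stolz_osc f \<alpha> \<epsilon> r (cis \<theta>))" for \<alpha> \<epsilon> r
    using borel_open[OF open_stolz_osc[of f \<alpha> \<epsilon> r]] by (simp add: pred_def)
  have "{\<theta>\<in>space borel. \<forall>a j. \<exists>m. \<not> stolz_osc f (real a + 2) (1 / (real j + 1)) (1 - 1 / (real m + 1)) (cis \<theta>)} \<in> sets borel"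
    by measurable
  then show ?thesis by (simp add: ex_nt_limit_iff)
qed

text \<open>Dilates multiplied by the indicator of the set of convergence tend to the limit on that
  set and to 0 off it. The default value 0 of \<open>bdry_fun\<close> agrees with this, so the
  convergence is pointwise everywhere.\<close>

lemma borel_measurable_bdry_fun:
  assumes f: "continuous_on (ball 0 1) f"
  shows "(\<lambda>\<theta>. bdry_fun f (cis \<theta>)) \<in> borel_measurable borel"
proof (rule borel_measurable_LIMSEQ_metric)
  define G where "G = {\<theta>. \<exists>L. nt_limit f (cis \<theta>) L}"
  have [measurable]: "G \<in> sets borel" unfolding G_def by (rule nt_limit_set_borel)
  have [measurable]: "(\<lambda>\<theta>. f (of_real (radius_seq k) * cis \<theta>)) \<in> borel_measurable borel" for k
    using radius_seq[of k] by (intro borel_measurable_circle_dilate f) auto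
  show "(\<lambda>\<theta>. indicator G \<theta> *\<^sub>R f (of_real (radius_seq k) * cis \<theta>)) \<in> borel_measurable borel" for k
    by measurable
  show "(\<lambda>k. indicator G \<theta> *\<^sub>R f (of_real (radius_seq k) * cis \<theta>)) \<longlonglongrightarrow> bdry_fun f (cis \<theta>)" for \<theta>
  proof (cases "\<theta> \<in> G")
    case True
    then obtain L where L: "nt_limit f (cis \<theta>) L" by (auto simp: G_def)
    then show ?thesis using True nt_limit_radial[OF L] bdry_fun_eq[OF L] by simp
  next
    case False
    then show ?thesis by (auto simp: G_def bdry_fun_def)
  qed
qed

text \<open>The maximal method. Taylor polynomials are continuous up to the circle, so oscillation
  of f near cis theta must come from the remainders; the maximal inequality shows that the angles
  where every remainder is large form a null set.\<close>

theorem fatou_nontangential: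
  assumes f: "f holomorphic_on ball 0 1" and s: "\<And>z. cmod z < 1 \<Longrightarrow> (\<lambda>n. c n * z ^ n) sums f z"
    and sm: "summable (\<lambda>n. (cmod (c n))\<^sup>2)"
  shows "AE \<theta> in lborel. \<theta> \<in> {0<..<2*pi} \<longrightarrow> (\<exists>L. nt_limit f (cis \<theta>) L)"
proof -
  have "AE \<theta> in lborel. \<theta> \<in> {0<..<2*pi} \<longrightarrow>
     (\<exists>m. \<not> stolz_osc f (real a + 2) (1 / (real j + 1)) (1 - 1 / (real m + 1)) (cis \<theta>))" for a j :: nat
  proof -
    define \<alpha> where "\<alpha> = real a + 2"
    define \<epsilon> where "\<epsilon> = 1 / (real j + 1)"
    have \<alpha>: "\<alpha> > 0" and \<epsilon>: "\<epsilon> > 0" by (auto simp: \<alpha>_def \<epsilon>_def)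
    define R where "R N z = f z - (\<Sum>n<N. c n * z ^ n)" for N z
    \<comment> \<open>Four errors of size epsilon / 4 enter the oscillation: two from the polynomial
      and two from the remainder.\<close>
    define E where "E N = {\<theta>\<in>{0<..<2*pi}. \<exists>z\<in>stolz \<alpha> (cis \<theta>). \<epsilon> / 4 < cmod (R N z)}" for N
    have Eeq: "E N = {\<theta>. \<exists>z\<in>stolz \<alpha> (cis \<theta>). \<epsilon> / 4 < cmod (R N z)} \<inter> {0<..<2*pi}" for N
      by (auto simp: E_def)
    have Em: "E N \<in> sets lborel" for N unfolding Eeq using open_stolz_shadow by auto
    define T where "T N = (\<Sum>n. (cmod (c (n + N)))\<^sup>2)" for N
    have bound: "emeasure lborel (E N) \<le> ennreal (1280 * (1 + \<alpha>)\<^sup>2 * T N / (\<epsilon> / 4)\<^sup>2)" for N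
    proof -
      \<comment> \<open>The remainder as a power series in its own right, with the first N
        coefficients erased.\<close>
      define c' where "c' n = (if n < N then 0 else c n)" for n
      have e: "(\<lambda>n. (cmod (c' (n + N)))\<^sup>2) = (\<lambda>n. (cmod (c (n + N)))\<^sup>2)" by (simp add: c'_def)
      have sm': "summable (\<lambda>n. (cmod (c' n))\<^sup>2)"
        using sm summable_iff_shift[of "\<lambda>n. (cmod (c n))\<^sup>2" N] e
          summable_iff_shift[of "\<lambda>n. (cmod (c' n))\<^sup>2" N] by simp
      have "(\<Sum>n. (cmod (c' n))\<^sup>2) = T N"
        using suminf_split_initial_segment[OF sm', of N] unfolding T_def e by (simp add: c'_def)
      moreover have "R N holomorphic_on ball 0 1"
        unfolding R_def[abs_def] by (intro holomorphic_intros f)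
      moreover have "(\<lambda>n. c' n * z ^ n) sums R N z" if "cmod z < 1" for z
      proof -
        have "(\<lambda>n. if n \<in> {..<N} then c n * z ^ n else 0) sums (\<Sum>n<N. c n * z ^ n)"
          by (rule sums_If_finite_set) simp
        from sums_diff[OF s[OF that] this]
        have "(\<lambda>n. c n * z ^ n - (if n \<in> {..<N} then c n * z ^ n else 0)) sums R N z"
          by (simp add: R_def)
        moreover have "(\<lambda>n. c n * z ^ n - (if n \<in> {..<N} then c n * z ^ n else 0)) = (\<lambda>n. c' n * z ^ n)"
          by (auto simp: c'_def)
        ultimately show ?thesis by simp
      qed
      ultimately show ?thesis
        unfolding E_def using stolz_maximal[of "R N" c' \<alpha> "\<epsilon> / 4"] sm' \<alpha> \<epsilon> by simp
    qed
    have T0: "T \<longlonglongrightarrow> 0"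
      unfolding T_def[abs_def] using suminf_exist_split2[OF sm] by simp
    define Z where "Z = (\<Inter>N. E N)"
    have Zm: "Z \<in> sets lborel" unfolding Z_def using Em by (intro sets.countable_INT'') auto
    have "emeasure lborel Z \<le> 0"
    proof (rule LIMSEQ_le_const)
      have "(\<lambda>N. ennreal (1280 * (1 + \<alpha>)\<^sup>2 * T N / (\<epsilon> / 4)\<^sup>2)) \<longlonglongrightarrow> ennreal (1280 * (1 + \<alpha>)\<^sup>2 * 0 / (\<epsilon> / 4)\<^sup>2)"
        using \<epsilon> by (intro tendsto_ennrealI tendsto_intros T0) auto
      then show "(\<lambda>N. ennreal (1280 * (1 + \<alpha>)\<^sup>2 * T N / (\<epsilon> / 4)\<^sup>2)) \<longlonglongrightarrow> 0" by simp
      have "emeasure lborel Z \<le> ennreal (1280 * (1 + \<alpha>)\<^sup>2 * T N / (\<epsilon> / 4)\<^sup>2)" for N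
        by (rule order.trans[OF emeasure_mono bound]) (use Em in \<open>auto simp: Z_def\<close>)
      then show "\<exists>N0. \<forall>N\<ge>N0. emeasure lborel Z \<le> ennreal (1280 * (1 + \<alpha>)\<^sup>2 * T N / (\<epsilon> / 4)\<^sup>2)" by blast
    qed
    then have "Z \<in> null_sets lborel" using Zm by auto
    then have "AE \<theta> in lborel. \<theta> \<notin> Z" by (rule AE_not_in)
    then show ?thesis
    proof eventually_elim
      case (elim \<theta>)
      show ?case
      proof
        assume \<theta>: "\<theta> \<in> {0<..<2*pi}"
        then obtain N where N: "\<And>z. z \<in> stolz \<alpha> (cis \<theta>) \<Longrightarrow> cmod (R N z) \<le> \<epsilon> / 4"
          using elim by (fastforce simp: Z_def E_def not_less)
        define p where "p z = (\<Sum>n<N. c n * z ^ n)" for z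
        have "isCont p (cis \<theta>)" unfolding p_def[abs_def] by (intro continuous_intros)
        then obtain d where d: "d > 0" "\<And>z. cmod (z - cis \<theta>) < d \<Longrightarrow> cmod (p z - p (cis \<theta>)) < \<epsilon> / 4"
          using \<epsilon> unfolding continuous_at_eps_delta dist_norm by (metis zero_less_divide_iff zero_less_numeral)
        obtain m where m: "\<alpha> / d < real m" using reals_Archimedean2 by blast
        have near: "cmod (p z - p (cis \<theta>)) < \<epsilon> / 4" if z: "z \<in> stolz \<alpha> (cis \<theta>)" "1 - 1 / (real m + 1) < cmod z" for z
        proof (rule d(2))
          have "cmod (z - cis \<theta>) < \<alpha> * (1 - cmod z)" using z by (simp add: stolz_def)
          also have "\<dots> \<le> \<alpha> * (1 / (real m + 1))" using z \<alpha> by (intro mult_left_mono) auto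
          also have "\<dots> < d" using m d(1) by (simp add: field_simps)
          finally show "cmod (z - cis \<theta>) < d" .
        qed
        have "\<not> stolz_osc f \<alpha> \<epsilon> (1 - 1 / (real m + 1)) (cis \<theta>)"
        proof
          assume "stolz_osc f \<alpha> \<epsilon> (1 - 1 / (real m + 1)) (cis \<theta>)"
          then obtain z w where zw: "z \<in> stolz \<alpha> (cis \<theta>)" "w \<in> stolz \<alpha> (cis \<theta>)"
            "1 - 1 / (real m + 1) < cmod z" "1 - 1 / (real m + 1) < cmod w" "\<epsilon> < cmod (f z - f w)"
            by (auto simp: stolz_osc_def)
          have "f z - f w = (p z - p (cis \<theta>)) - (p w - p (cis \<theta>)) + (R N z - R N w)"
            by (simp add: R_def p_def)
          then have "cmod (f z - f w) \<le> cmod (p z - p (cis \<theta>)) + cmod (p w - p (cis \<theta>)) + (cmod (R N z) + cmod (R N w))"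
            by (metis add_mono norm_triangle_ineq4 norm_triangle_mono)
          moreover have "cmod (p z - p (cis \<theta>)) < \<epsilon> / 4" "cmod (p w - p (cis \<theta>)) < \<epsilon> / 4"
            "cmod (R N z) \<le> \<epsilon> / 4" "cmod (R N w) \<le> \<epsilon> / 4" using near N zw by auto
          ultimately show False using zw(5) by linarith
        qed
        then show "\<exists>m. \<not> stolz_osc f (real a + 2) (1 / (real j + 1)) (1 - 1 / (real m + 1)) (cis \<theta>)"
          unfolding \<alpha>_def \<epsilon>_def by blast
      qed
    qed
  qed
  then have "AE \<theta> in lborel. \<forall>a j. \<theta> \<in> {0<..<2*pi} \<longrightarrow>
     (\<exists>m. \<not> stolz_osc f (real a + 2) (1 / (real j + 1)) (1 - 1 / (real m + 1)) (cis \<theta>))"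
    unfolding AE_all_countable by blast
  then show ?thesis by eventually_elim (simp add: ex_nt_limit_iff)
qed

section \<open>Boundary functions and oscillation\<close>

text \<open>Arc length carried by the angles in [0, 2 pi]. Being a finite measure on the whole line,
  it allows Bochner integrals and Fubini without explicit restrictions.\<close>

definition circ :: "real measure" where
  "circ = density lborel (\<lambda>t. ennreal (indicator {0..2*pi} t))"

lemma borel_measurable_cnj [measurable]: "cnj \<in> borel_measurable borel"
  by (intro borel_measurable_continuous_onI continuous_intros)

lemma sets_circ [measurable_cong]: "sets circ = sets borel"
  and space_circ [simp]: "space circ = UNIV"
  by (auto simp: circ_def)

lemma nn_integral_circ:
  assumes [measurable]: "g \<in> borel_measurable borel"
  shows "(\<integral>\<^sup>+t. g t \<partial>circ) = (\<integral>\<^sup>+t\<in>{0..2*pi}. g t \<partial>lborel)"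
proof -
  have "(\<integral>\<^sup>+t. g t \<partial>circ) = (\<integral>\<^sup>+t. ennreal (indicator {0..2*pi} t) * g t \<partial>lborel)"
    unfolding circ_def by (rule nn_integral_density) auto
  also have "\<dots> = (\<integral>\<^sup>+t\<in>{0..2*pi}. g t \<partial>lborel)"
    by (intro nn_integral_cong) (auto simp: indicator_def)
  finally show ?thesis .
qed

lemma emeasure_circ: "emeasure circ UNIV = ennreal (2*pi)"
  using nn_integral_circ[of "\<lambda>_. 1"] by (simp add: nn_integral_const)

interpretation circ: finite_measure circ
  by (rule finite_measureI) (simp add: emeasure_circ)

lemma AE_circ: "(AE x in circ. P x) \<longleftrightarrow> (AE x in lborel. x \<in> {0..2*pi} \<longrightarrow> P x)"
  unfolding circ_def by (subst AE_density) (auto simp: indicator_def)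

lemma integral_circ:
  fixes g :: "real \<Rightarrow> 'a :: {banach, second_countable_topology}"
  assumes [measurable]: "g \<in> borel_measurable borel"
  shows "integral\<^sup>L circ g = set_lebesgue_integral lborel {0..2*pi} g"
  unfolding circ_def set_lebesgue_integral_def by (rule integral_density) auto

lemma circ_integral_continuous:
  fixes g :: "real \<Rightarrow> complex"
  assumes "g \<in> borel_measurable borel" and c: "continuous_on {0..2*pi} g" and I: "(g has_integral I) {0..2*pi}"
  shows "integral\<^sup>L circ g = I"
  using set_borel_integral_eq_integral(2)[OF borel_integrable_atLeastAtMost'[OF c]] integral_unique[OF I]
  by (simp add: integral_circ assms)

lemma integrable_circ_bounded:
  fixes g :: "real \<Rightarrow> 'a :: {banach, second_countable_topology}"
  assumes "g \<in> borel_measurable borel" "\<And>t. norm (g t) \<le> B"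
  shows "integrable circ g"
  by (rule circ.integrable_const_bound[of _ B]) (use assms in auto)

lemma integral_poisson_kernel: "cmod z < 1 \<Longrightarrow> (\<integral>\<^sup>+t. ennreal (poisson_kernel z t) \<partial>circ) = ennreal (2*pi)"
proof -
  assume z: "cmod z < 1"
  have "((\<lambda>t. (1::complex) * of_real (poisson_kernel z t)) has_integral (2 * pi * 1)) {0..2*pi}"
    using circle_poisson_integral[of "\<lambda>_. 1" z] z by simp
  from has_integral_linear[OF this bounded_linear_Re]
  have "(poisson_kernel z has_integral 2 * pi) {0..2*pi}" by (simp add: o_def)
  then show ?thesis
    using nn_integral_has_integral_atLeastAtMost[OF continuous_poisson_kernel[OF z], of 0 "2*pi"] poisson_kernel_nonneg[OF z]
    by (simp add: nn_integral_circ)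
qed

lemma cis_neq: "cmod z < 1 \<Longrightarrow> cis t \<noteq> z"
  using cis_minus_nonzero[of z t] by simp

lemma poisson_kernel_le:
  assumes z: "cmod z < 1"
  shows "poisson_kernel z t \<le> 2 / (1 - cmod z)\<^sup>2"
proof -
  have "(1 - cmod z)\<^sup>2 \<le> (cmod (cis t - z))\<^sup>2"
    using z norm_cis_minus_ge[of z t] by (intro power_mono) auto
  then have "poisson_kernel z t \<le> (1 - (cmod z)\<^sup>2) / (1 - cmod z)\<^sup>2"
    unfolding poisson_kernel_def using z cis_neq[OF z, of t]
    by (intro divide_left_mono) (auto simp: power_le_one_iff)
  also have "\<dots> \<le> 2 / (1 - cmod z)\<^sup>2" by (intro divide_right_mono) (auto intro: order.trans[of _ 0])
  finally show ?thesis .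
qed

text \<open>Harmonic measure on the circle as seen from z, written in the angle and of total mass
  1.\<close>

definition pmeasure :: "complex \<Rightarrow> real measure" where
  "pmeasure z = density circ (\<lambda>t. ennreal (poisson_kernel z t / (2*pi)))"

lemma sets_pmeasure [measurable_cong]: "sets (pmeasure z) = sets borel"
  and space_pmeasure [simp]: "space (pmeasure z) = UNIV"
  by (auto simp: pmeasure_def sets_circ)

lemma nn_integral_pmeasure:
  assumes [measurable]: "g \<in> borel_measurable borel"
  shows "(\<integral>\<^sup>+t. g t \<partial>pmeasure z) = (\<integral>\<^sup>+t. ennreal (poisson_kernel z t / (2*pi)) * g t \<partial>circ)"
  unfolding pmeasure_def by (rule nn_integral_density) auto

lemma integral_pmeasure:
  fixes g :: "real \<Rightarrow> 'a :: {banach, second_countable_topology}"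
  assumes "g \<in> borel_measurable borel" "cmod z < 1"
  shows "integral\<^sup>L (pmeasure z) g = integral\<^sup>L circ (\<lambda>t. (poisson_kernel z t / (2*pi)) *\<^sub>R g t)"
  unfolding pmeasure_def using assms poisson_kernel_nonneg[of z]
  by (intro integral_density) auto

lemma integrable_pmeasure:
  fixes g :: "real \<Rightarrow> 'a :: {banach, second_countable_topology}"
  assumes g: "integrable circ g" and z: "cmod z < 1"
  shows "integrable (pmeasure z) g"
proof -
  have gm [measurable]: "g \<in> borel_measurable borel" using borel_measurable_integrable[OF g] by simp
  have "integrable circ (\<lambda>t. (poisson_kernel z t / (2*pi)) *\<^sub>R g t)"
  proof (rule Bochner_Integration.integrable_bound)
    show "integrable circ (\<lambda>t. (2 / (1 - cmod z)\<^sup>2 / (2*pi)) *\<^sub>R g t)" using g by simp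
    show "AE t in circ. norm ((poisson_kernel z t / (2*pi)) *\<^sub>R g t) \<le> norm ((2 / (1 - cmod z)\<^sup>2 / (2*pi)) *\<^sub>R g t)"
    proof (rule AE_I2)
      fix t
      have "poisson_kernel z t / (2*pi) \<le> 2 / (1 - cmod z)\<^sup>2 / (2*pi)"
        by (intro divide_right_mono poisson_kernel_le z) auto
      then have "\<bar>poisson_kernel z t / (2*pi)\<bar> \<le> \<bar>2 / (1 - cmod z)\<^sup>2 / (2*pi)\<bar>"
        using poisson_kernel_nonneg[OF z, of t] by (simp add: abs_of_nonneg)
      then show "norm ((poisson_kernel z t / (2*pi)) *\<^sub>R g t) \<le> norm ((2 / (1 - cmod z)\<^sup>2 / (2*pi)) *\<^sub>R g t)"
        unfolding norm_scaleR by (intro mult_right_mono) auto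
    qed
  qed measurable
  then show ?thesis
    unfolding pmeasure_def using poisson_kernel_nonneg[OF z]
    by (subst integrable_density) auto
qed

lemma emeasure_pmeasure: "cmod z < 1 \<Longrightarrow> emeasure (pmeasure z) UNIV = 1"
proof -
  assume z: "cmod z < 1"
  have "emeasure (pmeasure z) UNIV = (\<integral>\<^sup>+t. 1 \<partial>pmeasure z)" by (simp add: nn_integral_const)
  also have "\<dots> = (\<integral>\<^sup>+t. ennreal (1 / (2*pi)) * ennreal (poisson_kernel z t) \<partial>circ)"
    unfolding nn_integral_pmeasure[OF borel_measurable_const]
    using poisson_kernel_nonneg[OF z] by (intro nn_integral_cong) (simp add: ennreal_mult[symmetric])
  also have "\<dots> = ennreal (1 / (2*pi)) * ennreal (2*pi)"
    by (subst nn_integral_cmult) (auto simp: integral_poisson_kernel[OF z])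
  also have "\<dots> = 1" by (subst ennreal_mult[symmetric]) auto
  finally show ?thesis .
qed

lemma nn_integral_square_le:
  assumes [measurable]: "g \<in> borel_measurable M" and M: "emeasure M (space M) = 1"
  shows "(\<integral>\<^sup>+x. g x \<partial>M)\<^sup>2 \<le> (\<integral>\<^sup>+x. (g x)\<^sup>2 \<partial>M)"
  using Cauchy_Schwarz_nn_integral[of g M "\<lambda>_. 1"] M by (simp add: nn_integral_const)

lemma norm_minus_integral_le:
  fixes G :: "real \<Rightarrow> 'a :: {banach, second_countable_topology}"
  assumes M: "emeasure M (space M) = 1" and G: "integrable M G"
  shows "ennreal (norm (x - integral\<^sup>L M G)) \<le> (\<integral>\<^sup>+v. ennreal (norm (x - G v)) \<partial>M)"
proof -
  interpret finite_measure M by (rule finite_measureI) (simp add: M)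
  have "integral\<^sup>L M (\<lambda>v. x - G v) = x - integral\<^sup>L M G"
    using G M by (simp add: measure_def)
  then have "norm (x - integral\<^sup>L M G) \<le> (\<integral>v. norm (x - G v) \<partial>M)"
    by (metis integral_norm_bound)
  also have "ennreal (\<integral>v. norm (x - G v) \<partial>M) = (\<integral>\<^sup>+v. ennreal (norm (x - G v)) \<partial>M)"
    using G by (intro nn_integral_eq_integral[symmetric]) auto
  finally show ?thesis using ennreal_leI by (metis)
qed

text \<open>The mean is replaced by a second independent copy of the variable, and the square is
  moved inside both integrals by Cauchy-Schwarz.\<close>

lemma oscillation_square_le:
  fixes G :: "real \<Rightarrow> 'a :: {banach, second_countable_topology}"
  assumes M: "emeasure M (space M) = 1" and G: "integrable M G"
  shows "(\<integral>\<^sup>+u. ennreal (norm (G u - integral\<^sup>L M G)) \<partial>M)\<^sup>2 \<le> (\<integral>\<^sup>+u. \<integral>\<^sup>+v. ennreal ((norm (G u - G v))\<^sup>2) \<partial>M \<partial>M)"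
proof -
  interpret finite_measure M by (rule finite_measureI) (simp add: M)
  have [measurable]: "G \<in> borel_measurable M" using G by simp
  have "(\<integral>\<^sup>+u. ennreal (norm (G u - integral\<^sup>L M G)) \<partial>M)\<^sup>2 \<le> (\<integral>\<^sup>+u. (ennreal (norm (G u - integral\<^sup>L M G)))\<^sup>2 \<partial>M)"
    by (rule nn_integral_square_le[OF _ M]) measurable
  also have "\<dots> \<le> (\<integral>\<^sup>+u. (\<integral>\<^sup>+v. ennreal (norm (G u - G v)) \<partial>M)\<^sup>2 \<partial>M)"
    by (intro nn_integral_mono power_mono norm_minus_integral_le M G) auto
  also have "\<dots> \<le> (\<integral>\<^sup>+u. \<integral>\<^sup>+v. (ennreal (norm (G u - G v)))\<^sup>2 \<partial>M \<partial>M)"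
    by (intro nn_integral_mono nn_integral_square_le M) measurable
  finally show ?thesis by (simp add: ennreal_power)
qed

text \<open>From |g| <= eta + |g|^2 / eta. It turns L^2 convergence into L^1 convergence without
  square roots of extended reals.\<close>

lemma nn_integral_norm_le_square:
  fixes g :: "real \<Rightarrow> complex"
  assumes [measurable]: "g \<in> borel_measurable borel" and \<eta>: "\<eta> > 0"
  shows "(\<integral>\<^sup>+t. ennreal (cmod (g t)) \<partial>circ) \<le> ennreal (2*pi*\<eta>) + ennreal (1/\<eta>) * (\<integral>\<^sup>+t. ennreal ((cmod (g t))\<^sup>2) \<partial>circ)"
proof -
  have "(\<integral>\<^sup>+t. ennreal (cmod (g t)) \<partial>circ) \<le> (\<integral>\<^sup>+t. (ennreal \<eta> + ennreal (1/\<eta>) * ennreal ((cmod (g t))\<^sup>2)) \<partial>circ)"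
  proof (rule nn_integral_mono)
    fix t
    have "cmod (g t) \<le> \<eta> + 1/\<eta> * (cmod (g t))\<^sup>2"
    proof (cases "cmod (g t) \<le> \<eta>")
      case True
      then show ?thesis using \<eta> by (simp add: add_increasing2)
    next
      case False
      then have "cmod (g t) * \<eta> \<le> cmod (g t) * cmod (g t)" by (intro mult_left_mono) auto
      then have "cmod (g t) \<le> 1/\<eta> * (cmod (g t))\<^sup>2" using \<eta> by (simp add: field_simps power2_eq_square)
      then show ?thesis using \<eta> by simp
    qed
    then have "ennreal (cmod (g t)) \<le> ennreal (\<eta> + 1/\<eta> * (cmod (g t))\<^sup>2)" by (rule ennreal_leI)
    then show "ennreal (cmod (g t)) \<le> ennreal \<eta> + ennreal (1/\<eta>) * ennreal ((cmod (g t))\<^sup>2)"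
      using \<eta> by (simp add: ennreal_mult[symmetric])
  qed
  also have "\<dots> = (\<integral>\<^sup>+t. ennreal \<eta> \<partial>circ) + (\<integral>\<^sup>+t. ennreal (1/\<eta>) * ennreal ((cmod (g t))\<^sup>2) \<partial>circ)"
    by (rule nn_integral_add) measurable
  also have "\<dots> = ennreal (2*pi*\<eta>) + ennreal (1/\<eta>) * (\<integral>\<^sup>+t. ennreal ((cmod (g t))\<^sup>2) \<partial>circ)"
    using \<eta> by (subst nn_integral_cmult)
      (auto simp: nn_integral_const emeasure_circ ennreal_mult[symmetric] mult.commute)
  finally show ?thesis .
qed

lemma integrable_circ_square:
  fixes g :: "real \<Rightarrow> complex"
  assumes [measurable]: "g \<in> borel_measurable borel" and fin: "(\<integral>\<^sup>+t. ennreal ((cmod (g t))\<^sup>2) \<partial>circ) < \<infinity>"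
  shows "integrable circ g"
proof -
  have "(\<integral>\<^sup>+t. ennreal (cmod (g t)) \<partial>circ) \<le> ennreal (2*pi*1) + ennreal (1/1) * (\<integral>\<^sup>+t. ennreal ((cmod (g t))\<^sup>2) \<partial>circ)"
    by (rule nn_integral_norm_le_square) auto
  also have "\<dots> < \<infinity>" using fin by simp
  finally show ?thesis by (auto simp: integrable_iff_bounded)
qed

section \<open>The boundary function of an H^2 function\<close>

locale hardy_function =
  fixes f :: "complex \<Rightarrow> complex"
  assumes hardy2: "hardy2 f"
begin

definition coeff :: "nat \<Rightarrow> complex" where "coeff n = (deriv ^^ n) f 0 / fact n"
definition F :: "real \<Rightarrow> complex" where "F t = bdry_fun f (cis t)"
definition fr :: "nat \<Rightarrow> real \<Rightarrow> complex" where "fr k t = f (of_real (radius_seq k) * cis t)"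

lemma hol: "f holomorphic_on ball 0 1" using hardy2 by (simp add: hardy2_def)
lemma cont: "continuous_on (ball 0 1) f" by (rule holomorphic_on_imp_continuous_on[OF hol])
lemma summable_coeff: "summable (\<lambda>n. (cmod (coeff n))\<^sup>2)"
  unfolding coeff_def by (rule hardy2_summable[OF hardy2])
lemma sums_coeff: "cmod z < 1 \<Longrightarrow> (\<lambda>n. coeff n * z ^ n) sums f z"
  using holomorphic_power_series[OF hol, of z] by (simp add: coeff_def)

lemma borel_F [measurable]: "F \<in> borel_measurable borel"
  unfolding F_def[abs_def] by (rule borel_measurable_bdry_fun[OF cont])

lemma borel_fr [measurable]: "fr k \<in> borel_measurable borel"
  unfolding fr_def[abs_def] using radius_seq[of k] by (intro borel_measurable_circle_dilate cont) auto

lemma AE_nt_limit: "AE t in circ. nt_limit f (cis t) (F t)"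
proof -
  have "AE t::real in lborel. t \<notin> {0, 2*pi}"
    by (rule AE_not_in) (intro finite_imp_null_set_lborel, simp)
  moreover have "AE t in lborel. t \<in> {0<..<2*pi} \<longrightarrow> (\<exists>L. nt_limit f (cis t) L)"
    by (rule fatou_nontangential[OF hol _ summable_coeff]) (rule sums_coeff)
  ultimately have "AE t in lborel. t \<in> {0..2*pi} \<longrightarrow> nt_limit f (cis t) (F t)"
  proof eventually_elim
    case (elim t)
    show ?case
    proof
      assume "t \<in> {0..2*pi}"
      then have "t \<in> {0<..<2*pi}" using elim(1) by auto
      then obtain L where "nt_limit f (cis t) L" using elim(2) by auto
      then show "nt_limit f (cis t) (F t)" using bdry_fun_eq[of f "cis t" L] by (simp add: F_def)
    qed
  qed
  then show ?thesis by (simp add: AE_circ)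
qed

lemma AE_fr_LIMSEQ: "AE t in circ. (\<lambda>k. fr k t) \<longlonglongrightarrow> F t"
  using AE_nt_limit by eventually_elim (simp add: fr_def nt_limit_radial)

text \<open>Fatou's lemma along the radii, with Parseval bounding every dilate by the square sum of
  the coefficients.\<close>

lemma F_square_integrable: "(\<integral>\<^sup>+t. ennreal ((cmod (F t))\<^sup>2) \<partial>circ) < \<infinity>"
proof -
  have "(\<integral>\<^sup>+t. ennreal ((cmod (F t))\<^sup>2) \<partial>circ) = (\<integral>\<^sup>+t. liminf (\<lambda>k. ennreal ((cmod (fr k t))\<^sup>2)) \<partial>circ)"
  proof (rule nn_integral_cong_AE)
    show "AE t in circ. ennreal ((cmod (F t))\<^sup>2) = liminf (\<lambda>k. ennreal ((cmod (fr k t))\<^sup>2))"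
      using AE_fr_LIMSEQ
    proof eventually_elim
      case (elim t)
      have "(\<lambda>k. ennreal ((cmod (fr k t))\<^sup>2)) \<longlonglongrightarrow> ennreal ((cmod (F t))\<^sup>2)"
        by (intro tendsto_ennrealI tendsto_intros elim)
      then show ?case using lim_imp_Liminf by (metis trivial_limit_sequentially)
    qed
  qed
  also have "\<dots> \<le> liminf (\<lambda>k. \<integral>\<^sup>+t. ennreal ((cmod (fr k t))\<^sup>2) \<partial>circ)"
    by (rule nn_integral_liminf) measurable
  also have "\<dots> \<le> ennreal (\<Sum>n. 2*pi*(cmod (coeff n))\<^sup>2)"
  proof (rule Liminf_le)
    show "\<forall>\<^sub>F k in sequentially. (\<integral>\<^sup>+t. ennreal ((cmod (fr k t))\<^sup>2) \<partial>circ) \<le> ennreal (\<Sum>n. 2*pi*(cmod (coeff n))\<^sup>2)"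
    proof (rule always_eventually, rule allI)
      fix k
      have "(\<integral>\<^sup>+t. ennreal ((cmod (fr k t))\<^sup>2) \<partial>circ) = (\<Sum>n. ennreal (2*pi*(cmod (coeff n))\<^sup>2 * radius_seq k ^ (2*n)))"
      proof -
        have "(\<lambda>t. ennreal ((cmod (fr k t))\<^sup>2)) \<in> borel_measurable borel" by measurable
        then show ?thesis
          using radius_seq[of k] unfolding fr_def
          by (simp only: nn_integral_circ, intro nn_integral_circle_power_series[of _ f "radius_seq k", OF sums_coeff]) simp_all
      qed
      also have "\<dots> \<le> (\<Sum>n. ennreal (2*pi*(cmod (coeff n))\<^sup>2))"
      proof (intro suminf_le summableI ennreal_leI)
        fix n
        have "radius_seq k ^ (2*n) \<le> 1" using radius_seq[of k] by (intro power_le_one) auto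
        then show "2*pi*(cmod (coeff n))\<^sup>2 * radius_seq k ^ (2*n) \<le> 2*pi*(cmod (coeff n))\<^sup>2"
          using mult_left_mono[of "radius_seq k ^ (2*n)" 1 "2*pi*(cmod (coeff n))\<^sup>2"] by simp
      qed
      also have "\<dots> = ennreal (\<Sum>n. 2*pi*(cmod (coeff n))\<^sup>2)"
        by (intro suminf_ennreal2 summable_mult summable_coeff) auto
      finally show "(\<integral>\<^sup>+t. ennreal ((cmod (fr k t))\<^sup>2) \<partial>circ) \<le> ennreal (\<Sum>n. 2*pi*(cmod (coeff n))\<^sup>2)" .
    qed
  qed simp
  finally show ?thesis by (simp add: le_less_trans)
qed

lemma integrable_F: "integrable circ F"
  by (rule integrable_circ_square[OF borel_F F_square_integrable])

text \<open>Fatou's lemma for h z = f (r z) - f z, whose coefficients are those of f times r^n - 1.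
  The auxiliary radius \<open>radius_seq l\<close> tends to 1 while r stays fixed.\<close>

lemma fr_L2_bound:
  "(\<integral>\<^sup>+t. ennreal ((cmod (fr k t - F t))\<^sup>2) \<partial>circ) \<le> ennreal (\<Sum>n. 2*pi*(cmod (coeff n))\<^sup>2 * (1 - radius_seq k ^ n)\<^sup>2)"
proof -
  let ?r = "radius_seq k"
  define h where "h z = f (of_real ?r * z) - f z" for z
  have rn: "0 \<le> ?r ^ n" "?r ^ n \<le> 1" for n using radius_seq[of k] by (auto intro: power_le_one)
  have hs: "(\<lambda>n. (coeff n * (of_real (?r ^ n) - 1)) * z ^ n) sums h z" if z: "cmod z < 1" for z
  proof -
    have "?r * cmod z \<le> 1 * cmod z" using radius_seq[of k] by (intro mult_right_mono) auto
    then have "cmod (of_real ?r * z) < 1" using radius_seq[of k] z by (simp add: norm_mult)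
    from sums_diff[OF sums_coeff[OF this] sums_coeff[OF z]] show ?thesis
      by (simp add: h_def algebra_simps)
  qed
  define d where "d l t = fr l t" for l t
  have sm: "summable (\<lambda>n. 2*pi*(cmod (coeff n))\<^sup>2 * (1 - ?r ^ n)\<^sup>2)"
  proof (rule summable_comparison_test')
    show "summable (\<lambda>n. 2*pi*(cmod (coeff n))\<^sup>2)" by (intro summable_mult summable_coeff)
    show "norm (2*pi*(cmod (coeff n))\<^sup>2 * (1 - ?r ^ n)\<^sup>2) \<le> 2*pi*(cmod (coeff n))\<^sup>2" if "0 \<le> n" for n
    proof -
      have "(1 - ?r ^ n)\<^sup>2 \<le> 1" using rn[of n] by (intro power_le_one) auto
      then show ?thesis using mult_left_mono[of "(1 - ?r ^ n)\<^sup>2" 1 "2*pi*(cmod (coeff n))\<^sup>2"] by simp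
    qed
  qed
  have hm: "(\<lambda>t. h (of_real (radius_seq l) * cis t)) \<in> borel_measurable borel" for l
  proof -
    have "continuous_on (ball 0 1) h" unfolding h_def[abs_def]
      using dilate_properties(2)[OF hol, of ?r] radius_seq[of k]
      by (intro continuous_intros cont) (auto dest: holomorphic_on_imp_continuous_on)
    then show ?thesis using radius_seq[of l] by (intro borel_measurable_circle_dilate) auto
  qed
  have "(\<integral>\<^sup>+t. ennreal ((cmod (fr k t - F t))\<^sup>2) \<partial>circ)
     = (\<integral>\<^sup>+t. liminf (\<lambda>l. ennreal ((cmod (h (of_real (radius_seq l) * cis t)))\<^sup>2)) \<partial>circ)"
  proof (rule nn_integral_cong_AE)
    show "AE t in circ. ennreal ((cmod (fr k t - F t))\<^sup>2) = liminf (\<lambda>l. ennreal ((cmod (h (of_real (radius_seq l) * cis t)))\<^sup>2))"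
      using AE_fr_LIMSEQ
    proof eventually_elim
      case (elim t)
      have "isCont f (of_real ?r * cis t)"
        using radius_seq[of k] continuous_on_interior[OF cont, of "of_real ?r * cis t"] by (simp add: norm_mult)
      moreover have "(\<lambda>l. of_real ?r * (of_real (radius_seq l) * cis t)) \<longlonglongrightarrow> of_real ?r * cis t"
        by (intro tendsto_intros radial_seq_LIMSEQ)
      ultimately have "(\<lambda>l. f (of_real ?r * (of_real (radius_seq l) * cis t))) \<longlonglongrightarrow> fr k t"
        unfolding fr_def by (rule isCont_tendsto_compose)
      then have "(\<lambda>l. h (of_real (radius_seq l) * cis t)) \<longlonglongrightarrow> fr k t - F t"
        unfolding h_def using elim by (intro tendsto_diff) (auto simp: fr_def)
      then have "(\<lambda>l. ennreal ((cmod (h (of_real (radius_seq l) * cis t)))\<^sup>2)) \<longlonglongrightarrow> ennreal ((cmod (fr k t - F t))\<^sup>2)"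
        by (intro tendsto_ennrealI tendsto_intros)
      then show ?case using lim_imp_Liminf by (metis trivial_limit_sequentially)
    qed
  qed
  also have "\<dots> \<le> liminf (\<lambda>l. \<integral>\<^sup>+t. ennreal ((cmod (h (of_real (radius_seq l) * cis t)))\<^sup>2) \<partial>circ)"
    using hm by (intro nn_integral_liminf) measurable
  also have "\<dots> \<le> ennreal (\<Sum>n. 2*pi*(cmod (coeff n))\<^sup>2 * (1 - ?r ^ n)\<^sup>2)"
  proof (rule Liminf_le)
    show "\<forall>\<^sub>F l in sequentially. (\<integral>\<^sup>+t. ennreal ((cmod (h (of_real (radius_seq l) * cis t)))\<^sup>2) \<partial>circ)
        \<le> ennreal (\<Sum>n. 2*pi*(cmod (coeff n))\<^sup>2 * (1 - ?r ^ n)\<^sup>2)"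
    proof (rule always_eventually, rule allI)
      fix l
      have "(\<integral>\<^sup>+t. ennreal ((cmod (h (of_real (radius_seq l) * cis t)))\<^sup>2) \<partial>circ)
         = (\<Sum>n. ennreal (2*pi*(cmod (coeff n * (of_real (?r ^ n) - 1)))\<^sup>2 * radius_seq l ^ (2*n)))"
      proof -
        have "(\<lambda>t. ennreal ((cmod (h (of_real (radius_seq l) * cis t)))\<^sup>2)) \<in> borel_measurable borel"
          using hm[of l] by measurable
        then show ?thesis
          using radius_seq[of l]
          by (simp only: nn_integral_circ, intro nn_integral_circle_power_series[of _ h "radius_seq l", OF hs]) simp_all
      qed
      also have "\<dots> \<le> (\<Sum>n. ennreal (2*pi*(cmod (coeff n))\<^sup>2 * (1 - ?r ^ n)\<^sup>2))"
      proof (intro suminf_le summableI ennreal_leI)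
        fix n
        have e: "(cmod (coeff n * (of_real (?r ^ n) - 1)))\<^sup>2 = (cmod (coeff n))\<^sup>2 * (1 - ?r ^ n)\<^sup>2"
        proof -
          have "complex_of_real (?r ^ n) - 1 = of_real (?r ^ n - 1)" by simp
          then have "cmod (of_real (?r ^ n) - 1) = \<bar>?r ^ n - 1\<bar>" by (metis norm_of_real)
          then show ?thesis by (simp add: norm_mult power_mult_distrib power2_commute)
        qed
        have "radius_seq l ^ (2*n) \<le> 1" using radius_seq[of l] by (intro power_le_one) auto
        then show "2*pi*(cmod (coeff n * (of_real (?r ^ n) - 1)))\<^sup>2 * radius_seq l ^ (2*n) \<le> 2*pi*(cmod (coeff n))\<^sup>2 * (1 - ?r ^ n)\<^sup>2"
          unfolding e using mult_left_mono[of "radius_seq l ^ (2*n)" 1 "2*pi*((cmod (coeff n))\<^sup>2 * (1 - ?r ^ n)\<^sup>2)"]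
          by (simp add: mult.assoc)
      qed
      also have "\<dots> = ennreal (\<Sum>n. 2*pi*(cmod (coeff n))\<^sup>2 * (1 - ?r ^ n)\<^sup>2)"
        by (intro suminf_ennreal2 sm) auto
      finally show "(\<integral>\<^sup>+t. ennreal ((cmod (h (of_real (radius_seq l) * cis t)))\<^sup>2) \<partial>circ)
        \<le> ennreal (\<Sum>n. 2*pi*(cmod (coeff n))\<^sup>2 * (1 - ?r ^ n)\<^sup>2)" .
    qed
  qed simp
  finally show ?thesis .
qed

lemma fr_L2_LIMSEQ: "(\<lambda>k. \<integral>\<^sup>+t. ennreal ((cmod (fr k t - F t))\<^sup>2) \<partial>circ) \<longlonglongrightarrow> 0"
proof (rule tendsto_sandwich[OF _ _ tendsto_const])
  have "((\<lambda>k. \<Sum>n. 2*pi*(cmod (coeff n))\<^sup>2 * (1 - radius_seq k ^ n)\<^sup>2) \<longlongrightarrow> (\<Sum>n. 2*pi*(cmod (coeff n))\<^sup>2 * (1 - 1 ^ n)\<^sup>2)) sequentially"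
  \<comment> \<open>Dominated convergence for series: every term tends to 0, and the square-summable
    coefficients supply the majorant.\<close>
  proof (rule conjunct2[OF conjunct2[OF tannerys_theorem[where M = "\<lambda>n. 2*pi*(cmod (coeff n))\<^sup>2"]]])
    show "(\<lambda>k. 2*pi*(cmod (coeff n))\<^sup>2 * (1 - radius_seq k ^ n)\<^sup>2) \<longlonglongrightarrow> 2*pi*(cmod (coeff n))\<^sup>2 * (1 - 1 ^ n)\<^sup>2" for n
      by (intro tendsto_intros radius_seq_LIMSEQ)
    show "\<forall>\<^sub>F (n, k) in sequentially \<times>\<^sub>F sequentially. norm (2*pi*(cmod (coeff n))\<^sup>2 * (1 - radius_seq k ^ n)\<^sup>2) \<le> 2*pi*(cmod (coeff n))\<^sup>2"
    proof (rule always_eventually, clarify)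
      fix n k
      have "0 \<le> radius_seq k ^ n" "radius_seq k ^ n \<le> 1" using radius_seq[of k] by (auto intro: power_le_one)
      then have "(1 - radius_seq k ^ n)\<^sup>2 \<le> 1" by (intro power_le_one) auto
      then show "norm (2*pi*(cmod (coeff n))\<^sup>2 * (1 - radius_seq k ^ n)\<^sup>2) \<le> 2*pi*(cmod (coeff n))\<^sup>2"
        using mult_left_mono[of "(1 - radius_seq k ^ n)\<^sup>2" 1 "2*pi*(cmod (coeff n))\<^sup>2"] by simp
    qed
    show "summable (\<lambda>n. 2*pi*(cmod (coeff n))\<^sup>2)" by (intro summable_mult summable_coeff)
  qed simp
  then have "(\<lambda>k. ennreal (\<Sum>n. 2*pi*(cmod (coeff n))\<^sup>2 * (1 - radius_seq k ^ n)\<^sup>2)) \<longlonglongrightarrow> ennreal 0"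
    by (intro tendsto_ennrealI) simp
  then show "(\<lambda>k. ennreal (\<Sum>n. 2*pi*(cmod (coeff n))\<^sup>2 * (1 - radius_seq k ^ n)\<^sup>2)) \<longlonglongrightarrow> 0" by simp
qed (auto intro!: always_eventually fr_L2_bound)

lemma fr_L1_LIMSEQ: "(\<lambda>k. \<integral>\<^sup>+t. ennreal (cmod (fr k t - F t)) \<partial>circ) \<longlonglongrightarrow> 0"
proof (rule order_tendstoI)
  fix e :: ennreal assume "0 < e"
  obtain \<eta> where \<eta>: "\<eta> > 0" "ennreal (2*pi*\<eta>) < e"
  proof (cases e)
    case (real r)
    then have "r > 0" using \<open>0 < e\<close> by (simp add: ennreal_less_zero_iff)
    then show ?thesis using that[of "r / (4*pi)"] real by (simp add: ennreal_lessI)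
  next
    case top
    then show ?thesis using that[of 1] by simp
  qed
  have "(\<lambda>k. ennreal (2*pi*\<eta>) + ennreal (1/\<eta>) * (\<integral>\<^sup>+t. ennreal ((cmod (fr k t - F t))\<^sup>2) \<partial>circ)) \<longlonglongrightarrow> ennreal (2*pi*\<eta>) + ennreal (1/\<eta>) * 0"
    by (intro tendsto_add tendsto_const ennreal_tendsto_cmult fr_L2_LIMSEQ) simp
  then have "\<forall>\<^sub>F k in sequentially. ennreal (2*pi*\<eta>) + ennreal (1/\<eta>) * (\<integral>\<^sup>+t. ennreal ((cmod (fr k t - F t))\<^sup>2) \<partial>circ) < e"
    by (rule order_tendstoD(2)) (use \<eta> in simp)
  then show "\<forall>\<^sub>F k in sequentially. (\<integral>\<^sup>+t. ennreal (cmod (fr k t - F t)) \<partial>circ) < e"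
    by eventually_elim (rule le_less_trans[OF nn_integral_norm_le_square[OF _ \<eta>(1)]], measurable)
qed auto

text \<open>T will be the identity or conjugation, so that both Cauchy-type formulas are covered at
  once. The test function q is bounded, hence L^1 convergence of the dilates is enough.\<close>

lemma fr_integral_LIMSEQ:
  fixes q :: "real \<Rightarrow> complex"
  assumes T: "bounded_linear T" and [measurable]: "q \<in> borel_measurable borel" and B: "\<And>t. cmod (q t) \<le> B"
  shows "(\<lambda>k. \<integral>t. T (fr k t) * q t \<partial>circ) \<longlonglongrightarrow> (\<integral>t. T (F t) * q t \<partial>circ)"
    and "integrable circ (\<lambda>t. T (F t) * q t)"
proof -
  interpret T: bounded_linear T by (rule T)
  have Tm [measurable]: "T \<in> borel_measurable borel"
    by (intro borel_measurable_continuous_onI linear_continuous_on T)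
  have B0: "0 \<le> B" using B[of 0] norm_ge_zero order_trans by blast
  obtain C where C: "\<And>x. norm (T x) \<le> C * norm x" "0 < C" using T.pos_bounded by (metis mult.commute)
  have intq: "integrable circ (\<lambda>t. T (G t) * q t)" if G: "integrable circ G" for G :: "real \<Rightarrow> complex"
  proof (rule Bochner_Integration.integrable_bound)
    have [measurable]: "G \<in> borel_measurable borel" using borel_measurable_integrable[OF G] by simp
    show "integrable circ (\<lambda>t. (C * B) *\<^sub>R G t)" using G by simp
    show "(\<lambda>t. T (G t) * q t) \<in> borel_measurable circ" by measurable
    show "AE t in circ. norm (T (G t) * q t) \<le> norm ((C * B) *\<^sub>R G t)"
    proof (rule AE_I2)
      fix t
      have "norm (T (G t)) * cmod (q t) \<le> (C * norm (G t)) * B"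
        by (intro mult_mono C B mult_nonneg_nonneg) (use C in auto)
      then show "norm (T (G t) * q t) \<le> norm ((C * B) *\<^sub>R G t)"
        using C B0 by (simp add: norm_mult mult_ac)
    qed
  qed
  show "integrable circ (\<lambda>t. T (F t) * q t)" by (rule intq[OF integrable_F])
  have fri: "integrable circ (fr k)" for k
  proof -
    have "continuous_on (cball 0 1) (\<lambda>u. f (of_real (radius_seq k) * u))"
      using radius_seq[of k] by (intro dilate_properties(1)[OF hol]) auto
    then have "bounded ((\<lambda>u. f (of_real (radius_seq k) * u)) ` cball 0 1)"
      by (intro compact_imp_bounded compact_continuous_image) auto
    then obtain b where "\<forall>w\<in>(\<lambda>u. f (of_real (radius_seq k) * u)) ` cball 0 1. cmod w \<le> b"
      unfolding bounded_iff by blast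
    then show ?thesis by (intro integrable_circ_bounded[of _ b]) (auto simp: fr_def)
  qed
  show "(\<lambda>k. \<integral>t. T (fr k t) * q t \<partial>circ) \<longlonglongrightarrow> (\<integral>t. T (F t) * q t \<partial>circ)"
  proof (rule tendsto_L1_int)
    have "(\<lambda>k. ennreal (C * B) * (\<integral>\<^sup>+t. ennreal (cmod (fr k t - F t)) \<partial>circ)) \<longlonglongrightarrow> ennreal (C * B) * 0"
      by (intro ennreal_tendsto_cmult fr_L1_LIMSEQ) simp
    then have l: "(\<lambda>k. ennreal (C * B) * (\<integral>\<^sup>+t. ennreal (cmod (fr k t - F t)) \<partial>circ)) \<longlonglongrightarrow> 0" by simp
    show "(\<lambda>k. \<integral>\<^sup>+t. ennreal (norm (T (fr k t) * q t - T (F t) * q t)) \<partial>circ) \<longlonglongrightarrow> 0"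
    proof (rule tendsto_sandwich[OF _ _ tendsto_const l])
      show "\<forall>\<^sub>F k in sequentially. (\<integral>\<^sup>+t. ennreal (norm (T (fr k t) * q t - T (F t) * q t)) \<partial>circ)
          \<le> ennreal (C * B) * (\<integral>\<^sup>+t. ennreal (cmod (fr k t - F t)) \<partial>circ)"
      proof (rule always_eventually, rule allI)
        fix k
        have "(\<integral>\<^sup>+t. ennreal (norm (T (fr k t) * q t - T (F t) * q t)) \<partial>circ) \<le> (\<integral>\<^sup>+t. ennreal (C * B) * ennreal (cmod (fr k t - F t)) \<partial>circ)"
        proof (rule nn_integral_mono)
          fix t
          have "norm (T (fr k t - F t)) * cmod (q t) \<le> (C * norm (fr k t - F t)) * B"
            by (intro mult_mono C B mult_nonneg_nonneg) (use C in auto)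
          then have "norm (T (fr k t) * q t - T (F t) * q t) \<le> (C * B) * cmod (fr k t - F t)"
          proof -
            have "T (fr k t) * q t - T (F t) * q t = T (fr k t - F t) * q t" by (simp add: T.diff algebra_simps)
            then show ?thesis using \<open>norm (T (fr k t - F t)) * cmod (q t) \<le> _\<close> by (simp add: norm_mult mult_ac)
          qed
          then have "ennreal (norm (T (fr k t) * q t - T (F t) * q t)) \<le> ennreal ((C * B) * cmod (fr k t - F t))"
            by (rule ennreal_leI)
          also have "\<dots> = ennreal (C * B) * ennreal (cmod (fr k t - F t))"
            using C B0 by (intro ennreal_mult) auto
          finally show "ennreal (norm (T (fr k t) * q t - T (F t) * q t)) \<le> ennreal (C * B) * ennreal (cmod (fr k t - F t))" .
        qed
        also have "\<dots> = ennreal (C * B) * (\<integral>\<^sup>+t. ennreal (cmod (fr k t - F t)) \<partial>circ)"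
          by (rule nn_integral_cmult) measurable
        finally show "(\<integral>\<^sup>+t. ennreal (norm (T (fr k t) * q t - T (F t) * q t)) \<partial>circ) \<le> \<dots>" .
      qed
    qed simp
  qed (auto intro!: intq fri integrable_F)
qed

text \<open>Each dilate satisfies the formula because it is continuous on the closed disk; both
  sides then converge.\<close>

lemma poisson_F:
  assumes z: "cmod z < 1"
  shows "(\<integral>t. F t * of_real (poisson_kernel z t) \<partial>circ) = 2 * pi * f z"
proof -
  have A: "(\<lambda>k. \<integral>t. fr k t * of_real (poisson_kernel z t) \<partial>circ) \<longlonglongrightarrow> (\<integral>t. F t * of_real (poisson_kernel z t) \<partial>circ)"
    by (rule fr_integral_LIMSEQ(1)[OF bounded_linear_ident, of _ "2 / (1 - cmod z)\<^sup>2"])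
       (use poisson_kernel_le[OF z] poisson_kernel_nonneg[OF z] in auto)
  have B: "(\<integral>t. fr k t * of_real (poisson_kernel z t) \<partial>circ) = 2 * pi * f (of_real (radius_seq k) * z)" for k
  proof (rule circ_integral_continuous)
    have r: "0 \<le> radius_seq k" "radius_seq k < 1" using radius_seq[of k] by auto
    show "((\<lambda>t. fr k t * of_real (poisson_kernel z t)) has_integral (2 * pi * f (of_real (radius_seq k) * z))) {0..2*pi}"
      unfolding fr_def using circle_poisson_integral[OF dilate_properties(1,2)[OF hol r] z] .
    show "continuous_on {0..2*pi} (\<lambda>t. fr k t * of_real (poisson_kernel z t))"
      unfolding fr_def
      by (intro continuous_intros continuous_poisson_kernel z continuous_on_compose2[OF dilate_properties(1)[OF hol r], of _ cis]) auto
  qed measurable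
  have C: "(\<lambda>k. 2 * pi * f (of_real (radius_seq k) * z)) \<longlonglongrightarrow> 2 * pi * f z"
    using z continuous_on_interior[OF cont, of z]
    by (intro tendsto_intros isCont_tendsto_compose[OF _ radial_seq_LIMSEQ]) auto
  show ?thesis by (rule LIMSEQ_unique[OF A[unfolded B] C])
qed

lemma deriv_kernel_bound:
  assumes z: "cmod z < 1"
  shows "cmod (cis t / (cis t - z)\<^sup>2) \<le> 1 / (1 - cmod z)\<^sup>2" "cmod (cis t / (cis t - z)\<^sup>2) = poisson_kernel z t / (1 - (cmod z)\<^sup>2)"
proof -
  have "(1 - cmod z)\<^sup>2 \<le> (cmod (cis t - z))\<^sup>2"
    using z norm_cis_minus_ge[of z t] by (intro power_mono) auto
  then show "cmod (cis t / (cis t - z)\<^sup>2) \<le> 1 / (1 - cmod z)\<^sup>2"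
    unfolding norm_divide norm_power norm_cis using z cis_neq[OF z, of t]
    by (intro divide_left_mono) auto
  have "1 - (cmod z)\<^sup>2 \<noteq> 0" using z by (simp add: power2_eq_1_iff) (smt (verit) norm_ge_zero)
  then show "cmod (cis t / (cis t - z)\<^sup>2) = poisson_kernel z t / (1 - (cmod z)\<^sup>2)"
    by (simp add: poisson_kernel_def norm_divide norm_power)
qed

text \<open>Limits of the two circle identities for dilates. The second one, orthogonality of the
  conjugate, is what allows f' to be recovered from the real part of F alone.\<close>

lemma deriv_F:
  assumes z: "cmod z < 1"
  shows "(\<integral>t. F t * (cis t / (cis t - z)\<^sup>2) \<partial>circ) = 2 * pi * deriv f z"
    and "(\<integral>t. cnj (F t) * (cis t / (cis t - z)\<^sup>2) \<partial>circ) = 0"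
proof -
  let ?q = "\<lambda>t. cis t / (cis t - z)\<^sup>2"
  have qm: "?q \<in> borel_measurable borel" by measurable
  have cq: "continuous_on A ?q" for A
    using cis_neq[OF z] by (intro continuous_intros) auto
  have cfr: "continuous_on A (fr k)" for A k
    unfolding fr_def
    using radius_seq[of k] by (intro continuous_on_compose2[OF dilate_properties(1)[OF hol, of "radius_seq k"], of _ cis] continuous_intros) auto
  have r: "0 \<le> radius_seq k" "radius_seq k < 1" for k using radius_seq[of k] by auto
  have A: "(\<lambda>k. \<integral>t. fr k t * ?q t \<partial>circ) \<longlonglongrightarrow> (\<integral>t. F t * ?q t \<partial>circ)"
    by (rule fr_integral_LIMSEQ(1)[OF bounded_linear_ident qm deriv_kernel_bound(1)[OF z]])
  have B: "(\<integral>t. fr k t * ?q t \<partial>circ) = 2 * pi * (of_real (radius_seq k) * deriv f (of_real (radius_seq k) * z))" for k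
  proof (rule circ_integral_continuous)
    show "((\<lambda>t. fr k t * ?q t) has_integral (2 * pi * (of_real (radius_seq k) * deriv f (of_real (radius_seq k) * z)))) {0..2*pi}"
      unfolding fr_def
      using circle_deriv_integral[OF dilate_properties(1,2)[OF hol r] z] dilate_properties(3)[OF hol r z] by simp
  qed (measurable, intro continuous_on_mult continuous_on_cnj cq cfr)
  have C: "(\<lambda>k. 2 * pi * (of_real (radius_seq k) * deriv f (of_real (radius_seq k) * z))) \<longlonglongrightarrow> 2 * pi * (of_real 1 * deriv f z)"
  proof -
    have "continuous_on (ball 0 1) (deriv f)"
      by (intro holomorphic_on_imp_continuous_on holomorphic_deriv hol) auto
    then show ?thesis using z continuous_on_interior[of "ball 0 1" "deriv f" z]
      by (intro tendsto_intros isCont_tendsto_compose[OF _ radial_seq_LIMSEQ] radius_seq_LIMSEQ) auto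
  qed
  show "(\<integral>t. F t * ?q t \<partial>circ) = 2 * pi * deriv f z"
    using LIMSEQ_unique[OF A[unfolded B] C] by simp
  have "(\<lambda>k. \<integral>t. cnj (fr k t) * ?q t \<partial>circ) \<longlonglongrightarrow> (\<integral>t. cnj (F t) * ?q t \<partial>circ)"
    by (rule fr_integral_LIMSEQ(1)[OF bounded_linear_cnj qm deriv_kernel_bound(1)[OF z]])
  moreover have "(\<integral>t. cnj (fr k t) * ?q t \<partial>circ) = 0" for k
  proof (rule circ_integral_continuous)
    show "((\<lambda>t. cnj (fr k t) * ?q t) has_integral 0) {0..2*pi}"
      unfolding fr_def
      using circle_conj_integral[OF dilate_properties(1,2)[OF hol r] z] by simp
  qed (measurable, intro continuous_on_mult continuous_on_cnj cq cfr)
  ultimately show "(\<integral>t. cnj (F t) * ?q t \<partial>circ) = 0" using LIMSEQ_unique[OF _ tendsto_const] by simp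
qed

lemma integral_pmeasure_F:
  assumes z: "cmod z < 1"
  shows "integral\<^sup>L (pmeasure z) F = f z"
proof -
  have "integral\<^sup>L (pmeasure z) F = (\<integral>t. (1 / of_real (2*pi)) * (F t * of_real (poisson_kernel z t)) \<partial>circ)"
    by (subst integral_pmeasure[OF borel_F z]) (simp add: scaleR_conv_of_real mult_ac)
  also have "\<dots> = f z" by (simp add: poisson_F[OF z])
  finally show ?thesis .
qed

text \<open>The Cauchy formula for \<open>f'\<close> and the orthogonality of \<open>cnj F\<close> to the kernel express
  \<open>f'(z)\<close> through the real part of \<open>F - f z\<close>, rotated so that \<open>f z \<ge> 0\<close>. This real part has
  mean zero, so its positive part, which is at most \<open>\<bar>F\<bar> - \<bar>f z\<bar>\<close>, controls it.\<close>

lemma deriv_le_oscillation: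
  assumes z: "cmod z < 1"
  shows "(1 - (cmod z)\<^sup>2) * cmod (deriv f z) \<le> 4 * (\<integral>t. \<bar>cmod (F t) - cmod (f z)\<bar> \<partial>pmeasure z)"
proof -
  define l where "l = (if f z = 0 then 1 else cnj (sgn (f z)))"
  have ln: "cmod l = 1" by (simp add: l_def norm_sgn)
  have lf: "l * f z = of_real (cmod (f z))"
  proof (cases "f z = 0")
    case False
    have "l * f z = (f z * cnj (f z)) / of_real (cmod (f z))"
      using False by (simp add: l_def sgn_eq)
    also have "f z * cnj (f z) = of_real (cmod (f z)) * of_real (cmod (f z))"
      by (metis complex_norm_square of_real_mult power2_eq_square)
    finally show ?thesis using False by simp
  qed (simp add: l_def)
  define u where "u t = Re (l * F t) - cmod (f z)" for t
  have um [measurable]: "u \<in> borel_measurable borel" unfolding u_def[abs_def] by measurable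
  have ui: "integrable circ u"
    unfolding u_def[abs_def] by (intro Bochner_Integration.integrable_diff integrable_Re integrable_mult_right integrable_F) simp
  let ?q = "\<lambda>t. cis t / (cis t - z)\<^sup>2"
  have qm [measurable]: "?q \<in> borel_measurable borel" by measurable
  have i1: "integrable circ (\<lambda>t. F t * ?q t)" "integrable circ (\<lambda>t. cnj (F t) * ?q t)"
    using fr_integral_LIMSEQ(2)[OF bounded_linear_ident qm deriv_kernel_bound(1)[OF z]]
      fr_integral_LIMSEQ(2)[OF bounded_linear_cnj qm deriv_kernel_bound(1)[OF z]] by auto
  have i2: "integrable circ ?q" by (rule integrable_circ_bounded[OF qm deriv_kernel_bound(1)[OF z]])
  \<comment> \<open>The derivative kernel annihilates constants, so subtracting |f z| does not
    change the integral.\<close>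
  have q0: "(\<integral>t. ?q t \<partial>circ) = 0"
  proof (rule circ_integral_continuous[OF qm])
    show "continuous_on {0..2*pi} ?q" using cis_neq[OF z] by (intro continuous_intros) auto
    show "(?q has_integral 0) {0..2*pi}" using circle_deriv_integral[of "\<lambda>_. 1" z] z by simp
  qed
  have "(\<integral>t. of_real (2 * u t) * ?q t \<partial>circ) = (\<integral>t. l * (F t * ?q t) + cnj l * (cnj (F t) * ?q t) - of_real (2 * cmod (f z)) * ?q t \<partial>circ)"
  proof (rule Bochner_Integration.integral_cong)
    fix t
    have "complex_of_real (2 * u t) = l * F t + cnj (l * F t) - of_real (2 * cmod (f z))"
      by (simp add: u_def complex_add_cnj del: complex_cnj_mult)
    then have E: "complex_of_real (2 * u t) = l * F t + cnj l * cnj (F t) - of_real (2 * cmod (f z))"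
      by simp
    show "of_real (2 * u t) * ?q t = l * (F t * ?q t) + cnj l * (cnj (F t) * ?q t) - of_real (2 * cmod (f z)) * ?q t"
      unfolding E by (simp only: left_diff_distrib distrib_right mult.assoc)
  qed simp
  also have "\<dots> = l * (2 * pi * deriv f z)"
  proof -
    have "(\<integral>t. x * a t + y * b t - w * d t \<partial>circ) = x * (\<integral>t. a t \<partial>circ) + y * (\<integral>t. b t \<partial>circ) - w * (\<integral>t. d t \<partial>circ)"
      if "integrable circ a" "integrable circ b" "integrable circ d"
      for a b d :: "real \<Rightarrow> complex" and x y w using that by simp
    from this[OF i1 i2] show ?thesis by (simp only: deriv_F[OF z] q0) simp
  qed
  finally have e: "l * (2 * pi * deriv f z) = (\<integral>t. of_real (2 * u t) * ?q t \<partial>circ)" ..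
  have z2: "0 < 1 - (cmod z)\<^sup>2" using z by (simp add: power_less_one_iff)
  define P where "P t = poisson_kernel z t" for t
  have Pm [measurable]: "P \<in> borel_measurable borel" unfolding P_def[abs_def] by measurable
  have P0: "0 \<le> P t" for t by (simp add: P_def poisson_kernel_nonneg z)
  have iP: "integrable circ (\<lambda>t. h t * P t)" if h: "integrable circ h" for h :: "real \<Rightarrow> real"
  proof -
    have "integrable (pmeasure z) h" by (rule integrable_pmeasure[OF h z])
    then have "integrable circ (\<lambda>t. (P t / (2*pi)) *\<^sub>R h t)"
      unfolding pmeasure_def P_def using poisson_kernel_nonneg[OF z] borel_measurable_integrable[OF h]
      by (subst (asm) integrable_density) auto
    from integrable_mult_right[OF this, of "2*pi"] show ?thesis by (simp add: mult.commute)
  qed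
  have "2 * pi * cmod (deriv f z) = cmod (\<integral>t. of_real (2 * u t) * ?q t \<partial>circ)"
    unfolding e[symmetric] by (simp add: norm_mult ln)
  also have "\<dots> \<le> (\<integral>t. cmod (of_real (2 * u t) * ?q t) \<partial>circ)" by (rule integral_norm_bound)
  also have "\<dots> = (\<integral>t. (2 / (1 - (cmod z)\<^sup>2)) * (\<bar>u t\<bar> * P t) \<partial>circ)"
  proof (rule Bochner_Integration.integral_cong)
    fix t
    have "cmod (of_real (2 * u t) * ?q t) = \<bar>2 * u t\<bar> * (P t / (1 - (cmod z)\<^sup>2))"
      by (simp only: norm_mult norm_of_real deriv_kernel_bound(2)[OF z] P_def)
    then show "cmod (of_real (2 * u t) * ?q t) = (2 / (1 - (cmod z)\<^sup>2)) * (\<bar>u t\<bar> * P t)"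
      by (simp only: abs_mult) simp
  qed simp
  also have "\<dots> = 2 / (1 - (cmod z)\<^sup>2) * (\<integral>t. \<bar>u t\<bar> * P t \<partial>circ)" by simp
  finally have a: "2 * pi * ((1 - (cmod z)\<^sup>2) * cmod (deriv f z)) \<le> 2 * (\<integral>t. \<bar>u t\<bar> * P t \<partial>circ)"
    using z2 by (simp add: field_simps)
  have u0: "(\<integral>t. u t * P t \<partial>circ) = 0"
  proof -
    have iPc: "integrable circ (\<lambda>t. F t * of_real (P t))"
      unfolding P_def
      by (rule fr_integral_LIMSEQ(2)[OF bounded_linear_ident, of _ "2 / (1 - cmod z)\<^sup>2"])
         (use poisson_kernel_le[OF z] poisson_kernel_nonneg[OF z] in auto)
    have P1: "(\<integral>t. P t \<partial>circ) = 2 * pi"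
      using integral_poisson_kernel[OF z] P0 by (subst integral_eq_nn_integral) (auto simp: P_def)
    have iP1: "integrable circ P" using iP[of "\<lambda>_. 1"] by simp
    have "(\<integral>t. u t * P t \<partial>circ) = (\<integral>t. Re (l * (F t * of_real (P t))) - cmod (f z) * P t \<partial>circ)"
      by (rule Bochner_Integration.integral_cong) (auto simp: u_def algebra_simps)
    also have "\<dots> = Re (l * (2 * pi * f z)) - cmod (f z) * (2 * pi)"
    proof -
      have "(\<integral>t. Re (h t) - x * g t \<partial>circ) = Re (integral\<^sup>L circ h) - x * integral\<^sup>L circ g"
        if "integrable circ h" "integrable circ g" for h g x using that by simp
      from this[OF integrable_mult_right[OF iPc] iP1] show ?thesis
        by (simp only: integral_mult_right_zero poisson_F[OF z, folded P_def] P1)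
    qed
    also have "l * (2 * pi * f z) = of_real (2 * pi * cmod (f z))" using lf by (simp add: mult_ac)
    finally show ?thesis by simp
  qed
  have "(\<integral>t. \<bar>u t\<bar> * P t \<partial>circ) = (\<integral>t. \<bar>u t\<bar> * P t + u t * P t \<partial>circ)"
    using u0 iP[OF ui] iP[of "\<lambda>t. \<bar>u t\<bar>"] ui by simp
  also have "\<dots> \<le> (\<integral>t. 2 * (\<bar>cmod (F t) - cmod (f z)\<bar> * P t) \<partial>circ)"
  proof (rule integral_mono)
    show "integrable circ (\<lambda>t. \<bar>u t\<bar> * P t + u t * P t)" using iP[OF ui] iP[of "\<lambda>t. \<bar>u t\<bar>"] ui by simp
    show "integrable circ (\<lambda>t. 2 * (\<bar>cmod (F t) - cmod (f z)\<bar> * P t))"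
      using integrable_F by (intro integrable_mult_right iP) simp
    fix t
    have "Re (l * F t) \<le> cmod (F t)" using complex_Re_le_cmod[of "l * F t"] by (simp add: norm_mult ln)
    then have "\<bar>u t\<bar> + u t \<le> 2 * \<bar>cmod (F t) - cmod (f z)\<bar>" by (simp add: u_def abs_if)
    then show "\<bar>u t\<bar> * P t + u t * P t \<le> 2 * (\<bar>cmod (F t) - cmod (f z)\<bar> * P t)"
      using mult_right_mono[OF _ P0[of t]] by (fastforce simp: algebra_simps)
  qed
  finally have b: "(\<integral>t. \<bar>u t\<bar> * P t \<partial>circ) \<le> 2 * (\<integral>t. \<bar>cmod (F t) - cmod (f z)\<bar> * P t \<partial>circ)" by simp
  have "(\<integral>t. \<bar>cmod (F t) - cmod (f z)\<bar> \<partial>pmeasure z) = (\<integral>t. (1 / (2*pi)) * (\<bar>cmod (F t) - cmod (f z)\<bar> * P t) \<partial>circ)"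
    by (subst integral_pmeasure[OF _ z]) (auto simp: P_def mult_ac)
  then have "(\<integral>t. \<bar>cmod (F t) - cmod (f z)\<bar> * P t \<partial>circ) = 2 * pi * (\<integral>t. \<bar>cmod (F t) - cmod (f z)\<bar> \<partial>pmeasure z)"
    by simp
  with a b have "2 * pi * ((1 - (cmod z)\<^sup>2) * cmod (deriv f z)) \<le> 2 * pi * (4 * (\<integral>t. \<bar>cmod (F t) - cmod (f z)\<bar> \<partial>pmeasure z))"
    by linarith
  then show ?thesis by (rule mult_left_le_imp_le) simp
qed

end

section \<open>Weights\<close>

text \<open>\<open>\<Phi>\<close> is a real-valued form of phi_K with some slack built in: the
  factor 2 absorbs constants from chord estimates, and t runs up to 2 because chords of the circle
  have length at most 2.\<close>

locale weight =
  fixes K \<Phi> :: "real \<Rightarrow> real"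
  assumes K_nonneg: "0 \<le> K x" and K_mono: "mono K"
    and Phi_nonneg: "0 \<le> \<Phi> x" and Phi_mono: "mono \<Phi>"
    and scale: "0 < s \<Longrightarrow> 0 < t \<Longrightarrow> t \<le> 2 \<Longrightarrow> K (2 * s * t) \<le> \<Phi> s * K t"
    and fin0: "(\<integral>\<^sup>+s\<in>{0<..1}. ennreal (\<Phi> s / s) \<partial>lborel) < \<infinity>"
    and fin1: "(\<integral>\<^sup>+s\<in>{1..}. ennreal (\<Phi> s / s\<^sup>2) \<partial>lborel) < \<infinity>"
begin

definition A0 :: real where "A0 = enn2real (\<integral>\<^sup>+s\<in>{0<..1}. ennreal (\<Phi> s / s) \<partial>lborel)"
definition A1 :: real where "A1 = enn2real (\<integral>\<^sup>+s\<in>{1..}. ennreal (\<Phi> s / s\<^sup>2) \<partial>lborel)"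

lemma A0: "(\<integral>\<^sup>+s\<in>{0<..1}. ennreal (\<Phi> s / s) \<partial>lborel) = ennreal A0" "0 \<le> A0"
  using fin0 by (auto simp: A0_def)

lemma A1: "(\<integral>\<^sup>+s\<in>{1..}. ennreal (\<Phi> s / s\<^sup>2) \<partial>lborel) = ennreal A1" "0 \<le> A1"
  using fin1 by (auto simp: A1_def)

lemma borel_K [measurable]: "K \<in> borel_measurable borel"
  by (rule borel_measurable_mono[OF K_mono])

lemma borel_Phi [measurable]: "\<Phi> \<in> borel_measurable borel"
  by (rule borel_measurable_mono[OF Phi_mono])

lemma K_le: "x \<le> y \<Longrightarrow> K x \<le> K y"
  using K_mono by (simp add: mono_def)

lemma Phi_le: "x \<le> y \<Longrightarrow> \<Phi> x \<le> \<Phi> y"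
  using Phi_mono by (simp add: mono_def)

lemma K_double_le: "0 < t \<Longrightarrow> t \<le> 2 \<Longrightarrow> 0 < x \<Longrightarrow> K (2 * x) \<le> \<Phi> (x / t) * K t"
  using scale[of "x / t" t] by simp

section \<open>Rescaled integrals and Laplace transforms of the weight\<close>

lemma Phi_integral_small:
  assumes c: "c > 0"
  shows "(\<integral>\<^sup>+x\<in>{0<..1/c}. ennreal (\<Phi> (c * x) / x) \<partial>lborel) = ennreal A0"
proof -
  have "ennreal A0 = ennreal c * (\<integral>\<^sup>+x. ennreal (\<Phi> (0 + c * x) / (0 + c * x)) * indicator {0<..1} (0 + c * x) \<partial>lborel)"
    unfolding A0(1)[symmetric] using c
    by (subst nn_integral_real_affine[where c = c and t = 0]) auto
  also have "\<dots> = (\<integral>\<^sup>+x. ennreal c * (ennreal (\<Phi> (0 + c * x) / (0 + c * x)) * indicator {0<..1} (0 + c * x)) \<partial>lborel)"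
    by (rule nn_integral_cmult[symmetric]) measurable
  also have "\<dots> = (\<integral>\<^sup>+x\<in>{0<..1/c}. ennreal (\<Phi> (c * x) / x) \<partial>lborel)"
  proof (rule nn_integral_cong)
    fix x :: real
    have "ennreal c * ennreal (\<Phi> (c * x) / (c * x)) = ennreal (\<Phi> (c * x) / x)" if "0 < x"
      using c that Phi_nonneg by (subst ennreal_mult[symmetric]) auto
    moreover have "0 < c * x \<longleftrightarrow> 0 < x" "c * x \<le> 1 \<longleftrightarrow> x \<le> 1/c" using c by (auto simp: zero_less_mult_iff field_simps)
    ultimately show "ennreal c * (ennreal (\<Phi> (0 + c * x) / (0 + c * x)) * indicator {0<..1} (0 + c * x)) = ennreal (\<Phi> (c * x) / x) * indicator {0<..1/c} x"
      by (simp add: indicator_def)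
  qed
  finally show ?thesis by simp
qed

lemma Phi_integral_large:
  assumes c: "c > 0"
  shows "(\<integral>\<^sup>+x\<in>{1/c..}. ennreal (\<Phi> (c * x) / x\<^sup>2) \<partial>lborel) = ennreal (c * A1)"
proof -
  have "ennreal (c * A1) = ennreal c * (ennreal c * (\<integral>\<^sup>+x. ennreal (\<Phi> (0 + c * x) / (0 + c * x)\<^sup>2) * indicator {1..} (0 + c * x) \<partial>lborel))"
    using c A1(2) unfolding ennreal_mult[OF less_imp_le[OF c] A1(2)]
    by (subst A1(1)[symmetric], subst nn_integral_real_affine[where c = c and t = 0]) auto
  also have "\<dots> = (\<integral>\<^sup>+x. ennreal c * (ennreal c * (ennreal (\<Phi> (0 + c * x) / (0 + c * x)\<^sup>2) * indicator {1..} (0 + c * x))) \<partial>lborel)"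
    by (simp add: nn_integral_cmult)
  also have "\<dots> = (\<integral>\<^sup>+x\<in>{1/c..}. ennreal (\<Phi> (c * x) / x\<^sup>2) \<partial>lborel)"
  proof (rule nn_integral_cong)
    fix x :: real
    have "ennreal c * (ennreal c * ennreal (\<Phi> (c * x) / (c * x)\<^sup>2)) = ennreal (c * (c * (\<Phi> (c * x) / (c * x)\<^sup>2)))"
      using c Phi_nonneg by (simp add: ennreal_mult del: times_divide_eq_right)
    also have "c * (c * (\<Phi> (c * x) / (c * x)\<^sup>2)) = \<Phi> (c * x) / x\<^sup>2"
      using c by (simp add: power2_eq_square)
    finally have "ennreal c * (ennreal c * ennreal (\<Phi> (c * x) / (c * x)\<^sup>2)) = ennreal (\<Phi> (c * x) / x\<^sup>2)" .
    moreover have "1 \<le> c * x \<longleftrightarrow> 1/c \<le> x" using c by (auto simp: field_simps)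
    ultimately show "ennreal c * (ennreal c * (ennreal (\<Phi> (0 + c * x) / (0 + c * x)\<^sup>2) * indicator {1..} (0 + c * x))) = ennreal (\<Phi> (c * x) / x\<^sup>2) * indicator {1/c..} x"
      by (simp add: indicator_def)
  qed
  finally show ?thesis by simp
qed

text \<open>Only s in [1/n, 2/n] is kept; there the exponential is at least exp(-4) and G is at
  least G (1/n).\<close>

lemma laplace_lower:
  fixes G :: "real \<Rightarrow> real"
  assumes n: "n \<ge> (1::nat)" and G: "G \<in> borel_measurable borel" "\<And>x y. x \<le> y \<Longrightarrow> G x \<le> G y" "\<And>x. 0 \<le> G x"
  shows "ennreal (exp (-4) / real n * G (1 / real n)) \<le> (\<integral>\<^sup>+s\<in>{0<..}. ennreal (exp (- 2 * real n * s) * G s) \<partial>lborel)"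
proof -
  have n0: "real n > 0" using n by simp
  have "ennreal (exp (-4) / real n * G (1 / real n)) = (\<integral>\<^sup>+s. ennreal (exp (-4) * G (1 / real n)) * indicator {1/real n..2/real n} s \<partial>lborel)"
    using n0 G(3) by (simp add: nn_integral_cmult_indicator ennreal_mult[symmetric] field_simps)
  also have "\<dots> \<le> (\<integral>\<^sup>+s\<in>{0<..}. ennreal (exp (- 2 * real n * s) * G s) \<partial>lborel)"
  proof (rule nn_integral_mono)
    fix s :: real
    show "ennreal (exp (-4) * G (1 / real n)) * indicator {1/real n..2/real n} s \<le> ennreal (exp (- 2 * real n * s) * G s) * indicator {0<..} s"
    proof (cases "s \<in> {1/real n..2/real n}")
      case True
      then have s: "1 / real n \<le> s" "s \<le> 2 / real n" by auto
      have "0 < s" using s(1) n0 by (meson divide_pos_pos less_le_trans zero_less_one)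
      moreover have "real n * s \<le> 2" using s(2) n0 by (simp add: field_simps)
      then have "exp (-4) \<le> exp (- 2 * real n * s)" by (simp add: mult.commute)
      then have "exp (-4) * G (1 / real n) \<le> exp (- 2 * real n * s) * G s"
        using s G by (intro mult_mono) auto
      ultimately show ?thesis using True by (simp add: ennreal_leI)
    qed simp
  qed
  finally show ?thesis .
qed

text \<open>Split at s = 1/n. Below, K s <= K (1/n); above, \<open>scale\<close> gives K s <= Phi (n
  s) K (1/n) while exp(-2 n s) <= (n s)^-2, so the integral of Phi s / s^2 bounds the tail. With
  \<open>laplace_lower\<close> the transform is comparable to K (1/n) / n.\<close>

lemma laplace_upper:
  assumes n: "n \<ge> (1::nat)"
  shows "(\<integral>\<^sup>+s\<in>{0<..}. ennreal (exp (- 2 * real n * s) * K s) \<partial>lborel) \<le> ennreal ((1 + A1) / real n * K (1 / real n))"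
proof -
  let ?k = "K (1 / real n)"
  have n0: "real n > 0" using n by simp
  have "(\<integral>\<^sup>+s\<in>{0<..}. ennreal (exp (- 2 * real n * s) * K s) \<partial>lborel)
     \<le> (\<integral>\<^sup>+s. (ennreal ?k * indicator {0..1/real n} s + ennreal (?k / (real n)\<^sup>2) * (ennreal (\<Phi> (real n * s) / s\<^sup>2) * indicator {1/real n..} s)) \<partial>lborel)"
  proof (rule nn_integral_mono)
    fix s :: real
    consider "s \<le> 0" | "0 < s" "s \<le> 1/real n" | "1 / real n < s" "0 < s" using n0 by (smt (verit) divide_pos_pos)
    then show "ennreal (exp (- 2 * real n * s) * K s) * indicator {0<..} s
      \<le> ennreal ?k * indicator {0..1/real n} s + ennreal (?k / (real n)\<^sup>2) * (ennreal (\<Phi> (real n * s) / s\<^sup>2) * indicator {1/real n..} s)"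
    proof cases
      case 2
      have "exp (- 2 * real n * s) * K s \<le> 1 * ?k"
        using 2 K_nonneg K_le by (intro mult_mono) auto
      then show ?thesis using 2 by (auto simp: indicator_def intro: add_increasing2 ennreal_leI)
    next
      case 3
      have ns: "0 < real n * s" using n0 3 by simp
      have "K s \<le> K (2 * s)" using 3 by (intro K_le) simp
      also have "\<dots> \<le> \<Phi> (s / (1 / real n)) * ?k" using n n0 3 by (intro K_double_le) (auto simp: field_simps)
      finally have a: "K s \<le> \<Phi> (real n * s) * ?k" by (simp add: mult.commute)
      have "real n * s \<le> exp (real n * s)" using exp_ge_add_one_self[of "real n * s"] by linarith
      then have "(real n * s)\<^sup>2 \<le> (exp (real n * s))\<^sup>2" using ns by (intro power_mono) auto
      also have "\<dots> = exp (2 * real n * s)" by (simp add: power2_eq_square exp_add[symmetric])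
      finally have le: "(real n * s)\<^sup>2 \<le> exp (2 * real n * s)" .
      have "exp (- 2 * real n * s) = 1 / exp (2 * real n * s)" by (simp add: exp_minus inverse_eq_divide)
      also have "\<dots> \<le> 1 / (real n * s)\<^sup>2"
        by (intro divide_left_mono mult_pos_pos zero_less_power exp_gt_zero le ns) simp
      finally have "exp (- 2 * real n * s) \<le> 1 / (real n * s)\<^sup>2" .
      then have "exp (- 2 * real n * s) * K s \<le> 1 / (real n * s)\<^sup>2 * (\<Phi> (real n * s) * ?k)"
        using a K_nonneg by (intro mult_mono) auto
      also have "\<dots> = ?k / (real n)\<^sup>2 * (\<Phi> (real n * s) / s\<^sup>2)" by (simp add: power_mult_distrib)
      finally have "ennreal (exp (- 2 * real n * s) * K s) \<le> ennreal (?k / (real n)\<^sup>2) * ennreal (\<Phi> (real n * s) / s\<^sup>2)"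
        using K_nonneg Phi_nonneg by (subst ennreal_mult[symmetric]) (auto intro: ennreal_leI)
      then show ?thesis using 3 by (simp add: indicator_def)
    qed simp
  qed
  also have "\<dots> = ennreal ?k * ennreal (1 / real n) + ennreal (?k / (real n)\<^sup>2) * ennreal (real n * A1)"
    using n0 Phi_integral_large[OF n0]
    by (subst nn_integral_add) (auto simp: nn_integral_cmult nn_integral_cmult_indicator)
  also have "\<dots> = ennreal ((1 + A1) / real n * ?k)"
  proof -
    have "?k * (1 / real n) + ?k / (real n)\<^sup>2 * (real n * A1) = (1 + A1) / real n * ?k"
      using n0 by (simp add: power2_eq_square field_simps)
    then show ?thesis
      using K_nonneg A1(2) n0 by (simp add: ennreal_mult[symmetric] ennreal_plus[symmetric] del: ennreal_plus)
  qed
  finally show ?thesis .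
qed

text \<open>For s = log (1/r) the right-hand argument is 1 - r^2, so the Green weight is compared
  with the weight of the disk. Up to constants both transforms see K only at scale 1/n; this is why
  they compare although s is unbounded and 1 - exp(-2 s) is not.\<close>

lemma laplace_compare:
  assumes n: "n \<ge> (1::nat)"
  shows "(\<integral>\<^sup>+s\<in>{0<..}. ennreal (exp (- 2 * real n * s) * K s) \<partial>lborel)
     \<le> ennreal ((1 + A1) * exp 4 * \<Phi> 1) * (\<integral>\<^sup>+s\<in>{0<..}. ennreal (exp (- 2 * real n * s) * K (1 - exp (- 2 * s))) \<partial>lborel)"
proof -
  have n0: "real n > 0" using n by simp
  define t where "t = 1 - exp (- 2 * (1 / real n))"
  \<comment> \<open>From exp x >= 1 + x. The resulting t is at least 2 / (3 n), so one doubling of t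
    already exceeds 1/n.\<close>
  have "exp (- 2 * (1 / real n)) \<le> 1 / (1 + 2 / real n)"
    using exp_ge_add_one_self[of "2 / real n"] n0
    by (simp add: exp_minus inverse_eq_divide) (intro divide_left_mono, auto intro!: mult_pos_pos add_pos_pos)
  also have "\<dots> = 1 - 2 / (real n + 2)" using n0 by (simp add: field_simps)
  also have "\<dots> \<le> 1 - 2 / (3 * real n)" using n by (simp add: field_simps)
  finally have t1: "2 / (3 * real n) \<le> t" by (simp add: t_def)
  then have t0: "0 < t" using n0 by (smt (verit) divide_pos_pos)
  have t2: "t \<le> 2" unfolding t_def using exp_gt_zero[of "- 2 * (1 / real n)"] by linarith
  have "1 / real n \<le> 2 * 1 * t"
  proof -
    have "1 / real n \<le> 2 * (2 / (3 * real n))" using n0 by (simp add: field_simps)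
    then show ?thesis using t1 by linarith
  qed
  then have "K (1 / real n) \<le> K (2 * 1 * t)" by (rule K_le)
  also have "\<dots> \<le> \<Phi> 1 * K t" using t0 t2 by (intro scale) auto
  finally have kt: "K (1 / real n) \<le> \<Phi> 1 * K t" .
  have "(\<integral>\<^sup>+s\<in>{0<..}. ennreal (exp (- 2 * real n * s) * K s) \<partial>lborel) \<le> ennreal ((1 + A1) / real n * K (1 / real n))"
    by (rule laplace_upper[OF n])
  also have "\<dots> \<le> ennreal (((1 + A1) * exp 4 * \<Phi> 1) * (exp (-4) / real n * K t))"
  proof (rule ennreal_leI)
    have "(1 + A1) / real n * K (1 / real n) \<le> (1 + A1) / real n * (\<Phi> 1 * K t)"
      using kt A1(2) n0 by (intro mult_left_mono) auto
    also have "\<dots> = (1 + A1) / real n * (\<Phi> 1 * K t) * (exp 4 * exp (-4))" by (simp flip: exp_add)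
    also have "\<dots> = ((1 + A1) * exp 4 * \<Phi> 1) * (exp (-4) / real n * K t)" by (simp add: mult_ac)
    finally show "(1 + A1) / real n * K (1 / real n) \<le> \<dots>" .
  qed
  also have "\<dots> = ennreal ((1 + A1) * exp 4 * \<Phi> 1) * ennreal (exp (-4) / real n * K t)"
    using A1(2) Phi_nonneg K_nonneg by (intro ennreal_mult) auto
  also have "\<dots> \<le> ennreal ((1 + A1) * exp 4 * \<Phi> 1) * (\<integral>\<^sup>+s\<in>{0<..}. ennreal (exp (- 2 * real n * s) * K (1 - exp (- 2 * s))) \<partial>lborel)"
    unfolding t_def
    by (intro mult_left_mono laplace_lower[OF n, of "\<lambda>s. K (1 - exp (- 2 * s))"]) (auto intro: K_le K_nonneg)
  finally show ?thesis .
qed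

text \<open>This integral is the multiplier of the n-th Taylor coefficient in the rotation-invariant
  double integral. Use |cis (n t) - 1| <= n |t| for |t| <= 1/n and <= 2 beyond; the outer part is
  again a tail of Phi s / s^2.\<close>

lemma cis_kernel_le:
  assumes n: "n \<ge> (1::nat)"
  shows "(\<integral>\<^sup>+t\<in>{-pi..pi}. ennreal ((cmod (cis (real n * t) - 1))\<^sup>2 * (K (cmod (cis t - 1)) / (cmod (cis t - 1))\<^sup>2)) \<partial>lborel)
     \<le> ennreal ((8 + 32 * A1) * real n * K (1 / real n))"
proof -
  let ?k = "K (1 / real n)"
  have n0: "real n > 0" using n by simp
  \<comment> \<open>A majorant for positive t only; negative t is covered by reflection, which
    doubles the constant.\<close>
  define H where "H t = ennreal (4 * (real n)\<^sup>2 * ?k) * indicator {0..1/real n} t + ennreal (16 * ?k) * (ennreal (\<Phi> (real n * t) / t\<^sup>2) * indicator {1/real n..} t)" for t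
  have [measurable]: "H \<in> borel_measurable borel" unfolding H_def[abs_def] by measurable
  have Hint: "(\<integral>\<^sup>+t. H t \<partial>lborel) = ennreal ((4 + 16 * A1) * real n * ?k)"
  proof -
    have "(\<integral>\<^sup>+t. H t \<partial>lborel) = ennreal (4 * (real n)\<^sup>2 * ?k) * ennreal (1 / real n) + ennreal (16 * ?k) * ennreal (real n * A1)"
      unfolding H_def using n0 Phi_integral_large[OF n0]
      by (subst nn_integral_add) (auto simp: nn_integral_cmult nn_integral_cmult_indicator)
    also have "\<dots> = ennreal (4 * (real n)\<^sup>2 * ?k * (1 / real n) + 16 * ?k * (real n * A1))"
      using K_nonneg A1(2) n0 by (simp add: ennreal_mult[symmetric] ennreal_plus[symmetric] del: ennreal_plus)
    also have "4 * (real n)\<^sup>2 * ?k * (1 / real n) + 16 * ?k * (real n * A1) = (4 + 16 * A1) * real n * ?k"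
      using n0 by (simp add: power2_eq_square field_simps)
    finally show ?thesis .
  qed
  have "(\<integral>\<^sup>+t\<in>{-pi..pi}. ennreal ((cmod (cis (real n * t) - 1))\<^sup>2 * (K (cmod (cis t - 1)) / (cmod (cis t - 1))\<^sup>2)) \<partial>lborel)
      \<le> (\<integral>\<^sup>+t. (H t + H (-t)) \<partial>lborel)"
  proof (rule nn_integral_mono)
    fix t :: real
    let ?f = "(cmod (cis (real n * t) - 1))\<^sup>2 * (K (cmod (cis t - 1)) / (cmod (cis t - 1))\<^sup>2)"
    show "ennreal ?f * indicator {-pi..pi} t \<le> H t + H (-t)"
    proof (cases "t = 0 \<or> \<bar>t\<bar> > pi")
      case True
      then show ?thesis by (auto simp: indicator_def)
    next
      case False
      define x where "x = \<bar>t\<bar>"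
      have x: "0 < x" "x \<le> pi" using False by (auto simp: x_def)
      have l: "x / 2 \<le> cmod (cis t - 1)" using norm_cis_diff_ge[of t 0] x by (simp add: x_def)
      have u: "cmod (cis t - 1) \<le> x" using norm_cis_diff_le[of t 0] by (simp add: x_def)
      have n1: "cmod (cis (real n * t) - 1) \<le> real n * x" using norm_cis_diff_le[of "real n * t" 0] by (simp add: x_def abs_mult)
      have n2: "cmod (cis (real n * t) - 1) \<le> 2" using norm_cis_diff_le_2[of "real n * t" 0] by simp
      have "K (cmod (cis t - 1)) / (cmod (cis t - 1))\<^sup>2 \<le> K x / (x / 2)\<^sup>2"
        using l u x K_nonneg by (intro frac_le K_le power_mono) auto
      then have f1: "?f \<le> B\<^sup>2 * (K x / (x / 2)\<^sup>2)" if "cmod (cis (real n * t) - 1) \<le> B" for B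
        using that K_nonneg by (intro mult_mono power_mono) auto
      have "ennreal ?f \<le> H x"
      proof (cases "x \<le> 1 / real n")
        case True
        have "?f \<le> (real n * x)\<^sup>2 * (K x / (x / 2)\<^sup>2)" by (rule f1[OF n1])
        also have "\<dots> = 4 * (real n)\<^sup>2 * K x" using x by (simp add: power_mult_distrib power_divide)
        also have "\<dots> \<le> 4 * (real n)\<^sup>2 * ?k" using True by (intro mult_left_mono K_le) auto
        finally have "ennreal ?f \<le> ennreal (4 * (real n)\<^sup>2 * ?k)" by (rule ennreal_leI)
        then show ?thesis using True x by (auto simp: H_def indicator_def intro: add_increasing2)
      next
        case False
        have "K x \<le> K (2 * x)" using x by (intro K_le) simp
        also have "\<dots> \<le> \<Phi> (x / (1 / real n)) * ?k" using n n0 x by (intro K_double_le) (auto simp: field_simps)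
        finally have a: "K x \<le> \<Phi> (real n * x) * ?k" by (simp add: mult.commute)
        have "?f \<le> 2\<^sup>2 * (K x / (x / 2)\<^sup>2)" by (rule f1[OF n2])
        also have "\<dots> \<le> 2\<^sup>2 * (\<Phi> (real n * x) * ?k / (x / 2)\<^sup>2)"
          using a by (intro mult_left_mono divide_right_mono) auto
        also have "\<dots> = 16 * ?k * (\<Phi> (real n * x) / x\<^sup>2)" by (simp add: power_divide)
        finally have "ennreal ?f \<le> ennreal (16 * ?k * (\<Phi> (real n * x) / x\<^sup>2))" by (rule ennreal_leI)
        also have "\<dots> = ennreal (16 * ?k) * ennreal (\<Phi> (real n * x) / x\<^sup>2)"
          using K_nonneg Phi_nonneg by (intro ennreal_mult) auto
        finally show ?thesis using False by (simp add: H_def indicator_def)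
      qed
      also have "H x \<le> H t + H (-t)" by (cases "t \<ge> 0") (auto simp: x_def add_increasing add_increasing2)
      finally show ?thesis by (auto simp: indicator_def)
    qed
  qed
  also have "\<dots> = (\<integral>\<^sup>+t. H t \<partial>lborel) + (\<integral>\<^sup>+t. H (-t) \<partial>lborel)"
    by (rule nn_integral_add) measurable
  also have "(\<integral>\<^sup>+t. H (-t) \<partial>lborel) = (\<integral>\<^sup>+t. H t \<partial>lborel)"
    using nn_integral_real_affine[of H "-1" 0] by simp
  also have "(\<integral>\<^sup>+t. H t \<partial>lborel) + (\<integral>\<^sup>+t. H t \<partial>lborel) = ennreal ((8 + 32 * A1) * real n * ?k)"
    unfolding Hint using K_nonneg A1(2)
    by (subst ennreal_plus[symmetric]) (auto simp: algebra_simps)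
  finally show ?thesis .
qed

end

text \<open>The witness is phi_K (4 s): writing 2 s t = 4 s (t/2) with t <= 2 gives t/2 <= 1, as
  phi_K requires. The dilation moves the split point of the two integrals from 1 to 4, which changes
  them only on a bounded range away from 0.\<close>

lemma weight_exists:
  fixes K :: "real \<Rightarrow> real"
  assumes K_nonneg: "\<forall>t\<ge>0. K t \<ge> 0"
    and K_mono: "mono_on {0..} K"
    and int0: "(\<integral>\<^sup>+ s\<in>{0<..1}. phiK K s / ennreal s \<partial>lborel) < top"
    and int1: "(\<integral>\<^sup>+ s\<in>{1..}. phiK K s / ennreal (s\<^sup>2) \<partial>lborel) < top"
  obtains \<Phi> where "weight (\<lambda>x. K (max 0 x)) \<Phi>"
proof -
  \<comment> \<open>K is continued to the left by its value at 0, which gives a monotone function on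
    the whole line.\<close>
  define k where "k x = K (max 0 x)" for x
  have k0: "0 \<le> k x" for x using K_nonneg by (simp add: k_def)
  have km: "mono k" using K_mono by (auto simp: k_def mono_def mono_on_def)
  have kK: "k x = K x" if "0 \<le> x" for x using that by (simp add: k_def)
  define ph where "ph s = (SUP t\<in>{0<..1::real}. ennreal (k (s * t)) / ennreal (k t))" for s
  have phm: "mono ph"
  proof (rule monoI)
    fix x y :: real assume "x \<le> y"
    then show "ph x \<le> ph y" unfolding ph_def using km
      by (intro SUP_mono) (auto intro!: bexI divide_right_mono_ennreal ennreal_leI monoD[OF km] mult_right_mono)
  qed
  have phK: "phiK K s = ph s" if "0 \<le> s" for s
    unfolding phiK_def ph_def using that by (intro SUP_cong) (auto simp: kK)
  have i0: "(\<integral>\<^sup>+ s\<in>{0<..1}. ph s / ennreal s \<partial>lborel) < \<infinity>"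
  proof -
    have "(\<integral>\<^sup>+ s\<in>{0<..1}. ph s / ennreal s \<partial>lborel) = (\<integral>\<^sup>+ s\<in>{0<..1}. phiK K s / ennreal s \<partial>lborel)"
      by (intro nn_integral_cong) (auto simp: indicator_def phK)
    then show ?thesis using int0 by simp
  qed
  have i1: "(\<integral>\<^sup>+ s\<in>{1..}. ph s / ennreal (s\<^sup>2) \<partial>lborel) < \<infinity>"
  proof -
    have "(\<integral>\<^sup>+ s\<in>{1..}. ph s / ennreal (s\<^sup>2) \<partial>lborel) = (\<integral>\<^sup>+ s\<in>{1..}. phiK K s / ennreal (s\<^sup>2) \<partial>lborel)"
      by (intro nn_integral_cong) (auto simp: indicator_def phK)
    then show ?thesis using int1 by simp
  qed
  \<comment> \<open>phi_K is increasing, so an infinite value would persist on a half line and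
    contradict the second integral.\<close>
  have fin: "ph s < \<infinity>" for s
  proof (rule ccontr)
    assume "\<not> ph s < \<infinity>"
    then have inf: "ph s = \<infinity>" by (simp add: less_top[symmetric])
    define m where "m = max 1 s"
    have "(\<integral>\<^sup>+x. \<infinity> * indicator {m..m+1} x \<partial>lborel) \<le> (\<integral>\<^sup>+ s\<in>{1..}. ph s / ennreal (s\<^sup>2) \<partial>lborel)"
    proof (rule nn_integral_mono)
      fix x :: real
      show "\<infinity> * indicator {m..m+1} x \<le> ph x / ennreal (x\<^sup>2) * indicator {1..} x"
      proof (cases "x \<in> {m..m+1}")
        case True
        then have "1 \<le> x" "ph s \<le> ph x" using monoD[OF phm, of s x] by (auto simp: m_def)
        then have "ph x = top" "1 \<le> x" using inf top.extremum_unique by fastforce+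
        then show ?thesis by (simp add: ennreal_top_divide)
      qed simp
    qed
    moreover have "(\<integral>\<^sup>+x. \<infinity> * indicator {m..m+1} x \<partial>lborel) = \<infinity>"
      by (subst nn_integral_cmult_indicator) (auto simp: ennreal_top_mult)
    ultimately show False using i1 by simp
  qed
  define p where "p s = enn2real (ph s)" for s
  have pe: "ennreal (p s) = ph s" for s using fin[of s] by (simp add: p_def)
  have p0: "0 \<le> p s" for s by (simp add: p_def)
  have pm: "mono p" unfolding p_def using phm fin by (auto simp: mono_def intro!: enn2real_mono)
  have [measurable]: "p \<in> borel_measurable borel" by (rule borel_measurable_mono[OF pm])
  have ksc: "k (s * t) \<le> p s * k t" if t: "0 < t" "t \<le> 1" for s t
  proof -
    have "ennreal (k (s * t)) / ennreal (k t) \<le> ph s"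
      unfolding ph_def using t by (intro SUP_upper) auto
    then have a: "ennreal (k (s * t)) / ennreal (k t) \<le> ennreal (p s)" by (simp add: pe)
    show ?thesis
    proof (cases "k t = 0")
      case True
      \<comment> \<open>Since c/0 is infinite for c > 0, finiteness of phi_K forces the numerator to
        vanish here.\<close>
      then have "k (s * t) = 0"
        using a k0[of "s * t"] by (cases "k (s * t) = 0") (auto simp: ennreal_divide_zero top_unique)
      then show ?thesis using True by simp
    next
      case False
      then have kt: "0 < k t" using k0[of t] by simp
      then have "ennreal (k (s * t) / k t) \<le> ennreal (p s)" using a k0 by (simp add: divide_ennreal)
      then have "k (s * t) / k t \<le> p s" using p0 by (simp add: ennreal_le_iff)
      then show ?thesis using kt by (simp add: field_simps)
    qed
  qed
  have j0: "(\<integral>\<^sup>+ s\<in>{0<..1}. ennreal (p s / s) \<partial>lborel) < \<infinity>"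
  proof -
    have "(\<integral>\<^sup>+ s\<in>{0<..1}. ennreal (p s / s) \<partial>lborel) = (\<integral>\<^sup>+ s\<in>{0<..1}. ph s / ennreal s \<partial>lborel)"
      by (intro nn_integral_cong) (auto simp: indicator_def pe[symmetric] divide_ennreal p0)
    then show ?thesis using i0 by simp
  qed
  have j1: "(\<integral>\<^sup>+ s\<in>{1..}. ennreal (p s / s\<^sup>2) \<partial>lborel) < \<infinity>"
  proof -
    have "(\<integral>\<^sup>+ s\<in>{1..}. ennreal (p s / s\<^sup>2) \<partial>lborel) = (\<integral>\<^sup>+ s\<in>{1..}. ph s / ennreal (s\<^sup>2) \<partial>lborel)"
      by (intro nn_integral_cong) (auto simp: indicator_def pe[symmetric] divide_ennreal p0)
    then show ?thesis using i1 by simp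
  qed
  have j4: "(\<integral>\<^sup>+ s\<in>{0<..4}. ennreal (p s / s) \<partial>lborel) < \<infinity>"
  proof -
    have "(\<integral>\<^sup>+ s\<in>{0<..4}. ennreal (p s / s) \<partial>lborel)
       \<le> (\<integral>\<^sup>+ s. (ennreal (p s / s) * indicator {0<..1} s + ennreal 4 * (ennreal (p s / s\<^sup>2) * indicator {1..} s)) \<partial>lborel)"
    proof (rule nn_integral_mono)
      fix s :: real
      consider "s \<le> 0 \<or> 4 < s" | "0 < s" "s \<le> 1" | "1 < s" "s \<le> 4" by linarith
      then show "ennreal (p s / s) * indicator {0<..4} s
        \<le> ennreal (p s / s) * indicator {0<..1} s + ennreal 4 * (ennreal (p s / s\<^sup>2) * indicator {1..} s)"
      proof cases
        case 3
        have "p s / s = p s * s / s\<^sup>2" using 3 by (simp add: power2_eq_square)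
        also have "\<dots> \<le> p s * 4 / s\<^sup>2" using 3 p0 by (intro divide_right_mono mult_left_mono) auto
        finally have "ennreal (p s / s) \<le> ennreal (4 * (p s / s\<^sup>2))" by (intro ennreal_leI) (simp add: mult.commute)
        also have "\<dots> = ennreal 4 * ennreal (p s / s\<^sup>2)" using p0 by (intro ennreal_mult) auto
        finally show ?thesis using 3 by (simp add: indicator_def)
      qed (auto simp: indicator_def)
    qed
    also have "\<dots> = (\<integral>\<^sup>+ s\<in>{0<..1}. ennreal (p s / s) \<partial>lborel) + ennreal 4 * (\<integral>\<^sup>+ s\<in>{1..}. ennreal (p s / s\<^sup>2) \<partial>lborel)"
      by (subst nn_integral_add) (auto simp: nn_integral_cmult)
    also have "\<dots> < \<infinity>" using j0 j1 by (simp add: ennreal_mult_less_top)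
    finally show ?thesis .
  qed
  have "weight k (\<lambda>s. p (4 * s))"
  proof
    show "mono (\<lambda>s. p (4 * s))" using pm by (auto simp: mono_def)
    show "k (2 * s * t) \<le> p (4 * s) * k t" if "0 < s" "0 < t" "t \<le> 2" for s t
    proof -
      have "k (2 * s * t) \<le> p (4 * s) * k (t / 2)" using ksc[of "t / 2" "4 * s"] that by (simp add: mult.assoc)
      also have "\<dots> \<le> p (4 * s) * k t" using that p0 monoD[OF km, of "t / 2" t] by (intro mult_left_mono) auto
      finally show ?thesis .
    qed
    show "(\<integral>\<^sup>+ s\<in>{0<..1}. ennreal (p (4 * s) / s) \<partial>lborel) < \<infinity>"
    proof -
      have "(\<integral>\<^sup>+ s\<in>{0<..4}. ennreal (p s / s) \<partial>lborel) = ennreal 4 * (\<integral>\<^sup>+ s. ennreal (p (0 + 4 * s) / (0 + 4 * s)) * indicator {0<..4} (0 + 4 * s) \<partial>lborel)"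
        by (subst nn_integral_real_affine[where c = 4 and t = 0]) auto
      also have "\<dots> = (\<integral>\<^sup>+ s. ennreal 4 * (ennreal (p (0 + 4 * s) / (0 + 4 * s)) * indicator {0<..4} (0 + 4 * s)) \<partial>lborel)"
        by (rule nn_integral_cmult[symmetric]) measurable
      also have "\<dots> = (\<integral>\<^sup>+ s\<in>{0<..1}. ennreal (p (4 * s) / s) \<partial>lborel)"
      proof (rule nn_integral_cong)
        fix s :: real
        have "ennreal 4 * ennreal (p (4 * s) / (4 * s)) = ennreal (p (4 * s) / s)" if "0 < s"
          using that p0 by (subst ennreal_mult[symmetric]) auto
        then show "ennreal 4 * (ennreal (p (0 + 4 * s) / (0 + 4 * s)) * indicator {0<..4} (0 + 4 * s)) = ennreal (p (4 * s) / s) * indicator {0<..1} s"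
          by (auto simp: indicator_def)
      qed
      finally show ?thesis using j4 by simp
    qed
    show "(\<integral>\<^sup>+ s\<in>{1..}. ennreal (p (4 * s) / s\<^sup>2) \<partial>lborel) < \<infinity>"
    proof -
      have "(\<integral>\<^sup>+ s\<in>{1..}. ennreal (p (4 * s) / s\<^sup>2) \<partial>lborel)
        \<le> (\<integral>\<^sup>+ s. ennreal 16 * (ennreal (p (0 + 4 * s) / (0 + 4 * s)\<^sup>2) * indicator {1..} (0 + 4 * s)) \<partial>lborel)"
      proof (rule nn_integral_mono)
        fix s :: real
        have "ennreal (p (4 * s) / s\<^sup>2) = ennreal 16 * ennreal (p (4 * s) / (4 * s)\<^sup>2)"
          using p0 by (subst ennreal_mult[symmetric]) (auto simp: power_mult_distrib)
        then show "ennreal (p (4 * s) / s\<^sup>2) * indicator {1..} s \<le> ennreal 16 * (ennreal (p (0 + 4 * s) / (0 + 4 * s)\<^sup>2) * indicator {1..} (0 + 4 * s))"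
          by (auto simp: indicator_def)
      qed
      also have "\<dots> = ennreal 16 * (\<integral>\<^sup>+ s. ennreal (p (0 + 4 * s) / (0 + 4 * s)\<^sup>2) * indicator {1..} (0 + 4 * s) \<partial>lborel)"
        by (rule nn_integral_cmult) measurable
      also have "\<dots> \<le> ennreal 16 * (ennreal 4 * (\<integral>\<^sup>+ s. ennreal (p (0 + 4 * s) / (0 + 4 * s)\<^sup>2) * indicator {1..} (0 + 4 * s) \<partial>lborel))"
        by (intro mult_left_mono) (auto intro: order.trans[OF eq_refl[OF mult_1_left[symmetric]] mult_right_mono])
      also have "ennreal 4 * (\<integral>\<^sup>+ s. ennreal (p (0 + 4 * s) / (0 + 4 * s)\<^sup>2) * indicator {1..} (0 + 4 * s) \<partial>lborel) = (\<integral>\<^sup>+ s\<in>{1..}. ennreal (p s / s\<^sup>2) \<partial>lborel)"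
        by (subst (2) nn_integral_real_affine[where c = 4 and t = 0]) auto
      finally show ?thesis using j1 by (simp add: ennreal_mult_less_top le_less_trans)
    qed
  qed (use k0 km p0 in auto)
  moreover have "k = (\<lambda>x. K (max 0 x))" by (auto simp: k_def)
  ultimately show ?thesis using that by blast
qed

section \<open>Oscillation over the disk\<close>

lemma pred_mem_ball [measurable]: "Measurable.pred borel (\<lambda>z::complex. z \<in> ball c r)"
proof -
  have "ball c r \<in> sets borel" by simp
  then show ?thesis by (simp add: pred_def)
qed

lemma norm_cis_minus_swap: "cmod (cis u - of_real r * cis t) = cmod (cis t - of_real r * cis u)"
proof -
  have "cis u - of_real r * cis t = cis u * cis t * cnj (cis t - of_real r * cis u)"
    by (simp add: cis_cnj algebra_simps cis_mult mult.left_commute[of "of_real r"])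
  then show ?thesis by (simp add: norm_mult del: complex_cnj_diff)
qed

text \<open>The kernel is symmetric in its two angles; after exchanging them the integral is that of
  a Poisson kernel over the circle.\<close>

lemma nn_integral_inverse_norm_square:
  assumes r: "0 < r" "r < 1"
  shows "(\<integral>\<^sup>+t\<in>{0..2*pi}. ennreal (1 / (cmod (cis u - of_real r * cis t))\<^sup>2) \<partial>lborel) = ennreal (2 * pi / (1 - r\<^sup>2))"
proof -
  have r2: "0 < 1 - r\<^sup>2" using r by (simp add: power_less_one_iff)
  have z: "cmod (of_real r * cis u) < 1" using r by (simp add: norm_mult)
  have e: "1 / (cmod (cis u - of_real r * cis t))\<^sup>2 = 1 / (1 - r\<^sup>2) * poisson_kernel (of_real r * cis u) t" for t
    using r r2 by (simp add: poisson_kernel_def norm_mult norm_cis_minus_swap[of u r t])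
  have "(\<integral>\<^sup>+t\<in>{0..2*pi}. ennreal (1 / (cmod (cis u - of_real r * cis t))\<^sup>2) \<partial>lborel)
    = (\<integral>\<^sup>+t. ennreal (1 / (1 - r\<^sup>2)) * ennreal (poisson_kernel (of_real r * cis u) t) \<partial>circ)"
    unfolding e using r2 poisson_kernel_nonneg[OF z]
    by (subst nn_integral_circ[symmetric]) (auto intro!: nn_integral_cong simp: ennreal_mult[symmetric])
  also have "\<dots> = ennreal (1 / (1 - r\<^sup>2)) * ennreal (2 * pi)"
    by (simp add: nn_integral_cmult integral_poisson_kernel[OF z])
  also have "\<dots> = ennreal (2 * pi / (1 - r\<^sup>2))" using r2 by (subst ennreal_mult[symmetric]) auto
  finally show ?thesis .
qed

text \<open>Two regimes. From d <= A + B the product of the two poles is bounded by 4 / d^2 times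
  their sum, which is efficient when 1 - r is below d. The other bound uses only A >= 1 - r and
  serves when 1 - r is above d.\<close>

lemma nn_integral_two_point_kernel:
  assumes r: "0 < r" "r < 1" and d: "0 < d" "d \<le> cmod (cis u - cis v)"
  shows "(\<integral>\<^sup>+t\<in>{0..2*pi}. ennreal (1 / ((cmod (cis u - of_real r * cis t))\<^sup>2 * (cmod (cis v - of_real r * cis t))\<^sup>2)) \<partial>lborel)
      \<le> ennreal (16 * pi / (d\<^sup>2 * (1 - r\<^sup>2)))"
    and "(\<integral>\<^sup>+t\<in>{0..2*pi}. ennreal (1 / ((cmod (cis u - of_real r * cis t))\<^sup>2 * (cmod (cis v - of_real r * cis t))\<^sup>2)) \<partial>lborel)
      \<le> ennreal (2 * pi / ((1 - r)\<^sup>2 * (1 - r\<^sup>2)))"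
proof -
  define A where "A t = cmod (cis u - of_real r * cis t)" for t
  define B where "B t = cmod (cis v - of_real r * cis t)" for t
  have r2: "0 < 1 - r\<^sup>2" using r by (simp add: power_less_one_iff)
  have A: "1 - r \<le> A t" and B: "1 - r \<le> B t" for t
    using norm_cis_minus_ge[of "of_real r * cis t" u] norm_cis_minus_ge[of "of_real r * cis t" v] r
    by (auto simp: A_def B_def norm_mult)
  have A0: "0 < A t" and B0: "0 < B t" for t using A[of t] B[of t] r by linarith+
  have [measurable]: "A \<in> borel_measurable borel" "B \<in> borel_measurable borel"
    unfolding A_def[abs_def] B_def[abs_def] by measurable
  have iA: "(\<integral>\<^sup>+t\<in>{0..2*pi}. ennreal (1 / (A t)\<^sup>2) \<partial>lborel) = ennreal (2 * pi / (1 - r\<^sup>2))"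
    and iB: "(\<integral>\<^sup>+t\<in>{0..2*pi}. ennreal (1 / (B t)\<^sup>2) \<partial>lborel) = ennreal (2 * pi / (1 - r\<^sup>2))"
    using nn_integral_inverse_norm_square[OF r] by (auto simp: A_def B_def)
  have "(\<integral>\<^sup>+t\<in>{0..2*pi}. ennreal (1 / ((A t)\<^sup>2 * (B t)\<^sup>2)) \<partial>lborel)
     \<le> (\<integral>\<^sup>+t. ennreal (4 / d\<^sup>2) * (ennreal (1 / (A t)\<^sup>2) * indicator {0..2*pi} t + ennreal (1 / (B t)\<^sup>2) * indicator {0..2*pi} t) \<partial>lborel)"
  proof (rule nn_integral_mono)
    fix t
    have dAB: "d \<le> A t + B t"
      using norm_triangle_ineq4[of "cis u - of_real r * cis t" "cis v - of_real r * cis t"] d(2) by (simp add: A_def B_def)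
    have "1 / ((A t)\<^sup>2 * (B t)\<^sup>2) \<le> 4 / d\<^sup>2 * (1 / (A t)\<^sup>2 + 1 / (B t)\<^sup>2)"
    proof -
      have "d\<^sup>2 \<le> (A t + B t)\<^sup>2" using dAB d(1) by (intro power_mono) auto
      also have "(A t + B t)\<^sup>2 = 2 * ((A t)\<^sup>2 + (B t)\<^sup>2) - (A t - B t)\<^sup>2"
        by (simp add: power2_eq_square algebra_simps)
      also have "\<dots> \<le> 4 * ((A t)\<^sup>2 + (B t)\<^sup>2)" by (smt (verit) zero_le_power2)
      finally have "d\<^sup>2 \<le> 4 * ((A t)\<^sup>2 + (B t)\<^sup>2)" .
      then have "1 \<le> 4 / d\<^sup>2 * ((A t)\<^sup>2 + (B t)\<^sup>2)" using d(1) by (simp add: field_simps)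
      then have "1 / ((A t)\<^sup>2 * (B t)\<^sup>2) \<le> 4 / d\<^sup>2 * ((A t)\<^sup>2 + (B t)\<^sup>2) / ((A t)\<^sup>2 * (B t)\<^sup>2)"
        by (intro divide_right_mono) auto
      also have "\<dots> = 4 / d\<^sup>2 * (1 / (A t)\<^sup>2 + 1 / (B t)\<^sup>2)"
        using A0[of t] B0[of t] by (simp add: field_simps)
      finally show ?thesis .
    qed
    then have "ennreal (1 / ((A t)\<^sup>2 * (B t)\<^sup>2)) \<le> ennreal (4 / d\<^sup>2 * (1 / (A t)\<^sup>2 + 1 / (B t)\<^sup>2))" by (rule ennreal_leI)
    also have "\<dots> = ennreal (4 / d\<^sup>2) * (ennreal (1 / (A t)\<^sup>2) + ennreal (1 / (B t)\<^sup>2))"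
      by (subst ennreal_mult, simp, simp, subst ennreal_plus, simp_all)
    finally show "ennreal (1 / ((A t)\<^sup>2 * (B t)\<^sup>2)) * indicator {0..2*pi} t
      \<le> ennreal (4 / d\<^sup>2) * (ennreal (1 / (A t)\<^sup>2) * indicator {0..2*pi} t + ennreal (1 / (B t)\<^sup>2) * indicator {0..2*pi} t)"
      by (auto simp: indicator_def)
  qed
  also have "\<dots> = ennreal (4 / d\<^sup>2) * (ennreal (2 * pi / (1 - r\<^sup>2)) + ennreal (2 * pi / (1 - r\<^sup>2)))"
    by (subst nn_integral_cmult, measurable, subst nn_integral_add) (auto simp: iA iB)
  also have "\<dots> = ennreal (4 / d\<^sup>2 * (2 * pi / (1 - r\<^sup>2) + 2 * pi / (1 - r\<^sup>2)))"
    using r2 by (subst ennreal_mult, simp, simp, subst ennreal_plus, simp_all)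
  also have "4 / d\<^sup>2 * (2 * pi / (1 - r\<^sup>2) + 2 * pi / (1 - r\<^sup>2)) = 16 * pi / (d\<^sup>2 * (1 - r\<^sup>2))"
  proof -
    have "4 / d\<^sup>2 * (2 * pi / x + 2 * pi / x) = 16 * pi / (d\<^sup>2 * x)" if "x \<noteq> 0" for x
      using that d by (simp add: field_simps)
    from this[of "1 - r\<^sup>2"] r2 show ?thesis by linarith
  qed
  finally show "(\<integral>\<^sup>+t\<in>{0..2*pi}. ennreal (1 / ((cmod (cis u - of_real r * cis t))\<^sup>2 * (cmod (cis v - of_real r * cis t))\<^sup>2)) \<partial>lborel)
      \<le> ennreal (16 * pi / (d\<^sup>2 * (1 - r\<^sup>2)))" by (simp add: A_def B_def)
  have "(\<integral>\<^sup>+t\<in>{0..2*pi}. ennreal (1 / ((A t)\<^sup>2 * (B t)\<^sup>2)) \<partial>lborel)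
     \<le> (\<integral>\<^sup>+t. ennreal (1 / (1 - r)\<^sup>2) * (ennreal (1 / (B t)\<^sup>2) * indicator {0..2*pi} t) \<partial>lborel)"
  proof (rule nn_integral_mono)
    fix t
    have "(1 - r)\<^sup>2 \<le> (A t)\<^sup>2" using A[of t] r by (intro power_mono) auto
    then have "1 / (A t)\<^sup>2 \<le> 1 / (1 - r)\<^sup>2" using A0[of t] r by (intro divide_left_mono) auto
    then have "1 / (A t)\<^sup>2 * (1 / (B t)\<^sup>2) \<le> 1 / (1 - r)\<^sup>2 * (1 / (B t)\<^sup>2)" by (intro mult_right_mono) auto
    then have "ennreal (1 / (A t)\<^sup>2 * (1 / (B t)\<^sup>2)) \<le> ennreal (1 / (1 - r)\<^sup>2 * (1 / (B t)\<^sup>2))" by (rule ennreal_leI)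
    also have "\<dots> = ennreal (1 / (1 - r)\<^sup>2) * ennreal (1 / (B t)\<^sup>2)" by (rule ennreal_mult) auto
    finally show "ennreal (1 / ((A t)\<^sup>2 * (B t)\<^sup>2)) * indicator {0..2*pi} t
      \<le> ennreal (1 / (1 - r)\<^sup>2) * (ennreal (1 / (B t)\<^sup>2) * indicator {0..2*pi} t)"
      by (auto simp: indicator_def)
  qed
  also have "\<dots> = ennreal (1 / (1 - r)\<^sup>2) * ennreal (2 * pi / (1 - r\<^sup>2))"
    by (subst nn_integral_cmult) (auto simp: iB)
  also have "\<dots> = ennreal (2 * pi / ((1 - r)\<^sup>2 * (1 - r\<^sup>2)))"
    using r2 by (subst ennreal_mult[symmetric]) auto
  finally show "(\<integral>\<^sup>+t\<in>{0..2*pi}. ennreal (1 / ((cmod (cis u - of_real r * cis t))\<^sup>2 * (cmod (cis v - of_real r * cis t))\<^sup>2)) \<partial>lborel)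
      \<le> ennreal (2 * pi / ((1 - r)\<^sup>2 * (1 - r\<^sup>2)))" by (simp add: A_def B_def)
qed

context weight
begin

definition C0 :: real where "C0 = 8 * pi * A0 + 6 * pi * A1"

lemma C0_nonneg: "0 \<le> C0" using A0(2) A1(2) by (simp add: C0_def)

text \<open>At radius exp(-s) and with delta the chord, K (1 - |z|^2) <= Phi (s / delta) K delta.
  The angular integral with its Jacobian is of order 1 / (delta^2 s) for s <= delta and 1 / (delta
  s^2) for s > delta; these are the two integrability conditions rescaled by delta.\<close>

lemma two_point_kernel_disk:
  assumes d: "0 < cmod (cis u - cis v)"
  shows "(\<integral>\<^sup>+z\<in>ball 0 1. ennreal (K (1 - (cmod z)\<^sup>2) / ((cmod (cis u - z))\<^sup>2 * (cmod (cis v - z))\<^sup>2)) \<partial>lborel)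
     \<le> ennreal (C0 * (K (cmod (cis u - cis v)) / (cmod (cis u - cis v))\<^sup>2))"
proof -
  define \<delta> where "\<delta> = cmod (cis u - cis v)"
  have \<delta>: "0 < \<delta>" "\<delta> \<le> 2" using d norm_cis_diff_le_2[of u v] by (auto simp: \<delta>_def)
  define Q where "Q r = (\<integral>\<^sup>+t\<in>{0..2*pi}. ennreal (1 / ((cmod (cis u - of_real r * cis t))\<^sup>2 * (cmod (cis v - of_real r * cis t))\<^sup>2)) \<partial>lborel)" for r :: real
  have "(\<integral>\<^sup>+z\<in>ball 0 1. ennreal (K (1 - (cmod z)\<^sup>2) / ((cmod (cis u - z))\<^sup>2 * (cmod (cis v - z))\<^sup>2)) \<partial>lborel)
    = (\<integral>\<^sup>+s\<in>{0<..}. (ennreal (exp (- 2 * s)) * (\<integral>\<^sup>+t\<in>{0..2*pi}. ennreal (K (1 - (cmod (of_real (exp (-s)) * cis t))\<^sup>2) /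
       ((cmod (cis u - of_real (exp (-s)) * cis t))\<^sup>2 * (cmod (cis v - of_real (exp (-s)) * cis t))\<^sup>2)) \<partial>lborel)) \<partial>lborel)"
    by (rule nn_integral_disk_polar) measurable
  also have "\<dots> = (\<integral>\<^sup>+s\<in>{0<..}. (ennreal (exp (- 2 * s)) * (ennreal (K (1 - exp (- 2 * s))) * Q (exp (-s)))) \<partial>lborel)"
  proof (rule nn_integral_cong)
    fix s :: real
    have "(exp (-s))\<^sup>2 = exp (- 2 * s)" by (simp add: power2_eq_square exp_add[symmetric])
    then have "(\<integral>\<^sup>+t\<in>{0..2*pi}. ennreal (K (1 - (cmod (of_real (exp (-s)) * cis t))\<^sup>2) /
       ((cmod (cis u - of_real (exp (-s)) * cis t))\<^sup>2 * (cmod (cis v - of_real (exp (-s)) * cis t))\<^sup>2)) \<partial>lborel)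
      = (\<integral>\<^sup>+t. ennreal (K (1 - exp (- 2 * s))) * (ennreal (1 / ((cmod (cis u - of_real (exp (-s)) * cis t))\<^sup>2 * (cmod (cis v - of_real (exp (-s)) * cis t))\<^sup>2)) * indicator {0..2*pi} t) \<partial>lborel)"
      by (intro nn_integral_cong) (simp add: norm_mult indicator_def ennreal_mult[symmetric] K_nonneg flip: exp_of_real)
    also have "\<dots> = ennreal (K (1 - exp (- 2 * s))) * Q (exp (-s))"
      unfolding Q_def by (rule nn_integral_cmult) measurable
    finally show "ennreal (exp (- 2 * s)) * (\<integral>\<^sup>+t\<in>{0..2*pi}. ennreal (K (1 - (cmod (of_real (exp (-s)) * cis t))\<^sup>2) /
       ((cmod (cis u - of_real (exp (-s)) * cis t))\<^sup>2 * (cmod (cis v - of_real (exp (-s)) * cis t))\<^sup>2)) \<partial>lborel) * indicator {0<..} s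
      = ennreal (exp (- 2 * s)) * (ennreal (K (1 - exp (- 2 * s))) * Q (exp (-s))) * indicator {0<..} s" by simp
  qed
  also have "\<dots> \<le> (\<integral>\<^sup>+s. (ennreal (8 * pi * K \<delta> / \<delta>\<^sup>2) * (ennreal (\<Phi> (1/\<delta> * s) / s) * indicator {0<..1/(1/\<delta>)} s)
      + ennreal (6 * pi * K \<delta> / \<delta>) * (ennreal (\<Phi> (1/\<delta> * s) / s\<^sup>2) * indicator {1/(1/\<delta>)..} s)) \<partial>lborel)"
  proof (rule nn_integral_mono)
    fix s :: real
    show "ennreal (exp (- 2 * s)) * (ennreal (K (1 - exp (- 2 * s))) * Q (exp (-s))) * indicator {0<..} s
      \<le> ennreal (8 * pi * K \<delta> / \<delta>\<^sup>2) * (ennreal (\<Phi> (1/\<delta> * s) / s) * indicator {0<..1/(1/\<delta>)} s)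
      + ennreal (6 * pi * K \<delta> / \<delta>) * (ennreal (\<Phi> (1/\<delta> * s) / s\<^sup>2) * indicator {1/(1/\<delta>)..} s)"
    proof (cases "0 < s")
      case s: True
      have r: "0 < exp (-s)" "exp (-s) < 1" using s by auto
      have r2: "(exp (-s))\<^sup>2 = exp (- 2 * s)" by (simp add: power2_eq_square exp_add[symmetric])
      define q where "q = 1 - exp (- 2 * s)"
      have q: "0 < q" using s by (simp add: q_def)
      have q2: "q \<le> 2 * s" using exp_ge_add_one_self[of "- 2 * s"] by (simp add: q_def)
      have "K q \<le> K (2 * s)" by (rule K_le[OF q2])
      also have "\<dots> \<le> \<Phi> (s / \<delta>) * K \<delta>" using \<delta> s by (intro K_double_le) auto
      finally have Kq: "K q \<le> \<Phi> (1/\<delta> * s) * K \<delta>" by simp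
      have eq: "exp (- 2 * s) / q \<le> 1 / (2 * s)"
      proof -
        have "1 + 2 * s \<le> exp (2 * s)" by (rule exp_ge_add_one_self)
        then have "2 * s \<le> exp (2 * s) - 1" by linarith
        moreover have "exp (- 2 * s) / q = 1 / (exp (2 * s) - 1)"
          using s by (simp add: q_def exp_minus field_simps)
        ultimately show ?thesis using s by (auto intro!: divide_left_mono)
      qed
      show ?thesis
      proof (cases "s \<le> \<delta>")
        case True
        have "Q (exp (-s)) \<le> ennreal (16 * pi / (\<delta>\<^sup>2 * q))"
          unfolding Q_def q_def using nn_integral_two_point_kernel(1)[OF r \<delta>(1), of u v] by (simp add: \<delta>_def r2)
        then have "ennreal (exp (- 2 * s)) * (ennreal (K q) * Q (exp (-s))) \<le> ennreal (exp (- 2 * s)) * (ennreal (K q) * ennreal (16 * pi / (\<delta>\<^sup>2 * q)))"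
          by (intro mult_left_mono) auto
        also have "\<dots> = ennreal (exp (- 2 * s) * (K q * (16 * pi / (\<delta>\<^sup>2 * q))))"
          using K_nonneg q by (simp add: ennreal_mult del: times_divide_eq_right)
        also have "\<dots> \<le> ennreal (8 * pi * K \<delta> / \<delta>\<^sup>2 * (\<Phi> (1/\<delta> * s) / s))"
        proof (rule ennreal_leI)
          have "exp (- 2 * s) * (K q * (16 * pi / (\<delta>\<^sup>2 * q))) = (exp (- 2 * s) / q) * K q * (16 * pi / \<delta>\<^sup>2)"
            by (simp add: field_simps)
          also have "\<dots> \<le> 1 / (2 * s) * (\<Phi> (1/\<delta> * s) * K \<delta>) * (16 * pi / \<delta>\<^sup>2)"
            using eq Kq K_nonneg s by (intro mult_right_mono mult_mono) auto
          also have "\<dots> = 8 * pi * K \<delta> / \<delta>\<^sup>2 * (\<Phi> (1/\<delta> * s) / s)" by (simp add: field_simps)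
          finally show "exp (- 2 * s) * (K q * (16 * pi / (\<delta>\<^sup>2 * q))) \<le> \<dots>" .
        qed
        also have "\<dots> = ennreal (8 * pi * K \<delta> / \<delta>\<^sup>2) * ennreal (\<Phi> (1/\<delta> * s) / s)"
          using K_nonneg Phi_nonneg s by (intro ennreal_mult) auto
        finally show ?thesis using True s by (simp add: q_def indicator_def add_increasing2)
      next
        case False
        have "Q (exp (-s)) \<le> ennreal (2 * pi / ((1 - exp (-s))\<^sup>2 * q))"
          unfolding Q_def q_def using nn_integral_two_point_kernel(2)[OF r \<delta>(1), of u v] by (simp add: \<delta>_def r2)
        then have "ennreal (exp (- 2 * s)) * (ennreal (K q) * Q (exp (-s))) \<le> ennreal (exp (- 2 * s)) * (ennreal (K q) * ennreal (2 * pi / ((1 - exp (-s))\<^sup>2 * q)))"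
          by (intro mult_left_mono) auto
        also have "\<dots> = ennreal (exp (- 2 * s) * (K q * (2 * pi / ((1 - exp (-s))\<^sup>2 * q))))"
          using K_nonneg q by (simp add: ennreal_mult del: times_divide_eq_right)
        also have "\<dots> \<le> ennreal (6 * pi * K \<delta> / \<delta> * (\<Phi> (1/\<delta> * s) / s\<^sup>2))"
        proof (rule ennreal_leI)
          have e1: "exp (- 2 * s) / (1 - exp (-s))\<^sup>2 \<le> 1 / s\<^sup>2"
          proof -
            have "s \<le> exp s - 1" using exp_ge_add_one_self[of s] by linarith
            then have "s\<^sup>2 \<le> (exp s - 1)\<^sup>2" using s by (intro power_mono) auto
            moreover have "exp (- 2 * s) / (1 - exp (-s))\<^sup>2 = 1 / (exp s - 1)\<^sup>2"
            proof -
              have "1 - exp (-s) = exp (-s) * (exp s - 1)" by (simp add: algebra_simps exp_add[symmetric])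
              then have "(1 - exp (-s))\<^sup>2 = exp (- 2 * s) * (exp s - 1)\<^sup>2" by (simp only: power_mult_distrib r2)
              then show ?thesis by simp
            qed
            ultimately show ?thesis using s by (auto intro!: divide_left_mono)
          qed
          \<comment> \<open>Here 1/q = 1 + exp(-2 s) / q, and delta <= 2 allows the constant 1 to be
            written as at most 2 / delta.\<close>
          have e2: "1 / q \<le> 3 / \<delta>"
          proof -
            have "1 / q = 1 + exp (- 2 * s) / q" using q by (simp add: q_def field_simps)
            also have "\<dots> \<le> 1 + 1 / (2 * s)" using eq by simp
            also have "\<dots> \<le> 2 / \<delta> + 1 / \<delta>"
            proof (rule add_mono)
              show "1 \<le> 2 / \<delta>" using \<delta> by simp
              show "1 / (2 * s) \<le> 1 / \<delta>" using \<delta> False by (intro divide_left_mono) auto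
            qed
            finally show ?thesis by simp
          qed
          have "exp (- 2 * s) * (K q * (2 * pi / ((1 - exp (-s))\<^sup>2 * q))) = (exp (- 2 * s) / (1 - exp (-s))\<^sup>2) * (1 / q) * K q * (2 * pi)"
            by (simp add: field_simps)
          also have "\<dots> \<le> 1 / s\<^sup>2 * (3 / \<delta>) * (\<Phi> (1/\<delta> * s) * K \<delta>) * (2 * pi)"
            using e1 e2 Kq K_nonneg s q \<delta> by (intro mult_right_mono mult_mono) auto
          also have "\<dots> = 6 * pi * K \<delta> / \<delta> * (\<Phi> (1/\<delta> * s) / s\<^sup>2)" by (simp add: field_simps)
          finally show "exp (- 2 * s) * (K q * (2 * pi / ((1 - exp (-s))\<^sup>2 * q))) \<le> \<dots>" .
        qed
        also have "\<dots> = ennreal (6 * pi * K \<delta> / \<delta>) * ennreal (\<Phi> (1/\<delta> * s) / s\<^sup>2)"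
          using K_nonneg Phi_nonneg s \<delta> by (intro ennreal_mult) auto
        finally show ?thesis using False s by (simp add: q_def indicator_def)
      qed
    qed (simp add: indicator_def)
  qed
  also have "\<dots> = ennreal (8 * pi * K \<delta> / \<delta>\<^sup>2) * ennreal A0 + ennreal (6 * pi * K \<delta> / \<delta>) * ennreal (1/\<delta> * A1)"
    using \<delta> Phi_integral_small[of "1/\<delta>"] Phi_integral_large[of "1/\<delta>"]
    by (subst nn_integral_add) (simp_all add: nn_integral_cmult)
  also have "\<dots> = ennreal (8 * pi * K \<delta> / \<delta>\<^sup>2 * A0 + 6 * pi * K \<delta> / \<delta> * (1/\<delta> * A1))"
    using K_nonneg[of \<delta>] A0(2) A1(2) \<delta>
    by (simp add: ennreal_mult[symmetric] ennreal_plus[symmetric] del: ennreal_plus)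
  also have "8 * pi * K \<delta> / \<delta>\<^sup>2 * A0 + 6 * pi * K \<delta> / \<delta> * (1/\<delta> * A1) = C0 * (K \<delta> / \<delta>\<^sup>2)"
    using \<delta> by (simp add: C0_def power2_eq_square field_simps)
  finally show ?thesis by (simp add: \<delta>_def)
qed

text \<open>The substitution by sigma_a centres the weight at the origin and moves the poles to the
  preimages u', v'. By the chordal identity the Jacobian and the pole factors leave a constant c
  independent of z.\<close>

lemma two_point_kernel_moebius:
  assumes a: "cmod a < 1" and d: "0 < cmod (cis u - cis v)"
  shows "(\<integral>\<^sup>+z\<in>ball 0 1. ennreal (K (1 - (cmod (disk_aut a z))\<^sup>2) / ((cmod (cis u - z))\<^sup>2 * (cmod (cis v - z))\<^sup>2)) \<partial>lborel)
     \<le> ennreal (C0 * (K (cmod (disk_aut a (cis u) - disk_aut a (cis v))) / (cmod (cis u - cis v))\<^sup>2))"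
proof -
  have "cmod (disk_aut a (cis u)) = 1" "cmod (disk_aut a (cis v)) = 1"
    using norm_disk_aut_circle[OF a] by auto
  then obtain u' v' where u': "disk_aut a (cis u) = cis u'" and v': "disk_aut a (cis v) = cis v'"
    by (metis cis_Arg_unique complex_norm_eq_1_exp cis_conv_exp)
  have su: "disk_aut a (cis u') = cis u" "disk_aut a (cis v') = cis v"
    using disk_aut_involution[OF a, of "cis u"] disk_aut_involution[OF a, of "cis v"] u' v' by auto
  define p where "p z = cmod (1 - cnj a * z)" for z
  have p0: "0 < p z" if "cmod z \<le> 1" for z using one_minus_cnj_mult_nonzero[OF a that] by (simp add: p_def)
  define A where "A = 1 - (cmod a)\<^sup>2"
  have A: "0 < A" using a by (simp add: A_def power_less_one_iff)
  define \<delta> where "\<delta> = cmod (cis u' - cis v')"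
  have d\<delta>: "cmod (cis u - cis v) = A * \<delta> / (p (cis u') * p (cis v'))"
    using norm_disk_aut_diff[OF a, of "cis u'" "cis v'"] su by (simp add: A_def \<delta>_def p_def)
  have \<delta>: "0 < \<delta>"
  proof (rule ccontr)
    assume "\<not> 0 < \<delta>"
    then have "\<delta> = 0" using norm_ge_zero[of "cis u' - cis v'"] unfolding \<delta>_def by linarith
    then show False using d d\<delta> by simp
  qed
  define c where "c = (p (cis u') * p (cis v'))\<^sup>2 / A\<^sup>2"
  have c0: "0 \<le> c" by (simp add: c_def)
  have "(\<integral>\<^sup>+z\<in>ball 0 1. ennreal (K (1 - (cmod (disk_aut a z))\<^sup>2) / ((cmod (cis u - z))\<^sup>2 * (cmod (cis v - z))\<^sup>2)) \<partial>lborel)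
    = (\<integral>\<^sup>+z\<in>ball 0 1. ennreal ((cmod (deriv (disk_aut a) z))\<^sup>2) * ennreal (K (1 - (cmod (disk_aut a (disk_aut a z)))\<^sup>2) / ((cmod (cis u - disk_aut a z))\<^sup>2 * (cmod (cis v - disk_aut a z))\<^sup>2)) \<partial>lborel)"
    by (rule nn_integral_disk_aut[OF a]) measurable
  also have "\<dots> = (\<integral>\<^sup>+z. ennreal c * (ennreal (K (1 - (cmod z)\<^sup>2) / ((cmod (cis u' - z))\<^sup>2 * (cmod (cis v' - z))\<^sup>2)) * indicator (ball 0 1) z) \<partial>lborel)"
  proof (rule nn_integral_cong)
    fix z :: complex
    show "ennreal ((cmod (deriv (disk_aut a) z))\<^sup>2) * ennreal (K (1 - (cmod (disk_aut a (disk_aut a z)))\<^sup>2) / ((cmod (cis u - disk_aut a z))\<^sup>2 * (cmod (cis v - disk_aut a z))\<^sup>2)) * indicator (ball 0 1) z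
      = ennreal c * (ennreal (K (1 - (cmod z)\<^sup>2) / ((cmod (cis u' - z))\<^sup>2 * (cmod (cis v' - z))\<^sup>2)) * indicator (ball 0 1) z)"
    proof (cases "cmod z < 1")
      case True
      define k where "k = K (1 - (cmod z)\<^sup>2)"
      have k0: "0 \<le> k" by (simp add: k_def K_nonneg)
      have dz: "cmod (deriv (disk_aut a) z) = A / (p z)\<^sup>2"
        using norm_deriv_disk_aut[OF a, of z] True by (simp add: A_def p_def)
      have uz: "cmod (cis u - disk_aut a z) = A * cmod (cis u' - z) / (p (cis u') * p z)"
        "cmod (cis v - disk_aut a z) = A * cmod (cis v' - z) / (p (cis v') * p z)"
        using norm_disk_aut_diff[OF a, of "cis u'" z] norm_disk_aut_diff[OF a, of "cis v'" z] True su
        by (simp_all add: A_def p_def)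
      have nz: "cmod (cis u' - z) \<noteq> 0" "cmod (cis v' - z) \<noteq> 0" using cis_neq[OF True] by auto
      have pz: "0 < p z" "0 < p (cis u')" "0 < p (cis v')" using p0 True by auto
      have "(A / (p z)\<^sup>2)\<^sup>2 * (k / ((A * cmod (cis u' - z) / (p (cis u') * p z))\<^sup>2 * (A * cmod (cis v' - z) / (p (cis v') * p z))\<^sup>2))
        = c * (k / ((cmod (cis u' - z))\<^sup>2 * (cmod (cis v' - z))\<^sup>2))"
        unfolding c_def using A pz nz by (simp add: field_simps power2_eq_square)
      then have "(cmod (deriv (disk_aut a) z))\<^sup>2 * (k / ((cmod (cis u - disk_aut a z))\<^sup>2 * (cmod (cis v - disk_aut a z))\<^sup>2))
        = c * (k / ((cmod (cis u' - z))\<^sup>2 * (cmod (cis v' - z))\<^sup>2))" by (simp only: dz uz)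
      then have "ennreal ((cmod (deriv (disk_aut a) z))\<^sup>2) * ennreal (k / ((cmod (cis u - disk_aut a z))\<^sup>2 * (cmod (cis v - disk_aut a z))\<^sup>2))
        = ennreal c * ennreal (k / ((cmod (cis u' - z))\<^sup>2 * (cmod (cis v' - z))\<^sup>2))"
        using k0 c0 by (subst (1 2) ennreal_mult[symmetric]) auto
      then show ?thesis using True disk_aut_involution[OF a, of z] by (simp add: k_def)
    qed (simp add: indicator_def)
  qed
  also have "\<dots> = ennreal c * (\<integral>\<^sup>+z\<in>ball 0 1. ennreal (K (1 - (cmod z)\<^sup>2) / ((cmod (cis u' - z))\<^sup>2 * (cmod (cis v' - z))\<^sup>2)) \<partial>lborel)"
    by (rule nn_integral_cmult) measurable
  also have "\<dots> \<le> ennreal c * ennreal (C0 * (K \<delta> / \<delta>\<^sup>2))"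
    using two_point_kernel_disk[of u' v'] \<delta> by (intro mult_left_mono) (auto simp: \<delta>_def)
  also have "\<dots> = ennreal (c * (C0 * (K \<delta> / \<delta>\<^sup>2)))"
    using c0 C0_nonneg K_nonneg by (intro ennreal_mult[symmetric]) auto
  also have "c * (C0 * (K \<delta> / \<delta>\<^sup>2)) = C0 * (K \<delta> / (cmod (cis u - cis v))\<^sup>2)"
    unfolding d\<delta> c_def using \<delta> A p0[of "cis u'"] p0[of "cis v'"] by (simp add: power_mult_distrib power_divide)
  finally show ?thesis by (simp add: u' v' \<delta>_def)
qed

interpretation lc: pair_sigma_finite "lborel :: complex measure" circ ..

text \<open>The two Poisson densities carry (1 - |z|^2)^2, which cancels the denominator exactly.
  Fubini then leaves the two-point kernel integral for each fixed pair of boundary points.\<close>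

lemma oscillation_disk_le:
  fixes F :: "complex \<Rightarrow> complex"
  assumes [measurable]: "(\<lambda>t. F (cis t)) \<in> borel_measurable borel" and a: "cmod a < 1"
  shows "(\<integral>\<^sup>+z\<in>ball 0 1. (\<integral>\<^sup>+u. \<integral>\<^sup>+v. ennreal ((cmod (F (cis u) - F (cis v)))\<^sup>2) \<partial>pmeasure z \<partial>pmeasure z)
        * ennreal (K (1 - (cmod (disk_aut a z))\<^sup>2) / (1 - (cmod z)\<^sup>2)\<^sup>2) \<partial>lborel)
    \<le> ennreal (C0 / (4 * pi\<^sup>2)) * (\<integral>\<^sup>+u. \<integral>\<^sup>+v. ennreal ((cmod (F (cis u) - F (cis v)))\<^sup>2 / (cmod (cis u - cis v))\<^sup>2
          * K (cmod (disk_aut a (cis u) - disk_aut a (cis v)))) \<partial>circ \<partial>circ)"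
proof -
  define D where "D u v = (cmod (F (cis u) - F (cis v)))\<^sup>2" for u v
  have Dm [measurable]: "(\<lambda>x. D (f x) (g x)) \<in> borel_measurable M"
    if [measurable]: "f \<in> borel_measurable M" "g \<in> borel_measurable M" for f g and M :: "'x measure"
  proof -
    have "(\<lambda>x. F (cis (f x))) \<in> borel_measurable M" "(\<lambda>x. F (cis (g x))) \<in> borel_measurable M"
      using measurable_compose[OF that(1) assms(1)] measurable_compose[OF that(2) assms(1)] by auto
    then show ?thesis unfolding D_def by measurable
  qed
  \<comment> \<open>The disk is built into the weight so that w is jointly measurable in z, u and
    v.\<close>
  define w where "w z u v = K (1 - (cmod (disk_aut a z))\<^sup>2) / ((cmod (cis u - z))\<^sup>2 * (cmod (cis v - z))\<^sup>2) * (if cmod z < 1 then 1 else 0)" for z u v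
  have w0: "0 \<le> w z u v" for z u v by (simp add: w_def K_nonneg)
  have wm [measurable]: "(\<lambda>x. w (h x) (f x) (g x)) \<in> borel_measurable M"
    if [measurable]: "h \<in> borel_measurable M" "f \<in> borel_measurable M" "g \<in> borel_measurable M" for f g h and M :: "'x measure"
    unfolding w_def by measurable
  have D0: "0 \<le> D u v" for u v by (simp add: D_def)
  have "(\<integral>\<^sup>+z\<in>ball 0 1. (\<integral>\<^sup>+u. \<integral>\<^sup>+v. ennreal (D u v) \<partial>pmeasure z \<partial>pmeasure z)
        * ennreal (K (1 - (cmod (disk_aut a z))\<^sup>2) / (1 - (cmod z)\<^sup>2)\<^sup>2) \<partial>lborel)
     = (\<integral>\<^sup>+z. \<integral>\<^sup>+u. \<integral>\<^sup>+v. ennreal (D u v / (4 * pi\<^sup>2)) * ennreal (w z u v) \<partial>circ \<partial>circ \<partial>lborel)"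
  proof (rule nn_integral_cong)
    fix z :: complex
    show "(\<integral>\<^sup>+u. \<integral>\<^sup>+v. ennreal (D u v) \<partial>pmeasure z \<partial>pmeasure z)
        * ennreal (K (1 - (cmod (disk_aut a z))\<^sup>2) / (1 - (cmod z)\<^sup>2)\<^sup>2) * indicator (ball 0 1) z
      = (\<integral>\<^sup>+u. \<integral>\<^sup>+v. ennreal (D u v / (4 * pi\<^sup>2)) * ennreal (w z u v) \<partial>circ \<partial>circ)"
    proof (cases "cmod z < 1")
      case False
      then show ?thesis by (simp add: w_def indicator_def)
    next
      case True
      define k where "k = K (1 - (cmod (disk_aut a z))\<^sup>2) / (1 - (cmod z)\<^sup>2)\<^sup>2"
      have k0: "0 \<le> k" by (simp add: k_def K_nonneg)
      have z2: "1 - (cmod z)\<^sup>2 \<noteq> 0" using True by (simp add: power2_eq_1_iff) (smt (verit) norm_ge_zero)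
      define P where "P t = poisson_kernel z t / (2*pi)" for t
      have [measurable]: "P \<in> borel_measurable borel" unfolding P_def[abs_def] by measurable
      have P0: "0 \<le> P t" for t using poisson_kernel_nonneg[OF True] by (simp add: P_def)
      have "(\<integral>\<^sup>+u. \<integral>\<^sup>+v. ennreal (D u v) \<partial>pmeasure z \<partial>pmeasure z) * ennreal k
         = (\<integral>\<^sup>+u. ennreal (P u) * (\<integral>\<^sup>+v. ennreal (P v) * ennreal (D u v) \<partial>circ) \<partial>circ) * ennreal k"
        by (simp add: nn_integral_pmeasure P_def)
      also have "\<dots> = (\<integral>\<^sup>+u. \<integral>\<^sup>+v. ennreal k * (ennreal (P u) * (ennreal (P v) * ennreal (D u v))) \<partial>circ \<partial>circ)"
        by (simp add: nn_integral_cmult mult.commute[of _ "ennreal k"])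
      also have "\<dots> = (\<integral>\<^sup>+u. \<integral>\<^sup>+v. ennreal (D u v / (4 * pi\<^sup>2)) * ennreal (w z u v) \<partial>circ \<partial>circ)"
      proof (intro nn_integral_cong)
        fix u v
        have "k * (P u * (P v * D u v)) = D u v / (4 * pi\<^sup>2) * w z u v"
        proof -
          have "\<kappa> / x\<^sup>2 * (x / y / (2*pi) * (x / y' / (2*pi) * d)) = d / (4 * pi\<^sup>2) * (\<kappa> / (y * y'))"
            if "x \<noteq> 0" for \<kappa> x y y' d :: real
            using that by (simp add: power2_eq_square mult_ac)
          from this[OF z2] show ?thesis using True by (simp add: k_def P_def w_def poisson_kernel_def)
        qed
        then show "ennreal k * (ennreal (P u) * (ennreal (P v) * ennreal (D u v))) = ennreal (D u v / (4 * pi\<^sup>2)) * ennreal (w z u v)"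
          using k0 P0 D0 w0 by (simp add: ennreal_mult[symmetric] del: times_divide_eq_left)
      qed
      finally show ?thesis using True by (simp add: k_def)
    qed
  qed
  also have "\<dots> = (\<integral>\<^sup>+u. \<integral>\<^sup>+z. \<integral>\<^sup>+v. ennreal (D u v / (4 * pi\<^sup>2)) * ennreal (w z u v) \<partial>circ \<partial>lborel \<partial>circ)"
    by (rule lc.Fubini'[symmetric]) measurable
  also have "\<dots> = (\<integral>\<^sup>+u. \<integral>\<^sup>+v. \<integral>\<^sup>+z. ennreal (D u v / (4 * pi\<^sup>2)) * ennreal (w z u v) \<partial>lborel \<partial>circ \<partial>circ)"
    by (intro nn_integral_cong lc.Fubini'[symmetric]) measurable
  also have "\<dots> \<le> (\<integral>\<^sup>+u. \<integral>\<^sup>+v. ennreal (C0 / (4 * pi\<^sup>2)) * ennreal (D u v / (cmod (cis u - cis v))\<^sup>2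
          * K (cmod (disk_aut a (cis u) - disk_aut a (cis v)))) \<partial>circ \<partial>circ)"
  proof (intro nn_integral_mono)
    fix u v
    let ?k = "K (cmod (disk_aut a (cis u) - disk_aut a (cis v)))"
    show "(\<integral>\<^sup>+z. ennreal (D u v / (4 * pi\<^sup>2)) * ennreal (w z u v) \<partial>lborel) \<le> ennreal (C0 / (4 * pi\<^sup>2)) * ennreal (D u v / (cmod (cis u - cis v))\<^sup>2 * ?k)"
    proof (cases "cis u = cis v")
      case True
      then show ?thesis by (simp add: D_def)
    next
      case False
      have "(\<integral>\<^sup>+z. ennreal (D u v / (4 * pi\<^sup>2)) * ennreal (w z u v) \<partial>lborel) = ennreal (D u v / (4 * pi\<^sup>2)) * (\<integral>\<^sup>+z. ennreal (w z u v) \<partial>lborel)"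
        by (rule nn_integral_cmult) measurable
      also have "(\<integral>\<^sup>+z. ennreal (w z u v) \<partial>lborel) = (\<integral>\<^sup>+z\<in>ball 0 1. ennreal (K (1 - (cmod (disk_aut a z))\<^sup>2) / ((cmod (cis u - z))\<^sup>2 * (cmod (cis v - z))\<^sup>2)) \<partial>lborel)"
        by (intro nn_integral_cong) (simp add: w_def indicator_def)
      also have "ennreal (D u v / (4 * pi\<^sup>2)) * \<dots> \<le> ennreal (D u v / (4 * pi\<^sup>2)) * ennreal (C0 * (?k / (cmod (cis u - cis v))\<^sup>2))"
        using False by (intro mult_left_mono two_point_kernel_moebius a) auto
      also have "\<dots> = ennreal (D u v / (4 * pi\<^sup>2) * (C0 * (?k / (cmod (cis u - cis v))\<^sup>2)))"
        using D0 C0_nonneg K_nonneg by (intro ennreal_mult[symmetric]) auto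
      also have "D u v / (4 * pi\<^sup>2) * (C0 * (?k / (cmod (cis u - cis v))\<^sup>2)) = C0 / (4 * pi\<^sup>2) * (D u v / (cmod (cis u - cis v))\<^sup>2 * ?k)"
        by (simp add: mult_ac)
      also have "ennreal \<dots> = ennreal (C0 / (4 * pi\<^sup>2)) * ennreal (D u v / (cmod (cis u - cis v))\<^sup>2 * ?k)"
        using D0 C0_nonneg K_nonneg by (intro ennreal_mult) auto
      finally show ?thesis .
    qed
  qed
  also have "\<dots> = ennreal (C0 / (4 * pi\<^sup>2)) * (\<integral>\<^sup>+u. \<integral>\<^sup>+v. ennreal (D u v / (cmod (cis u - cis v))\<^sup>2
          * K (cmod (disk_aut a (cis u) - disk_aut a (cis v)))) \<partial>circ \<partial>circ)"
    by (simp add: nn_integral_cmult)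
  finally show ?thesis by (simp add: D_def)
qed

end

section \<open>From arcs to the conformally invariant double integral\<close>

lemma dyadic_bracket:
  fixes x :: real
  assumes "0 < x" "x \<le> 1"
  obtains N :: nat where "1 / 2 ^ (N + 1) < x" "x \<le> 1 / 2 ^ N"
proof -
  obtain k where "(1/2::real) ^ k < x" using real_arch_pow_inv[of x "1/2"] assms by auto
  then have "1 / 2 ^ (k + 1) < x" using assms by (simp add: power_one_over field_simps)
  then obtain N where N: "1 / 2 ^ (N + 1) < x" "\<And>j. j < N \<Longrightarrow> \<not> 1 / 2 ^ (j + 1) < x"
    using exists_least_iff[of "\<lambda>k. 1 / 2 ^ (k + 1) < x"] by auto
  have "x \<le> 1 / 2 ^ N" using N(2)[of "N - 1"] assms by (cases N) auto
  then show ?thesis using that N(1) by blast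
qed

text \<open>The comparison of |1 - rho cis s| with (1 - rho) + |s|; the missing lower bound by 1 -
  rho is \<open>norm_one_minus_cnj_mult_ge\<close>.\<close>

lemma norm_one_minus_cis_bounds:
  assumes "0 \<le> \<rho>" "\<rho> \<le> 1"
  shows "cmod (1 - of_real \<rho> * cis s) \<le> (1 - \<rho>) + \<bar>s\<bar>"
    and "\<bar>s\<bar> \<le> pi \<Longrightarrow> \<bar>s\<bar> / 4 \<le> cmod (1 - of_real \<rho> * cis s)"
proof -
  have d: "1 - of_real \<rho> * cis s = (1 - cis s) + of_real (1 - \<rho>) * cis s" by (simp add: algebra_simps)
  have n: "cmod (of_real (1 - \<rho>) * cis s) = 1 - \<rho>" using assms by (simp add: norm_mult del: of_real_diff)
  have "cmod (1 - of_real \<rho> * cis s) \<le> cmod (1 - cis s) + (1 - \<rho>)"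
    unfolding d using norm_triangle_ineq[of "1 - cis s" "of_real (1 - \<rho>) * cis s"] n by simp
  also have "cmod (1 - cis s) \<le> \<bar>s\<bar>" using norm_cis_diff_le[of 0 s] by simp
  finally show "cmod (1 - of_real \<rho> * cis s) \<le> (1 - \<rho>) + \<bar>s\<bar>" by simp
  assume "\<bar>s\<bar> \<le> pi"
  then have "\<bar>s\<bar> / 2 \<le> cmod (1 - cis s)" using norm_cis_diff_ge[of s 0] by (simp add: norm_minus_commute)
  also have "\<dots> \<le> cmod (1 - of_real \<rho> * cis s) + (1 - \<rho>)"
    using norm_triangle_ineq4[of "1 - of_real \<rho> * cis s" "of_real (1 - \<rho>) * cis s"] n d by (simp add: algebra_simps)
  also have "1 - \<rho> \<le> cmod (1 - of_real \<rho> * cis s)"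
    using norm_triangle_ineq2[of 1 "of_real \<rho> * cis s"] assms by (simp add: norm_mult)
  finally show "\<bar>s\<bar> / 4 \<le> cmod (1 - of_real \<rho> * cis s)" by simp
qed

lemma one_minus_cnj_cis: "1 - cnj (of_real \<rho> * cis \<alpha>) * cis v = 1 - of_real \<rho> * cis (v - \<alpha>)"
  by (simp add: cis_cnj cis_mult mult.assoc)

lemma norm_one_minus_cnj_cis_bounds:
  assumes a: "cmod a < 1"
  shows "cmod (1 - cnj a * cis v) \<le> (1 - cmod a) + \<bar>v - Arg a\<bar>"
    and "\<bar>v - Arg a\<bar> \<le> pi \<Longrightarrow> \<bar>v - Arg a\<bar> / 4 \<le> cmod (1 - cnj a * cis v)"
proof -
  have "a = of_real (cmod a) * cis (Arg a)" using rcis_cmod_Arg[of a] by (simp add: rcis_def)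
  then have e: "1 - cnj a * cis v = 1 - of_real (cmod a) * cis (v - Arg a)" by (metis one_minus_cnj_cis)
  show "cmod (1 - cnj a * cis v) \<le> (1 - cmod a) + \<bar>v - Arg a\<bar>"
    and "\<bar>v - Arg a\<bar> \<le> pi \<Longrightarrow> \<bar>v - Arg a\<bar> / 4 \<le> cmod (1 - cnj a * cis v)"
    unfolding e using norm_one_minus_cis_bounds[of "cmod a" "v - Arg a"] a by auto
qed

text \<open>Young's inequality for a finite convolution. It sums the far pairs, where
  \<open>\<Phi>\<close> is summable in m and the chain estimate in n - m.\<close>

lemma sum_convolution_le:
  fixes x y :: "nat \<Rightarrow> real"
  assumes "\<And>n. 0 \<le> x n" "\<And>n. 0 \<le> y n" and X: "(\<Sum>n\<le>N. x n) \<le> X" and Y: "\<And>M. (\<Sum>n\<le>M. y n) \<le> Y"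
  shows "(\<Sum>n\<le>N. \<Sum>m\<le>n. x m * y (n - m)) \<le> X * Y"
proof -
  have "(\<Sum>n\<le>N. \<Sum>m\<le>n. x m * y (n - m)) = (\<Sum>n\<le>N. \<Sum>m\<le>N. if m \<le> n then x m * y (n - m) else 0)"
    by (intro sum.cong refl sum.mono_neutral_cong_left) auto
  also have "\<dots> = (\<Sum>m\<le>N. \<Sum>n\<le>N. if m \<le> n then x m * y (n - m) else 0)" by (rule sum.swap)
  also have "\<dots> \<le> (\<Sum>m\<le>N. x m * Y)"
  proof (rule sum_mono)
    fix m assume "m \<in> {..N}"
    have "(\<Sum>n\<le>N. if m \<le> n then x m * y (n - m) else 0) = (\<Sum>n=m..N. x m * y (n - m))"
      by (intro sum.mono_neutral_cong_right) auto
    also have "\<dots> = x m * (\<Sum>k\<le>N - m. y k)"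
      unfolding sum_distrib_left[symmetric] using \<open>m \<in> {..N}\<close>
      by (intro arg_cong2[where f = "(*)"] refl sum.reindex_bij_witness[of _ "\<lambda>k. k + m" "\<lambda>n. n - m"]) auto
    also have "\<dots> \<le> x m * Y" by (intro mult_left_mono Y assms)
    finally show "(\<Sum>n\<le>N. if m \<le> n then x m * y (n - m) else 0) \<le> x m * Y" .
  qed
  also have "\<dots> = (\<Sum>m\<le>N. x m) * Y" by (simp add: sum_distrib_right)
  also have "\<dots> \<le> X * Y" using X Y[of 0] assms(2)[of 0] by (intro mult_right_mono) auto
  finally show ?thesis .
qed

context weight
begin

text \<open>Monotonicity bounds Phi s by the values on [s, 2 s], and the tail integral over that
  interval gives linear growth. The quadratic form matches the t^-2 needed in
  \<open>K_one_le\<close>.\<close>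

lemma Phi_quadratic:
  assumes s: "1/2 \<le> s"
  shows "\<Phi> s \<le> 16 * A1 * s\<^sup>2"
proof -
  have lin: "\<Phi> s \<le> 4 * A1 * s" if s: "1 \<le> s" for s
  proof -
    have "ennreal (\<Phi> s / (4 * s)) = (\<integral>\<^sup>+x. ennreal (\<Phi> s / (2 * s)\<^sup>2) * indicator {s..2 * s} x \<partial>lborel)"
      using s Phi_nonneg by (simp add: nn_integral_cmult_indicator ennreal_mult[symmetric] power2_eq_square)
    also have "\<dots> \<le> (\<integral>\<^sup>+x\<in>{1..}. ennreal (\<Phi> x / x\<^sup>2) \<partial>lborel)"
    proof (rule nn_integral_mono)
      fix x :: real
      show "ennreal (\<Phi> s / (2 * s)\<^sup>2) * indicator {s..2 * s} x \<le> ennreal (\<Phi> x / x\<^sup>2) * indicator {1..} x"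
      proof (cases "x \<in> {s..2 * s}")
        case True
        then have "\<Phi> s / (2 * s)\<^sup>2 \<le> \<Phi> x / x\<^sup>2"
          using s Phi_nonneg by (intro frac_le Phi_le power_mono) auto
        then show ?thesis using True s by (auto simp: indicator_def intro: ennreal_leI)
      qed simp
    qed
    also have "\<dots> = ennreal A1" by (rule A1(1))
    finally have "\<Phi> s / (4 * s) \<le> A1" using A1(2) by (simp add: ennreal_le_iff)
    then show ?thesis using s by (simp add: field_simps)
  qed
  show ?thesis
  proof (cases "1 \<le> s")
    case True
    have "\<Phi> s \<le> 4 * A1 * s" by (rule lin[OF True])
    also have "\<dots> \<le> 16 * A1 * s\<^sup>2" using True A1(2) by (simp add: power2_eq_square mult_mono)
    finally show ?thesis .
  next
    case False
    have "(1/2)\<^sup>2 \<le> s\<^sup>2" using s by (intro power_mono) auto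
    then have "1 \<le> 4 * s\<^sup>2" by (simp add: power2_eq_square)
    have "\<Phi> s \<le> \<Phi> 1" using False by (intro Phi_le) auto
    also have "\<dots> \<le> 4 * A1 * 1" by (rule lin) simp
    also have "\<dots> \<le> 4 * A1 * (4 * s\<^sup>2)" using \<open>1 \<le> 4 * s\<^sup>2\<close> A1(2) by (intro mult_left_mono) auto
    finally show ?thesis by simp
  qed
qed

text \<open>This lets the weighted arc condition control plain mean oscillation over the arc, t
  being chord over arc length. It is \<open>scale\<close> with s = 1/(2 t) combined with quadratic
  growth.\<close>

lemma K_one_le:
  assumes t: "0 < t" "t \<le> 1"
  shows "K 1 \<le> 4 * A1 * (K t / t\<^sup>2)"
proof -
  have "K 1 = K (2 * (1 / (2 * t)) * t)" using t by simp
  also have "\<dots> \<le> \<Phi> (1 / (2 * t)) * K t" using t by (intro scale) auto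
  also have "\<dots> \<le> 16 * A1 * (1 / (2 * t))\<^sup>2 * K t"
    using t by (intro mult_right_mono Phi_quadratic K_nonneg) (simp add: field_simps)
  also have "\<dots> = 4 * A1 * (K t / t\<^sup>2)" by (simp add: power2_eq_square)
  finally show ?thesis .
qed

text \<open>As 2048 = 2^11, the twelve terms n = 0..11 have arguments at least 1 and are bounded by
  Phi 2048; the remaining arguments are 1/2, 1/4, ... and cost 2 A0.\<close>

definition S1 :: real where "S1 = 12 * \<Phi> 2048 + 2 * A0"

lemma S1_nonneg: "0 \<le> S1" using Phi_nonneg A0(2) by (simp add: S1_def)

text \<open>On a dyadic interval (b/2, b] monotonicity gives Phi s / s >= Phi (b/2) / b, so that
  piece of the integral is at least half of the term Phi (b/2).\<close>

lemma Phi_dyadic_small: "(\<Sum>j<M. \<Phi> (1 / 2 ^ (j + 1))) \<le> 2 * A0"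
proof -
  have "ennreal ((\<Sum>j<M. \<Phi> (1 / 2 ^ (j + 1))) / 2) \<le> (\<integral>\<^sup>+s\<in>{1/2^M<..1}. ennreal (\<Phi> s / s) \<partial>lborel)" for M
  proof (induction M)
    case (Suc M)
    let ?b = "(1::real) / 2 ^ M"
    have b: "0 < ?b" "?b \<le> 1" by auto
    have "ennreal (\<Phi> (?b / 2) / 2) = (\<integral>\<^sup>+s. ennreal (\<Phi> (?b / 2) / ?b) * indicator {?b/2<..?b} s \<partial>lborel)"
    proof -
      have "ennreal (\<Phi> (b / 2) / 2) = (\<integral>\<^sup>+s. ennreal (\<Phi> (b / 2) / b) * indicator {b/2<..b} s \<partial>lborel)" if "0 < b" for b
        using that Phi_nonneg by (simp add: nn_integral_cmult_indicator ennreal_mult[symmetric])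
      from this[OF b(1)] show ?thesis .
    qed
    also have "\<dots> \<le> (\<integral>\<^sup>+s\<in>{?b/2<..?b}. ennreal (\<Phi> s / s) \<partial>lborel)"
    proof (rule nn_integral_mono)
      fix s :: real
      show "ennreal (\<Phi> (?b / 2) / ?b) * indicator {?b/2<..?b} s \<le> ennreal (\<Phi> s / s) * indicator {?b/2<..?b} s"
      proof (cases "s \<in> {?b/2<..?b}")
        case True
        have "0 < ?b / 2" by simp
        also have "\<dots> < s" using True by (simp only: greaterThanAtMost_iff)
        finally have s0: "0 < s" .
        have "\<Phi> (?b / 2) / ?b \<le> \<Phi> s / s"
          using True s0 Phi_nonneg by (intro frac_le Phi_le) auto
        then show ?thesis by (auto simp: indicator_def intro: ennreal_leI)
      qed simp
    qed
    finally have 1: "ennreal (\<Phi> (?b / 2) / 2) \<le> (\<integral>\<^sup>+s\<in>{?b/2<..?b}. ennreal (\<Phi> s / s) \<partial>lborel)" .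
    have "ennreal ((\<Sum>j<Suc M. \<Phi> (1 / 2 ^ (j + 1))) / 2) = ennreal ((\<Sum>j<M. \<Phi> (1 / 2 ^ (j + 1))) / 2) + ennreal (\<Phi> (?b / 2) / 2)"
      using Phi_nonneg by (subst ennreal_plus[symmetric]) (auto simp: sum_nonneg add_divide_distrib mult.commute)
    also have "\<dots> \<le> (\<integral>\<^sup>+s\<in>{?b<..1}. ennreal (\<Phi> s / s) \<partial>lborel) + (\<integral>\<^sup>+s\<in>{?b/2<..?b}. ennreal (\<Phi> s / s) \<partial>lborel)"
      by (intro add_mono Suc 1)
    also have "\<dots> = (\<integral>\<^sup>+s. (ennreal (\<Phi> s / s) * indicator {?b<..1} s + ennreal (\<Phi> s / s) * indicator {?b/2<..?b} s) \<partial>lborel)"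
      by (rule nn_integral_add[symmetric]) measurable
    also have "\<dots> = (\<integral>\<^sup>+s\<in>{?b/2<..1}. ennreal (\<Phi> s / s) \<partial>lborel)"
    proof (rule nn_integral_cong)
      fix s :: real
      have "(indicator {b<..1} s + indicator {b/2<..b} s :: ennreal) = indicator {b/2<..1} s"
        if "0 < b" "b \<le> 1" for b :: real using that by (auto simp: indicator_def)
      from this[OF b] show "ennreal (\<Phi> s / s) * indicator {?b<..1} s + ennreal (\<Phi> s / s) * indicator {?b/2<..?b} s = ennreal (\<Phi> s / s) * indicator {?b/2<..1} s"
        by (simp only: distrib_left[symmetric])
    qed
    finally show ?case by (simp add: mult.commute)
  qed simp
  also have "(\<integral>\<^sup>+s\<in>{1/2^M<..1}. ennreal (\<Phi> s / s) \<partial>lborel) \<le> (\<integral>\<^sup>+s\<in>{0<..1}. ennreal (\<Phi> s / s) \<partial>lborel)"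
  proof (intro nn_integral_mono mult_left_mono)
    fix s :: real
    have "0 < (1::real) / 2 ^ M" by simp
    then have "s \<in> {1/2^M<..1} \<Longrightarrow> s \<in> {0<..1}" by (meson greaterThanAtMost_iff less_trans)
    then show "(indicator {1/2^M<..1} s :: ennreal) \<le> indicator {0<..1} s"
      unfolding indicator_def by (auto simp del: greaterThanAtMost_iff)
  qed simp
  also have "\<dots> = ennreal A0" by (rule A0(1))
  finally show ?thesis using A0(2) by (simp add: ennreal_le_iff)
qed

lemma Phi_dyadic_sum: "(\<Sum>n\<le>N. \<Phi> (2048 / 2 ^ n)) \<le> S1"
proof -
  have split: "(\<Sum>n<m+k. g n) = (\<Sum>n<m. g n) + (\<Sum>n<k. g (m+n))" for g :: "nat \<Rightarrow> real" and m k
    by (induction k) (auto simp: add.assoc)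
  have "(\<Sum>n\<le>N. \<Phi> (2048 / 2 ^ n)) \<le> (\<Sum>n<12 + (N + 1). \<Phi> (2048 / 2 ^ n))"
    by (rule sum_mono2) (auto simp: Phi_nonneg)
  also have "\<dots> = (\<Sum>n<12. \<Phi> (2048 / 2 ^ n)) + (\<Sum>j<N+1. \<Phi> (2048 / 2 ^ (12 + j)))" by (rule split)
  also have "(\<Sum>j<N+1. \<Phi> (2048 / 2 ^ (12 + j))) = (\<Sum>j<N+1. \<Phi> (1 / 2 ^ (j + 1)))"
    by (intro sum.cong) (auto simp: power_add)
  also have "\<dots> \<le> 2 * A0" by (rule Phi_dyadic_small)
  also have "(\<Sum>n<12::nat. \<Phi> (2048 / 2 ^ n)) \<le> of_nat (card {..<12::nat}) * \<Phi> 2048"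
    by (rule sum_bounded_above) (auto intro!: Phi_le simp: field_simps)
  finally show ?thesis by (simp add: S1_def)
qed

text \<open>425984 = 26624 * 4 * 4: the far pairs give 26624, the geometric series of ratio 3/4
  gives 4, and \<open>K_one_le\<close> gives the other 4.\<close>

definition C2 :: real where "C2 = S1 * (1 + 425984 * A1)"

text \<open>The arcs \<open>I n\<close> are centred at \<open>a/\<bar>a\<bar>\<close> and have length \<open>l n\<close>, comparable to \<open>2^n (1 - \<bar>a\<bar>)\<close>;
  \<open>I N\<close> is the whole circle. A pair of points whose distances to the centre are comparable is
  controlled by the hypothesis on one arc. For the other pairs \<open>F u - F v\<close> is compared along the
  chain of arcs in between, as for functions of bounded mean oscillation.\<close>

theorem moebius_double_integral_le:
  fixes F :: "complex \<Rightarrow> complex"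
  assumes Fm: "(\<lambda>t. F (cis t)) \<in> borel_measurable borel" and a: "cmod a < 1" and B0: "0 \<le> B"
    and B: "\<And>t l. 0 < l \<Longrightarrow> l \<le> 2*pi \<Longrightarrow> (\<integral>\<^sup>+u\<in>{t..t+l}. \<integral>\<^sup>+v\<in>{t..t+l}.
      ennreal ((cmod (F (cis u) - F (cis v)))\<^sup>2 / (cmod (cis u - cis v))\<^sup>2 * K (cmod (cis u - cis v) / l)) \<partial>lborel \<partial>lborel) \<le> ennreal B"
  shows "(\<integral>\<^sup>+u. \<integral>\<^sup>+v. ennreal ((cmod (F (cis u) - F (cis v)))\<^sup>2 / (cmod (cis u - cis v))\<^sup>2
          * K (cmod (disk_aut a (cis u) - disk_aut a (cis v)))) \<partial>circ \<partial>circ) \<le> ennreal (C2 * B)"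
proof -
  define D where "D u v = (cmod (F (cis u) - F (cis v)))\<^sup>2" for u v
  define \<delta> where "\<delta> u v = cmod (cis u - cis v)" for u v
  define \<sigma> where "\<sigma> u v = cmod (disk_aut a (cis u) - disk_aut a (cis v))" for u v
  have Dm [measurable]: "(\<lambda>x. D (f x) (g x)) \<in> borel_measurable M"
    if [measurable]: "f \<in> borel_measurable M" "g \<in> borel_measurable M" for f g and M :: "'x measure"
  proof -
    have "(\<lambda>x. F (cis (f x))) \<in> borel_measurable M" "(\<lambda>x. F (cis (g x))) \<in> borel_measurable M"
      using measurable_compose[OF that(1) Fm] measurable_compose[OF that(2) Fm] by auto
    then show ?thesis unfolding D_def by measurable
  qed
  have dm [measurable]: "(\<lambda>x. \<delta> (f x) (g x)) \<in> borel_measurable M" "(\<lambda>x. \<sigma> (f x) (g x)) \<in> borel_measurable M"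
    if [measurable]: "f \<in> borel_measurable M" "g \<in> borel_measurable M" for f g and M :: "'x measure"
    unfolding \<delta>_def \<sigma>_def by measurable
  have D0: "0 \<le> D u v" and Dsym: "D u v = D v u" and d0: "0 \<le> \<delta> u v" for u v
    by (simp_all add: D_def \<delta>_def norm_minus_commute)
  have D_zero: "D u v = 0" if "\<delta> u v = 0" for u v using that by (simp add: D_def \<delta>_def)
  \<comment> \<open>The coefficient 3/2 matters: lengths double along the chain, so a factor 3/2 per
    step against 1/2 leaves the convergent ratio 3/4, whereas the usual coefficient 2 would leave
    ratio 1.\<close>
  have Dtri: "D u v \<le> 3/2 * D u w + 3 * D w v" for u v w
  proof -
    let ?x = "cmod (F (cis u) - F (cis w))" and ?y = "cmod (F (cis w) - F (cis v))"
    have "cmod (F (cis u) - F (cis v)) \<le> ?x + ?y"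
      using norm_triangle_ineq[of "F (cis u) - F (cis w)" "F (cis w) - F (cis v)"] by simp
    then have "D u v \<le> (?x + ?y)\<^sup>2" unfolding D_def by (intro power_mono) auto
    also have "\<dots> = 3/2 * ?x\<^sup>2 + 3 * ?y\<^sup>2 - 1/2 * (?x - 2 * ?y)\<^sup>2" by (simp add: power2_eq_square algebra_simps)
    also have "\<dots> \<le> 3/2 * ?x\<^sup>2 + 3 * ?y\<^sup>2" by simp
    finally show ?thesis by (simp add: D_def)
  qed
  \<comment> \<open>N is the number of doublings that take an arc of length about 1 - |a| to the
    full circle.\<close>
  obtain N where N: "1 / 2 ^ (N + 1) < 1 - cmod a" "1 - cmod a \<le> 1 / 2 ^ N"
    using dyadic_bracket[of "1 - cmod a"] a by auto
  define \<alpha> where "\<alpha> = Arg a"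
  define l where "l n = 2 * pi * 2 ^ n / 2 ^ N" for n :: nat
  define I where "I n = {\<alpha> - l n / 2..\<alpha> - l n / 2 + l n}" for n
  have l0: "0 < l n" for n by (simp add: l_def)
  have lSuc: "l (Suc n) = 2 * l n" for n by (simp add: l_def)
  have lN: "l N = 2 * pi" by (simp add: l_def)
  have lmono: "l m \<le> l n" if "m \<le> n" for m n
    using that by (simp add: l_def divide_right_mono)
  have ladd: "l (m + k) = 2 ^ k * l m" for m k by (simp add: l_def power_add)
  have l0n: "l 0 / l n = 1 / 2 ^ n" for n by (simp add: l_def)
  have I_iff: "u \<in> I n \<longleftrightarrow> \<bar>u - \<alpha>\<bar> \<le> l n / 2" for u n
    unfolding I_def atLeastAtMost_iff abs_le_iff by linarith
  have Imono: "u \<in> I n" if "u \<in> I m" "m \<le> n" for u m n using that lmono[of m n] by (simp add: I_iff)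
  have Im [measurable]: "I n \<in> sets borel" for n by (simp add: I_def)
  have \<delta>_le: "\<delta> u v \<le> l n" if "u \<in> I n" "v \<in> I n" for u v n
  proof -
    have "\<delta> u v \<le> \<bar>u - v\<bar>" unfolding \<delta>_def by (rule norm_cis_diff_le)
    also have "\<dots> \<le> l n" using that unfolding I_iff by linarith
    finally show ?thesis .
  qed
  define p where "p u = cmod (1 - cnj a * cis u)" for u
  have p_le: "p v \<le> l m" if "v \<in> I m" for v m
  proof -
    have "p v \<le> (1 - cmod a) + \<bar>v - \<alpha>\<bar>" unfolding p_def \<alpha>_def by (rule norm_one_minus_cnj_cis_bounds(1)[OF a])
    also have "\<dots> \<le> l 0 / 2 + l m / 2"
    proof (rule add_mono)
      have "2 * (1 / 2 ^ N) \<le> 2 * pi * (1 / 2 ^ N)" using pi_gt3 by (intro mult_right_mono) auto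
      then show "1 - cmod a \<le> l 0 / 2" using N(2) by (simp add: l_def)
    qed (use that I_iff in auto)
    also have "\<dots> \<le> l m" using lmono[of 0 m] by simp
    finally show ?thesis .
  qed
  \<comment> \<open>Take the smallest arc containing u. Being outside the next smaller one bounds
    \<open>p u\<close> below by a multiple of its length; for the innermost arc 1 - |a| itself is
    the bound.\<close>
  have level: "\<exists>n\<le>N. u \<in> I n \<and> l n / 16 \<le> p u" if "u \<in> I N" for u
  proof -
    define n where "n = (LEAST n. u \<in> I n)"
    have n: "u \<in> I n" "\<And>j. j < n \<Longrightarrow> u \<notin> I j"
      unfolding n_def by (rule LeastI[of "\<lambda>n. u \<in> I n", OF that], rule not_less_Least)
    have "n \<le> N" using n(2)[of N] that by (meson not_less)
    moreover have "l n / 16 \<le> p u"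
    proof (cases n)
      case 0
      have "l 0 / 16 \<le> 1 / 2 ^ (N + 1)" using pi_less_4 by (simp add: l_def field_simps)
      also have "\<dots> \<le> 1 - cmod a" using N(1) by simp
      also have "\<dots> \<le> p u" unfolding p_def by (rule norm_one_minus_cnj_mult_ge) simp
      finally show ?thesis using 0 by simp
    next
      case (Suc j)
      have "l n / 16 = l j / 2 / 4" using Suc lSuc by simp
      also have "\<dots> \<le> \<bar>u - \<alpha>\<bar> / 4" using n(2)[of j] Suc by (simp add: I_iff)
      also have "\<dots> \<le> p u" unfolding p_def \<alpha>_def
        using that lN by (intro norm_one_minus_cnj_cis_bounds(2)[OF a]) (simp add: I_iff \<alpha>_def)
      finally show ?thesis .
    qed
    ultimately show ?thesis using n(1) by blast
  qed
  have A_le: "1 - (cmod a)\<^sup>2 \<le> l 0"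
  proof -
    have "1 - (cmod a)\<^sup>2 = (1 - cmod a) * (1 + cmod a)" by (simp add: power2_eq_square algebra_simps)
    also have "\<dots> \<le> (1 / 2 ^ N) * 2" using N(2) a by (intro mult_mono) auto
    also have "\<dots> \<le> (1 / 2 ^ N) * (2 * pi)" using pi_gt3 by (intro mult_left_mono) auto
    finally show ?thesis by (simp add: l_def)
  qed
  have \<sigma>_le: "\<sigma> u v \<le> 256 * l 0 * \<delta> u v / (l n * l m)" if "l n / 16 \<le> p u" "l m / 16 \<le> p v" for u v n m
  proof -
    have "\<sigma> u v = (1 - (cmod a)\<^sup>2) * \<delta> u v / (p u * p v)"
      unfolding \<sigma>_def \<delta>_def p_def using norm_disk_aut_diff[OF a, of "cis u" "cis v"] by simp
    also have "\<dots> \<le> l 0 * \<delta> u v / (l n / 16 * (l m / 16))"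
      using that A_le d0 l0[of n] l0[of m] l0[of 0]
      by (intro frac_le mult_mono mult_nonneg_nonneg mult_pos_pos) (auto simp: less_imp_le)
    also have "\<dots> = 256 * l 0 * \<delta> u v / (l n * l m)" by simp
    finally show ?thesis .
  qed
  define x where "x n = \<Phi> (2048 / 2 ^ n)" for n :: nat
  have x0: "0 \<le> x n" for n by (simp add: x_def Phi_nonneg)
  define h where "h u v = D u v / (\<delta> u v)\<^sup>2 * K (\<sigma> u v)" for u v
  \<comment> \<open>The near terms are the arc condition on I n. In the far terms K is replaced by K
    1 and the chord by l n / 32, whence 1024 = 32^2.\<close>
  define near where "near n u v = ennreal (x n) * (ennreal (D u v / (\<delta> u v)\<^sup>2 * K (\<delta> u v / l n)) * indicator (I n) v * indicator (I n) u)" for n u v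
  define far where "far n m u v = ennreal (x m * K 1 * 1024 / (l n)\<^sup>2) * (ennreal (D u v) * indicator (I m) v * indicator (I n) u)" for n m u v
  have pt: "ennreal (h u v) \<le> (\<Sum>n\<le>N. near n u v) + (\<Sum>n\<le>N. \<Sum>m\<le>n. far n m u v + far n m v u)"
    if uv: "u \<in> I N" "v \<in> I N" for u v
  proof (cases "\<delta> u v = 0")
    case True
    then show ?thesis by (simp add: h_def)
  next
    case False
    then have dpos: "0 < \<delta> u v" using d0[of u v] by simp
    have main: "ennreal (h u v) \<le> (\<Sum>n\<le>N. near n u v) + (\<Sum>n\<le>N. \<Sum>m\<le>n. far n m u v + far n m v u)"
      if u: "n \<le> N" "u \<in> I n" "l n / 16 \<le> p u" and v: "m \<le> n" "v \<in> I m" "l m / 16 \<le> p v"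
        and dpos: "0 < \<delta> u v" for u v n m
    \<comment> \<open>Within four generations the scales agree up to a factor 16. Beyond that,
      \<open>p u\<close> and \<open>p v\<close> differ by at least l n / 32, which separates u from
      v.\<close>
    proof (cases "n \<le> m + 4")
      case True
      have vn: "v \<in> I n" using Imono v by blast
      have "l n \<le> 16 * l m" using lmono[OF True] ladd[of m 4] by simp
      then have lm: "l n / 16 \<le> l m" by simp
      have "\<sigma> u v \<le> 256 * l 0 * \<delta> u v / (l n * l m)" by (rule \<sigma>_le[OF u(3) v(3)])
      also have "\<dots> \<le> 256 * l 0 * \<delta> u v / (l n * (l n / 16))"
        using lm l0[of n] l0[of 0] l0[of m] dpos by (intro divide_left_mono mult_left_mono mult_pos_pos mult_nonneg_nonneg) auto
      \<comment> \<open>256 comes from the two factors 1/16 in \<open>level\<close> and 16 from the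
        scale gap; a factor 2 is split off for \<open>scale\<close>, leaving 2048.\<close>
      also have "\<dots> = 4096 * (l 0 / l n) * (\<delta> u v / l n)" by simp
      also have "\<dots> = 2 * (2048 / 2 ^ n) * (\<delta> u v / l n)" unfolding l0n by simp
      finally have "K (\<sigma> u v) \<le> K (2 * (2048 / 2 ^ n) * (\<delta> u v / l n))" by (rule K_le)
      also have "\<dots> \<le> x n * K (\<delta> u v / l n)"
        unfolding x_def using dpos l0[of n] \<delta>_le[OF u(2) vn] by (intro scale) (auto simp: field_simps)
      finally have Kle: "K (\<sigma> u v) \<le> x n * K (\<delta> u v / l n)" .
      have "h u v \<le> D u v / (\<delta> u v)\<^sup>2 * (x n * K (\<delta> u v / l n))"
        unfolding h_def using D0 by (intro mult_left_mono Kle) auto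
      also have "\<dots> = x n * (D u v / (\<delta> u v)\<^sup>2 * K (\<delta> u v / l n))" by simp
      finally have "ennreal (h u v) \<le> ennreal (x n * (D u v / (\<delta> u v)\<^sup>2 * K (\<delta> u v / l n)))" by (rule ennreal_leI)
      also have "\<dots> = near n u v"
        using x0 D0 K_nonneg u(2) vn by (simp add: near_def ennreal_mult[symmetric] del: times_divide_eq_left times_divide_eq_right)
      also have "\<dots> \<le> (\<Sum>n\<le>N. near n u v)" using u(1) by (intro member_le_sum) auto
      finally show ?thesis by (simp add: add_increasing2)
    next
      case False
      then have "l (m + 5) \<le> l n" by (intro lmono) simp
      then have lm: "l m \<le> l n / 32" using ladd[of m 5] by simp
      have "l n / 32 \<le> p u - p v" using u(3) p_le[OF v(2)] lm by simp
      also have "\<dots> \<le> cmod ((1 - cnj a * cis u) - (1 - cnj a * cis v))" unfolding p_def by (rule norm_triangle_ineq2)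
      also have "(1 - cnj a * cis u) - (1 - cnj a * cis v) = - cnj a * (cis u - cis v)" by (simp add: algebra_simps)
      also have "cmod \<dots> \<le> 1 * \<delta> u v" unfolding norm_mult \<delta>_def using a by (intro mult_right_mono) auto
      finally have dl: "l n / 32 \<le> \<delta> u v" by simp
      have vn: "v \<in> I n" using Imono v by blast
      have "\<sigma> u v \<le> 256 * l 0 * \<delta> u v / (l n * l m)" by (rule \<sigma>_le[OF u(3) v(3)])
      also have "\<dots> \<le> 256 * l 0 * l n / (l n * l m)"
        using \<delta>_le[OF u(2) vn] l0[of n] l0[of 0] l0[of m] by (intro divide_right_mono mult_left_mono) auto
      also have "\<dots> = 256 * (l 0 / l m)" using l0[of n] by simp
      also have "\<dots> = 2 * (128 / 2 ^ m) * 1" unfolding l0n by simp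
      finally have "K (\<sigma> u v) \<le> K (2 * (128 / 2 ^ m) * 1)" by (rule K_le)
      also have "\<dots> \<le> \<Phi> (128 / 2 ^ m) * K 1" by (rule scale) auto
      also have "\<dots> \<le> x m * K 1"
        unfolding x_def by (intro mult_right_mono Phi_le divide_right_mono K_nonneg) auto
      finally have Kle: "K (\<sigma> u v) \<le> x m * K 1" .
      have "(l n / 32)\<^sup>2 \<le> (\<delta> u v)\<^sup>2" using dl l0[of n] by (intro power_mono) auto
      then have "D u v / (\<delta> u v)\<^sup>2 \<le> D u v / (l n / 32)\<^sup>2"
        using D0 l0[of n] dpos by (intro divide_left_mono) auto
      then have "h u v \<le> D u v / (l n / 32)\<^sup>2 * (x m * K 1)"
        unfolding h_def using Kle D0 x0 K_nonneg by (intro mult_mono) auto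
      also have "\<dots> = x m * K 1 * 1024 / (l n)\<^sup>2 * D u v" by (simp add: power2_eq_square)
      finally have "ennreal (h u v) \<le> ennreal (x m * K 1 * 1024 / (l n)\<^sup>2 * D u v)" by (rule ennreal_leI)
      also have "\<dots> = far n m u v"
        using x0 D0 K_nonneg u(2) v(2) by (simp add: far_def ennreal_mult[symmetric] del: times_divide_eq_left times_divide_eq_right)
      also have "\<dots> \<le> far n m u v + far n m v u" by simp
      also have "\<dots> \<le> (\<Sum>m\<le>n. far n m u v + far n m v u)" using v(1) by (intro member_le_sum) auto
      also have "\<dots> \<le> (\<Sum>n\<le>N. \<Sum>m\<le>n. far n m u v + far n m v u)"
        using u(1) by (intro member_le_sum[of n "{..N}" "\<lambda>n. \<Sum>m\<le>n. far n m u v + far n m v u"]) auto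
      finally show ?thesis by (simp add: add_increasing)
    qed
    obtain n where n: "n \<le> N" "u \<in> I n" "l n / 16 \<le> p u" using level[OF uv(1)] by blast
    obtain m where m: "m \<le> N" "v \<in> I m" "l m / 16 \<le> p v" using level[OF uv(2)] by blast
    show ?thesis
    proof (cases "m \<le> n")
      case True
      then show ?thesis using main[OF n True m(2,3) dpos] by simp
    next
      case False
      \<comment> \<open>The swap is possible because h and the near terms are symmetric and the far
        terms are summed in both orders.\<close>
      have sym: "h u v = h v u" "near k u v = near k v u" for k
        by (simp_all add: h_def near_def D_def \<delta>_def \<sigma>_def norm_minus_commute mult_ac)
      have "\<delta> v u = \<delta> u v" by (simp add: \<delta>_def norm_minus_commute)
      then have "ennreal (h v u) \<le> (\<Sum>n\<le>N. near n v u) + (\<Sum>n\<le>N. \<Sum>m\<le>n. far n m v u + far n m u v)"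
        using main[OF m _ n(2,3)] False dpos by simp
      then show ?thesis by (simp add: sym(1) sym(2)[symmetric] add.commute[of "far _ _ u v"])
    qed
  qed
  have nearI: "(\<integral>\<^sup>+u. \<integral>\<^sup>+v. near n u v \<partial>lborel \<partial>lborel) \<le> ennreal (x n * B)" if "n \<le> N" for n
  proof -
    have "(\<integral>\<^sup>+u. \<integral>\<^sup>+v. near n u v \<partial>lborel \<partial>lborel)
      = ennreal (x n) * (\<integral>\<^sup>+u\<in>I n. \<integral>\<^sup>+v\<in>I n. ennreal (D u v / (\<delta> u v)\<^sup>2 * K (\<delta> u v / l n)) \<partial>lborel \<partial>lborel)"
      unfolding near_def by (simp add: nn_integral_cmult nn_integral_multc)
    also have "\<dots> \<le> ennreal (x n) * ennreal B"
      unfolding I_def D_def \<delta>_def using l0[of n] lmono[OF that] lN by (intro mult_left_mono B) auto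
    also have "\<dots> = ennreal (x n * B)" using x0 B0 by (intro ennreal_mult[symmetric]) auto
    finally show ?thesis .
  qed
  \<comment> \<open>Unweighted oscillation between two arcs. It is estimated for equal arcs first,
    and then one arc is shrunk generation by generation.\<close>
  define M where "M n m = (\<integral>\<^sup>+u. \<integral>\<^sup>+v. ennreal (D u v) * indicator (I m) v * indicator (I n) u \<partial>lborel \<partial>lborel)" for n m
  define B1 where "B1 = 4 * A1 * B"
  have B1: "0 \<le> B1" using A1(2) B0 by (simp add: B1_def)
  \<comment> \<open>\<open>K_one_le\<close> with t = chord / l n inserts the weight. Pairs with zero
    chord are harmless because D vanishes there.\<close>
  have diag: "ennreal (K 1) * M n n \<le> ennreal (l n * l n * B1)" if "n \<le> N" for n
  proof -
    have "ennreal (K 1) * M n n = (\<integral>\<^sup>+u. \<integral>\<^sup>+v. ennreal (K 1) * (ennreal (D u v) * indicator (I n) v * indicator (I n) u) \<partial>lborel \<partial>lborel)"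
      unfolding M_def by (simp add: nn_integral_cmult)
    also have "\<dots> \<le> (\<integral>\<^sup>+u. \<integral>\<^sup>+v. ennreal (l n * l n * (4 * A1)) * (ennreal (D u v / (\<delta> u v)\<^sup>2 * K (\<delta> u v / l n)) * indicator (I n) v * indicator (I n) u) \<partial>lborel \<partial>lborel)"
    proof (intro nn_integral_mono)
      fix u v
      show "ennreal (K 1) * (ennreal (D u v) * indicator (I n) v * indicator (I n) u)
        \<le> ennreal (l n * l n * (4 * A1)) * (ennreal (D u v / (\<delta> u v)\<^sup>2 * K (\<delta> u v / l n)) * indicator (I n) v * indicator (I n) u)"
      proof (cases "u \<in> I n \<and> v \<in> I n \<and> \<delta> u v \<noteq> 0")
        case True
        then have d: "0 < \<delta> u v / l n" "\<delta> u v / l n \<le> 1"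
          using \<delta>_le[of u n v] d0[of u v] l0[of n] by (auto simp: field_simps)
        have "K 1 * D u v \<le> 4 * A1 * (K (\<delta> u v / l n) / (\<delta> u v / l n)\<^sup>2) * D u v"
          by (intro mult_right_mono K_one_le d D0)
        also have "\<dots> = l n * l n * (4 * A1) * (D u v / (\<delta> u v)\<^sup>2 * K (\<delta> u v / l n))"
          by (simp add: power2_eq_square)
        finally have "ennreal (K 1 * D u v) \<le> ennreal (l n * l n * (4 * A1) * (D u v / (\<delta> u v)\<^sup>2 * K (\<delta> u v / l n)))" by (rule ennreal_leI)
        then have "ennreal (K 1) * ennreal (D u v) \<le> ennreal (l n * l n * (4 * A1)) * ennreal (D u v / (\<delta> u v)\<^sup>2 * K (\<delta> u v / l n))"
          using K_nonneg D0 A1(2) l0[of n] by (subst (1 2) ennreal_mult[symmetric]) auto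
        then show ?thesis using True by simp
      next
        case False
        then show ?thesis using D_zero[of u v] by (auto simp: indicator_def)
      qed
    qed
    also have "\<dots> = ennreal (l n * l n * (4 * A1)) * (\<integral>\<^sup>+u\<in>I n. \<integral>\<^sup>+v\<in>I n. ennreal (D u v / (\<delta> u v)\<^sup>2 * K (\<delta> u v / l n)) \<partial>lborel \<partial>lborel)"
      by (simp add: nn_integral_cmult nn_integral_multc)
    also have "\<dots> \<le> ennreal (l n * l n * (4 * A1)) * ennreal B"
      unfolding I_def D_def \<delta>_def using l0[of n] lmono[OF that] lN by (intro mult_left_mono B) auto
    also have "\<dots> = ennreal (l n * l n * B1)"
      using A1(2) B0 l0[of n] by (subst ennreal_mult[symmetric]) (auto simp: B1_def mult_ac)
    finally show ?thesis .
  qed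
  have eI: "emeasure lborel (I n) = ennreal (l n)" for n using l0[of n] by (simp add: I_def)
  \<comment> \<open>The triangle inequality for D is integrated over an intermediate point w in I
    (Suc m), the next larger arc.\<close>
  have chain: "ennreal (l (Suc m)) * M n m \<le> ennreal (3/2 * l m) * M n (Suc m) + ennreal (3 * l n) * M (Suc m) (Suc m)" for n m
  proof -
    have "ennreal (l (Suc m)) * M n m = (\<integral>\<^sup>+u. \<integral>\<^sup>+v. \<integral>\<^sup>+w. ennreal (D u v) * indicator (I m) v * indicator (I n) u * indicator (I (Suc m)) w \<partial>lborel \<partial>lborel \<partial>lborel)"
      unfolding M_def by (simp add: nn_integral_cmult nn_integral_multc eI mult.commute[of _ "ennreal (l (Suc m))"])
    also have "\<dots> \<le> (\<integral>\<^sup>+u. \<integral>\<^sup>+v. \<integral>\<^sup>+w. (ennreal (3/2) * (ennreal (D u w) * indicator (I (Suc m)) w * indicator (I n) u)) * indicator (I m) v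
         + (ennreal 3 * (ennreal (D v w) * indicator (I (Suc m)) w * indicator (I (Suc m)) v)) * indicator (I n) u \<partial>lborel \<partial>lborel \<partial>lborel)"
    proof (intro nn_integral_mono)
      fix u v w
      show "ennreal (D u v) * indicator (I m) v * indicator (I n) u * indicator (I (Suc m)) w
         \<le> (ennreal (3/2) * (ennreal (D u w) * indicator (I (Suc m)) w * indicator (I n) u)) * indicator (I m) v
         + (ennreal 3 * (ennreal (D v w) * indicator (I (Suc m)) w * indicator (I (Suc m)) v)) * indicator (I n) u"
      proof (cases "u \<in> I n \<and> v \<in> I m \<and> w \<in> I (Suc m)")
        case True
        then have v: "v \<in> I (Suc m)" using Imono[of v m "Suc m"] by simp
        have "ennreal (D u v) \<le> ennreal (3/2 * D u w + 3 * D v w)"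
          using Dtri[of u v w] Dsym[of w v] by (intro ennreal_leI) simp
        also have "\<dots> = ennreal (3/2) * ennreal (D u w) + ennreal 3 * ennreal (D v w)"
          using D0 by (subst ennreal_plus) (simp_all only: ennreal_mult D0 mult_nonneg_nonneg zero_le_numeral zero_le_divide_iff simp_thms)
        finally show ?thesis using True v by simp
      qed (auto simp: indicator_def)
    qed
    also have "\<dots> = (\<integral>\<^sup>+u. \<integral>\<^sup>+v. (\<integral>\<^sup>+w. (ennreal (3/2) * (ennreal (D u w) * indicator (I (Suc m)) w * indicator (I n) u)) * indicator (I m) v \<partial>lborel)
         + (\<integral>\<^sup>+w. (ennreal 3 * (ennreal (D v w) * indicator (I (Suc m)) w * indicator (I (Suc m)) v)) * indicator (I n) u \<partial>lborel) \<partial>lborel \<partial>lborel)"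
      by (intro nn_integral_cong nn_integral_add) measurable
    also have "\<dots> = (\<integral>\<^sup>+u. (\<integral>\<^sup>+v. \<integral>\<^sup>+w. (ennreal (3/2) * (ennreal (D u w) * indicator (I (Suc m)) w * indicator (I n) u)) * indicator (I m) v \<partial>lborel \<partial>lborel)
         + (\<integral>\<^sup>+v. \<integral>\<^sup>+w. (ennreal 3 * (ennreal (D v w) * indicator (I (Suc m)) w * indicator (I (Suc m)) v)) * indicator (I n) u \<partial>lborel \<partial>lborel) \<partial>lborel)"
      by (intro nn_integral_cong nn_integral_add) measurable
    also have "\<dots> = (\<integral>\<^sup>+u. \<integral>\<^sup>+v. \<integral>\<^sup>+w. (ennreal (3/2) * (ennreal (D u w) * indicator (I (Suc m)) w * indicator (I n) u)) * indicator (I m) v \<partial>lborel \<partial>lborel \<partial>lborel)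
         + (\<integral>\<^sup>+u. \<integral>\<^sup>+v. \<integral>\<^sup>+w. (ennreal 3 * (ennreal (D v w) * indicator (I (Suc m)) w * indicator (I (Suc m)) v)) * indicator (I n) u \<partial>lborel \<partial>lborel \<partial>lborel)"
      by (rule nn_integral_add) measurable
    also have "(\<integral>\<^sup>+u. \<integral>\<^sup>+v. \<integral>\<^sup>+w. (ennreal (3/2) * (ennreal (D u w) * indicator (I (Suc m)) w * indicator (I n) u)) * indicator (I m) v \<partial>lborel \<partial>lborel \<partial>lborel)
        = ennreal (3/2) * M n (Suc m) * ennreal (l m)"
      unfolding M_def by (simp add: nn_integral_cmult nn_integral_multc eI)
    also have "\<dots> = ennreal (3/2 * l m) * M n (Suc m)"
      using l0[of m] by (subst ennreal_mult) (simp_all add: mult_ac)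
    also have "(\<integral>\<^sup>+u. \<integral>\<^sup>+v. \<integral>\<^sup>+w. (ennreal 3 * (ennreal (D v w) * indicator (I (Suc m)) w * indicator (I (Suc m)) v)) * indicator (I n) u \<partial>lborel \<partial>lborel \<partial>lborel)
        = ennreal 3 * M (Suc m) (Suc m) * ennreal (l n)"
      unfolding M_def by (simp add: nn_integral_cmult nn_integral_multc eI)
    also have "\<dots> = ennreal (3 * l n) * M (Suc m) (Suc m)"
      using l0[of n] by (subst ennreal_mult) (simp_all add: mult_ac)
    finally show ?thesis .
  qed
  \<comment> \<open>In units of l n * l m * B1 and with k = n - m, the chain gives the recursion e
    (k+1) = 3/2 * e k + 6 with e 0 = 1. Its solution is 13 (3/2)^k - 12; the 6 is 3 times the length
    ratio 2.\<close>
  have tele: "ennreal (K 1) * M n m \<le> ennreal (l n * l m * B1 * (13 * (3/2) ^ (n - m) - 12))" if "m \<le> n" "n \<le> N" for n m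
    using that
  proof (induction m rule: inc_induct)
    case base
    then show ?case using diag[of n] by simp
  next
    case (step m)
    let ?e = "13 * (3/2) ^ (n - Suc m) - (12 :: real)"
    have e1: "1 \<le> (3/2 :: real) ^ (n - Suc m)" by (rule one_le_power) simp
    have nm: "n - m = Suc (n - Suc m)" using step by simp
    have "ennreal (l (Suc m)) * (ennreal (K 1) * M n m) = ennreal (K 1) * (ennreal (l (Suc m)) * M n m)" by (simp add: mult_ac)
    also have "\<dots> \<le> ennreal (K 1) * (ennreal (3/2 * l m) * M n (Suc m) + ennreal (3 * l n) * M (Suc m) (Suc m))"
      by (intro mult_left_mono chain) auto
    also have "\<dots> = ennreal (3/2 * l m) * (ennreal (K 1) * M n (Suc m)) + ennreal (3 * l n) * (ennreal (K 1) * M (Suc m) (Suc m))"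
      by (simp add: distrib_left mult_ac)
    also have "\<dots> \<le> ennreal (3/2 * l m) * ennreal (l n * l (Suc m) * B1 * ?e) + ennreal (3 * l n) * ennreal (l (Suc m) * l (Suc m) * B1)"
      using step by (intro add_mono mult_left_mono diag) auto
    also have "\<dots> = ennreal (3/2 * l m * (l n * l (Suc m) * B1 * ?e) + 3 * l n * (l (Suc m) * l (Suc m) * B1))"
    proof -
      have "ennreal p * ennreal q + ennreal r * ennreal s = ennreal (p * q + r * s)"
        if "0 \<le> p" "0 \<le> q" "0 \<le> r" "0 \<le> s" for p q r s
        using that by (simp add: ennreal_mult[symmetric] ennreal_plus[symmetric] del: ennreal_plus)
      moreover have "0 \<le> ?e" using e1 by linarith
      ultimately show ?thesis
        using l0[of m] l0[of n] l0[of "Suc m"] B1 by (simp del: times_divide_eq_left times_divide_eq_right)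
    qed
    also have "3/2 * l m * (l n * l (Suc m) * B1 * ?e) + 3 * l n * (l (Suc m) * l (Suc m) * B1)
      = l (Suc m) * (l n * l m * B1 * (13 * (3/2) ^ (n - m) - 12))"
      unfolding nm by (simp add: lSuc algebra_simps)
    also have "ennreal \<dots> = ennreal (l (Suc m)) * ennreal (l n * l m * B1 * (13 * (3/2) ^ (n - m) - 12))"
    proof (rule ennreal_mult)
      have "1 \<le> (3/2 :: real) ^ (n - m)" by (rule one_le_power) simp
      then have "0 \<le> 13 * (3/2) ^ (n - m) - (12 :: real)" by linarith
      then show "0 \<le> l n * l m * B1 * (13 * (3/2) ^ (n - m) - 12)"
        using l0[of m] l0[of n] B1 by (intro mult_nonneg_nonneg) (simp_all add: less_imp_le)
    qed (use l0[of "Suc m"] in simp)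
    finally show ?case
      using l0[of "Suc m"] by (subst (asm) ennreal_mult_le_mult_iff) auto
  qed
  \<comment> \<open>Division by (l n)^2 leaves l m / l n = 2^-(n - m), which turns (3/2)^(n - m)
    into (3/4)^(n - m). The constant is 26624 = 2 * 13 * 1024.\<close>
  have farI: "(\<integral>\<^sup>+u. \<integral>\<^sup>+v. far n m u v + far n m v u \<partial>lborel \<partial>lborel) \<le> ennreal (26624 * B1 * (x m * (3/4) ^ (n - m)))"
    if "m \<le> n" "n \<le> N" for n m
  proof -
    have "(\<integral>\<^sup>+u. \<integral>\<^sup>+v. far n m u v + far n m v u \<partial>lborel \<partial>lborel) = (\<integral>\<^sup>+u. (\<integral>\<^sup>+v. far n m u v \<partial>lborel) + (\<integral>\<^sup>+v. far n m v u \<partial>lborel) \<partial>lborel)"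
      unfolding far_def by (intro nn_integral_cong nn_integral_add) measurable
    also have "\<dots> = (\<integral>\<^sup>+u. \<integral>\<^sup>+v. far n m u v \<partial>lborel \<partial>lborel) + (\<integral>\<^sup>+u. \<integral>\<^sup>+v. far n m v u \<partial>lborel \<partial>lborel)"
      unfolding far_def by (rule nn_integral_add) measurable
    also have "(\<integral>\<^sup>+u. \<integral>\<^sup>+v. far n m v u \<partial>lborel \<partial>lborel) = (\<integral>\<^sup>+u. \<integral>\<^sup>+v. far n m u v \<partial>lborel \<partial>lborel)"
      unfolding far_def by (rule lborel_pair.Fubini') measurable
    also have "(\<integral>\<^sup>+u. \<integral>\<^sup>+v. far n m u v \<partial>lborel \<partial>lborel) = ennreal (x m * 1024 / (l n)\<^sup>2) * (ennreal (K 1) * M n m)"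
    proof -
      have "ennreal (x m * K 1 * 1024 / (l n)\<^sup>2) = ennreal (x m * 1024 / (l n)\<^sup>2) * ennreal (K 1)"
        using x0 K_nonneg by (subst ennreal_mult[symmetric]) (auto simp: mult_ac)
      then show ?thesis unfolding far_def M_def by (simp add: nn_integral_cmult mult.assoc)
    qed
    also have "\<dots> + \<dots> \<le> ennreal (x m * 1024 / (l n)\<^sup>2) * ennreal (l n * l m * B1 * (13 * (3/2) ^ (n - m) - 12))
        + ennreal (x m * 1024 / (l n)\<^sup>2) * ennreal (l n * l m * B1 * (13 * (3/2) ^ (n - m) - 12))"
      by (intro add_mono mult_left_mono tele that) auto
    also have "\<dots> \<le> ennreal (26624 * B1 * (x m * (3/4) ^ (n - m)))"
    proof -
      have e1: "1 \<le> (3/2 :: real) ^ (n - m)" by (rule one_le_power) simp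
      have ln: "l n = 2 ^ (n - m) * l m" using ladd[of m "n - m"] that by simp
      have q: "(3/2 :: real) ^ k = 2 ^ k * (3/4) ^ k" for k by (simp flip: power_mult_distrib)
      have "x m * 1024 / (l n)\<^sup>2 * (l n * l m * B1 * (13 * (3/2) ^ (n - m) - 12)) \<le> x m * 1024 / (l n)\<^sup>2 * (l n * l m * B1 * (13 * (3/2) ^ (n - m)))"
        using x0 B1 l0[of n] l0[of m] by (intro mult_left_mono) auto
      also have "\<dots> = 13312 * B1 * (x m * (3/4) ^ (n - m))"
        unfolding ln q using l0[of m] by (simp add: power2_eq_square)
      finally have le: "x m * 1024 / (l n)\<^sup>2 * (l n * l m * B1 * (13 * (3/2) ^ (n - m) - 12)) \<le> 13312 * B1 * (x m * (3/4) ^ (n - m))" .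
      have dbl: "ennreal p * ennreal q + ennreal p * ennreal q \<le> ennreal (2 * r)"
        if "0 \<le> p" "0 \<le> q" "p * q \<le> r" for p q r
      proof -
        have "ennreal p * ennreal q + ennreal p * ennreal q = ennreal (p * q + p * q)"
          using that by (simp add: ennreal_mult[symmetric] ennreal_plus[symmetric] del: ennreal_plus)
        also have "\<dots> \<le> ennreal (2 * r)" using that by (intro ennreal_leI) linarith
        finally show ?thesis .
      qed
      have "0 \<le> 13 * (3/2 :: real) ^ (n - m) - 12" using e1 by linarith
      then have "0 \<le> l n * l m * B1 * (13 * (3/2) ^ (n - m) - 12)"
        using l0[of n] l0[of m] B1 by (intro mult_nonneg_nonneg) (simp_all add: less_imp_le)
      then show ?thesis using dbl[OF _ _ le] x0[of m] by (simp add: mult.assoc)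
    qed
    finally show ?thesis .
  qed
  define H where "H u v = ennreal (h u v)" for u v
  have Hm [measurable]: "(\<lambda>x. H (f x) (g x)) \<in> borel_measurable M'"
    if [measurable]: "f \<in> borel_measurable M'" "g \<in> borel_measurable M'" for f g and M' :: "'x measure"
    unfolding H_def h_def by measurable
  have per: "H u (v + 2*pi) = H u v" "H (u + 2*pi) v = H u v" for u v
    by (simp_all add: H_def h_def D_def \<delta>_def \<sigma>_def flip: cis_mult)
  have IN: "I N = {\<alpha> - pi..\<alpha> - pi + 2*pi}" by (simp add: I_def lN)
  have "(\<integral>\<^sup>+u. \<integral>\<^sup>+v. H u v \<partial>circ \<partial>circ) = (\<integral>\<^sup>+u\<in>{0..2*pi}. \<integral>\<^sup>+v\<in>{0..2*pi}. H u v \<partial>lborel \<partial>lborel)"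
    by (simp add: nn_integral_circ)
  also have "\<dots> = (\<integral>\<^sup>+u\<in>{0..2*pi}. \<integral>\<^sup>+v\<in>I N. H u v \<partial>lborel \<partial>lborel)"
    unfolding IN using nn_integral_periodic[of "H u" "\<alpha> - pi" for u] per by simp
  also have "\<dots> = (\<integral>\<^sup>+u\<in>I N. \<integral>\<^sup>+v\<in>I N. H u v \<partial>lborel \<partial>lborel)"
    unfolding IN by (rule nn_integral_periodic[symmetric]) (measurable, simp add: per)
  also have "\<dots> \<le> (\<integral>\<^sup>+u. \<integral>\<^sup>+v. (\<Sum>n\<le>N. near n u v) + (\<Sum>n\<le>N. \<Sum>m\<le>n. far n m u v + far n m v u) \<partial>lborel \<partial>lborel)"
  proof (rule nn_integral_mono)
    fix u
    have "(\<integral>\<^sup>+v\<in>I N. H u v \<partial>lborel) * indicator (I N) u = (\<integral>\<^sup>+v. H u v * indicator (I N) v * indicator (I N) u \<partial>lborel)"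
      by (rule nn_integral_multc[symmetric]) measurable
    also have "\<dots> \<le> (\<integral>\<^sup>+v. (\<Sum>n\<le>N. near n u v) + (\<Sum>n\<le>N. \<Sum>m\<le>n. far n m u v + far n m v u) \<partial>lborel)"
      using pt by (intro nn_integral_mono) (auto simp: H_def indicator_def)
    finally show "(\<integral>\<^sup>+v\<in>I N. H u v \<partial>lborel) * indicator (I N) u \<le> \<dots>" .
  qed
  also have "\<dots> = (\<integral>\<^sup>+u. (\<Sum>n\<le>N. \<integral>\<^sup>+v. near n u v \<partial>lborel) + (\<Sum>n\<le>N. \<Sum>m\<le>n. \<integral>\<^sup>+v. far n m u v + far n m v u \<partial>lborel) \<partial>lborel)"
  proof (rule nn_integral_cong)
    fix u
    have "(\<integral>\<^sup>+v. (\<Sum>n\<le>N. near n u v) + (\<Sum>n\<le>N. \<Sum>m\<le>n. far n m u v + far n m v u) \<partial>lborel)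
      = (\<integral>\<^sup>+v. (\<Sum>n\<le>N. near n u v) \<partial>lborel) + (\<integral>\<^sup>+v. (\<Sum>n\<le>N. \<Sum>m\<le>n. far n m u v + far n m v u) \<partial>lborel)"
      unfolding near_def far_def by (rule nn_integral_add) measurable
    also have "(\<integral>\<^sup>+v. (\<Sum>n\<le>N. near n u v) \<partial>lborel) = (\<Sum>n\<le>N. \<integral>\<^sup>+v. near n u v \<partial>lborel)"
      unfolding near_def by (rule nn_integral_sum) measurable
    also have "(\<integral>\<^sup>+v. (\<Sum>n\<le>N. \<Sum>m\<le>n. far n m u v + far n m v u) \<partial>lborel) = (\<Sum>n\<le>N. \<integral>\<^sup>+v. (\<Sum>m\<le>n. far n m u v + far n m v u) \<partial>lborel)"
      unfolding far_def by (rule nn_integral_sum) measurable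
    also have "\<dots> = (\<Sum>n\<le>N. \<Sum>m\<le>n. \<integral>\<^sup>+v. far n m u v + far n m v u \<partial>lborel)"
      unfolding far_def by (intro sum.cong refl nn_integral_sum) measurable
    finally show "(\<integral>\<^sup>+v. (\<Sum>n\<le>N. near n u v) + (\<Sum>n\<le>N. \<Sum>m\<le>n. far n m u v + far n m v u) \<partial>lborel)
      = (\<Sum>n\<le>N. \<integral>\<^sup>+v. near n u v \<partial>lborel) + (\<Sum>n\<le>N. \<Sum>m\<le>n. \<integral>\<^sup>+v. far n m u v + far n m v u \<partial>lborel)" .
  qed
  also have "\<dots> = (\<integral>\<^sup>+u. (\<Sum>n\<le>N. \<integral>\<^sup>+v. near n u v \<partial>lborel) \<partial>lborel) + (\<integral>\<^sup>+u. (\<Sum>n\<le>N. \<Sum>m\<le>n. \<integral>\<^sup>+v. far n m u v + far n m v u \<partial>lborel) \<partial>lborel)"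
    unfolding near_def far_def by (rule nn_integral_add) measurable
  also have "(\<integral>\<^sup>+u. (\<Sum>n\<le>N. \<integral>\<^sup>+v. near n u v \<partial>lborel) \<partial>lborel) = (\<Sum>n\<le>N. \<integral>\<^sup>+u. \<integral>\<^sup>+v. near n u v \<partial>lborel \<partial>lborel)"
    unfolding near_def by (rule nn_integral_sum) measurable
  also have "(\<integral>\<^sup>+u. (\<Sum>n\<le>N. \<Sum>m\<le>n. \<integral>\<^sup>+v. far n m u v + far n m v u \<partial>lborel) \<partial>lborel)
      = (\<Sum>n\<le>N. \<integral>\<^sup>+u. (\<Sum>m\<le>n. \<integral>\<^sup>+v. far n m u v + far n m v u \<partial>lborel) \<partial>lborel)"
    unfolding far_def by (rule nn_integral_sum) measurable
  also have "\<dots> = (\<Sum>n\<le>N. \<Sum>m\<le>n. \<integral>\<^sup>+u. \<integral>\<^sup>+v. far n m u v + far n m v u \<partial>lborel \<partial>lborel)"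
    unfolding far_def by (intro sum.cong refl nn_integral_sum) measurable
  also have "(\<Sum>n\<le>N. \<integral>\<^sup>+u. \<integral>\<^sup>+v. near n u v \<partial>lborel \<partial>lborel) + \<dots>
      \<le> (\<Sum>n\<le>N. ennreal (x n * B)) + (\<Sum>n\<le>N. \<Sum>m\<le>n. ennreal (26624 * B1 * (x m * (3/4) ^ (n - m))))"
    by (intro add_mono sum_mono nearI farI) auto
  also have "\<dots> = ennreal ((\<Sum>n\<le>N. x n) * B + 26624 * B1 * (\<Sum>n\<le>N. \<Sum>m\<le>n. x m * (3/4) ^ (n - m)))"
    using x0 B0 B1
    by (simp add: sum_ennreal sum_nonneg sum_distrib_right sum_distrib_left ennreal_plus[symmetric] del: ennreal_plus)
  also have "\<dots> \<le> ennreal (S1 * B + 26624 * B1 * (S1 * 4))"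
  proof (intro ennreal_leI add_mono mult_right_mono mult_left_mono)
    show X: "(\<Sum>n\<le>N. x n) \<le> S1" unfolding x_def by (rule Phi_dyadic_sum)
    have "(\<Sum>n\<le>M. (3/4::real) ^ n) = 4 - 3 * (3/4) ^ M" for M
      by (induction M) auto
    then have "(\<Sum>n\<le>M. (3/4::real) ^ n) \<le> 4" for M by simp
    then show "(\<Sum>n\<le>N. \<Sum>m\<le>n. x m * (3/4) ^ (n - m)) \<le> S1 * 4"
      by (intro sum_convolution_le x0 X) auto
  qed (use B0 B1 in auto)
  also have "S1 * B + 26624 * B1 * (S1 * 4) = C2 * B" by (simp add: C2_def B1_def algebra_simps)
  finally show ?thesis by (simp add: H_def h_def D_def \<delta>_def \<sigma>_def)
qed

end

section \<open>The Dirichlet energy and the boundary double integral\<close>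

text \<open>An automorphism maps a radius to a circular arc that meets the circle without tangency,
  with an aperture depending on \<open>a\<close> alone. This is where nontangential rather than
  radial limits become necessary.\<close>

lemma disk_aut_radial_stolz:
  assumes a: "cmod a < 1" and \<zeta>: "cmod \<zeta> = 1"
  shows "disk_aut a (of_real (radius_seq k) * \<zeta>) \<in> stolz (1 + 4 / (1 - cmod a)) (disk_aut a \<zeta>)"
proof -
  define \<rho> where "\<rho> = radius_seq k"
  have \<rho>: "0 < \<rho>" "\<rho> < 1" using radius_seq[of k] by (auto simp: \<rho>_def)
  define w where "w = of_real \<rho> * \<zeta>"
  have w1: "cmod w = \<rho>" using \<rho> \<zeta> by (simp add: w_def norm_mult)
  define A where "A = 1 - (cmod a)\<^sup>2"
  have A: "0 < A" using a by (simp add: A_def power_less_one_iff)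
  define p where "p z = cmod (1 - cnj a * z)" for z
  have pw: "0 < p w" "0 < p \<zeta>"
    using one_minus_cnj_mult_nonzero[OF a, of w] one_minus_cnj_mult_nonzero[OF a, of \<zeta>] w1 \<rho> \<zeta> by (auto simp: p_def)
  have pz: "1 - cmod a \<le> p \<zeta>" unfolding p_def using \<zeta> by (intro norm_one_minus_cnj_mult_ge) simp
  have pw2: "p w \<le> 2"
  proof -
    have "cmod (cnj a * w) \<le> 1 * 1" unfolding norm_mult using a w1 \<rho> by (intro mult_mono) auto
    then show ?thesis unfolding p_def using norm_triangle_ineq4[of 1 "cnj a * w"] by simp
  qed
  define x where "x = disk_aut a w"
  have x1: "cmod x < 1" unfolding x_def using norm_disk_aut_less[OF a] w1 \<rho> by simp
  have wz: "cmod (w - \<zeta>) = 1 - \<rho>"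
  proof -
    have "w - \<zeta> = of_real (\<rho> - 1) * \<zeta>" by (simp add: w_def algebra_simps)
    then show ?thesis using \<rho> \<zeta> by (simp add: norm_mult del: of_real_diff)
  qed
  have d: "cmod (x - disk_aut a \<zeta>) = A * (1 - \<rho>) / (p w * p \<zeta>)"
    unfolding x_def using norm_disk_aut_diff[OF a, of w \<zeta>] w1 \<rho> \<zeta> by (simp add: A_def p_def wz)
  have "1 - (cmod x)\<^sup>2 = A * (1 - \<rho>\<^sup>2) / (p w)\<^sup>2"
    unfolding x_def using one_minus_norm_disk_aut[of a w] pw w1 by (simp add: A_def p_def)
  also have "A * (1 - \<rho>\<^sup>2) / (p w)\<^sup>2 \<ge> A * (1 - \<rho>) / (p w)\<^sup>2"
  proof (intro divide_right_mono mult_left_mono)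
    have "\<rho> * \<rho> \<le> \<rho> * 1" using \<rho> by (intro mult_left_mono) auto
    then show "1 - \<rho> \<le> 1 - \<rho>\<^sup>2" by (simp add: power2_eq_square)
  qed (use A in auto)
  finally have e1: "A * (1 - \<rho>) / (p w)\<^sup>2 \<le> 1 - (cmod x)\<^sup>2" .
  have "1 - (cmod x)\<^sup>2 = (1 - cmod x) * (1 + cmod x)" by (simp add: power2_eq_square algebra_simps)
  also have "\<dots> \<le> (1 - cmod x) * 2" using x1 by (intro mult_left_mono) auto
  finally have e2: "A * (1 - \<rho>) / (p w)\<^sup>2 \<le> 2 * (1 - cmod x)" using e1 by simp
  have "cmod (x - disk_aut a \<zeta>) = (A * (1 - \<rho>) / (p w)\<^sup>2) * (p w / p \<zeta>)"
    unfolding d using pw by (simp add: power2_eq_square)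
  also have "\<dots> \<le> (2 * (1 - cmod x)) * (2 / (1 - cmod a))"
    using e2 pw pw2 pz a x1 by (intro mult_mono frac_le) auto
  also have "\<dots> = 4 / (1 - cmod a) * (1 - cmod x)" by simp
  also have "\<dots> < (1 + 4 / (1 - cmod a)) * (1 - cmod x)" using x1 by (simp add: distrib_right)
  finally show ?thesis using x1 by (simp add: stolz_def x_def w_def \<rho>_def)
qed

context hardy_function
begin

definition comp_coeff :: "complex \<Rightarrow> nat \<Rightarrow> complex" where
  "comp_coeff a n = (deriv ^^ n) (\<lambda>z. f (disk_aut a z)) 0 / fact n"

lemma sums_comp_coeff:
  assumes "cmod a < 1" "cmod z < 1"
  shows "(\<lambda>n. comp_coeff a n * z ^ n) sums f (disk_aut a z)"
  using holomorphic_power_series[OF holomorphic_comp_disk_aut[OF assms(1) hol], of z] assms(2)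
  by (simp add: comp_coeff_def)

text \<open>The exceptional angles pull back to a null set because the change of variables has
  positive density. At all other angles the image of the radius approaches the boundary inside a
  cone.\<close>

lemma AE_comp_LIMSEQ:
  assumes a: "cmod a < 1"
  shows "AE t in circ. (\<lambda>k. f (disk_aut a (of_real (radius_seq k) * cis t))) \<longlonglongrightarrow> F (moebius_angle a t)"
proof -
  define Z where "Z = - {t. \<exists>L. nt_limit f (cis t) L}"
  have [measurable]: "Z \<in> sets borel"
    unfolding Z_def using sets.compl_sets[OF nt_limit_set_borel[of f]] by (simp add: Compl_eq_Diff_UNIV)
  define q where "q t = (1 - (cmod a)\<^sup>2) / (cmod (1 - cnj a * cis t))\<^sup>2" for t
  have qm [measurable]: "q \<in> borel_measurable borel" unfolding q_def[abs_def] by measurable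
  have q0: "0 < q t" for t
    using a one_minus_cnj_mult_nonzero[OF a, of "cis t"] by (auto simp: q_def power_less_one_iff)
  have [measurable]: "moebius_angle a \<in> borel_measurable borel" by (rule borel_measurable_moebius_angle[OF a])
  have "(\<integral>\<^sup>+t\<in>{0..2*pi}. indicator Z t \<partial>lborel) = (\<integral>\<^sup>+t. indicator Z t \<partial>circ)"
    by (rule nn_integral_circ[symmetric]) measurable
  also have "\<dots> = 0"
  proof (subst nn_integral_0_iff_AE)
    show "AE t in circ. indicator Z t = (0::ennreal)"
      using AE_nt_limit by eventually_elim (auto simp: Z_def indicator_def)
  qed measurable
  finally have "(\<integral>\<^sup>+t\<in>{0..2*pi}. indicator Z t \<partial>lborel) = 0" .
  moreover have "(\<integral>\<^sup>+t\<in>{0..2*pi}. indicator Z t \<partial>lborel) = (\<integral>\<^sup>+t\<in>{0..2*pi}. indicator Z (moebius_angle a t) * ennreal (q t) \<partial>lborel)"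
    unfolding q_def
  proof (rule nn_integral_moebius_angle[OF a])
    show "indicator Z \<in> borel_measurable borel" by measurable
  qed (auto simp: Z_def indicator_def simp flip: cis_mult)
  moreover have "(\<integral>\<^sup>+t\<in>{0..2*pi}. indicator Z (moebius_angle a t) * ennreal (q t) \<partial>lborel) = (\<integral>\<^sup>+t. indicator Z (moebius_angle a t) * ennreal (q t) \<partial>circ)"
    by (rule nn_integral_circ[symmetric]) measurable
  ultimately have "(\<integral>\<^sup>+t. indicator Z (moebius_angle a t) * ennreal (q t) \<partial>circ) = 0" by simp
  then have "AE t in circ. indicator Z (moebius_angle a t) * ennreal (q t) = 0"
    by (subst (asm) nn_integral_0_iff_AE) measurable
  then show ?thesis
  proof eventually_elim
    case (elim t)
    have "ennreal (q t) \<noteq> 0" using q0[of t] by (simp add: ennreal_eq_0_iff)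
    then have "moebius_angle a t \<notin> Z" using elim by (auto simp: indicator_def)
    then obtain L where L: "nt_limit f (cis (moebius_angle a t)) L" by (auto simp: Z_def)
    have "F (moebius_angle a t) = L" unfolding F_def by (rule bdry_fun_eq[OF L]) simp
    moreover have "(\<lambda>k. f (disk_aut a (of_real (radius_seq k) * cis t))) \<longlonglongrightarrow> L"
    proof (rule nt_limit_seq[OF L])
      show "1 < 1 + 4 / (1 - cmod a)" using a by simp
      show "disk_aut a (of_real (radius_seq k) * cis t) \<in> stolz (1 + 4 / (1 - cmod a)) (cis (moebius_angle a t))" for k
        unfolding cis_moebius_angle[OF a] by (rule disk_aut_radial_stolz[OF a]) simp
      have "isCont (disk_aut a) (cis t)"
        by (rule DERIV_isCont[OF disk_aut_has_derivative[OF one_minus_cnj_mult_nonzero[OF a]]]) simp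
      then show "(\<lambda>k. disk_aut a (of_real (radius_seq k) * cis t)) \<longlonglongrightarrow> cis (moebius_angle a t)"
        unfolding cis_moebius_angle[OF a] by (rule isCont_tendsto_compose[OF _ radial_seq_LIMSEQ])
    qed simp
    ultimately show ?case by simp
  qed
qed

lemma borel_comp_dilate [measurable]:
  assumes a: "cmod a < 1"
  shows "(\<lambda>t. f (disk_aut a (of_real (radius_seq k) * cis t))) \<in> borel_measurable borel"
  using borel_measurable_circle_dilate[OF holomorphic_on_imp_continuous_on[OF holomorphic_comp_disk_aut[OF a hol]], of "radius_seq k"]
    radius_seq[of k] by simp

text \<open>Rotation by t multiplies the n-th Taylor coefficient by cis (n t). Parseval gives the
  norm of the difference, and a radius below 1 only decreases it.\<close>

lemma rotation_difference_le:
  assumes a: "cmod a < 1"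
  shows "(\<integral>\<^sup>+u\<in>{0..2*pi}. ennreal ((cmod (f (disk_aut a (of_real (radius_seq k) * cis (u + t))) - f (disk_aut a (of_real (radius_seq k) * cis u))))\<^sup>2) \<partial>lborel)
    \<le> (\<Sum>n. ennreal (2*pi*(cmod (comp_coeff a n))\<^sup>2 * (cmod (cis (real n * t) - 1))\<^sup>2))"
proof -
  define h where "h z = f (disk_aut a (z * cis t)) - f (disk_aut a z)" for z
  have hs: "(\<lambda>n. (comp_coeff a n * (cis (real n * t) - 1)) * z ^ n) sums h z" if z: "cmod z < 1" for z
  proof -
    have "cmod (z * cis t) < 1" using z by (simp add: norm_mult)
    from sums_diff[OF sums_comp_coeff[OF a this] sums_comp_coeff[OF a z]]
    have "(\<lambda>n. comp_coeff a n * (z * cis t) ^ n - comp_coeff a n * z ^ n) sums h z" by (simp add: h_def)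
    moreover have "(\<lambda>n. comp_coeff a n * (z * cis t) ^ n - comp_coeff a n * z ^ n) = (\<lambda>n. (comp_coeff a n * (cis (real n * t) - 1)) * z ^ n)"
      by (simp add: power_mult_distrib Complex.DeMoivre algebra_simps)
    ultimately show ?thesis by simp
  qed
  have r: "0 \<le> radius_seq k" "radius_seq k < 1" using radius_seq[of k] by auto
  have "(\<integral>\<^sup>+u\<in>{0..2*pi}. ennreal ((cmod (f (disk_aut a (of_real (radius_seq k) * cis (u + t))) - f (disk_aut a (of_real (radius_seq k) * cis u))))\<^sup>2) \<partial>lborel)
    = (\<integral>\<^sup>+u\<in>{0..2*pi}. ennreal ((cmod (h (of_real (radius_seq k) * cis u)))\<^sup>2) \<partial>lborel)"
    by (simp add: h_def cis_mult[symmetric] mult.assoc)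
  also have "\<dots> = (\<Sum>n. ennreal (2*pi*(cmod (comp_coeff a n * (cis (real n * t) - 1)))\<^sup>2 * radius_seq k ^ (2*n)))"
    by (rule nn_integral_circle_power_series[of _ h, OF hs r])
  also have "\<dots> \<le> (\<Sum>n. ennreal (2*pi*(cmod (comp_coeff a n))\<^sup>2 * (cmod (cis (real n * t) - 1))\<^sup>2))"
  proof (intro suminf_le summableI ennreal_leI)
    fix n
    have "radius_seq k ^ (2*n) \<le> 1" using r by (intro power_le_one) auto
    then show "2*pi*(cmod (comp_coeff a n * (cis (real n * t) - 1)))\<^sup>2 * radius_seq k ^ (2*n)
        \<le> 2*pi*(cmod (comp_coeff a n))\<^sup>2 * (cmod (cis (real n * t) - 1))\<^sup>2"
      unfolding norm_mult power_mult_distrib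
      using mult_left_mono[of "radius_seq k ^ (2*n)" 1 "2*pi*((cmod (comp_coeff a n))\<^sup>2 * (cmod (cis (real n * t) - 1))\<^sup>2)"]
      by (simp add: mult.assoc)
  qed
  finally show ?thesis .
qed

end

section \<open>The weighted double integral of the boundary function\<close>

locale weighted_hardy = weight K \<Phi> + hardy_function f
  for K \<Phi> :: "real \<Rightarrow> real" and f :: "complex \<Rightarrow> complex"
begin

definition kern :: "real \<Rightarrow> real" where "kern x = K x / x\<^sup>2"

lemma kern_nonneg: "0 \<le> kern x" by (simp add: kern_def K_nonneg)

lemma borel_kern [measurable]: "kern \<in> borel_measurable borel"
  unfolding kern_def[abs_def] by measurable

text \<open>With t = v - u the weight depends on t alone, so Parseval in u diagonalises the double
  integral. Its n-th multiplier is at most (8 + 32 A1) n K (1/n), while the energy carries n^2 times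
  a Laplace transform of size at least exp(-4) K (1/n) / n; the ratio is uniform in n.\<close>

lemma dilate_double_integral_le:
  assumes a: "cmod a < 1"
  defines "h \<equiv> \<lambda>k u. f (disk_aut a (of_real (radius_seq k) * cis u))"
  shows "(\<integral>\<^sup>+u. \<integral>\<^sup>+v. ennreal ((cmod (h k u - h k v))\<^sup>2 * kern (cmod (cis u - cis v))) \<partial>circ \<partial>circ)
    \<le> ennreal (exp 4 * (8 + 32 * A1)) * (\<integral>\<^sup>+z\<in>ball 0 1. ennreal ((cmod (deriv f z))\<^sup>2) * ennreal (K (ln (1 / cmod (disk_aut a z)))) \<partial>lborel)"
proof -
  define c where "c = comp_coeff a"
  have hm [measurable]: "h k \<in> borel_measurable borel" unfolding h_def by (rule borel_comp_dilate[OF a])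
  have hm' [measurable]: "(\<lambda>x. h k (g x)) \<in> borel_measurable M" if "g \<in> borel_measurable M" for g and M :: "'x measure"
    by (rule measurable_compose[OF that hm])
  have hper: "h k (u + 2*pi) = h k u" for u by (simp add: h_def flip: cis_mult)
  have rot: "cmod (cis u - cis (u + t)) = cmod (cis t - 1)" for u t
  proof -
    have "cis u - cis (u + t) = - (cis u * (cis t - 1))" by (simp add: cis_mult[symmetric] algebra_simps)
    then show ?thesis by (simp only: norm_minus_cancel norm_mult norm_cis mult_1)
  qed
  have "(\<integral>\<^sup>+u. \<integral>\<^sup>+v. ennreal ((cmod (h k u - h k v))\<^sup>2 * kern (cmod (cis u - cis v))) \<partial>circ \<partial>circ)
     = (\<integral>\<^sup>+u. (\<integral>\<^sup>+t\<in>{-pi..pi}. ennreal ((cmod (h k u - h k (u + t)))\<^sup>2 * kern (cmod (cis t - 1))) \<partial>lborel) \<partial>circ)"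
  proof (rule nn_integral_cong)
    fix u
    let ?g = "\<lambda>v. ennreal ((cmod (h k u - h k v))\<^sup>2 * kern (cmod (cis u - cis v)))"
    have "(\<integral>\<^sup>+v. ?g v \<partial>circ) = (\<integral>\<^sup>+v\<in>{0..2*pi}. ?g v \<partial>lborel)" by (rule nn_integral_circ) measurable
    also have "\<dots> = (\<integral>\<^sup>+v\<in>{u-pi..u-pi+2*pi}. ?g v \<partial>lborel)"
      by (rule nn_integral_periodic[symmetric]) (measurable, simp add: hper flip: cis_mult)
    also have "\<dots> = (\<integral>\<^sup>+t. ?g (t + u) * indicator {u-pi..u-pi+2*pi} (t + u) \<partial>lborel)"
      by (rule nn_integral_lborel_shift[symmetric]) measurable
    also have "\<dots> = (\<integral>\<^sup>+t\<in>{-pi..pi}. ennreal ((cmod (h k u - h k (u + t)))\<^sup>2 * kern (cmod (cis t - 1))) \<partial>lborel)"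
      by (intro nn_integral_cong) (auto simp: indicator_def rot add.commute[of _ u])
    finally show "(\<integral>\<^sup>+v. ?g v \<partial>circ) = \<dots>" .
  qed
  also have "\<dots> = (\<integral>\<^sup>+t. \<integral>\<^sup>+u. ennreal ((cmod (h k u - h k (u + t)))\<^sup>2 * kern (cmod (cis t - 1))) * indicator {-pi..pi} t \<partial>circ \<partial>lborel)"
  proof -
    interpret lc: pair_sigma_finite "lborel :: real measure" circ ..
    show ?thesis by (rule lc.Fubini') measurable
  qed
  also have "\<dots> \<le> (\<integral>\<^sup>+t. (\<Sum>n. ennreal (2*pi*(cmod (c n))\<^sup>2) * (ennreal ((cmod (cis (real n * t) - 1))\<^sup>2 * kern (cmod (cis t - 1))) * indicator {-pi..pi} t)) \<partial>lborel)"
  proof (rule nn_integral_mono)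
    fix t
    have "(\<integral>\<^sup>+u. ennreal ((cmod (h k u - h k (u + t)))\<^sup>2 * kern (cmod (cis t - 1))) * indicator {-pi..pi} t \<partial>circ)
      = (\<integral>\<^sup>+u. (ennreal (kern (cmod (cis t - 1))) * indicator {-pi..pi} t) * ennreal ((cmod (h k (u + t) - h k u))\<^sup>2) \<partial>circ)"
      by (intro nn_integral_cong) (simp add: ennreal_mult kern_nonneg norm_minus_commute mult_ac)
    also have "\<dots> = (ennreal (kern (cmod (cis t - 1))) * indicator {-pi..pi} t) * (\<integral>\<^sup>+u. ennreal ((cmod (h k (u + t) - h k u))\<^sup>2) \<partial>circ)"
      by (rule nn_integral_cmult) measurable
    also have "(\<integral>\<^sup>+u. ennreal ((cmod (h k (u + t) - h k u))\<^sup>2) \<partial>circ) = (\<integral>\<^sup>+u\<in>{0..2*pi}. ennreal ((cmod (h k (u + t) - h k u))\<^sup>2) \<partial>lborel)"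
      by (rule nn_integral_circ) measurable
    also have "(ennreal (kern (cmod (cis t - 1))) * indicator {-pi..pi} t) * \<dots> \<le> (ennreal (kern (cmod (cis t - 1))) * indicator {-pi..pi} t) *
        (\<Sum>n. ennreal (2*pi*(cmod (c n))\<^sup>2 * (cmod (cis (real n * t) - 1))\<^sup>2))"
      unfolding h_def c_def by (intro mult_left_mono rotation_difference_le a) auto
    also have "\<dots> = (\<Sum>n. (ennreal (kern (cmod (cis t - 1))) * indicator {-pi..pi} t) * ennreal (2*pi*(cmod (c n))\<^sup>2 * (cmod (cis (real n * t) - 1))\<^sup>2))"
      by (rule ennreal_suminf_cmult[symmetric])
    also have "\<dots> = (\<Sum>n. ennreal (2*pi*(cmod (c n))\<^sup>2) * (ennreal ((cmod (cis (real n * t) - 1))\<^sup>2 * kern (cmod (cis t - 1))) * indicator {-pi..pi} t))"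
      by (intro suminf_cong) (simp add: ennreal_mult kern_nonneg mult_ac)
    finally show "(\<integral>\<^sup>+u. ennreal ((cmod (h k u - h k (u + t)))\<^sup>2 * kern (cmod (cis t - 1))) * indicator {-pi..pi} t \<partial>circ) \<le> \<dots>" .
  qed
  also have "\<dots> = (\<Sum>n. ennreal (2*pi*(cmod (c n))\<^sup>2) * (\<integral>\<^sup>+t\<in>{-pi..pi}. ennreal ((cmod (cis (real n * t) - 1))\<^sup>2 * kern (cmod (cis t - 1))) \<partial>lborel))"
    by (subst nn_integral_suminf) (auto simp: nn_integral_cmult)
  \<comment> \<open>The multiplier at n = 0 vanishes because cis 0 = 1; the shift aligns the series
    with that of the derivative.\<close>
  also have "\<dots> = (\<Sum>n. ennreal (2*pi*(cmod (c (Suc n)))\<^sup>2) * (\<integral>\<^sup>+t\<in>{-pi..pi}. ennreal ((cmod (cis (real (Suc n) * t) - 1))\<^sup>2 * kern (cmod (cis t - 1))) \<partial>lborel))"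
    (is "suminf ?G = _")
  proof -
    have "suminf ?G = suminf (\<lambda>n. ?G (n + 1)) + sum ?G {..<1}" by (rule suminf_offset) simp
    moreover have "sum ?G {..<1} = 0" by simp
    ultimately show ?thesis by simp
  qed
  also have "\<dots> \<le> (\<Sum>n. ennreal (exp 4 * (8 + 32 * A1)) * (ennreal (2*pi*(real (Suc n) * cmod (c (Suc n)))\<^sup>2) * (\<integral>\<^sup>+s\<in>{0<..}. ennreal (exp (- 2 * real (Suc n) * s)) * ennreal (K (ln (1 / exp (-s)))) \<partial>lborel)))"
  proof (intro suminf_le summableI)
    fix n
    let ?m = "real (Suc n)" and ?b = "2*pi*(cmod (c (Suc n)))\<^sup>2"
    have b: "0 \<le> ?b" by simp
    have k: "0 \<le> K (1 / ?m)" by (rule K_nonneg)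
    have "ennreal ?b * (\<integral>\<^sup>+t\<in>{-pi..pi}. ennreal ((cmod (cis (?m * t) - 1))\<^sup>2 * kern (cmod (cis t - 1))) \<partial>lborel)
      \<le> ennreal ?b * ennreal ((8 + 32 * A1) * ?m * K (1 / ?m))"
      unfolding kern_def by (intro mult_left_mono cis_kernel_le) auto
    also have "\<dots> = ennreal (exp 4 * (8 + 32 * A1) * (2*pi*(?m * cmod (c (Suc n)))\<^sup>2)) * ennreal (exp (-4) / ?m * K (1 / ?m))"
    proof -
      have "?b * ((8 + 32 * A1) * ?m * K (1 / ?m)) = ?b * ((8 + 32 * A1) * ?m * K (1 / ?m)) * (exp 4 * exp (-4))"
        by (simp flip: exp_add)
      also have "\<dots> = (exp 4 * (8 + 32 * A1) * (2*pi*(?m * cmod (c (Suc n)))\<^sup>2)) * (exp (-4) / ?m * K (1 / ?m))"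
        by (simp add: power_mult_distrib power2_eq_square del: of_nat_Suc)
      finally have "?b * ((8 + 32 * A1) * ?m * K (1 / ?m)) = \<dots>" .
      then show ?thesis using A1(2) k b by (subst (1 2) ennreal_mult[symmetric]) auto
    qed
    also have "\<dots> \<le> ennreal (exp 4 * (8 + 32 * A1) * (2*pi*(?m * cmod (c (Suc n)))\<^sup>2)) * (\<integral>\<^sup>+s\<in>{0<..}. ennreal (exp (- 2 * ?m * s) * K s) \<partial>lborel)"
      by (intro mult_left_mono laplace_lower) (auto intro: K_le K_nonneg)
    also have "\<dots> = ennreal (exp 4 * (8 + 32 * A1)) * (ennreal (2*pi*(?m * cmod (c (Suc n)))\<^sup>2) * (\<integral>\<^sup>+s\<in>{0<..}. ennreal (exp (- 2 * ?m * s) * K s) \<partial>lborel))"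
      using A1(2) by (subst ennreal_mult) (auto simp: mult.assoc)
    also have "(\<integral>\<^sup>+s\<in>{0<..}. ennreal (exp (- 2 * ?m * s) * K s) \<partial>lborel) = (\<integral>\<^sup>+s\<in>{0<..}. ennreal (exp (- 2 * ?m * s)) * ennreal (K (ln (1 / exp (-s)))) \<partial>lborel)"
    proof -
      have "ln (1 / exp (-s)) = s" for s :: real by (simp add: ln_div)
      then show ?thesis by (intro nn_integral_cong) (simp only: ennreal_mult[OF exp_ge_zero K_nonneg])
    qed
    finally show "ennreal ?b * (\<integral>\<^sup>+t\<in>{-pi..pi}. ennreal ((cmod (cis (?m * t) - 1))\<^sup>2 * kern (cmod (cis t - 1))) \<partial>lborel)
      \<le> ennreal (exp 4 * (8 + 32 * A1)) * (ennreal (2*pi*(?m * cmod (c (Suc n)))\<^sup>2) * (\<integral>\<^sup>+s\<in>{0<..}. ennreal (exp (- 2 * ?m * s)) * ennreal (K (ln (1 / exp (-s)))) \<partial>lborel))" .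
  qed
  also have "\<dots> = ennreal (exp 4 * (8 + 32 * A1)) * (\<Sum>n. ennreal (2*pi*(real (Suc n) * cmod (c (Suc n)))\<^sup>2) * (\<integral>\<^sup>+s\<in>{0<..}. ennreal (exp (- 2 * real (Suc n) * s)) * ennreal (K (ln (1 / exp (-s)))) \<partial>lborel))"
    by (rule ennreal_suminf_cmult)
  also have "(\<Sum>n. ennreal (2*pi*(real (Suc n) * cmod (c (Suc n)))\<^sup>2) * (\<integral>\<^sup>+s\<in>{0<..}. ennreal (exp (- 2 * real (Suc n) * s)) * ennreal (K (ln (1 / exp (-s)))) \<partial>lborel))
    = (\<integral>\<^sup>+z\<in>ball 0 1. ennreal ((cmod (deriv (\<lambda>z. f (disk_aut a z)) z))\<^sup>2) * ennreal (K (ln (1 / cmod z))) \<partial>lborel)"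
    unfolding c_def comp_coeff_def
    by (rule nn_integral_disk_deriv[OF holomorphic_comp_disk_aut[OF a hol], of "\<lambda>r. ennreal (K (ln (1 / r)))", symmetric]) measurable
  also have "\<dots> = (\<integral>\<^sup>+z\<in>ball 0 1. ennreal ((cmod (deriv f z))\<^sup>2) * ennreal (K (ln (1 / cmod (disk_aut a z)))) \<partial>lborel)"
    by (rule nn_integral_deriv_disk_aut[OF a hol, of "\<lambda>r. ennreal (K (ln (1 / r)))", symmetric]) measurable
  finally show ?thesis .
qed

text \<open>Changing both variables by the lift of sigma_a preserves du dv / |u - v|^2 and turns
  |sigma_a u - sigma_a v| into |u - v|. Fatou's lemma then passes from the dilates of the
  composition to its boundary values.\<close>

lemma moebius_double_integral_le_deriv:
  assumes a: "cmod a < 1"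
  shows "(\<integral>\<^sup>+u. \<integral>\<^sup>+v. ennreal ((cmod (F u - F v))\<^sup>2 / (cmod (cis u - cis v))\<^sup>2 * K (cmod (disk_aut a (cis u) - disk_aut a (cis v)))) \<partial>circ \<partial>circ)
    \<le> ennreal (exp 4 * (8 + 32 * A1)) * (\<integral>\<^sup>+z\<in>ball 0 1. ennreal ((cmod (deriv f z))\<^sup>2) * ennreal (K (ln (1 / cmod (disk_aut a z)))) \<partial>lborel)"
  (is "_ \<le> ?R")
proof -
  define \<psi> where "\<psi> = moebius_angle a"
  have pm [measurable]: "\<psi> \<in> borel_measurable borel" unfolding \<psi>_def by (rule borel_measurable_moebius_angle[OF a])
  have cpsi: "cis (\<psi> t) = disk_aut a (cis t)" for t unfolding \<psi>_def by (rule cis_moebius_angle[OF a])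
  define q where "q t = (1 - (cmod a)\<^sup>2) / (cmod (1 - cnj a * cis t))\<^sup>2" for t
  have [measurable]: "q \<in> borel_measurable borel" unfolding q_def[abs_def] by measurable
  have q0: "0 < q t" for t
    using a one_minus_cnj_mult_nonzero[OF a, of "cis t"] by (auto simp: q_def power_less_one_iff)
  have change: "(\<integral>\<^sup>+t. H t \<partial>circ) = (\<integral>\<^sup>+t. H (\<psi> t) * ennreal (q t) \<partial>circ)"
    if [measurable]: "H \<in> borel_measurable borel" and "\<And>t. H (t + 2*pi) = H t" for H
  proof -
    have "(\<integral>\<^sup>+t. H t \<partial>circ) = (\<integral>\<^sup>+t\<in>{0..2*pi}. H t \<partial>lborel)" by (rule nn_integral_circ) measurable
    also have "\<dots> = (\<integral>\<^sup>+t\<in>{0..2*pi}. H (\<psi> t) * ennreal (q t) \<partial>lborel)"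
      unfolding \<psi>_def q_def by (rule nn_integral_moebius_angle[OF a that])
    also have "\<dots> = (\<integral>\<^sup>+t. H (\<psi> t) * ennreal (q t) \<partial>circ)"
      by (rule nn_integral_circ[symmetric]) measurable
    finally show ?thesis .
  qed
  define Y where "Y u v = ennreal ((cmod (F u - F v))\<^sup>2 / (cmod (cis u - cis v))\<^sup>2 * K (cmod (disk_aut a (cis u) - disk_aut a (cis v))))" for u v
  have Ym [measurable]: "(\<lambda>x. Y (g x) (g' x)) \<in> borel_measurable M"
    if [measurable]: "g \<in> borel_measurable M" "g' \<in> borel_measurable M" for g g' and M :: "'x measure"
    unfolding Y_def by measurable
  have Fper: "F (t + 2*pi) = F t" for t by (simp add: F_def flip: cis_mult)
  have Yper: "Y (u + 2*pi) v = Y u v" "Y u (v + 2*pi) = Y u v" for u v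
    by (simp_all add: Y_def Fper) (simp_all flip: cis_mult)
  define h where "h k u = f (disk_aut a (of_real (radius_seq k) * cis u))" for k u
  have hm: "h k \<in> borel_measurable borel" for k unfolding h_def[abs_def] by (rule borel_comp_dilate[OF a])
  have hm' [measurable]: "(\<lambda>x. h k (g x)) \<in> borel_measurable M" if "g \<in> borel_measurable M" for g k and M :: "'x measure"
    by (rule measurable_compose[OF that hm])
  define X where "X k u v = ennreal ((cmod (h k u - h k v))\<^sup>2 * kern (cmod (cis u - cis v)))" for k u v
  have Xm [measurable]: "(\<lambda>x. X k (g x) (g' x)) \<in> borel_measurable M"
    if [measurable]: "g \<in> borel_measurable M" "g' \<in> borel_measurable M" for k g g' and M :: "'x measure"
    unfolding X_def by measurable
  have conf: "Y (\<psi> u) (\<psi> v) * ennreal (q v) * ennreal (q u) = ennreal ((cmod (F (\<psi> u) - F (\<psi> v)))\<^sup>2 * kern (cmod (cis u - cis v)))" for u v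
  proof -
    have s: "disk_aut a (disk_aut a (cis t)) = cis t" for t by (rule disk_aut_involution[OF a]) simp
    define A where "A = 1 - (cmod a)\<^sup>2"
    define p where "p t = cmod (1 - cnj a * cis t)" for t
    have p: "0 < p t" for t using one_minus_cnj_mult_nonzero[OF a, of "cis t"] by (simp add: p_def)
    have A: "0 < A" using a by (simp add: A_def power_less_one_iff)
    have d: "cmod (disk_aut a (cis u) - disk_aut a (cis v)) = A * cmod (cis u - cis v) / (p u * p v)"
      using norm_disk_aut_diff[OF a, of "cis u" "cis v"] by (simp add: A_def p_def)
    have "x / (A * \<delta> / (p u * p v))\<^sup>2 * \<kappa> * (A / (p v)\<^sup>2) * (A / (p u)\<^sup>2) = x * (\<kappa> / \<delta>\<^sup>2)" for x \<delta> \<kappa> :: real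
      using A p[of u] p[of v] by (simp add: power2_eq_square field_simps)
    then have "(cmod (F (\<psi> u) - F (\<psi> v)))\<^sup>2 / (cmod (disk_aut a (cis u) - disk_aut a (cis v)))\<^sup>2 * K (cmod (cis u - cis v)) * q v * q u
       = (cmod (F (\<psi> u) - F (\<psi> v)))\<^sup>2 * kern (cmod (cis u - cis v))"
      unfolding d by (simp only: q_def kern_def A_def[symmetric] p_def[symmetric])
    then show ?thesis
      unfolding Y_def cpsi s using K_nonneg q0[of u] q0[of v] by (simp add: ennreal_mult[symmetric] less_imp_le del: times_divide_eq_left times_divide_eq_right)
  qed
  have lim: "AE t in circ. (\<lambda>k. h k t) \<longlonglongrightarrow> F (\<psi> t)"
    unfolding h_def \<psi>_def by (rule AE_comp_LIMSEQ[OF a])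
  have "(\<integral>\<^sup>+u. \<integral>\<^sup>+v. Y u v \<partial>circ \<partial>circ) = (\<integral>\<^sup>+u. (\<integral>\<^sup>+v. Y (\<psi> u) v \<partial>circ) * ennreal (q u) \<partial>circ)"
    by (rule change) (measurable, simp add: Yper)
  also have "\<dots> = (\<integral>\<^sup>+u. (\<integral>\<^sup>+v. Y (\<psi> u) (\<psi> v) * ennreal (q v) \<partial>circ) * ennreal (q u) \<partial>circ)"
  proof (rule nn_integral_cong)
    fix u
    show "(\<integral>\<^sup>+v. Y (\<psi> u) v \<partial>circ) * ennreal (q u) = (\<integral>\<^sup>+v. Y (\<psi> u) (\<psi> v) * ennreal (q v) \<partial>circ) * ennreal (q u)"
      by (subst change[of "Y (\<psi> u)"]) (auto simp: Yper)
  qed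
  also have "\<dots> = (\<integral>\<^sup>+u. \<integral>\<^sup>+v. ennreal ((cmod (F (\<psi> u) - F (\<psi> v)))\<^sup>2 * kern (cmod (cis u - cis v))) \<partial>circ \<partial>circ)"
    unfolding conf[symmetric] by (intro nn_integral_cong nn_integral_multc[symmetric]) measurable
  also have "\<dots> = (\<integral>\<^sup>+u. \<integral>\<^sup>+v. liminf (\<lambda>k. X k u v) \<partial>circ \<partial>circ)"
  proof (rule nn_integral_cong_AE)
    \<comment> \<open>Convergence holds for almost every u and, for each such u, for almost every v;
      the identification with the lower limit is therefore made one variable at a time.\<close>
    show "AE u in circ. (\<integral>\<^sup>+v. ennreal ((cmod (F (\<psi> u) - F (\<psi> v)))\<^sup>2 * kern (cmod (cis u - cis v))) \<partial>circ) = (\<integral>\<^sup>+v. liminf (\<lambda>k. X k u v) \<partial>circ)"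
      using lim
    proof eventually_elim
      case u: (elim u)
      show ?case
      proof (rule nn_integral_cong_AE)
        show "AE v in circ. ennreal ((cmod (F (\<psi> u) - F (\<psi> v)))\<^sup>2 * kern (cmod (cis u - cis v))) = liminf (\<lambda>k. X k u v)"
          using lim
        proof eventually_elim
          case v: (elim v)
          have "(\<lambda>k. X k u v) \<longlonglongrightarrow> ennreal ((cmod (F (\<psi> u) - F (\<psi> v)))\<^sup>2 * kern (cmod (cis u - cis v)))"
            unfolding X_def by (intro tendsto_ennrealI tendsto_intros u v)
          then show ?case using lim_imp_Liminf by (metis trivial_limit_sequentially)
        qed
      qed
    qed
  qed
  also have "\<dots> \<le> (\<integral>\<^sup>+u. liminf (\<lambda>k. \<integral>\<^sup>+v. X k u v \<partial>circ) \<partial>circ)"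
    by (intro nn_integral_mono nn_integral_liminf) measurable
  also have "\<dots> \<le> liminf (\<lambda>k. \<integral>\<^sup>+u. \<integral>\<^sup>+v. X k u v \<partial>circ \<partial>circ)"
    by (rule nn_integral_liminf) measurable
  also have "\<dots> \<le> ?R"
    by (rule Liminf_le) (auto intro!: always_eventually simp: X_def h_def dilate_double_integral_le[OF a])
  finally show ?thesis by (simp add: Y_def)
qed

definition C3 :: real where "C3 = \<Phi> 4 * (exp 4 * (8 + 32 * A1))"

lemma arc_double_integral_le_deriv:
  assumes l: "0 < l" "l \<le> 2*pi" and B0: "0 \<le> B"
    and B: "\<And>a. cmod a < 1 \<Longrightarrow> (\<integral>\<^sup>+z\<in>ball 0 1. ennreal ((cmod (deriv f z))\<^sup>2) * ennreal (K (ln (1 / cmod (disk_aut a z)))) \<partial>lborel) \<le> ennreal B"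
  shows "(\<integral>\<^sup>+u\<in>{t..t+l}. \<integral>\<^sup>+v\<in>{t..t+l}. ennreal ((cmod (F u - F v))\<^sup>2 / (cmod (cis u - cis v))\<^sup>2 * K (cmod (cis u - cis v) / l)) \<partial>lborel \<partial>lborel)
    \<le> ennreal (C3 * B)"
proof -
  \<comment> \<open>For l = 2 pi this gives a = 0, so the full circle needs no separate
    treatment.\<close>
  define \<rho> where "\<rho> = 1 - l / (2*pi)"
  have \<rho>: "0 \<le> \<rho>" "\<rho> < 1" using l by (auto simp: \<rho>_def)
  define \<alpha> where "\<alpha> = t + l / 2"
  define a where "a = of_real \<rho> * cis \<alpha>"
  have na: "cmod a = \<rho>" using \<rho> by (simp add: a_def norm_mult)
  have a1: "cmod a < 1" using na \<rho> by simp
  define Y where "Y u v = ennreal ((cmod (F u - F v))\<^sup>2 / (cmod (cis u - cis v))\<^sup>2 * K (cmod (disk_aut a (cis u) - disk_aut a (cis v))))" for u v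
  have Ym [measurable]: "(\<lambda>x. Y (g x) (g' x)) \<in> borel_measurable M"
    if [measurable]: "g \<in> borel_measurable M" "g' \<in> borel_measurable M" for g g' and M :: "'x measure"
    unfolding Y_def by measurable
  have Fper: "F (t + 2*pi) = F t" for t by (simp add: F_def flip: cis_mult)
  have Yper: "Y (u + 2*pi) v = Y u v" "Y u (v + 2*pi) = Y u v" for u v
    by (simp_all add: Y_def Fper) (simp_all flip: cis_mult)
  have p: "cmod (1 - cnj a * cis u) \<le> l" if "u \<in> {t..t+l}" for u
  proof -
    have "1 - cnj a * cis u = 1 - of_real \<rho> * cis (u - \<alpha>)" by (simp add: a_def cis_cnj cis_mult mult.assoc)
    also have "cmod \<dots> = cmod ((1 - cis (u - \<alpha>)) + of_real (1 - \<rho>) * cis (u - \<alpha>))" by (simp add: algebra_simps)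
    also have "\<dots> \<le> cmod (1 - cis (u - \<alpha>)) + cmod (of_real (1 - \<rho>) * cis (u - \<alpha>))" by (rule norm_triangle_ineq)
    also have "\<dots> \<le> \<bar>u - \<alpha>\<bar> + (1 - \<rho>)"
      using norm_cis_diff_le[of 0 "u - \<alpha>"] \<rho> by (simp add: norm_mult del: of_real_diff)
    also have "\<dots> \<le> l / 2 + l / (2*pi)"
    proof (rule add_mono)
      show "\<bar>u - \<alpha>\<bar> \<le> l / 2" unfolding \<alpha>_def abs_le_iff using that by (simp add: field_simps)
    qed (simp add: \<rho>_def)
    also have "\<dots> \<le> l / 2 + l / 2" using l pi_gt3 by (intro add_left_mono divide_left_mono) auto
    finally show ?thesis by simp
  qed
  have pt: "ennreal ((cmod (F u - F v))\<^sup>2 / (cmod (cis u - cis v))\<^sup>2 * K (cmod (cis u - cis v) / l)) \<le> ennreal (\<Phi> 4) * Y u v"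
    if u: "u \<in> {t..t+l}" and v: "v \<in> {t..t+l}" for u v
  proof (cases "cis u = cis v")
    case True
    then show ?thesis by simp
  next
    case False
    define \<delta> where "\<delta> = cmod (cis u - cis v)"
    define \<sigma> where "\<sigma> = cmod (disk_aut a (cis u) - disk_aut a (cis v))"
    have \<delta>: "0 < \<delta>" using False by (simp add: \<delta>_def)
    define x where "x = cmod (1 - cnj a * cis u)"
    define y where "y = cmod (1 - cnj a * cis v)"
    have xy: "0 < x" "0 < y" using one_minus_cnj_mult_nonzero[OF a1] by (auto simp: x_def y_def)
    have s: "\<sigma> = (1 - \<rho>\<^sup>2) * \<delta> / (x * y)"
      using norm_disk_aut_diff[OF a1, of "cis u" "cis v"] by (simp add: \<sigma>_def \<delta>_def x_def y_def na)
    have "\<rho>\<^sup>2 \<le> \<rho>" using \<rho> by (simp add: power2_eq_square mult_left_le)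
    moreover have "\<rho>\<^sup>2 \<le> 1" using \<rho> by (simp add: power_le_one_iff)
    \<comment> \<open>The numerator is at least l / (2 pi) times the chord and the denominator at
      most l^2. Hence chord / l <= 2 pi sigma, and pi < 4 leads to Phi 4.\<close>
    ultimately have "l / (2*pi) * \<delta> / (l * l) \<le> \<sigma>"
      unfolding s using p[OF u] p[OF v] xy \<delta> l \<rho>
      by (intro frac_le mult_mono mult_pos_pos mult_nonneg_nonneg) (auto simp: \<rho>_def x_def y_def)
    then have "\<delta> / l \<le> 2 * pi * \<sigma>" using l by (simp add: field_simps)
    moreover have s0: "0 < \<sigma>" unfolding s using xy \<delta> \<rho> by (intro divide_pos_pos mult_pos_pos) (auto simp: power_less_one_iff)
    moreover have "2 * pi * \<sigma> \<le> 2 * 4 * \<sigma>" using s0 pi_less_4 by (intro mult_right_mono) auto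
    ultimately have "K (\<delta> / l) \<le> K (2 * 4 * \<sigma>)" by (intro K_le) linarith
    also have "\<dots> \<le> \<Phi> 4 * K \<sigma>"
    proof (rule scale)
      have "cmod (disk_aut a (cis u)) = 1" "cmod (disk_aut a (cis v)) = 1" using norm_disk_aut_circle[OF a1] by auto
      then show "\<sigma> \<le> 2" unfolding \<sigma>_def using norm_triangle_ineq4[of "disk_aut a (cis u)" "disk_aut a (cis v)"] by simp
    qed (use s0 in auto)
    finally have "(cmod (F u - F v))\<^sup>2 / \<delta>\<^sup>2 * K (\<delta> / l) \<le> (cmod (F u - F v))\<^sup>2 / \<delta>\<^sup>2 * (\<Phi> 4 * K \<sigma>)"
      by (intro mult_left_mono) auto
    then have "ennreal ((cmod (F u - F v))\<^sup>2 / \<delta>\<^sup>2 * K (\<delta> / l)) \<le> ennreal (\<Phi> 4 * ((cmod (F u - F v))\<^sup>2 / \<delta>\<^sup>2 * K \<sigma>))"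
      by (intro ennreal_leI) (simp add: mult_ac)
    also have "\<dots> = ennreal (\<Phi> 4) * Y u v"
      unfolding Y_def \<delta>_def \<sigma>_def using Phi_nonneg K_nonneg by (intro ennreal_mult) auto
    finally show ?thesis by (simp add: \<delta>_def)
  qed
  have "(\<integral>\<^sup>+u\<in>{t..t+l}. \<integral>\<^sup>+v\<in>{t..t+l}. ennreal ((cmod (F u - F v))\<^sup>2 / (cmod (cis u - cis v))\<^sup>2 * K (cmod (cis u - cis v) / l)) \<partial>lborel \<partial>lborel)
     \<le> (\<integral>\<^sup>+u\<in>{t..t+2*pi}. \<integral>\<^sup>+v\<in>{t..t+2*pi}. ennreal (\<Phi> 4) * Y u v \<partial>lborel \<partial>lborel)"
  proof (rule nn_integral_mono)
    fix u
    show "(\<integral>\<^sup>+v\<in>{t..t+l}. ennreal ((cmod (F u - F v))\<^sup>2 / (cmod (cis u - cis v))\<^sup>2 * K (cmod (cis u - cis v) / l)) \<partial>lborel) * indicator {t..t+l} u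
      \<le> (\<integral>\<^sup>+v\<in>{t..t+2*pi}. ennreal (\<Phi> 4) * Y u v \<partial>lborel) * indicator {t..t+2*pi} u"
    proof (cases "u \<in> {t..t+l}")
      case True
      have "(\<integral>\<^sup>+v\<in>{t..t+l}. ennreal ((cmod (F u - F v))\<^sup>2 / (cmod (cis u - cis v))\<^sup>2 * K (cmod (cis u - cis v) / l)) \<partial>lborel)
        \<le> (\<integral>\<^sup>+v\<in>{t..t+2*pi}. ennreal (\<Phi> 4) * Y u v \<partial>lborel)"
      proof (rule nn_integral_mono)
        fix v
        show "ennreal ((cmod (F u - F v))\<^sup>2 / (cmod (cis u - cis v))\<^sup>2 * K (cmod (cis u - cis v) / l)) * indicator {t..t+l} v
          \<le> ennreal (\<Phi> 4) * Y u v * indicator {t..t+2*pi} v"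
          using pt[OF True, of v] l by (cases "v \<in> {t..t+l}") auto
      qed
      then show ?thesis using True l by simp
    qed simp
  qed
  also have "\<dots> = (\<integral>\<^sup>+u\<in>{0..2*pi}. \<integral>\<^sup>+v\<in>{0..2*pi}. ennreal (\<Phi> 4) * Y u v \<partial>lborel \<partial>lborel)"
  proof -
    have "(\<integral>\<^sup>+v\<in>{t..t+2*pi}. ennreal (\<Phi> 4) * Y u v \<partial>lborel) = (\<integral>\<^sup>+v\<in>{0..2*pi}. ennreal (\<Phi> 4) * Y u v \<partial>lborel)" for u
      by (rule nn_integral_periodic) (auto simp: Yper)
    then show ?thesis by (simp only:) (rule nn_integral_periodic, auto simp: Yper)
  qed
  also have "\<dots> = ennreal (\<Phi> 4) * (\<integral>\<^sup>+u. \<integral>\<^sup>+v. Y u v \<partial>circ \<partial>circ)"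
    by (simp add: nn_integral_circ nn_integral_cmult mult.assoc)
  also have "\<dots> \<le> ennreal (\<Phi> 4) * (ennreal (exp 4 * (8 + 32 * A1)) * ennreal B)"
    unfolding Y_def
    by (intro mult_left_mono order.trans[OF moebius_double_integral_le_deriv[OF a1] mult_left_mono[OF B[OF a1]]]) auto
  also have "\<dots> = ennreal (C3 * B)"
    using Phi_nonneg A1(2) B0 by (simp add: C3_def ennreal_mult mult.assoc)
  finally show ?thesis .
qed

end

section \<open>The equivalence\<close>

lemma QK_bd_cong:
  assumes "\<And>x. 0 \<le> x \<Longrightarrow> K x = K' x"
  shows "QK_bd K F = QK_bd K' F"
proof -
  have "K (cmod (cis u - cis v) / l) = K' (cmod (cis u - cis v) / l)" if "l \<in> {0<..2*pi}" for u v l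
    using that by (intro assms) auto
  then have "(SUP (t, l)\<in>UNIV \<times> {0<..2*pi}. \<integral>\<^sup>+u\<in>{t..t+l}. \<integral>\<^sup>+v\<in>{t..t+l}.
      ennreal ((cmod (F (cis u) - F (cis v)))\<^sup>2 / (cmod (cis u - cis v))\<^sup>2 * K (cmod (cis u - cis v) / l)) \<partial>lborel \<partial>lborel)
    = (SUP (t, l)\<in>UNIV \<times> {0<..2*pi}. \<integral>\<^sup>+u\<in>{t..t+l}. \<integral>\<^sup>+v\<in>{t..t+l}.
      ennreal ((cmod (F (cis u) - F (cis v)))\<^sup>2 / (cmod (cis u - cis v))\<^sup>2 * K' (cmod (cis u - cis v) / l)) \<partial>lborel \<partial>lborel)"
    by (intro SUP_cong) (auto simp del: times_divide_eq_left)
  then show ?thesis unfolding QK_bd_def by simp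
qed

lemma ln_inverse_nonneg: "0 \<le> x \<Longrightarrow> x < 1 \<Longrightarrow> 0 \<le> ln (1 / x :: real)"
  by (cases "x = 0") (auto intro!: ln_ge_zero)

lemma QK_bdD:
  assumes "QK_bd K F"
  obtains B where "0 \<le> B" "\<And>t l. 0 < l \<Longrightarrow> l \<le> 2*pi \<Longrightarrow> (\<integral>\<^sup>+u\<in>{t..t+l}. \<integral>\<^sup>+v\<in>{t..t+l}.
      ennreal ((cmod (F (cis u) - F (cis v)))\<^sup>2 / (cmod (cis u - cis v))\<^sup>2 * K (cmod (cis u - cis v) / l)) \<partial>lborel \<partial>lborel) \<le> ennreal B"
proof -
  let ?I = "\<lambda>t l. \<integral>\<^sup>+u\<in>{t..t+l}. \<integral>\<^sup>+v\<in>{t..t+l}.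
      ennreal ((cmod (F (cis u) - F (cis v)))\<^sup>2 / (cmod (cis u - cis v))\<^sup>2 * K (cmod (cis u - cis v) / l)) \<partial>lborel \<partial>lborel"
  define S where "S = (SUP (t, l)\<in>UNIV \<times> {0<..2*pi}. ?I t l)"
  have "S < top" using assms by (simp add: QK_bd_def S_def)
  then obtain B where B: "S = ennreal B" "0 \<le> B" by (cases S) auto
  have "?I t l \<le> ennreal B" if "0 < l" "l \<le> 2*pi" for t l
    unfolding B(1)[symmetric] S_def
    using that by (intro SUP_upper2[of "(t, l)"]) auto
  then show ?thesis using that B(2) by blast
qed

context weighted_hardy
begin

definition gap :: "complex \<Rightarrow> real" where
  "gap z = poisson_int (\<lambda>\<zeta>. cmod (bdry_fun f \<zeta>)) z - cmod (f z)"

definition green_energy :: "complex \<Rightarrow> ennreal" where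
  "green_energy a = (\<integral>\<^sup>+z\<in>ball 0 1. ennreal ((cmod (deriv f z))\<^sup>2) * ennreal (K (ln (1 / cmod (disk_aut a z)))) \<partial>lborel)"

lemma poisson_int_eq:
  assumes z: "cmod z < 1"
  shows "poisson_int (\<lambda>\<zeta>. cmod (bdry_fun f \<zeta>)) z = (\<integral>t. cmod (F t) \<partial>pmeasure z)"
proof -
  have "(\<integral>t. cmod (F t) \<partial>pmeasure z) = (\<integral>t. (poisson_kernel z t / (2*pi)) *\<^sub>R cmod (F t) \<partial>circ)"
    by (rule integral_pmeasure) (use z in measurable)
  also have "\<dots> = (LINT t:{0..2*pi}|lborel. (poisson_kernel z t / (2*pi)) *\<^sub>R cmod (F t))"
    by (rule integral_circ) measurable
  also have "\<dots> = poisson_int (\<lambda>\<zeta>. cmod (bdry_fun f \<zeta>)) z"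
    unfolding poisson_int_def set_lebesgue_integral_def
    by (intro Bochner_Integration.integral_cong refl) (simp add: poisson_kernel_def F_def mult_ac)
  finally show ?thesis by simp
qed

lemma integrable_pmeasure_F:
  assumes "cmod z < 1"
  shows "integrable (pmeasure z) F" "integrable (pmeasure z) (\<lambda>t. cmod (F t))"
  using integrable_pmeasure[OF _ assms] integrable_F by auto

text \<open>Since f z is the Poisson mean of F, the gap is at most the mean of ||f z| - |F||, hence
  of |F - mean of F|; \<open>oscillation_square_le\<close> then applies.\<close>

lemma gap_square_le:
  assumes z: "cmod z < 1"
  shows "ennreal ((gap z)\<^sup>2) \<le> (\<integral>\<^sup>+u. \<integral>\<^sup>+v. ennreal ((cmod (F u - F v))\<^sup>2) \<partial>pmeasure z \<partial>pmeasure z)"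
proof -
  let ?M = "pmeasure z"
  have M: "emeasure ?M (space ?M) = 1" using emeasure_pmeasure[OF z] by simp
  have "\<bar>gap z\<bar> = norm (cmod (f z) - integral\<^sup>L ?M (\<lambda>t. cmod (F t)))"
    by (simp add: gap_def poisson_int_eq[OF z] abs_minus_commute)
  then have "ennreal \<bar>gap z\<bar> \<le> (\<integral>\<^sup>+v. ennreal (norm (cmod (f z) - cmod (F v))) \<partial>?M)"
    using norm_minus_integral_le[OF M integrable_pmeasure_F(2)[OF z]] by metis
  also have "\<dots> \<le> (\<integral>\<^sup>+v. ennreal (cmod (F v - integral\<^sup>L ?M F)) \<partial>?M)"
  proof (intro nn_integral_mono ennreal_leI)
    fix v
    show "norm (cmod (f z) - cmod (F v)) \<le> cmod (F v - integral\<^sup>L ?M F)"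
      unfolding integral_pmeasure_F[OF z] using norm_triangle_ineq3[of "F v" "f z"] by (simp add: abs_minus_commute)
  qed
  finally have "(ennreal \<bar>gap z\<bar>)\<^sup>2 \<le> (\<integral>\<^sup>+v. ennreal (cmod (F v - integral\<^sup>L ?M F)) \<partial>?M)\<^sup>2"
    by (intro power_mono) auto
  also have "\<dots> \<le> (\<integral>\<^sup>+u. \<integral>\<^sup>+v. ennreal ((cmod (F u - F v))\<^sup>2) \<partial>?M \<partial>?M)"
    by (rule oscillation_square_le[OF M integrable_pmeasure_F(1)[OF z]])
  finally show ?thesis by (simp add: ennreal_power)
qed

text \<open>\<open>deriv_le_oscillation\<close> compares |F| with |f z|; moving the centre to the
  mean of |F| costs |gap z|. The 32 is 4^2 times the 2 from squaring a sum.\<close>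

lemma deriv_square_le:
  assumes z: "cmod z < 1"
  shows "ennreal (((1 - (cmod z)\<^sup>2) * cmod (deriv f z))\<^sup>2)
    \<le> ennreal 32 * ((\<integral>\<^sup>+u. \<integral>\<^sup>+v. ennreal ((cmod (of_real (cmod (F u)) - of_real (cmod (F v)) :: complex))\<^sup>2) \<partial>pmeasure z \<partial>pmeasure z) + ennreal ((gap z)\<^sup>2))"
proof -
  let ?M = "pmeasure z"
  have M: "emeasure ?M (space ?M) = 1" using emeasure_pmeasure[OF z] by simp
  interpret finite_measure ?M by (rule finite_measureI) (use M in simp)
  define m where "m = integral\<^sup>L ?M (\<lambda>t. cmod (F t))"
  have g: "gap z = m - cmod (f z)" by (simp add: gap_def m_def poisson_int_eq[OF z])
  note iF = integrable_pmeasure_F(2)[OF z]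
  define w where "w = (\<integral>t. \<bar>cmod (F t) - m\<bar> \<partial>?M)"
  have w0: "0 \<le> w" by (simp add: w_def)
  have "(\<integral>t. \<bar>cmod (F t) - cmod (f z)\<bar> \<partial>?M) \<le> (\<integral>t. \<bar>cmod (F t) - m\<bar> + \<bar>gap z\<bar> \<partial>?M)"
    using iF by (intro integral_mono) (auto simp: g)
  also have "\<dots> = w + \<bar>gap z\<bar>"
    using iF M by (simp add: w_def measure_def)
  finally have "(1 - (cmod z)\<^sup>2) * cmod (deriv f z) \<le> 4 * (w + \<bar>gap z\<bar>)"
    by (intro order.trans[OF deriv_le_oscillation[OF z]] mult_left_mono) auto
  moreover have "0 \<le> (1 - (cmod z)\<^sup>2) * cmod (deriv f z)"
    using z by (intro mult_nonneg_nonneg) (auto simp: power_le_one_iff)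
  ultimately have "((1 - (cmod z)\<^sup>2) * cmod (deriv f z))\<^sup>2 \<le> (4 * (w + \<bar>gap z\<bar>))\<^sup>2" by (intro power_mono) auto
  also have "\<dots> = 32 * (w\<^sup>2 + (gap z)\<^sup>2) - 16 * (w - \<bar>gap z\<bar>)\<^sup>2" by (simp add: power2_eq_square algebra_simps)
  also have "\<dots> \<le> 32 * (w\<^sup>2 + (gap z)\<^sup>2)" by simp
  finally have "ennreal (((1 - (cmod z)\<^sup>2) * cmod (deriv f z))\<^sup>2) \<le> ennreal (32 * (w\<^sup>2 + (gap z)\<^sup>2))" by (rule ennreal_leI)
  also have "\<dots> = ennreal 32 * (ennreal (w\<^sup>2) + ennreal ((gap z)\<^sup>2))" by (subst ennreal_mult, simp, simp, subst ennreal_plus, simp_all)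
  also have "ennreal (w\<^sup>2) \<le> (\<integral>\<^sup>+u. \<integral>\<^sup>+v. ennreal ((cmod (of_real (cmod (F u)) - of_real (cmod (F v)) :: complex))\<^sup>2) \<partial>?M \<partial>?M)"
  proof -
    have "ennreal w = (\<integral>\<^sup>+t. ennreal (norm (cmod (F t) - m)) \<partial>?M)"
      unfolding w_def using iF by (subst nn_integral_eq_integral) auto
    then have "(ennreal w)\<^sup>2 \<le> (\<integral>\<^sup>+u. \<integral>\<^sup>+v. ennreal ((norm (cmod (F u) - cmod (F v)))\<^sup>2) \<partial>?M \<partial>?M)"
      using oscillation_square_le[OF M iF] by (simp add: m_def)
    also have "\<dots> = (\<integral>\<^sup>+u. \<integral>\<^sup>+v. ennreal ((cmod (of_real (cmod (F u)) - of_real (cmod (F v)) :: complex))\<^sup>2) \<partial>?M \<partial>?M)"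
      by (simp add: norm_of_real flip: of_real_diff)
    finally show ?thesis using w0 by (simp add: ennreal_power)
  qed
  finally show ?thesis by (simp add: mult_left_mono add_right_mono)
qed

text \<open>With \<open>a\<close> moved to the origin both energies are series in the same Taylor
  coefficients, and \<open>laplace_compare\<close> is applied term by term.\<close>

lemma green_energy_le:
  assumes a: "cmod a < 1"
  shows "green_energy a \<le> ennreal ((1 + A1) * exp 4 * \<Phi> 1) *
    (\<integral>\<^sup>+z\<in>ball 0 1. ennreal ((cmod (deriv f z))\<^sup>2) * ennreal (K (1 - (cmod (disk_aut a z))\<^sup>2)) \<partial>lborel)"
proof -
  let ?h = "\<lambda>z. f (disk_aut a z)"
  have h: "?h holomorphic_on ball 0 1" by (rule holomorphic_comp_disk_aut[OF a hol])
  let ?c = "\<lambda>n. ennreal (2*pi*(real (Suc n) * cmod ((deriv ^^ Suc n) ?h 0 / fact (Suc n)))\<^sup>2)"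
  have e: "exp (-s) ^ 2 = exp (- 2 * s)" "ln (1 / exp (-s)) = s" for s :: real
    by (simp_all add: power2_eq_square ln_div flip: exp_add)
  have green: "green_energy a = (\<Sum>n. ?c n * (\<integral>\<^sup>+s\<in>{0<..}. ennreal (exp (- 2 * real (Suc n) * s)) * ennreal (K (ln (1 / exp (-s)))) \<partial>lborel))"
    unfolding green_energy_def
    using nn_integral_deriv_disk_aut[OF a hol, of "\<lambda>r. ennreal (K (ln (1 / r)))"]
      nn_integral_disk_deriv[OF h, of "\<lambda>r. ennreal (K (ln (1 / r)))"] by simp
  have std: "(\<integral>\<^sup>+z\<in>ball 0 1. ennreal ((cmod (deriv f z))\<^sup>2) * ennreal (K (1 - (cmod (disk_aut a z))\<^sup>2)) \<partial>lborel)
     = (\<Sum>n. ?c n * (\<integral>\<^sup>+s\<in>{0<..}. ennreal (exp (- 2 * real (Suc n) * s)) * ennreal (K (1 - (exp (-s))\<^sup>2)) \<partial>lborel))"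
    using nn_integral_deriv_disk_aut[OF a hol, of "\<lambda>r. ennreal (K (1 - r\<^sup>2))"]
      nn_integral_disk_deriv[OF h, of "\<lambda>r. ennreal (K (1 - r\<^sup>2))"] by simp
  have "green_energy a \<le> (\<Sum>n. ennreal ((1 + A1) * exp 4 * \<Phi> 1) * (?c n * (\<integral>\<^sup>+s\<in>{0<..}. ennreal (exp (- 2 * real (Suc n) * s)) * ennreal (K (1 - (exp (-s))\<^sup>2)) \<partial>lborel)))"
    unfolding green
  proof (intro suminf_le summableI)
    fix n
    let ?J = "\<lambda>G. \<integral>\<^sup>+s\<in>{0<..}. ennreal (exp (- 2 * real (Suc n) * s)) * ennreal (K (G s)) \<partial>lborel"
    have J: "?J G = (\<integral>\<^sup>+s\<in>{0<..}. ennreal (exp (- 2 * real (Suc n) * s) * K (G s)) \<partial>lborel)" for G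
      by (simp only: ennreal_mult[OF exp_ge_zero K_nonneg])
    have "?J (\<lambda>s. ln (1 / exp (-s))) \<le> ennreal ((1 + A1) * exp 4 * \<Phi> 1) * ?J (\<lambda>s. 1 - (exp (-s))\<^sup>2)"
      unfolding e J by (rule laplace_compare) simp
    then have "?c n * ?J (\<lambda>s. ln (1 / exp (-s))) \<le> ?c n * (ennreal ((1 + A1) * exp 4 * \<Phi> 1) * ?J (\<lambda>s. 1 - (exp (-s))\<^sup>2))"
      by (rule mult_left_mono) simp
    then show "?c n * ?J (\<lambda>s. ln (1 / exp (-s))) \<le> ennreal ((1 + A1) * exp 4 * \<Phi> 1) * (?c n * ?J (\<lambda>s. 1 - (exp (-s))\<^sup>2))"
      by (simp only: mult.left_commute)
  qed
  also have "\<dots> = ennreal ((1 + A1) * exp 4 * \<Phi> 1) * (\<Sum>n. ?c n * (\<integral>\<^sup>+s\<in>{0<..}. ennreal (exp (- 2 * real (Suc n) * s)) * ennreal (K (1 - (exp (-s))\<^sup>2)) \<partial>lborel))"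
    by (rule ennreal_suminf_cmult)
  finally show ?thesis unfolding std .
qed

lemma bdry_in_QK_bd:
  assumes B: "\<And>a. cmod a < 1 \<Longrightarrow> green_energy a \<le> ennreal B" and B0: "0 \<le> B"
  shows "QK_bd K (bdry_fun f)"
  unfolding QK_bd_def
proof (intro conjI)
  show "(\<lambda>t. bdry_fun f (cis t)) \<in> borel_measurable lborel" using borel_F by (simp add: F_def[abs_def])
  show "(\<integral>\<^sup>+t\<in>{0..2*pi}. ennreal ((cmod (bdry_fun f (cis t)))\<^sup>2) \<partial>lborel) < top"
    using F_square_integrable borel_F by (subst (asm) nn_integral_circ) (auto simp: F_def[abs_def])
  have "(SUP (t, l)\<in>UNIV \<times> {0<..2*pi}. \<integral>\<^sup>+u\<in>{t..t+l}. \<integral>\<^sup>+v\<in>{t..t+l}.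
          ennreal ((cmod (bdry_fun f (cis u) - bdry_fun f (cis v)))\<^sup>2 / (cmod (cis u - cis v))\<^sup>2 * K (cmod (cis u - cis v) / l)) \<partial>lborel \<partial>lborel) \<le> ennreal (C3 * B)"
    using arc_double_integral_le_deriv[OF _ _ B0 B[unfolded green_energy_def]]
    by (intro SUP_least) (auto simp: F_def)
  then show "(SUP (t, l)\<in>UNIV \<times> {0<..2*pi}. \<integral>\<^sup>+u\<in>{t..t+l}. \<integral>\<^sup>+v\<in>{t..t+l}.
          ennreal ((cmod (bdry_fun f (cis u) - bdry_fun f (cis v)))\<^sup>2 / (cmod (cis u - cis v))\<^sup>2 * K (cmod (cis u - cis v) / l)) \<partial>lborel \<partial>lborel) < top"
    by (rule le_less_trans) simp
qed

text \<open>By the reverse triangle inequality, taking moduli does not increase the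
  integrand.\<close>

lemma QK_bd_norm:
  assumes "QK_bd K (bdry_fun f)"
  shows "QK_bd K (\<lambda>\<zeta>. of_real (cmod (bdry_fun f \<zeta>)))"
  unfolding QK_bd_def
proof (intro conjI)
  have "(\<lambda>t. complex_of_real (cmod (F t))) \<in> borel_measurable lborel" using borel_F by measurable
  then show "(\<lambda>t. complex_of_real (cmod (bdry_fun f (cis t)))) \<in> borel_measurable lborel"
    unfolding F_def .
  show "(\<integral>\<^sup>+t\<in>{0..2*pi}. ennreal ((cmod (of_real (cmod (bdry_fun f (cis t))) :: complex))\<^sup>2) \<partial>lborel) < top"
    using assms by (simp add: QK_bd_def)
  have "(SUP (t, l)\<in>UNIV \<times> {0<..2*pi}. \<integral>\<^sup>+u\<in>{t..t+l}. \<integral>\<^sup>+v\<in>{t..t+l}.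
      ennreal ((cmod (of_real (cmod (bdry_fun f (cis u))) - of_real (cmod (bdry_fun f (cis v))) :: complex))\<^sup>2 / (cmod (cis u - cis v))\<^sup>2 * K (cmod (cis u - cis v) / l)) \<partial>lborel \<partial>lborel)
    \<le> (SUP (t, l)\<in>UNIV \<times> {0<..2*pi}. \<integral>\<^sup>+u\<in>{t..t+l}. \<integral>\<^sup>+v\<in>{t..t+l}.
      ennreal ((cmod (bdry_fun f (cis u) - bdry_fun f (cis v)))\<^sup>2 / (cmod (cis u - cis v))\<^sup>2 * K (cmod (cis u - cis v) / l)) \<partial>lborel \<partial>lborel)"
  proof (intro SUP_mono')
    have "(cmod (of_real (cmod x) - of_real (cmod y) :: complex))\<^sup>2 \<le> (cmod (x - y))\<^sup>2" for x y :: complex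
      using norm_triangle_ineq3[of x y] by (intro power_mono) (auto simp: norm_of_real simp flip: of_real_diff)
    then show "(case x of (t, l) \<Rightarrow> \<integral>\<^sup>+u\<in>{t..t+l}. \<integral>\<^sup>+v\<in>{t..t+l}.
      ennreal ((cmod (of_real (cmod (bdry_fun f (cis u))) - of_real (cmod (bdry_fun f (cis v))) :: complex))\<^sup>2 / (cmod (cis u - cis v))\<^sup>2 * K (cmod (cis u - cis v) / l)) \<partial>lborel \<partial>lborel)
      \<le> (case x of (t, l) \<Rightarrow> \<integral>\<^sup>+u\<in>{t..t+l}. \<integral>\<^sup>+v\<in>{t..t+l}.
      ennreal ((cmod (bdry_fun f (cis u) - bdry_fun f (cis v)))\<^sup>2 / (cmod (cis u - cis v))\<^sup>2 * K (cmod (cis u - cis v) / l)) \<partial>lborel \<partial>lborel)" for x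
      by (cases x) (auto intro!: nn_integral_mono mult_right_mono ennreal_leI divide_right_mono K_nonneg)
  qed
  also have "\<dots> < top" using assms by (simp add: QK_bd_def)
  finally show "(SUP (t, l)\<in>UNIV \<times> {0<..2*pi}. \<integral>\<^sup>+u\<in>{t..t+l}. \<integral>\<^sup>+v\<in>{t..t+l}.
      ennreal ((cmod (of_real (cmod (bdry_fun f (cis u))) - of_real (cmod (bdry_fun f (cis v))) :: complex))\<^sup>2 / (cmod (cis u - cis v))\<^sup>2 * K (cmod (cis u - cis v) / l)) \<partial>lborel \<partial>lborel) < top" .
qed

text \<open>Kept general in G because it is applied twice: to the boundary function for the gap, and
  to its modulus for the derivative.\<close>

lemma oscillation_energy_le:
  assumes Gm: "(\<lambda>t. G (cis t)) \<in> borel_measurable borel" and "QK_bd K G"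
  obtains C where "\<And>a. cmod a < 1 \<Longrightarrow> (\<integral>\<^sup>+z\<in>ball 0 1. (\<integral>\<^sup>+u. \<integral>\<^sup>+v. ennreal ((cmod (G (cis u) - G (cis v)))\<^sup>2) \<partial>pmeasure z \<partial>pmeasure z)
        * ennreal (K (1 - (cmod (disk_aut a z))\<^sup>2) / (1 - (cmod z)\<^sup>2)\<^sup>2) \<partial>lborel) \<le> ennreal C"
proof -
  obtain B where B: "0 \<le> B" "\<And>t l. 0 < l \<Longrightarrow> l \<le> 2*pi \<Longrightarrow> (\<integral>\<^sup>+u\<in>{t..t+l}. \<integral>\<^sup>+v\<in>{t..t+l}.
      ennreal ((cmod (G (cis u) - G (cis v)))\<^sup>2 / (cmod (cis u - cis v))\<^sup>2 * K (cmod (cis u - cis v) / l)) \<partial>lborel \<partial>lborel) \<le> ennreal B"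
    using QK_bdD[OF assms(2)] by blast
  have "(\<integral>\<^sup>+z\<in>ball 0 1. (\<integral>\<^sup>+u. \<integral>\<^sup>+v. ennreal ((cmod (G (cis u) - G (cis v)))\<^sup>2) \<partial>pmeasure z \<partial>pmeasure z)
        * ennreal (K (1 - (cmod (disk_aut a z))\<^sup>2) / (1 - (cmod z)\<^sup>2)\<^sup>2) \<partial>lborel) \<le> ennreal (C0 / (4 * pi\<^sup>2) * (C2 * B))" if a: "cmod a < 1" for a
  proof -
    have "(\<integral>\<^sup>+z\<in>ball 0 1. (\<integral>\<^sup>+u. \<integral>\<^sup>+v. ennreal ((cmod (G (cis u) - G (cis v)))\<^sup>2) \<partial>pmeasure z \<partial>pmeasure z)
        * ennreal (K (1 - (cmod (disk_aut a z))\<^sup>2) / (1 - (cmod z)\<^sup>2)\<^sup>2) \<partial>lborel) \<le> ennreal (C0 / (4 * pi\<^sup>2)) * ennreal (C2 * B)"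
      by (rule order.trans[OF oscillation_disk_le[OF Gm a] mult_left_mono[OF moebius_double_integral_le[OF Gm a B]]]) auto
    also have "\<dots> = ennreal (C0 / (4 * pi\<^sup>2) * (C2 * B))"
      using C0_nonneg S1_nonneg A1(2) B(1) by (intro ennreal_mult[symmetric]) (auto simp: C2_def)
    finally show ?thesis .
  qed
  then show ?thesis using that by blast
qed

lemma gap_energy_bounded:
  assumes "QK_bd K (bdry_fun f)"
  obtains C where "\<And>a. cmod a < 1 \<Longrightarrow> (\<integral>\<^sup>+z\<in>ball 0 1. ennreal ((gap z)\<^sup>2 * K (1 - (cmod (disk_aut a z))\<^sup>2) / (1 - (cmod z)\<^sup>2)\<^sup>2) \<partial>lborel) \<le> ennreal C"
proof -
  obtain C where C: "\<And>a. cmod a < 1 \<Longrightarrow> (\<integral>\<^sup>+z\<in>ball 0 1. (\<integral>\<^sup>+u. \<integral>\<^sup>+v. ennreal ((cmod (F u - F v))\<^sup>2) \<partial>pmeasure z \<partial>pmeasure z)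
        * ennreal (K (1 - (cmod (disk_aut a z))\<^sup>2) / (1 - (cmod z)\<^sup>2)\<^sup>2) \<partial>lborel) \<le> ennreal C"
    using oscillation_energy_le[OF borel_F[unfolded F_def[abs_def]] assms] unfolding F_def by blast
  have "(\<integral>\<^sup>+z\<in>ball 0 1. ennreal ((gap z)\<^sup>2 * K (1 - (cmod (disk_aut a z))\<^sup>2) / (1 - (cmod z)\<^sup>2)\<^sup>2) \<partial>lborel) \<le> ennreal C" if a: "cmod a < 1" for a
  proof (rule order.trans[OF nn_integral_mono C[OF a]])
    fix z
    let ?k = "K (1 - (cmod (disk_aut a z))\<^sup>2) / (1 - (cmod z)\<^sup>2)\<^sup>2"
    have "ennreal ((gap z)\<^sup>2 * K (1 - (cmod (disk_aut a z))\<^sup>2) / (1 - (cmod z)\<^sup>2)\<^sup>2) = ennreal ((gap z)\<^sup>2) * ennreal ?k"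
      using K_nonneg by (subst ennreal_mult[symmetric]) auto
    then show "ennreal ((gap z)\<^sup>2 * K (1 - (cmod (disk_aut a z))\<^sup>2) / (1 - (cmod z)\<^sup>2)\<^sup>2) * indicator (ball 0 1) z
      \<le> (\<integral>\<^sup>+u. \<integral>\<^sup>+v. ennreal ((cmod (F u - F v))\<^sup>2) \<partial>pmeasure z \<partial>pmeasure z) * ennreal ?k * indicator (ball 0 1) z"
      using gap_square_le[of z] by (cases "cmod z < 1") (auto intro!: mult_right_mono)
  qed
  then show ?thesis using that by blast
qed

text \<open>The measure itself depends on z. With the Poisson density written out, z becomes an
  ordinary variable of a jointly Borel integrand.\<close>

lemma borel_measurable_oscillation [measurable]:
  fixes H :: "real \<Rightarrow> complex"
  assumes [measurable]: "H \<in> borel_measurable borel"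
  shows "(\<lambda>z. \<integral>\<^sup>+u. \<integral>\<^sup>+v. ennreal ((cmod (H u - H v))\<^sup>2) \<partial>pmeasure z \<partial>pmeasure z) \<in> borel_measurable borel"
proof -
  have "(\<lambda>z. \<integral>\<^sup>+u. \<integral>\<^sup>+v. ennreal ((cmod (H u - H v))\<^sup>2) \<partial>pmeasure z \<partial>pmeasure z)
    = (\<lambda>z. \<integral>\<^sup>+u. ennreal (poisson_kernel z u / (2*pi)) * (\<integral>\<^sup>+v. ennreal (poisson_kernel z v / (2*pi)) * ennreal ((cmod (H u - H v))\<^sup>2) \<partial>circ) \<partial>circ)"
    by (simp add: nn_integral_pmeasure)
  also have "\<dots> \<in> borel_measurable borel" unfolding poisson_kernel_def by measurable
  finally show ?thesis .
qed

text \<open>Nothing is assumed about f off the open disk, hence the indicator.\<close>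

lemma borel_measurable_gap:
  "(\<lambda>z. indicator (ball 0 1) z * gap z) \<in> borel_measurable borel"
proof -
  have [measurable]: "F \<in> borel_measurable borel" by (rule borel_F)
  have [measurable]: "(\<lambda>z. indicator (ball 0 1) z *\<^sub>R f z) \<in> borel_measurable borel"
    by (rule borel_measurable_continuous_on_indicator) (auto intro: holomorphic_on_imp_continuous_on hol)
  have [measurable]: "(\<lambda>z. poisson_int (\<lambda>\<zeta>. cmod (bdry_fun f \<zeta>)) z) \<in> borel_measurable borel"
    unfolding poisson_int_def set_lebesgue_integral_def F_def[symmetric] by measurable
  have "(\<lambda>z. indicator (ball 0 1) z * gap z) =
    (\<lambda>z. indicator (ball 0 1) z * poisson_int (\<lambda>\<zeta>. cmod (bdry_fun f \<zeta>)) z - cmod (indicator (ball 0 1) z *\<^sub>R f z))"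
    by (auto simp: gap_def fun_eq_iff indicator_def)
  also have "\<dots> \<in> borel_measurable borel" by measurable
  finally show ?thesis .
qed

text \<open>The factor (1 - |z|^2)^2 of \<open>deriv_square_le\<close> is absorbed by the
  denominator of the weight, so the arc condition on |F| bounds the oscillation term and the
  hypothesis bounds the gap term.\<close>

lemma green_energy_bounded:
  assumes Q: "QK_bd K (\<lambda>\<zeta>. of_real (cmod (bdry_fun f \<zeta>)))"
    and G: "\<And>a. cmod a < 1 \<Longrightarrow> (\<integral>\<^sup>+z\<in>ball 0 1. ennreal ((gap z)\<^sup>2 * K (1 - (cmod (disk_aut a z))\<^sup>2) / (1 - (cmod z)\<^sup>2)\<^sup>2) \<partial>lborel) \<le> ennreal D"
  obtains C where "\<And>a. cmod a < 1 \<Longrightarrow> green_energy a \<le> ennreal C"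
proof -
  let ?V = "\<lambda>z. \<integral>\<^sup>+u. \<integral>\<^sup>+v. ennreal ((cmod (of_real (cmod (F u)) - of_real (cmod (F v)) :: complex))\<^sup>2) \<partial>pmeasure z \<partial>pmeasure z"
  have [measurable]: "F \<in> borel_measurable borel" by (rule borel_F)
  have gm: "(\<lambda>z. ennreal ((gap z)\<^sup>2 * K (1 - (cmod (disk_aut a z))\<^sup>2) / (1 - (cmod z)\<^sup>2)\<^sup>2) * indicator (ball 0 1) z) \<in> borel_measurable borel" for a
  proof -
    have "(\<lambda>z. ennreal ((gap z)\<^sup>2 * K (1 - (cmod (disk_aut a z))\<^sup>2) / (1 - (cmod z)\<^sup>2)\<^sup>2) * indicator (ball 0 1) z)
      = (\<lambda>z. ennreal ((indicator (ball 0 1) z * gap z)\<^sup>2 * K (1 - (cmod (disk_aut a z))\<^sup>2) / (1 - (cmod z)\<^sup>2)\<^sup>2))"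
      by (auto simp: fun_eq_iff indicator_def)
    also have "\<dots> \<in> borel_measurable borel" using borel_measurable_gap by measurable
    finally show ?thesis .
  qed
  note gm [measurable]
  have "(\<lambda>t. complex_of_real (cmod (F t))) \<in> borel_measurable borel" by measurable
  then have "(\<lambda>t. complex_of_real (cmod (bdry_fun f (cis t)))) \<in> borel_measurable borel" unfolding F_def .
  then obtain E where E: "\<And>a. cmod a < 1 \<Longrightarrow> (\<integral>\<^sup>+z\<in>ball 0 1. ?V z * ennreal (K (1 - (cmod (disk_aut a z))\<^sup>2) / (1 - (cmod z)\<^sup>2)\<^sup>2) \<partial>lborel) \<le> ennreal E"
    using oscillation_energy_le[OF _ Q] unfolding F_def by blast
  have "green_energy a \<le> ennreal ((1 + A1) * exp 4 * \<Phi> 1) * (ennreal 32 * (ennreal E + ennreal D))" if a: "cmod a < 1" for a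
  proof -
    let ?k = "\<lambda>z. K (1 - (cmod (disk_aut a z))\<^sup>2) / (1 - (cmod z)\<^sup>2)\<^sup>2"
    have "(\<integral>\<^sup>+z\<in>ball 0 1. ennreal ((cmod (deriv f z))\<^sup>2) * ennreal (K (1 - (cmod (disk_aut a z))\<^sup>2)) \<partial>lborel) \<le> ennreal 32 * (ennreal E + ennreal D)"
    proof -
      have "(\<integral>\<^sup>+z\<in>ball 0 1. ennreal ((cmod (deriv f z))\<^sup>2) * ennreal (K (1 - (cmod (disk_aut a z))\<^sup>2)) \<partial>lborel)
        \<le> (\<integral>\<^sup>+z. ennreal 32 * (?V z * ennreal (?k z) * indicator (ball 0 1) z
              + ennreal ((gap z)\<^sup>2 * K (1 - (cmod (disk_aut a z))\<^sup>2) / (1 - (cmod z)\<^sup>2)\<^sup>2) * indicator (ball 0 1) z) \<partial>lborel)"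
      proof (rule nn_integral_mono)
        fix z
        show "ennreal ((cmod (deriv f z))\<^sup>2) * ennreal (K (1 - (cmod (disk_aut a z))\<^sup>2)) * indicator (ball 0 1) z
          \<le> ennreal 32 * (?V z * ennreal (?k z) * indicator (ball 0 1) z
              + ennreal ((gap z)\<^sup>2 * K (1 - (cmod (disk_aut a z))\<^sup>2) / (1 - (cmod z)\<^sup>2)\<^sup>2) * indicator (ball 0 1) z)"
        proof (cases "cmod z < 1")
          case True
          have k0: "0 \<le> ?k z" by (simp add: K_nonneg)
          have "1 - (cmod z)\<^sup>2 \<noteq> 0" using True by (simp add: power2_eq_1_iff) (smt (verit) norm_ge_zero)
          then have "(cmod (deriv f z))\<^sup>2 * K (1 - (cmod (disk_aut a z))\<^sup>2) = ((1 - (cmod z)\<^sup>2) * cmod (deriv f z))\<^sup>2 * ?k z"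
            by (simp add: power_mult_distrib)
          then have "ennreal ((cmod (deriv f z))\<^sup>2) * ennreal (K (1 - (cmod (disk_aut a z))\<^sup>2))
            = ennreal (((1 - (cmod z)\<^sup>2) * cmod (deriv f z))\<^sup>2) * ennreal (?k z)"
            using k0 K_nonneg by (metis ennreal_mult zero_le_power2)
          also have "\<dots> \<le> (ennreal 32 * (?V z + ennreal ((gap z)\<^sup>2))) * ennreal (?k z)"
            by (rule mult_right_mono[OF deriv_square_le[OF True]]) simp
          also have "\<dots> = ennreal 32 * (?V z * ennreal (?k z) + ennreal ((gap z)\<^sup>2) * ennreal (?k z))"
            by (simp only: distrib_left distrib_right mult.assoc)
          also have "ennreal ((gap z)\<^sup>2) * ennreal (?k z) = ennreal ((gap z)\<^sup>2 * K (1 - (cmod (disk_aut a z))\<^sup>2) / (1 - (cmod z)\<^sup>2)\<^sup>2)"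
            using k0 by (simp add: ennreal_mult[symmetric])
          finally show ?thesis using True by simp
        qed simp
      qed
      also have "\<dots> = ennreal 32 * ((\<integral>\<^sup>+z\<in>ball 0 1. ?V z * ennreal (?k z) \<partial>lborel)
          + (\<integral>\<^sup>+z\<in>ball 0 1. ennreal ((gap z)\<^sup>2 * K (1 - (cmod (disk_aut a z))\<^sup>2) / (1 - (cmod z)\<^sup>2)\<^sup>2) \<partial>lborel))"
      proof -
        have [measurable]: "(\<lambda>z. ?V z * ennreal (?k z) * indicator (ball 0 1) z) \<in> borel_measurable borel"
          unfolding indicator_def pred_mem_ball by measurable
        show ?thesis
          by (subst nn_integral_cmult, simp, subst nn_integral_add) (use gm[of a] in auto)
      qed
      also have "\<dots> \<le> ennreal 32 * (ennreal E + ennreal D)"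
        by (intro mult_left_mono add_mono E[OF a] G[OF a]) simp
      finally show ?thesis .
    qed
    then show ?thesis by (intro order.trans[OF green_energy_le[OF a]] mult_left_mono) auto
  qed
  moreover obtain C where "ennreal ((1 + A1) * exp 4 * \<Phi> 1) * (ennreal 32 * (ennreal E + ennreal D)) = ennreal C"
    by (cases "ennreal ((1 + A1) * exp 4 * \<Phi> 1) * (ennreal 32 * (ennreal E + ennreal D))") (auto simp: ennreal_mult_eq_top_iff)
  ultimately show ?thesis by (intro that[of C]) (simp only:)
qed

end

theorem theorem1p1:
  fixes K :: "real \<Rightarrow> real" and f :: "complex \<Rightarrow> complex"
  assumes K_nonneg: "\<forall>t\<ge>0. K t \<ge> 0"
    and K_mono: "mono_on {0..} K"
    and K_rcont: "\<forall>t\<ge>0. continuous (at_right t) K"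
    and int0: "(\<integral>\<^sup>+ s\<in>{0<..1}. phiK K s / ennreal s \<partial>lborel) < top"
    and int1: "(\<integral>\<^sup>+ s\<in>{1..}. phiK K s / ennreal (s\<^sup>2) \<partial>lborel) < top"
    and f_H2: "hardy2 f"
  shows "(QK K f \<longleftrightarrow> QK_bd K (bdry_fun f)) \<and>
         (QK_bd K (bdry_fun f) \<longleftrightarrow>
            (QK_bd K (\<lambda>\<zeta>. complex_of_real (cmod (bdry_fun f \<zeta>))) \<and>
             (SUP a\<in>ball 0 1. \<integral>\<^sup>+ z\<in>ball 0 1.
                ennreal ((poisson_int (\<lambda>\<zeta>. cmod (bdry_fun f \<zeta>)) z - cmod (f z))\<^sup>2
                   * K (1 - (cmod (disk_aut a z))\<^sup>2) / (1 - (cmod z)\<^sup>2)\<^sup>2) \<partial>lborel) < top))"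
proof -
  obtain \<Phi> where W: "weight (\<lambda>x. K (max 0 x)) \<Phi>"
    using weight_exists[OF K_nonneg K_mono int0 int1] by blast
  \<comment> \<open>K is evaluated only at nonnegative arguments in the statement, so it may be
    exchanged for its continuation, to which \<open>weight\<close> applies.\<close>
  define k where "k x = K (max 0 x)" for x
  have kK: "k x = K x" if "0 \<le> x" for x using that by (simp add: k_def)
  interpret weighted_hardy k \<Phi> f
    using W f_H2 by (simp add: weighted_hardy_def hardy_function_def k_def[abs_def])
  have bd: "QK_bd K G = QK_bd k G" for G by (rule QK_bd_cong) (simp add: kK)
  have QK: "QK K f \<longleftrightarrow> (SUP a\<in>ball 0 1. green_energy a) < top"
  proof -
    have "(\<integral>\<^sup>+z\<in>ball 0 1. ennreal ((cmod (deriv f z))\<^sup>2 * K (green_disk a z)) \<partial>lborel) = green_energy a" if a: "a \<in> ball 0 1" for a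
      unfolding green_energy_def
    proof (rule nn_integral_cong)
      fix z
      show "ennreal ((cmod (deriv f z))\<^sup>2 * K (green_disk a z)) * indicator (ball 0 1) z
        = ennreal ((cmod (deriv f z))\<^sup>2) * ennreal (k (ln (1 / cmod (disk_aut a z)))) * indicator (ball 0 1) z"
      proof (cases "cmod z < 1")
        case True
        have "0 \<le> ln (1 / cmod (disk_aut a z))"
          using norm_disk_aut_less[of a z] a True by (intro ln_inverse_nonneg) auto
        then have "K (green_disk a z) = k (ln (1 / cmod (disk_aut a z)))" by (simp only: green_disk_def kK)
        then show ?thesis by (simp add: ennreal_mult K_nonneg weight.K_nonneg[OF weight_axioms])
      qed (simp add: indicator_def)
    qed
    then show ?thesis unfolding QK_def using hol by (simp cong: SUP_cong_simp)
  qed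
  have gapE: "(\<integral>\<^sup>+ z\<in>ball 0 1. ennreal ((poisson_int (\<lambda>\<zeta>. cmod (bdry_fun f \<zeta>)) z - cmod (f z))\<^sup>2
                   * K (1 - (cmod (disk_aut a z))\<^sup>2) / (1 - (cmod z)\<^sup>2)\<^sup>2) \<partial>lborel)
     = (\<integral>\<^sup>+z\<in>ball 0 1. ennreal ((gap z)\<^sup>2 * k (1 - (cmod (disk_aut a z))\<^sup>2) / (1 - (cmod z)\<^sup>2)\<^sup>2) \<partial>lborel)" if a: "a \<in> ball 0 1" for a
  proof (rule nn_integral_cong)
    fix z
    show "ennreal ((poisson_int (\<lambda>\<zeta>. cmod (bdry_fun f \<zeta>)) z - cmod (f z))\<^sup>2
                   * K (1 - (cmod (disk_aut a z))\<^sup>2) / (1 - (cmod z)\<^sup>2)\<^sup>2) * indicator (ball 0 1) z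
      = ennreal ((gap z)\<^sup>2 * k (1 - (cmod (disk_aut a z))\<^sup>2) / (1 - (cmod z)\<^sup>2)\<^sup>2) * indicator (ball 0 1) z"
    proof (cases "cmod z < 1")
      case True
      have "0 \<le> 1 - (cmod (disk_aut a z))\<^sup>2"
        using norm_disk_aut_less[of a z] a True by (simp add: power_le_one_iff)
      then show ?thesis by (simp add: gap_def kK)
    qed (simp add: indicator_def)
  qed
  \<comment> \<open>Finiteness of each supremum over \<open>a\<close> is traded for a uniform real
    bound, the form in which the implications are proved.\<close>
  have SUP_finite: "(SUP a\<in>ball (0::complex) 1. I a) < top \<longleftrightarrow> (\<exists>C. \<forall>a. cmod a < 1 \<longrightarrow> I a \<le> ennreal C)" for I :: "complex \<Rightarrow> ennreal"
  proof
    assume "(SUP a\<in>ball (0::complex) 1. I a) < top"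
    then obtain C where C: "(SUP a\<in>ball (0::complex) 1. I a) = ennreal C"
      by (cases "SUP a\<in>ball (0::complex) 1. I a") auto
    have "I a \<le> ennreal C" if "cmod a < 1" for a
      unfolding C[symmetric] using that by (intro SUP_upper) auto
    then show "\<exists>C. \<forall>a. cmod a < 1 \<longrightarrow> I a \<le> ennreal C" by blast
  next
    assume "\<exists>C. \<forall>a. cmod a < 1 \<longrightarrow> I a \<le> ennreal C"
    then obtain C where "\<And>a. cmod a < 1 \<Longrightarrow> I a \<le> ennreal C" by blast
    then have "(SUP a\<in>ball (0::complex) 1. I a) \<le> ennreal C" by (intro SUP_least) auto
    then show "(SUP a\<in>ball (0::complex) 1. I a) < top" by (rule le_less_trans) simp
  qed
  let ?gapE = "\<lambda>a. \<integral>\<^sup>+z\<in>ball 0 1. ennreal ((gap z)\<^sup>2 * k (1 - (cmod (disk_aut a z))\<^sup>2) / (1 - (cmod z)\<^sup>2)\<^sup>2) \<partial>lborel"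
  have gapSUP: "(SUP a\<in>ball 0 1. \<integral>\<^sup>+ z\<in>ball 0 1.
                ennreal ((poisson_int (\<lambda>\<zeta>. cmod (bdry_fun f \<zeta>)) z - cmod (f z))\<^sup>2
                   * K (1 - (cmod (disk_aut a z))\<^sup>2) / (1 - (cmod z)\<^sup>2)\<^sup>2) \<partial>lborel) = (SUP a\<in>ball 0 1. ?gapE a)"
    by (rule SUP_cong[OF refl gapE])
  have 1: "QK_bd k (bdry_fun f)" if "(SUP a\<in>ball 0 1. green_energy a) < top"
  proof -
    from \<open>(SUP a\<in>ball 0 1. green_energy a) < top\<close> obtain B
      where B: "\<And>a. cmod a < 1 \<Longrightarrow> green_energy a \<le> ennreal B" unfolding SUP_finite by blast
    \<comment> \<open>\<open>ennreal\<close> sends negative reals to 0, so the bound may be replaced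
      by its positive part.\<close>
    have "green_energy a \<le> ennreal (max 0 B)" if "cmod a < 1" for a using B[OF that] by (simp add: ennreal_max_0)
    then show ?thesis by (rule bdry_in_QK_bd) auto
  qed
  have 2: "QK_bd k (\<lambda>\<zeta>. complex_of_real (cmod (bdry_fun f \<zeta>))) \<and> (SUP a\<in>ball 0 1. ?gapE a) < top" if q: "QK_bd k (bdry_fun f)"
  proof -
    obtain C where "\<And>a. cmod a < 1 \<Longrightarrow> ?gapE a \<le> ennreal C" by (rule gap_energy_bounded[OF q]) blast
    then show ?thesis using QK_bd_norm[OF q] unfolding SUP_finite by blast
  qed
  have 3: "(SUP a\<in>ball 0 1. green_energy a) < top"
    if q: "QK_bd k (\<lambda>\<zeta>. complex_of_real (cmod (bdry_fun f \<zeta>)))" "(SUP a\<in>ball 0 1. ?gapE a) < top"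
  proof -
    obtain D where "\<And>a. cmod a < 1 \<Longrightarrow> ?gapE a \<le> ennreal D" using q(2) unfolding SUP_finite by blast
    then obtain C where "\<And>a. cmod a < 1 \<Longrightarrow> green_energy a \<le> ennreal C" by (rule green_energy_bounded[OF q(1)]) blast+
    then show ?thesis unfolding SUP_finite by blast
  qed
  show ?thesis unfolding QK bd gapSUP using 1 2 3 by blast
qed

end
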